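(* Consider the distributed transfer learning problem described in the context, with general sample sizes $n_j$, transfer exponents $\gamma_j$ and privacy parameters $(\varepsilon_j,\delta_j)$. Let $r\in\mathbb R_+$ be the solution of $$ (n_0\wedge n_0^2\varepsilon_0^2r^d)\,r^{2\beta+d}+\sum_{j=1}^m (n_j\wedge n_j^2\varepsilon_j^2r^d)\,r^{2\beta\gamma_j+d}=1 . $$ The minimax rate for the excess risk is given by $$ \inf_{\hat f\in\mathcal M(\boldsymbol\varepsilon,\boldsymbol\delta)}\ \sup_{(P_0,\dots,P_m)\in\Pi(\alpha,\beta,\boldsymbol\gamma,\mu)}\mathcal E_0(\hat f)\ \asymp\ \big(L_N\,r^{\beta(1+\alpha)}\wedge 1\big) $$ whenever $\sum_{j} n_j\delta_j\to0$, for a sequence $L_N$ of order at most $(-\log\delta_{\min})^{\frac{\beta(1+\alpha)}{2\beta\gamma_{\min}+d}}$, where $\delta_{\min}=\min\{\delta_0,\dots,\delta_m\}$ and $\gamma_{\min}=\min\{1,\gamma_1,\dots,\gamma_m\}$.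
   Context: Notation: $a\wedge b=\min(a,b)$. The left side of the equation for $r$ is continuous and strictly increasing in $r$ from $0$ to $\infty$, so $r$ is well defined. Asymptotic statements are along a sequence of such problems indexed by $N$. $a_N\asymp b_N$ means $c\,b_N\le a_N\le C\,b_N$ for constants $0<c\le C<\infty$ not depending on the sample sizes or privacy parameters. Data: there are $m+1$ servers; server $0$ is the target and servers $1,\dots,m$ are sources. Server $j$ holds $n_j$ i.i.d. observations $Z^{(j)}=(Z^{(j)}_i)_{i\le n_j}$, $Z^{(j)}_i=(X^{(j)}_i,Y^{(j)}_i)\in[0,1]^d\times\{0,1\}$, from $P_j$, independently across servers. $P_j^X$ is the marginal law of $X$ under $P_j$ and $\eta_j(x)=P_j(Y=1\mid X=x)$. Privacy: server $j$ has privacy parameters $(\varepsilon_j,\delta_j)$ with $\varepsilon_j>0$, $\delta_j\in(0,1)$; write $(\boldsymbol\varepsilon,\boldsymbol\delta)=\{(\varepsilon_j,\delta_j)\}_{j=0}^m$. Each source server $j\in\{1,\dots,m\}$ releases a randomized transcript $\tilde T^{(j)}$ (in a measurable space) drawn from a conditional distribution given $Z^{(j)}$ only (no communication between sources), which is $(\varepsilon_j,\delta_j)$-differentially private: for all measurable $A$ and all $z,z'$ differing in one individual datum, $\mathbb P(\tilde T^{(j)}\in A\mid Z^{(j)}=z)\le e^{\varepsilon_j}\mathbb P(\tilde T^{(j)}\in A\mid Z^{(j)}=z')+\delta_j$. The target server uses $Z^{(0)}$ and $(\tilde T^{(1)},\dots,\tilde T^{(m)})$ to produce a final randomized transcript $\tilde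 T$ such that for all measurable $A$, all $z,z'$ differing in one datum and all values $t_1,\dots,t_m$, $\mathbb P(\tilde T\in A\mid Z^{(0)}=z,\tilde T^{(j)}=t_j,1\le j\le m)\le e^{\varepsilon_0}\mathbb P(\tilde T\in A\mid Z^{(0)}=z',\tilde T^{(j)}=t_j,1\le j\le m)+\delta_0$. $\mathcal M(\boldsymbol\varepsilon,\boldsymbol\delta)$ is the class of classifiers $\hat f:[0,1]^d\to\{0,1\}$ constructed from the final transcript $\tilde T$ of such a protocol. Risk: $R_0(f)=P_0(Y\ne f(X))$, $f_0^*(x)=\mathbf 1\{\eta_0(x)\ge 1/2\}$, and $\mathcal E_0(\hat f)=\mathbb E[R_0(\hat f)]-R_0(f_0^* )$, the expectation being over all data and randomization. Class $\Pi=\Pi(\alpha,\beta,\boldsymbol\gamma,\mu)$: fix $\alpha\ge0$, $0<\beta\le1$ with $\alpha\beta\le d$, constants $L,C_\alpha>0$, exponents $\gamma_j>0$ and constants $C_j>0$ ($1\le j\le m$), $\mu=(g_{\min},g_{\max})$ with $0<g_{\min}<g_{\max}<\infty$, and $c_\mu,r_\mu>0$. $\Pi$ is the set of $(P_0,\dots,P_m)$ such that: (i) for all $1\le j\le m$, $x\in[0,1]^d$: $\mathrm{sign}(\eta_j(x)-\tfrac12)=\mathrm{sign}(\eta_0(x)-\tfrac12)$ and $|\eta_j(x)-\tfrac12|\ge C_j|\eta_0(x)-\tfrac12|^{\gamma_j}$; (ii) $|\eta_0(x)-\eta_0(x')|\le L\|x-x'\|^\beta$ for all $x,x'\in[0,1]^d$;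 (iii) $P_0^X(0\le|\eta_0(X)-\tfrac12|\le t)\le C_\alpha t^\alpha$ for all $t>0$; (iv) all $P_j^X$, $0\le j\le m$, have the same compact support $A\subset[0,1]^d$, which is $(c_\mu,r_\mu)$-regular (i.e. $\lambda(A\cap B(x,s))\ge c_\mu\lambda(B(x,s))$ for all $0<s\le r_\mu$, $x\in A$, with $\lambda$ Lebesgue measure and $B(x,s)$ the Euclidean ball), and each has a Lebesgue density $g_j$ with $g_{\min}\le g_j\le g_{\max}$ on $A$ and $g_j=0$ off $A$. *)

theory Defs
  imports "HOL-Probability.Probability"
begin

section \<open>Observations\<close>

text \<open>An observation is a pair (feature, label); the label 1 is \<open>True\<close>.\<close>

type_synonym 'd obs = "(real ^ 'd) \<times> bool"

definition unit_cube :: "(real ^ 'd::finite) set" where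
  "unit_cube = {x. \<forall>i. 0 \<le> x $ i \<and> x $ i \<le> 1}"

definition cube_space :: "(real ^ 'd::finite) measure" where
  "cube_space = restrict_space borel unit_cube"

definition obs_space :: "('d::finite) obs measure" where
  "obs_space = cube_space \<Otimes>\<^sub>M count_space UNIV"

definition sample_space :: "nat \<Rightarrow> (nat \<Rightarrow> ('d::finite) obs) measure" where
  "sample_space n = PiM {..<n} (\<lambda>_. obs_space)"

definition sample_law :: "nat \<Rightarrow> ('d::finite) obs measure \<Rightarrow> (nat \<Rightarrow> 'd obs) measure" where
  "sample_law n P = PiM {..<n} (\<lambda>_. P)"


section \<open>Differentially private protocols\<close>

definition adjacent :: "nat \<Rightarrow> (nat \<Rightarrow> 'a) \<Rightarrow> (nat \<Rightarrow> 'a) \<Rightarrow> bool" where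
  "adjacent n z z' \<longleftrightarrow> (\<exists>i<n. \<forall>k<n. k \<noteq> i \<longrightarrow> z k = z' k)"

definition diff_private ::
  "real \<Rightarrow> real \<Rightarrow> nat \<Rightarrow> ((nat \<Rightarrow> ('d::finite) obs) \<Rightarrow> 't measure) \<Rightarrow> 't measure \<Rightarrow> bool" where
  "diff_private \<epsilon> \<delta> n K S \<longleftrightarrow>
     (\<forall>z\<in>space (sample_space n). \<forall>z'\<in>space (sample_space n). adjacent n z z' \<longrightarrow>
        (\<forall>A\<in>sets S. measure (K z) A \<le> exp \<epsilon> * measure (K z') A + \<delta>))"

text \<open>
  The transcripts of the source servers \<open>1, \<dots>, m\<close> and the final transcript live in arbitrary
  measurable spaces over \<open>'t\<close>, which are part of the protocol. All randomization is carried
  by the transcripts; the classifier is a function of the final transcript and of the feature.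
\<close>

record ('d, 't) protocol =
  src_space :: "nat \<Rightarrow> 't measure"
  src_kernel :: "nat \<Rightarrow> (nat \<Rightarrow> 'd obs) \<Rightarrow> 't measure"
  fin_space :: "'t measure"
  fin_kernel :: "(nat \<Rightarrow> 'd obs) \<times> (nat \<Rightarrow> 't) \<Rightarrow> 't measure"
  classifier :: "'t \<times> (real ^ 'd) \<Rightarrow> bool"

definition private_protocols ::
  "nat \<Rightarrow> (nat \<Rightarrow> nat) \<Rightarrow> (nat \<Rightarrow> real) \<Rightarrow> (nat \<Rightarrow> real) \<Rightarrow> ('d::finite, 't) protocol set" where
  "private_protocols m n \<epsilon> \<delta> = {p.
     (\<forall>j\<in>{1..m}.
        src_kernel p j \<in> sample_space (n j) \<rightarrow>\<^sub>M prob_algebra (src_space p j) \<and>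
        diff_private (\<epsilon> j) (\<delta> j) (n j) (src_kernel p j) (src_space p j)) \<and>
     fin_kernel p \<in> sample_space (n 0) \<Otimes>\<^sub>M PiM {1..m} (src_space p)
        \<rightarrow>\<^sub>M prob_algebra (fin_space p) \<and>
     (\<forall>t\<in>space (PiM {1..m} (src_space p)).
        diff_private (\<epsilon> 0) (\<delta> 0) (n 0) (\<lambda>z. fin_kernel p (z, t)) (fin_space p)) \<and>
     classifier p \<in> fin_space p \<Otimes>\<^sub>M cube_space \<rightarrow>\<^sub>M count_space UNIV}"

text \<open>
  The servers' samples are independent and source \<open>j\<close> only uses its own sample, so the source
  transcripts are independent of each other and of the target sample.
\<close>

definition transcript_law ::
  "(nat \<Rightarrow> nat) \<Rightarrow> ('d::finite, 't) protocol \<Rightarrow> (nat \<Rightarrow> 'd obs measure) \<Rightarrow> nat \<Rightarrow> 't measure" where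
  "transcript_law n p P j = sample_law (n j) (P j) \<bind> src_kernel p j"

definition final_law ::
  "nat \<Rightarrow> (nat \<Rightarrow> nat) \<Rightarrow> ('d::finite, 't) protocol \<Rightarrow> (nat \<Rightarrow> 'd obs measure) \<Rightarrow> 't measure" where
  "final_law m n p P =
     (sample_law (n 0) (P 0) \<Otimes>\<^sub>M PiM {1..m} (transcript_law n p P)) \<bind> fin_kernel p"


section \<open>Regression functions and excess risk\<close>

definition regression_fun :: "('d::finite) obs measure \<Rightarrow> (real ^ 'd \<Rightarrow> real) \<Rightarrow> bool" where
  "regression_fun P \<eta> \<longleftrightarrow>
     \<eta> \<in> borel_measurable cube_space \<and>
     (\<forall>x\<in>unit_cube. 0 \<le> \<eta> x \<and> \<eta> x \<le> 1) \<and>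
     (\<forall>B\<in>sets cube_space.
        emeasure P (B \<times> {True}) = (\<integral>\<^sup>+z. ennreal (\<eta> (fst z)) * indicator B (fst z) \<partial>P))"

definition risk :: "('d::finite) obs measure \<Rightarrow> (real ^ 'd \<Rightarrow> bool) \<Rightarrow> real" where
  "risk P f = measure P {z \<in> space P. snd z \<noteq> f (fst z)}"

text \<open>The choice of the version of the regression function does not affect the risk.\<close>

definition bayes_classifier :: "('d::finite) obs measure \<Rightarrow> real ^ 'd \<Rightarrow> bool" where
  "bayes_classifier P x \<longleftrightarrow> (SOME \<eta>. regression_fun P \<eta>) x \<ge> 1 / 2"

definition excess_risk ::
  "nat \<Rightarrow> (nat \<Rightarrow> nat) \<Rightarrow> ('d::finite, 't) protocol \<Rightarrow> (nat \<Rightarrow> 'd obs measure) \<Rightarrow> real" where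
  "excess_risk m n p P =
     (\<integral>T. risk (P 0) (\<lambda>x. classifier p (T, x)) \<partial>final_law m n p P)
       - risk (P 0) (bayes_classifier (P 0))"


section \<open>The class of distributions\<close>

definition measure_support :: "'a::topological_space measure \<Rightarrow> 'a set" where
  "measure_support M = {x. \<forall>U. open U \<longrightarrow> x \<in> U \<longrightarrow> emeasure M U > 0}"

definition regular_set :: "real \<Rightarrow> real \<Rightarrow> (real ^ 'd::finite) set \<Rightarrow> bool" where
  "regular_set c\<mu> r\<mu> A \<longleftrightarrow>
     (\<forall>x\<in>A. \<forall>s. 0 < s \<longrightarrow> s \<le> r\<mu> \<longrightarrow>
        measure lborel (A \<inter> ball x s) \<ge> c\<mu> * measure lborel (ball x s))"

definition X_marginal :: "('d::finite) obs measure \<Rightarrow> (real ^ 'd) measure" where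
  "X_marginal P = distr P borel fst"

text \<open>
  Regression functions are determined only almost everywhere; the pointwise conditions are
  read as the existence of versions satisfying them.
\<close>

definition transfer_class ::
  "nat \<Rightarrow> real \<Rightarrow> real \<Rightarrow> (nat \<Rightarrow> real) \<Rightarrow> real \<Rightarrow> real \<Rightarrow> (nat \<Rightarrow> real) \<Rightarrow> real \<Rightarrow> real \<Rightarrow> real \<Rightarrow> real
     \<Rightarrow> (nat \<Rightarrow> ('d::finite) obs measure) set" where
  "transfer_class m \<alpha> \<beta> \<gamma> L C\<alpha> Cs gmin gmax c\<mu> r\<mu> = {P.
     (\<forall>j\<le>m. P j \<in> space (prob_algebra obs_space)) \<and>
     (\<exists>\<eta>. (\<forall>j\<le>m. regression_fun (P j) (\<eta> j)) \<and>
        (\<forall>j\<in>{1..m}. \<forall>x\<in>unit_cube.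
           sgn (\<eta> j x - 1 / 2) = sgn (\<eta> 0 x - 1 / 2) \<and>
           \<bar>\<eta> j x - 1 / 2\<bar> \<ge> Cs j * \<bar>\<eta> 0 x - 1 / 2\<bar> powr \<gamma> j) \<and>
        (\<forall>x\<in>unit_cube. \<forall>x'\<in>unit_cube. \<bar>\<eta> 0 x - \<eta> 0 x'\<bar> \<le> L * norm (x - x') powr \<beta>) \<and>
        (\<forall>t>0. measure (P 0) {z \<in> space (P 0). \<bar>\<eta> 0 (fst z) - 1 / 2\<bar> \<le> t} \<le> C\<alpha> * t powr \<alpha>)) \<and>
     (\<exists>A. A \<subseteq> unit_cube \<and> compact A \<and> regular_set c\<mu> r\<mu> A \<and>
        (\<forall>j\<le>m. measure_support (X_marginal (P j)) = A \<and>
           (\<exists>g. g \<in> borel_measurable borel \<and>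
              X_marginal (P j) = density lborel (\<lambda>x. ennreal (g x)) \<and>
              (\<forall>x\<in>A. gmin \<le> g x \<and> g x \<le> gmax) \<and> (\<forall>x. x \<notin> A \<longrightarrow> g x = 0))))}"


section \<open>Minimax risk and rate\<close>

text \<open>
  The excess risk over the class is nonnegative, so \<open>ennreal\<close> loses nothing; the supremum over
  an empty class is 0. The argument of type \<open>'t itself\<close> fixes the type carrying the
  transcript spaces.
\<close>

definition minimax_risk ::
  "'t itself \<Rightarrow> nat \<Rightarrow> (nat \<Rightarrow> nat) \<Rightarrow> (nat \<Rightarrow> real) \<Rightarrow> (nat \<Rightarrow> real)
     \<Rightarrow> (nat \<Rightarrow> ('d::finite) obs measure) set \<Rightarrow> ennreal" where
  "minimax_risk _ m n \<epsilon> \<delta> Q =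
     (INF p\<in>(private_protocols m n \<epsilon> \<delta> :: ('d, 't) protocol set).
        SUP P\<in>Q. ennreal (excess_risk m n p P))"

definition rate_lhs ::
  "nat \<Rightarrow> nat \<Rightarrow> real \<Rightarrow> (nat \<Rightarrow> real) \<Rightarrow> (nat \<Rightarrow> nat) \<Rightarrow> (nat \<Rightarrow> real) \<Rightarrow> real \<Rightarrow> real" where
  "rate_lhs d m \<beta> \<gamma> n \<epsilon> r =
     min (real (n 0)) (real (n 0) ^ 2 * \<epsilon> 0 ^ 2 * r ^ d) * r powr (2 * \<beta> + real d)
     + (\<Sum>j=1..m. min (real (n j)) (real (n j) ^ 2 * \<epsilon> j ^ 2 * r ^ d)
                      * r powr (2 * \<beta> * \<gamma> j + real d))"

definition gamma_min :: "nat \<Rightarrow> (nat \<Rightarrow> real) \<Rightarrow> real" where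
  "gamma_min m \<gamma> = Min (insert 1 (\<gamma> ` {1..m}))"

definition delta_min :: "nat \<Rightarrow> (nat \<Rightarrow> real) \<Rightarrow> real" where
  "delta_min m \<delta> = Min (\<delta> ` {0..m})"

end

theory Submission
  imports Defs
begin

text \<open>
  The number \<open>m\<close> of sources is fixed, so one server \<open>j\<close> alone carries at least the share
  \<open>1 / (m + 1)\<close> of the equation defining \<open>r\<close>, and using only the sample of that server costs a
  constant. On a grid of width about \<open>r\<close>, let \<open>S\<^sub>k\<close> be the signed count of the labels observed in
  the cells around cell \<open>k\<close>. Releasing independent bits that are 1 with probability
  \<open>1 / (1 + exp (- l S\<^sub>k))\<close> is purely differentially private for \<open>l\<close> of order \<open>\<epsilon>\<^sub>j\<close>, because
  the logarithm of the logistic function is Lipschitz and one observation affects boundedly many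
  counts. A Chernoff bound for the wrong bits, integrated against the margin condition, gives the
  rate \<open>r powr (\<beta> (1 + \<alpha>))\<close> without a logarithmic factor.

  For the lower bound the features are uniform on small cubes in the middle of the grid cells, the
  regression function has a bump of unknown sign on each of about \<open>r powr (\<alpha> \<beta> - d)\<close> cells, and
  Assouad's argument applies as soon as flipping one sign moves the law of the final transcript by at
  most 1/2 in total variation. The servers are exchanged one at a time. If
  \<open>n\<^sub>j r powr (2 \<beta> \<gamma>\<^sub>j + d) \<le> 1\<close>, the samples of server \<open>j\<close> cannot be distinguished by their
  chi-square distance. Otherwise privacy is used: exchanging the observations one at a time changes
  any event by at most \<open>2 \<epsilon>\<^sub>j + \<delta>\<^sub>j\<close> times the total variation distance of one observation.
\<close>


section \<open>Risk and regression function\<close>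

text \<open>The two entries of the minimum in the equation for r have different origins. Flipping
  one bump changes the law of one observation of server j by a chi-square distance of order r^(2
  \<beta> \<gamma>_j + d), whence the first entry. Under privacy the total cost of flipping is of
  order n_j \<epsilon>_j r^(\<beta> \<gamma>_j + d), and the second summand is the square of this
  quantity. In the voting rule the same two quantities, n_j r^(2 \<beta> \<gamma>_j + d) and n_j
  \<epsilon>_j r^(\<beta> \<gamma>_j + d), are the exponents of the error bound.

  The class can be poor: for \<open>gmax < 1\<close> it is even empty, since a density bounded by
  \<open>gmax\<close> on a part of the unit cube has mass below one. Hence the lower bound is
  available only for \<open>1 < gmax\<close>, large \<open>C\<alpha>\<close> and small
  \<open>c\<mu>\<close>, and L_N has to be read off from the risk in order to cover all constants.
  The limit of the sums of n_j \<delta>_j keeps the additive part of privacy negligible and makes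
  -ln \<delta>_min eventually at least 1, so that every bounded L_N meets the growth
  condition.\<close>

lemma unit_cube_eq_cbox: "unit_cube = cbox (0::real^'d::finite) 1"
  by (auto simp: unit_cube_def mem_box_cart)

lemma unit_cube_borel [measurable]: "unit_cube \<in> sets borel"
  by (simp add: unit_cube_eq_cbox)

lemma space_cube_space [simp]: "space cube_space = unit_cube"
  by (simp add: cube_space_def space_restrict_space)

lemma space_obs_space [simp]: "space obs_space = unit_cube \<times> UNIV"
  by (simp add: obs_space_def space_pair_measure)

lemma measurable_cube_space_id: "(\<lambda>x. x) \<in> cube_space \<rightarrow>\<^sub>M borel"
  unfolding cube_space_def by (rule measurable_restrict_space1) simp

lemma borel_measurable_cube_spaceI:
  "f \<in> borel_measurable borel \<Longrightarrow> f \<in> borel_measurable cube_space"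
  unfolding cube_space_def by (rule measurable_restrict_space1)

lemma obs_law_facts:
  assumes "P \<in> space (prob_algebra obs_space)"
  shows "prob_space P" "sets P = sets obs_space" "space P = unit_cube \<times> UNIV"
proof -
  show "prob_space P" "sets P = sets obs_space"
    using assms by (auto simp: space_prob_algebra)
  then show "space P = unit_cube \<times> UNIV"
    using sets_eq_imp_space_eq[of P obs_space] by simp
qed

lemma measurable_fst_obs [measurable]: "fst \<in> obs_space \<rightarrow>\<^sub>M cube_space"
  unfolding obs_space_def by simp

lemma measurable_snd_obs [measurable]: "snd \<in> obs_space \<rightarrow>\<^sub>M count_space UNIV"
  unfolding obs_space_def by simp

text \<open>A regression function is specified only through the sets
  \<open>B \<times> {True}\<close>. The two weighted laws of the feature therefore agree as
  measures, and then all integrals agree, integrable or not.\<close>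

lemma label_integral_True:
  fixes a :: "real^'d::finite \<Rightarrow> real"
  assumes P: "P \<in> space (prob_algebra obs_space)" and \<eta>: "regression_fun P \<eta>"
    and a[measurable]: "a \<in> borel_measurable cube_space"
  shows "(\<integral>z. of_bool (snd z) * a (fst z) \<partial>P) = (\<integral>z. \<eta> (fst z) * a (fst z) \<partial>P)"
proof -
  note [measurable_cong] = obs_law_facts(2)[OF P]
  have \<eta>m[measurable]: "\<eta> \<in> borel_measurable cube_space" and \<eta>01: "\<And>x. x \<in> unit_cube \<Longrightarrow> 0 \<le> \<eta> x \<and> \<eta> x \<le> 1"
    and \<eta>B: "\<And>B. B \<in> sets cube_space \<Longrightarrow> emeasure P (B \<times> {True}) = (\<integral>\<^sup>+z. ennreal (\<eta> (fst z)) * indicator B (fst z) \<partial>P)"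
    using \<eta> unfolding regression_fun_def by auto
  define M1 where "M1 = distr (density P (\<lambda>z. ennreal (of_bool (snd z)))) cube_space fst"
  define M2 where "M2 = distr (density P (\<lambda>z. ennreal (\<eta> (fst z)))) cube_space fst"
  have spP: "space P = unit_cube \<times> UNIV" using obs_law_facts(3)[OF P] .
  have "M1 = M2"
  proof (rule measure_eqI)
    show "sets M1 = sets M2" by (simp add: M1_def M2_def)
    fix B assume "B \<in> sets M1"
    then have B[measurable]: "B \<in> sets cube_space" by (simp add: M1_def)
    have Bs: "B \<subseteq> unit_cube" using sets.sets_into_space[OF B] by simp
    have "emeasure M1 B = (\<integral>\<^sup>+z. ennreal (of_bool (snd z)) * indicator (fst -` B \<inter> space P) z \<partial>P)"
      unfolding M1_def by (subst emeasure_distr) (auto simp: emeasure_density)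
    also have "\<dots> = (\<integral>\<^sup>+z. indicator (B \<times> {True}) z \<partial>P)"
      by (intro nn_integral_cong) (auto simp: indicator_def)
    also have "\<dots> = emeasure P (B \<times> {True})"
      by (rule nn_integral_indicator) (simp add: obs_law_facts(2)[OF P] obs_space_def)
    also have "\<dots> = (\<integral>\<^sup>+z. ennreal (\<eta> (fst z)) * indicator (fst -` B \<inter> space P) z \<partial>P)"
      unfolding \<eta>B[OF B] by (intro nn_integral_cong) (auto simp: indicator_def)
    also have "\<dots> = emeasure M2 B"
      unfolding M2_def by (subst emeasure_distr) (auto simp: emeasure_density)
    finally show "emeasure M1 B = emeasure M2 B" .
  qed
  then have "(\<integral>x. a x \<partial>M1) = (\<integral>x. a x \<partial>M2)" by simp
  moreover have "(\<integral>x. a x \<partial>M1) = (\<integral>z. of_bool (snd z) * a (fst z) \<partial>P)"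
    unfolding M1_def by (subst integral_distr) (auto simp: integral_density)
  moreover have "(\<integral>x. a x \<partial>M2) = (\<integral>z. \<eta> (fst z) * a (fst z) \<partial>P)"
  proof -
    have "AE z in P. 0 \<le> \<eta> (fst z)" by (rule AE_I2) (use \<eta>01 spP in auto)
    then show ?thesis
      unfolding M2_def by (subst integral_distr) (simp_all add: integral_density)
  qed
  ultimately show ?thesis by simp
qed

text \<open>Subtracting \<open>b\<close> from both branches leaves an integral over the label
  \<open>True\<close> and one over the feature alone, so the label \<open>False\<close> requires no
  identity of its own. Boundedness serves the linearity of the integral.\<close>

lemma label_integral:
  fixes a b :: "real^'d::finite \<Rightarrow> real"
  assumes P: "P \<in> space (prob_algebra obs_space)" and \<eta>: "regression_fun P \<eta>"
    and a[measurable]: "a \<in> borel_measurable cube_space" and b[measurable]: "b \<in> borel_measurable cube_space"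
    and ab: "\<And>x. x \<in> unit_cube \<Longrightarrow> \<bar>a x\<bar> \<le> B" "\<And>x. x \<in> unit_cube \<Longrightarrow> \<bar>b x\<bar> \<le> B"
  shows "(\<integral>z. (if snd z then a (fst z) else b (fst z)) \<partial>P)
    = (\<integral>z. \<eta> (fst z) * a (fst z) + (1 - \<eta> (fst z)) * b (fst z) \<partial>P)"
proof -
  interpret prob_space P using obs_law_facts(1)[OF P] .
  note [measurable_cong] = obs_law_facts(2)[OF P]
  have spP: "space P = unit_cube \<times> UNIV" using obs_law_facts(3)[OF P] .
  have \<eta>m[measurable]: "\<eta> \<in> borel_measurable cube_space" and \<eta>01: "\<And>x. x \<in> unit_cube \<Longrightarrow> 0 \<le> \<eta> x \<and> \<eta> x \<le> 1"
    using \<eta> unfolding regression_fun_def by auto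
  have int: "integrable P (\<lambda>z. c (fst z))" "integrable P (\<lambda>z. \<eta> (fst z) * c (fst z))"
      "integrable P (\<lambda>z. of_bool (snd z) * c (fst z))"
    if [measurable]: "c \<in> borel_measurable cube_space" and c: "\<And>x. x \<in> unit_cube \<Longrightarrow> \<bar>c x\<bar> \<le> 2 * B" for c
  proof -
    show "integrable P (\<lambda>z. c (fst z))"
      by (rule integrable_const_bound[of _ "2 * B"]) (auto simp: spP intro!: AE_I2 c)
    have "\<bar>\<eta> x * c x\<bar> \<le> 2 * B" if "x \<in> unit_cube" for x
      using \<eta>01[OF that] c[OF that] mult_left_le_one_le[of "\<bar>c x\<bar>" "\<eta> x"] by (simp add: abs_mult)
    then show "integrable P (\<lambda>z. \<eta> (fst z) * c (fst z))"
      by (intro integrable_const_bound[of _ "2 * B"]) (auto simp: spP intro!: AE_I2)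
    have c': "\<bar>of_bool y * c x\<bar> \<le> 2 * B" if "x \<in> unit_cube" for x y
      using c[OF that] by (cases y) auto
    show "integrable P (\<lambda>z. of_bool (snd z) * c (fst z))"
    proof (rule integrable_const_bound[of _ "2 * B"])
      show "AE z in P. norm (of_bool (snd z) * c (fst z)) \<le> 2 * B"
        by (rule AE_I2) (use c' spP in \<open>simp only: real_norm_def mem_Times_iff\<close>)
    qed simp
  qed
  define c where "c = (\<lambda>x. a x - b x)"
  have [measurable]: "c \<in> borel_measurable cube_space" unfolding c_def by simp
  have cB: "\<bar>c x\<bar> \<le> 2 * B" "\<bar>b x\<bar> \<le> 2 * B" if "x \<in> unit_cube" for x
    using ab[OF that] by (auto simp: c_def)
  have "(\<integral>z. (if snd z then a (fst z) else b (fst z)) \<partial>P) = (\<integral>z. of_bool (snd z) * c (fst z) + b (fst z) \<partial>P)"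
    by (intro Bochner_Integration.integral_cong) (auto simp: c_def)
  also have "\<dots> = (\<integral>z. of_bool (snd z) * c (fst z) \<partial>P) + (\<integral>z. b (fst z) \<partial>P)"
    by (rule Bochner_Integration.integral_add) (use int cB in auto)
  also have "\<dots> = (\<integral>z. \<eta> (fst z) * c (fst z) \<partial>P) + (\<integral>z. b (fst z) \<partial>P)"
    by (subst label_integral_True[OF P \<eta>]) auto
  also have "\<dots> = (\<integral>z. \<eta> (fst z) * c (fst z) + b (fst z) \<partial>P)"
    by (rule Bochner_Integration.integral_add[symmetric]) (use int cB in auto)
  also have "\<dots> = (\<integral>z. \<eta> (fst z) * a (fst z) + (1 - \<eta> (fst z)) * b (fst z) \<partial>P)"
    by (intro Bochner_Integration.integral_cong) (auto simp: c_def algebra_simps)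
  finally show ?thesis .
qed

lemma risk_eq:
  fixes P :: "('d::finite) obs measure"
  assumes P: "P \<in> space (prob_algebra obs_space)" and \<eta>: "regression_fun P \<eta>"
    and f[measurable]: "f \<in> cube_space \<rightarrow>\<^sub>M count_space UNIV"
  shows "risk P f = (\<integral>z. (if f (fst z) then 1 - \<eta> (fst z) else \<eta> (fst z)) \<partial>P)"
proof -
  note [measurable_cong] = obs_law_facts(2)[OF P]
  have "risk P f = (\<integral>z. indicator {z \<in> space P. snd z \<noteq> f (fst z)} z \<partial>P)"
    unfolding risk_def by simp
  also have "\<dots> = (\<integral>z. (if snd z then of_bool (\<not> f (fst z)) else of_bool (f (fst z))) \<partial>P)"
    by (intro Bochner_Integration.integral_cong) (auto simp: indicator_def)
  also have "\<dots> = (\<integral>z. \<eta> (fst z) * of_bool (\<not> f (fst z)) + (1 - \<eta> (fst z)) * of_bool (f (fst z)) \<partial>P)"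
    by (rule label_integral[OF P \<eta>, of _ _ 1]) auto
  also have "\<dots> = (\<integral>z. (if f (fst z) then 1 - \<eta> (fst z) else \<eta> (fst z)) \<partial>P)"
    by (intro Bochner_Integration.integral_cong) auto
  finally show ?thesis .
qed

text \<open>Given the feature, the two possible decisions err with probabilities \<eta> and 1 -
  \<eta>. The plug-in rule takes the smaller one, and the gap is \<bar>2 \<eta> - 1\<bar> wherever
  the decisions differ.\<close>

lemma risk_diff_plugin:
  fixes P :: "('d::finite) obs measure"
  assumes P: "P \<in> space (prob_algebra obs_space)" and \<eta>: "regression_fun P \<eta>"
    and f[measurable]: "f \<in> cube_space \<rightarrow>\<^sub>M count_space UNIV"
  shows "risk P f - risk P (\<lambda>x. 1/2 \<le> \<eta> x)
    = (\<integral>z. \<bar>2 * \<eta> (fst z) - 1\<bar> * of_bool (f (fst z) \<noteq> (1/2 \<le> \<eta> (fst z))) \<partial>P)"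
proof -
  interpret prob_space P using obs_law_facts(1)[OF P] .
  note [measurable_cong] = obs_law_facts(2)[OF P]
  have spP: "space P = unit_cube \<times> UNIV" using obs_law_facts(3)[OF P] .
  have \<eta>m[measurable]: "\<eta> \<in> borel_measurable cube_space" and \<eta>01: "\<And>x. x \<in> unit_cube \<Longrightarrow> 0 \<le> \<eta> x \<and> \<eta> x \<le> 1"
    using \<eta> unfolding regression_fun_def by auto
  have gm[measurable]: "(\<lambda>x. 1/2 \<le> \<eta> x) \<in> cube_space \<rightarrow>\<^sub>M count_space UNIV" by measurable
  have int: "integrable P (\<lambda>z. if g (fst z) then 1 - \<eta> (fst z) else \<eta> (fst z))"
    if [measurable]: "g \<in> cube_space \<rightarrow>\<^sub>M count_space UNIV" for g
  proof (rule integrable_const_bound[of _ 1])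
    show "AE z in P. norm (if g (fst z) then 1 - \<eta> (fst z) else \<eta> (fst z)) \<le> 1"
      by (rule AE_I2) (use \<eta>01 spP in force)
  qed simp
  show ?thesis
    unfolding risk_eq[OF P \<eta> f] risk_eq[OF P \<eta> gm]
    apply (subst Bochner_Integration.integral_diff[symmetric])
      apply (rule int, measurable)
     apply (rule int, measurable)
    by (intro Bochner_Integration.integral_cong) auto
qed

text \<open>The plug-in rule of any version is optimal by \<open>risk_diff_plugin\<close> for that
  version, so the risks of two versions bound each other. This avoids comparing the versions
  themselves almost everywhere.\<close>

lemma risk_bayes:
  fixes P :: "('d::finite) obs measure"
  assumes P: "P \<in> space (prob_algebra obs_space)" and \<eta>: "regression_fun P \<eta>"
  shows "risk P (bayes_classifier P) = risk P (\<lambda>x. 1/2 \<le> \<eta> x)"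
proof -
  define \<eta>' where "\<eta>' = (SOME \<eta>. regression_fun P \<eta>)"
  have \<eta>': "regression_fun P \<eta>'" unfolding \<eta>'_def by (rule someI[where P="regression_fun P", OF \<eta>])
  have [measurable]: "\<eta> \<in> borel_measurable cube_space" "\<eta>' \<in> borel_measurable cube_space"
    using \<eta> \<eta>' unfolding regression_fun_def by auto
  have b: "bayes_classifier P = (\<lambda>x. 1/2 \<le> \<eta>' x)"
    by (rule ext) (simp add: bayes_classifier_def \<eta>'_def)
  have "risk P (\<lambda>x. 1/2 \<le> \<eta>' x) - risk P (\<lambda>x. 1/2 \<le> \<eta> x) \<ge> 0"
    by (subst risk_diff_plugin[OF P \<eta>]) auto
  moreover have "risk P (\<lambda>x. 1/2 \<le> \<eta> x) - risk P (\<lambda>x. 1/2 \<le> \<eta>' x) \<ge> 0"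
    by (subst risk_diff_plugin[OF P \<eta>']) auto
  ultimately show ?thesis unfolding b by simp
qed


section \<open>Laws of the transcripts\<close>

lemma sample_law_prob_algebra:
  assumes "P \<in> space (prob_algebra obs_space)"
  shows "sample_law n P \<in> space (prob_algebra (sample_space n))"
  using assms unfolding sample_law_def sample_space_def space_prob_algebra
  by (auto intro!: prob_space_PiM sets_PiM_cong)

lemma bind_in_prob_algebra:
  assumes "M \<in> space (prob_algebra A)" "K \<in> A \<rightarrow>\<^sub>M prob_algebra B"
  shows "M \<bind> K \<in> space (prob_algebra B)"
  using prob_space_bind'[OF assms] sets_bind'[OF assms] by (simp add: space_prob_algebra)

lemma pair_in_prob_algebra:
  assumes "M \<in> space (prob_algebra A)" "N \<in> space (prob_algebra B)"
  shows "M \<Otimes>\<^sub>M N \<in> space (prob_algebra (A \<Otimes>\<^sub>M B))"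
proof -
  have M: "prob_space M" "sets M = sets A" and N: "prob_space N" "sets N = sets B"
    using assms by (auto simp: space_prob_algebra)
  interpret pair_prob_space M N
    using M(1) N(1) by (simp add: pair_prob_space_def pair_sigma_finite_def prob_space_imp_sigma_finite)
  show ?thesis
    using prob_space_axioms sets_pair_measure_cong[OF M(2) N(2)] by (simp add: space_prob_algebra)
qed

lemma PiM_in_prob_algebra:
  assumes "\<And>i. i \<in> I \<Longrightarrow> M i \<in> space (prob_algebra (N i))"
  shows "PiM I M \<in> space (prob_algebra (PiM I N))"
  using assms unfolding space_prob_algebra
  by (auto intro!: prob_space_PiM sets_PiM_cong)

context
  fixes m :: nat and n :: "nat \<Rightarrow> nat" and \<epsilon> \<delta> :: "nat \<Rightarrow> real"
    and p :: "('d::finite, 't) protocol" and P :: "nat \<Rightarrow> 'd obs measure"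
  assumes p: "p \<in> private_protocols m n \<epsilon> \<delta>"
    and P: "\<And>j. j \<le> m \<Longrightarrow> P j \<in> space (prob_algebra obs_space)"
begin

lemma transcript_law_prob_algebra:
  assumes "j \<in> {1..m}"
  shows "transcript_law n p P j \<in> space (prob_algebra (src_space p j))"
  unfolding transcript_law_def
  by (rule bind_in_prob_algebra[OF sample_law_prob_algebra[OF P]])
     (use p assms in \<open>auto simp: private_protocols_def\<close>)

lemma final_law_prob_algebra: "final_law m n p P \<in> space (prob_algebra (fin_space p))"
  unfolding final_law_def
  by (rule bind_in_prob_algebra[OF pair_in_prob_algebra[OF sample_law_prob_algebra[OF P]
        PiM_in_prob_algebra[OF transcript_law_prob_algebra]]])
     (use p in \<open>auto simp: private_protocols_def\<close>)

text \<open>Fubini: averaging over the transcript first leaves the probability of a wrong decision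
  at a point, weighted by \<bar>2 \<eta> - 1\<bar>. The upper and the lower bound both start from
  this formula.\<close>

lemma excess_risk_eq:
  assumes \<eta>: "regression_fun (P 0) \<eta>"
  shows "excess_risk m n p P = (\<integral>z. \<bar>2 * \<eta> (fst z) - 1\<bar> *
    measure (final_law m n p P) {T \<in> space (final_law m n p P). classifier p (T, fst z) \<noteq> (1/2 \<le> \<eta> (fst z))} \<partial>P 0)"
proof -
  define F where "F = final_law m n p P"
  have F: "prob_space F" and Fs: "sets F = sets (fin_space p)"
    using final_law_prob_algebra by (auto simp: F_def space_prob_algebra)
  have P0: "P 0 \<in> space (prob_algebra obs_space)" using P by simp
  note [measurable_cong] = obs_law_facts(2)[OF P0] Fs
  have spP: "space (P 0) = unit_cube \<times> UNIV" using obs_law_facts(3)[OF P0] .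
  interpret F: prob_space F by fact
  interpret P0: prob_space "P 0" by (rule obs_law_facts(1)[OF P0])
  interpret FP: pair_prob_space F "P 0" ..
  have [measurable]: "classifier p \<in> fin_space p \<Otimes>\<^sub>M cube_space \<rightarrow>\<^sub>M count_space UNIV"
    using p by (simp add: private_protocols_def)
  have \<eta>m[measurable]: "\<eta> \<in> borel_measurable cube_space"
    and \<eta>01: "\<And>x. x \<in> unit_cube \<Longrightarrow> 0 \<le> \<eta> x \<and> \<eta> x \<le> 1"
    using \<eta> unfolding regression_fun_def by auto
  define R where "R T z = \<bar>2 * \<eta> (fst z) - 1\<bar> * of_bool (classifier p (T, fst z) \<noteq> (1/2 \<le> \<eta> (fst z)))"
    for T and z :: "'d obs"
  have Rm[measurable]: "case_prod R \<in> borel_measurable (F \<Otimes>\<^sub>M P 0)"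
    unfolding R_def by measurable
  have Rb: "\<bar>R T z\<bar> \<le> 1" if "z \<in> space (P 0)" for T z
    using \<eta>01[of "fst z"] that by (auto simp: R_def spP)
  have Rint: "integrable (F \<Otimes>\<^sub>M P 0) (case_prod R)"
    by (rule FP.integrable_const_bound[of _ 1]) (auto intro!: AE_I2 simp: space_pair_measure intro: Rb)
  have cm: "(\<lambda>x. classifier p (T, x)) \<in> cube_space \<rightarrow>\<^sub>M count_space UNIV" if "T \<in> space F" for T
    using that by measurable (use Fs that in \<open>auto dest: sets_eq_imp_space_eq\<close>)
  have diff: "risk (P 0) (\<lambda>x. classifier p (T, x)) - risk (P 0) (bayes_classifier (P 0)) = (\<integral>z. R T z \<partial>P 0)"
    if T: "T \<in> space F" for T
    unfolding risk_bayes[OF P0 \<eta>] R_def by (rule risk_diff_plugin[OF P0 \<eta> cm[OF T]])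
  have int1: "integrable F (\<lambda>T. \<integral>z. R T z \<partial>P 0)"
    using FP.integrable_fst'[OF Rint] by simp
  have "(\<integral>T. risk (P 0) (\<lambda>x. classifier p (T, x)) \<partial>F)
      = (\<integral>T. (\<integral>z. R T z \<partial>P 0) + risk (P 0) (bayes_classifier (P 0)) \<partial>F)"
    by (rule Bochner_Integration.integral_cong) (auto simp flip: diff)
  also have "\<dots> = (\<integral>T. (\<integral>z. R T z \<partial>P 0) \<partial>F) + risk (P 0) (bayes_classifier (P 0))"
    by (subst Bochner_Integration.integral_add) (auto simp: int1 F.prob_space)
  finally have "excess_risk m n p P = (\<integral>T. (\<integral>z. R T z \<partial>P 0) \<partial>F)"
    by (simp add: excess_risk_def F_def)
  also have "\<dots> = (\<integral>z. (\<integral>T. R T z \<partial>F) \<partial>P 0)"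
    by (rule FP.Fubini_integral[OF Rint, symmetric])
  also have "\<dots> = (\<integral>z. \<bar>2 * \<eta> (fst z) - 1\<bar> *
      measure F {T \<in> space F. classifier p (T, fst z) \<noteq> (1/2 \<le> \<eta> (fst z))} \<partial>P 0)"
  proof (rule Bochner_Integration.integral_cong)
    fix z assume z: "z \<in> space (P 0)"
    have "(\<integral>T. R T z \<partial>F) = \<bar>2 * \<eta> (fst z) - 1\<bar> * (\<integral>T. of_bool (classifier p (T, fst z) \<noteq> (1/2 \<le> \<eta> (fst z))) \<partial>F)"
      unfolding R_def by simp
    also have "(\<integral>T. of_bool (classifier p (T, fst z) \<noteq> (1/2 \<le> \<eta> (fst z))) \<partial>F)
        = (\<integral>T. indicator {T \<in> space F. classifier p (T, fst z) \<noteq> (1/2 \<le> \<eta> (fst z))} T \<partial>F)"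
      by (rule Bochner_Integration.integral_cong) (auto simp: indicator_def)
    also have "\<dots> = measure F {T \<in> space F. classifier p (T, fst z) \<noteq> (1/2 \<le> \<eta> (fst z))}"
      by (subst Bochner_Integration.integral_indicator) (rule arg_cong[of _ _ "measure F"], auto)
    finally show "(\<integral>T. R T z \<partial>F) = \<bar>2 * \<eta> (fst z) - 1\<bar> *
      measure F {T \<in> space F. classifier p (T, fst z) \<noteq> (1/2 \<le> \<eta> (fst z))}" .
  qed simp
  finally show ?thesis unfolding F_def .
qed

end

text \<open>Test functions with values in [0, 1] replace events: integrating out the transcripts of
  the other servers turns an event into such a function.\<close>

definition unit_valued :: "'a measure \<Rightarrow> ('a \<Rightarrow> real) \<Rightarrow> bool" where
  "unit_valued N f \<longleftrightarrow> f \<in> borel_measurable N \<and> (\<forall>x\<in>space N. 0 \<le> f x \<and> f x \<le> 1)"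

lemma unit_valuedD:
  assumes "unit_valued N f"
  shows "f \<in> borel_measurable N" "\<And>x. x \<in> space N \<Longrightarrow> 0 \<le> f x" "\<And>x. x \<in> space N \<Longrightarrow> f x \<le> 1"
  using assms by (auto simp: unit_valued_def)

lemma unit_valued_integral:
  assumes M: "M \<in> space (prob_algebra N)" and f: "unit_valued N f"
  shows "integrable M f" "0 \<le> (\<integral>x. f x \<partial>M)" "(\<integral>x. f x \<partial>M) \<le> 1"
    "ennreal (\<integral>x. f x \<partial>M) = (\<integral>\<^sup>+x. f x \<partial>M)"
proof -
  have M': "prob_space M" "sets M = sets N" using M by (auto simp: space_prob_algebra)
  interpret prob_space M by fact
  have sp: "space M = space N" using M'(2) by (rule sets_eq_imp_space_eq)
  have fm: "f \<in> borel_measurable M"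
    by (subst measurable_cong_sets[OF M'(2) refl]) (rule unit_valuedD(1)[OF f])
  have AE: "AE x in M. 0 \<le> f x" "AE x in M. f x \<le> 1" "AE x in M. norm (f x) \<le> 1"
    using unit_valuedD(2,3)[OF f] by (auto simp: sp intro!: AE_I2)
  show int: "integrable M f" by (rule integrable_const_bound[OF AE(3) fm])
  show "0 \<le> (\<integral>x. f x \<partial>M)" by (rule integral_nonneg_AE[OF AE(1)])
  show "(\<integral>x. f x \<partial>M) \<le> 1" by (rule integral_le_const[OF int AE(2)])
  show "ennreal (\<integral>x. f x \<partial>M) = (\<integral>\<^sup>+x. f x \<partial>M)"
    by (rule nn_integral_eq_integral[OF int AE(1), symmetric])
qed

lemma unit_valued_kernel:
  assumes K: "K \<in> N \<rightarrow>\<^sub>M prob_algebra N'" and G: "unit_valued N' G"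
  shows "unit_valued N (\<lambda>z. \<integral>t. G t \<partial>K z)"
  unfolding unit_valued_def
proof
  show "(\<lambda>z. \<integral>t. G t \<partial>K z) \<in> borel_measurable N"
    by (rule measurable_compose[OF measurable_prob_algebraD[OF K]
          integral_measurable_subprob_algebra[OF unit_valuedD(1)[OF G]]])
  show "\<forall>z\<in>space N. 0 \<le> (\<integral>t. G t \<partial>K z) \<and> (\<integral>t. G t \<partial>K z) \<le> 1"
    using unit_valued_integral(2,3)[OF measurable_space[OF K] G] by blast
qed

lemma integral_bind_unit_valued:
  assumes M: "M \<in> space (prob_algebra N)" and K: "K \<in> N \<rightarrow>\<^sub>M prob_algebra N'" and G: "unit_valued N' G"
  shows "(\<integral>t. G t \<partial>(M \<bind> K)) = (\<integral>z. (\<integral>t. G t \<partial>K z) \<partial>M)"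
proof -
  have sM: "sets M = sets N" using M by (simp add: space_prob_algebra)
  have KM: "K \<in> M \<rightarrow>\<^sub>M subprob_algebra N'"
    by (subst measurable_cong_sets[OF sM refl]) (rule measurable_prob_algebraD[OF K])
  have "ennreal (\<integral>t. G t \<partial>(M \<bind> K)) = (\<integral>\<^sup>+t. G t \<partial>(M \<bind> K))"
    by (rule unit_valued_integral(4)[OF bind_in_prob_algebra[OF M K] G])
  also have "\<dots> = (\<integral>\<^sup>+z. (\<integral>\<^sup>+t. G t \<partial>K z) \<partial>M)"
    by (rule nn_integral_bind[OF _ KM]) (use unit_valuedD(1)[OF G] in simp)
  also have "\<dots> = (\<integral>\<^sup>+z. ennreal (\<integral>t. G t \<partial>K z) \<partial>M)"
    using sets_eq_imp_space_eq[OF sM]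
    by (intro nn_integral_cong unit_valued_integral(4)[symmetric, OF _ G]) (auto intro: measurable_space[OF K])
  also have "\<dots> = ennreal (\<integral>z. (\<integral>t. G t \<partial>K z) \<partial>M)"
    by (rule unit_valued_integral(4)[symmetric, OF M unit_valued_kernel[OF K G]])
  finally show ?thesis
    using unit_valued_integral(2)[OF bind_in_prob_algebra[OF M K] G]
      unit_valued_integral(2)[OF M unit_valued_kernel[OF K G]] by simp
qed

lemma unit_valued_pair:
  assumes T: "T \<in> space (prob_algebra N')" and g: "unit_valued (N \<Otimes>\<^sub>M N') g"
  shows "unit_valued N (\<lambda>z. \<integral>t. g (z, t) \<partial>T)" "z \<in> space N \<Longrightarrow> unit_valued N' (\<lambda>t. g (z, t))"
proof -
  have T': "prob_space T" "sets T = sets N'" using T by (auto simp: space_prob_algebra)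
  interpret T: prob_space T by fact
  have gm: "g \<in> borel_measurable (N \<Otimes>\<^sub>M T)"
    by (subst measurable_cong_sets[OF sets_pair_measure_cong[OF refl T'(2)] refl]) (rule unit_valuedD(1)[OF g])
  show uv: "unit_valued N' (\<lambda>t. g (z, t))" if "z \<in> space N" for z
    using that unit_valuedD[OF g] unfolding unit_valued_def by (auto simp: space_pair_measure)
  show "unit_valued N (\<lambda>z. \<integral>t. g (z, t) \<partial>T)"
    unfolding unit_valued_def
  proof
    show "(\<lambda>z. \<integral>t. g (z, t) \<partial>T) \<in> borel_measurable N"
      by (rule T.borel_measurable_lebesgue_integral) (use gm in simp)
    show "\<forall>z\<in>space N. 0 \<le> (\<integral>t. g (z, t) \<partial>T) \<and> (\<integral>t. g (z, t) \<partial>T) \<le> 1"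
      using unit_valued_integral(2,3)[OF T uv] by blast
  qed
qed

lemma abs_integral_diff_le:
  fixes f g :: "'a \<Rightarrow> real"
  assumes M: "M \<in> space (prob_algebra N)" and f: "integrable M f" and g: "integrable M g"
    and c: "\<And>x. x \<in> space N \<Longrightarrow> \<bar>f x - g x\<bar> \<le> c"
  shows "\<bar>(\<integral>x. f x \<partial>M) - (\<integral>x. g x \<partial>M)\<bar> \<le> c"
proof -
  have M': "prob_space M" "sets M = sets N" using M by (auto simp: space_prob_algebra)
  interpret prob_space M by fact
  have sp: "space M = space N" using M'(2) by (rule sets_eq_imp_space_eq)
  have "\<bar>(\<integral>x. f x \<partial>M) - (\<integral>x. g x \<partial>M)\<bar> = \<bar>\<integral>x. f x - g x \<partial>M\<bar>"
    by (subst Bochner_Integration.integral_diff[OF f g]) simp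
  also have "\<dots> \<le> (\<integral>x. \<bar>f x - g x\<bar> \<partial>M)" by (rule integral_abs_bound)
  also have "\<dots> \<le> c" by (rule integral_le_const) (use f g c in \<open>auto simp: sp intro!: AE_I2\<close>)
  finally show ?thesis .
qed

lemma unit_valued_indicator: "B \<in> sets N \<Longrightarrow> unit_valued N (indicator B)"
  by (auto simp: unit_valued_def indicator_def)

context
  fixes m :: nat and n :: "nat \<Rightarrow> nat" and \<epsilon> \<delta> :: "nat \<Rightarrow> real" and p :: "('d::finite, 't) protocol"
  assumes p: "p \<in> private_protocols m n \<epsilon> \<delta>"
begin

lemma fin_kernel_unit_valued:
  assumes "B \<in> sets (fin_space p)"
  shows "unit_valued (sample_space (n 0) \<Otimes>\<^sub>M PiM {1..m} (src_space p)) (\<lambda>x. measure (fin_kernel p x) B)"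
proof -
  have ker: "fin_kernel p \<in> sample_space (n 0) \<Otimes>\<^sub>M PiM {1..m} (src_space p) \<rightarrow>\<^sub>M prob_algebra (fin_space p)"
    using p by (simp add: private_protocols_def)
  show ?thesis
    unfolding unit_valued_def
  proof
    show "(\<lambda>x. measure (fin_kernel p x) B) \<in> borel_measurable (sample_space (n 0) \<Otimes>\<^sub>M PiM {1..m} (src_space p))"
      by (rule measurable_compose[OF measurable_prob_algebraD[OF ker] measurable_measure_subprob_algebra[OF assms]])
    show "\<forall>x\<in>space (sample_space (n 0) \<Otimes>\<^sub>M PiM {1..m} (src_space p)). 0 \<le> measure (fin_kernel p x) B \<and> measure (fin_kernel p x) B \<le> 1"
    proof
      fix x :: "(nat \<Rightarrow> 'd obs) \<times> (nat \<Rightarrow> 't)"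
      assume "x \<in> space (sample_space (n 0) \<Otimes>\<^sub>M PiM {1..m} (src_space p))"
      then interpret prob_space "fin_kernel p x" using measurable_space[OF ker] by (simp add: space_prob_algebra)
      show "0 \<le> measure (fin_kernel p x) B \<and> measure (fin_kernel p x) B \<le> 1" by simp
    qed
  qed
qed

text \<open>In this iterated form the sample of the target and the transcripts of the sources can be
  exchanged, or integrated out, separately.\<close>

lemma final_law_measure:
  assumes P: "\<And>j. j \<le> m \<Longrightarrow> P j \<in> space (prob_algebra obs_space)" and B: "B \<in> sets (fin_space p)"
  shows "measure (final_law m n p P) B
    = (\<integral>z. (\<integral>t. measure (fin_kernel p (z, t)) B \<partial>PiM {1..m} (transcript_law n p P)) \<partial>sample_law (n 0) (P 0))"
proof -
  define S0 where "S0 = sample_law (n 0) (P 0)"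
  define TT where "TT = PiM {1..m} (transcript_law n p P)"
  have S0: "S0 \<in> space (prob_algebra (sample_space (n 0)))" unfolding S0_def by (rule sample_law_prob_algebra) (use P in auto)
  have TT: "TT \<in> space (prob_algebra (PiM {1..m} (src_space p)))"
    unfolding TT_def by (rule PiM_in_prob_algebra, rule transcript_law_prob_algebra[OF p], rule P)
  have ker: "fin_kernel p \<in> sample_space (n 0) \<Otimes>\<^sub>M PiM {1..m} (src_space p) \<rightarrow>\<^sub>M prob_algebra (fin_space p)"
    using p by (simp add: private_protocols_def)
  interpret S0: prob_space S0 using S0 by (simp add: space_prob_algebra)
  interpret TT: prob_space TT using TT by (simp add: space_prob_algebra)
  interpret ST: pair_sigma_finite S0 TT ..
  have FL: "final_law m n p P \<in> space (prob_algebra (fin_space p))"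
    by (rule final_law_prob_algebra[OF p]) (rule P)
  have "measure (final_law m n p P) B = (\<integral>t. indicator B t \<partial>final_law m n p P)"
    using FL sets.sets_into_space[OF B] sets_eq_imp_space_eq[of "final_law m n p P" "fin_space p"]
    by (simp add: space_prob_algebra Int_absorb2)
  also have "\<dots> = (\<integral>x. (\<integral>t. indicator B t \<partial>fin_kernel p x) \<partial>(S0 \<Otimes>\<^sub>M TT))"
    unfolding final_law_def S0_def[symmetric] TT_def[symmetric]
    by (rule integral_bind_unit_valued[OF pair_in_prob_algebra[OF S0 TT] ker unit_valued_indicator[OF B]])
  also have "\<dots> = (\<integral>x. measure (fin_kernel p x) B \<partial>(S0 \<Otimes>\<^sub>M TT))"
  proof (rule Bochner_Integration.integral_cong[OF refl])
    fix x assume "x \<in> space (S0 \<Otimes>\<^sub>M TT)"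
    then have "x \<in> space (sample_space (n 0) \<Otimes>\<^sub>M PiM {1..m} (src_space p))"
      using S0 TT by (auto simp: space_pair_measure space_prob_algebra dest!: sets_eq_imp_space_eq)
    then have "fin_kernel p x \<in> space (prob_algebra (fin_space p))" by (rule measurable_space[OF ker])
    then have "sets (fin_kernel p x) = sets (fin_space p)" by (simp add: space_prob_algebra)
    then show "(\<integral>t. indicator B t \<partial>fin_kernel p x) = measure (fin_kernel p x) B"
      using sets.sets_into_space[OF B] sets_eq_imp_space_eq[of "fin_kernel p x" "fin_space p"] by (simp add: Int_absorb2)
  qed
  also have "\<dots> = (\<integral>z. (\<integral>t. measure (fin_kernel p (z, t)) B \<partial>TT) \<partial>S0)"
    by (rule ST.integral_fst'[symmetric])
       (rule unit_valued_integral(1)[OF pair_in_prob_algebra[OF S0 TT] fin_kernel_unit_valued[OF B]])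
  finally show ?thesis by (simp add: S0_def TT_def)
qed

end


section \<open>A private voting rule\<close>

definition logistic_fun :: "real \<Rightarrow> real" where
  "logistic_fun s = 1 / (1 + exp (- s))"

lemma logistic_fun_bounds: "0 < logistic_fun s" "logistic_fun s < 1"
  by (simp_all add: logistic_fun_def add_pos_pos)

lemma one_minus_logistic_fun: "1 - logistic_fun s = logistic_fun (- s)"
proof -
  have "1 + exp s \<noteq> 0" "1 + exp (-s) \<noteq> 0" by (metis add_pos_pos exp_gt_zero less_irrefl zero_less_one)+
  then show ?thesis
    by (simp add: logistic_fun_def field_simps flip: exp_add)
qed

text \<open>Any fraction \<open>l\<close> of the exponent is admissible, so
  \<open>vote_error\<close> may lower the exponent from the privacy scale to a value that the
  Chernoff bound tolerates.\<close>

lemma logistic_fun_le_exp: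
  assumes "0 \<le> l" "l \<le> 1"
  shows "logistic_fun (- s) \<le> exp (- (l * s))"
proof (cases "0 \<le> s")
  case True
  have "logistic_fun (- s) \<le> exp (- s)"
    by (simp add: logistic_fun_def exp_minus divide_simps add_pos_pos)
  also have "\<dots> \<le> exp (- (l * s))"
    using True assms mult_right_mono[of l 1 s] by simp
  finally show ?thesis .
next
  case False
  have "logistic_fun (- s) \<le> 1" using logistic_fun_bounds[of "-s"] by simp
  also have "\<dots> \<le> exp (- (l * s))" using False assms by (simp add: mult_nonneg_nonpos)
  finally show ?thesis .
qed

lemma logistic_fun_ratio: "logistic_fun s \<le> exp \<bar>s - t\<bar> * logistic_fun t"
proof -
  have "1 + exp (- t) \<le> exp \<bar>s - t\<bar> * (1 + exp (- s))"
  proof -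
    have "exp (- t) = exp (s - t) * exp (- s)" by (simp flip: exp_add)
    also have "\<dots> \<le> exp \<bar>s - t\<bar> * exp (- s)" by (intro mult_right_mono) auto
    finally have "exp (- t) \<le> exp \<bar>s - t\<bar> * exp (- s)" .
    moreover have "1 \<le> exp \<bar>s - t\<bar>" by simp
    moreover have "exp \<bar>s - t\<bar> * (1 + exp (- s)) = exp \<bar>s - t\<bar> + exp \<bar>s - t\<bar> * exp (- s)"
      by (simp add: distrib_left)
    ultimately show ?thesis by linarith
  qed
  then show ?thesis
    by (simp add: logistic_fun_def divide_simps add_pos_pos mult.commute)
qed

section \<open>Grid cells, their neighbourhoods and the votes of the cells\<close>

definition cell :: "nat \<Rightarrow> real^'d::finite \<Rightarrow> 'd \<Rightarrow> nat" where
  "cell q x i = nat \<lfloor>real q * x $ i\<rfloor>"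

definition near :: "nat \<Rightarrow> ('d \<Rightarrow> nat) \<Rightarrow> real^'d::finite \<Rightarrow> bool" where
  "near q k x \<longleftrightarrow> (\<forall>i. \<bar>\<lfloor>real q * x $ i\<rfloor> - int (k i)\<bar> \<le> 1)"

text \<open>The index \<open>q\<close> is included because a coordinate equal to 1 falls into
  it.\<close>

definition cells :: "nat \<Rightarrow> ('d::finite \<Rightarrow> nat) set" where
  "cells q = {k. \<forall>i. k i \<le> q}"

lemma finite_cells [simp]: "finite (cells q :: ('d::finite \<Rightarrow> nat) set)"
proof -
  have "cells q = PiE (UNIV :: 'd set) (\<lambda>_. {..q})" by (auto simp: cells_def)
  then show ?thesis by (simp only:) (rule finite_PiE, auto)
qed

lemma finite_bool_funs: "finite {f :: ('d::finite \<Rightarrow> nat) \<Rightarrow> bool. \<forall>k. k \<notin> cells q \<longrightarrow> f k = False}" (is "finite ?\<Omega>")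
proof -
  have "?\<Omega> \<subseteq> (\<lambda>S k. k \<in> S) ` Pow (cells q)"
  proof
    fix f :: "('d \<Rightarrow> nat) \<Rightarrow> bool" assume "f \<in> ?\<Omega>"
    then show "f \<in> (\<lambda>S k. k \<in> S) ` Pow (cells q)"
      by (intro image_eqI[of _ _ "Collect f"]) auto
  qed
  then show ?thesis by (rule finite_subset) simp
qed

lemma cell_in_cells: "x \<in> unit_cube \<Longrightarrow> cell q x \<in> cells q"
  unfolding cells_def cell_def unit_cube_def
  by (auto simp: nat_le_iff) (metis floor_mono floor_of_nat mult.right_neutral mult_left_mono of_nat_0_le_iff)

lemma borel_measurable_vec_component [measurable]: "(\<lambda>x::real^'d::finite. x $ i) \<in> borel_measurable borel"
  by (intro borel_measurable_continuous_onI continuous_intros)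

lemma borel_measurable_cube_component [measurable]:
  "(\<lambda>x::real^'d::finite. x $ i) \<in> borel_measurable cube_space"
  by (rule borel_measurable_cube_spaceI) measurable

lemma measurable_cube_floor [measurable]:
  "(\<lambda>x::real^'d::finite. \<lfloor>real q * x $ i\<rfloor>) \<in> cube_space \<rightarrow>\<^sub>M count_space UNIV"
  by (rule measurable_compose[OF _ measurable_real_floor]) measurable

lemma measurable_near [measurable]:
  "near q (k :: 'd::finite \<Rightarrow> nat) \<in> cube_space \<rightarrow>\<^sub>M count_space UNIV"
proof -
  have [measurable]: "(\<lambda>x::real^'d. \<bar>\<lfloor>real q * x $ i\<rfloor> - int (k i)\<bar> \<le> 1) \<in> cube_space \<rightarrow>\<^sub>M count_space UNIV" for i
    by (rule measurable_compose[OF measurable_cube_floor, where g = "\<lambda>j. \<bar>j - int (k i)\<bar> \<le> 1"]) simp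
  show ?thesis unfolding near_def[abs_def] by measurable
qed

lemma measurable_cell_eq [measurable]:
  "(\<lambda>x::real^'d::finite. cell q x = k) \<in> cube_space \<rightarrow>\<^sub>M count_space UNIV"
proof -
  have [measurable]: "(\<lambda>x::real^'d. nat \<lfloor>real q * x $ i\<rfloor> = k i) \<in> cube_space \<rightarrow>\<^sub>M count_space UNIV" for i
    by (rule measurable_compose[OF measurable_cube_floor, where g = "\<lambda>j. nat j = k i"]) simp
  show ?thesis unfolding cell_def[abs_def] fun_eq_iff by measurable
qed

text \<open>The cells whose neighbourhood contains a point have at most three possible indices in
  each coordinate. This number determines how much one observation can influence the votes.\<close>

lemma card_near: "card {k \<in> cells q. near q k x} \<le> 3 ^ CARD('d)" for x :: "real^'d::finite"
proof -
  define I where "I = (\<lambda>i. nat ` {\<lfloor>real q * x $ i\<rfloor> - 1..\<lfloor>real q * x $ i\<rfloor> + 1})"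
  have "{k \<in> cells q. near q k x} \<subseteq> PiE UNIV I"
  proof
    fix k assume "k \<in> {k \<in> cells q. near q k x}"
    then have k: "\<bar>\<lfloor>real q * x $ i\<rfloor> - int (k i)\<bar> \<le> 1" for i by (auto simp: near_def)
    have "k i \<in> I i" for i
      unfolding I_def by (rule image_eqI[of _ _ "int (k i)"]) (use k[of i] in auto)
    then show "k \<in> PiE UNIV I" by auto
  qed
  then have "card {k \<in> cells q. near q k x} \<le> card (PiE UNIV I)"
    by (intro card_mono finite_PiE) (auto simp: I_def)
  also have "\<dots> = (\<Prod>i\<in>UNIV. card (I i))" by (simp add: card_PiE)
  also have "\<dots> \<le> (\<Prod>i\<in>(UNIV::'d set). 3)"
  proof (rule prod_mono)
    fix i
    have "card (I i) \<le> card {\<lfloor>real q * x $ i\<rfloor> - 1..\<lfloor>real q * x $ i\<rfloor> + 1}"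
      unfolding I_def by (rule card_image_le) simp
    then show "0 \<le> card (I i) \<and> card (I i) \<le> 3" by simp
  qed
  finally show ?thesis by simp
qed

text \<open>The neighbours of a cell vote as well: the support may meet the cell itself in a set of very
  small measure, whereas the regularity condition makes the neighbourhood heavy.\<close>
definition vote :: "nat \<Rightarrow> nat \<Rightarrow> (nat \<Rightarrow> ('d::finite) obs) \<Rightarrow> ('d \<Rightarrow> nat) \<Rightarrow> real" where
  "vote q n z k = (\<Sum>i<n. of_bool (near q k (fst (z i))) * (if snd (z i) then 1 else - 1))"

definition vote_pmf :: "nat \<Rightarrow> real \<Rightarrow> nat \<Rightarrow> (nat \<Rightarrow> ('d::finite) obs) \<Rightarrow> (('d \<Rightarrow> nat) \<Rightarrow> bool) pmf" where
  "vote_pmf q l n z = Pi_pmf (cells q) False (\<lambda>k. bernoulli_pmf (logistic_fun (l * vote q n z k)))"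

lemma pmf_bernoulli_logistic:
  "pmf (bernoulli_pmf (logistic_fun s)) b = logistic_fun (if b then s else - s)"
  using logistic_fun_bounds[of s] by (simp add: pmf_bernoulli_True pmf_bernoulli_False one_minus_logistic_fun)

section \<open>Privacy and measurability of the voting mechanism\<close>

text \<open>Replacing a datum withdraws one observation and adds another, and each of them moves at
  most \<open>3 ^ CARD('d)\<close> counts by one.\<close>

lemma vote_adjacent:
  fixes z :: "nat \<Rightarrow> ('d::finite) obs"
  assumes "adjacent n z z'"
  shows "(\<Sum>k\<in>cells q. \<bar>vote q n z k - vote q n z' k\<bar>) \<le> 2 * 3 ^ CARD('d)"
proof -
  obtain i where i: "i < n" "\<And>k. k < n \<Longrightarrow> k \<noteq> i \<Longrightarrow> z k = z' k"
    using assms by (auto simp: adjacent_def)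
  define g :: "('d \<Rightarrow> nat) \<Rightarrow> 'd obs \<Rightarrow> real"
    where "g = (\<lambda>k o'. of_bool (near q k (fst o')) * (if snd o' then 1 else - 1))"
  have v: "vote q n y k = g k (y i) + (\<Sum>j\<in>{..<n} - {i}. g k (y j))" for y k
    unfolding vote_def g_def using i(1) by (subst sum.remove[of _ i]) auto
  have "\<bar>vote q n z k - vote q n z' k\<bar> \<le> of_bool (near q k (fst (z i))) + of_bool (near q k (fst (z' i)))" for k
  proof -
    have "(\<Sum>j\<in>{..<n} - {i}. g k (z j)) = (\<Sum>j\<in>{..<n} - {i}. g k (z' j))"
      by (intro sum.cong) (auto simp: i(2))
    then show ?thesis unfolding v by (auto simp: g_def)
  qed
  then have "(\<Sum>k\<in>cells q. \<bar>vote q n z k - vote q n z' k\<bar>)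
     \<le> (\<Sum>k\<in>cells q. of_bool (near q k (fst (z i))) + of_bool (near q k (fst (z' i))))"
    by (intro sum_mono) auto
  also have "\<dots> = real (card {k \<in> cells q. near q k (fst (z i))}) + real (card {k \<in> cells q. near q k (fst (z' i))})"
    by (simp add: sum.distrib sum_of_bool_eq Int_def conj_commute)
  also have "\<dots> \<le> real (3 ^ CARD('d)) + real (3 ^ CARD('d))"
    by (intro add_mono of_nat_mono card_near)
  finally show ?thesis by simp
qed

text \<open>The bits are independent, so the likelihood ratios multiply and the exponent is
  \<open>l\<close> times the sum of all changes of counts. The number of cells, which grows with
  \<open>q\<close>, does not enter.\<close>

lemma pmf_vote_adjacent:
  fixes z :: "nat \<Rightarrow> ('d::finite) obs"
  assumes "adjacent n z z'" "0 \<le> l"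
  shows "pmf (vote_pmf q l n z) f \<le> exp (l * (2 * 3 ^ CARD('d))) * pmf (vote_pmf q l n z') f"
proof (cases "\<forall>x. x \<notin> cells q \<longrightarrow> f x = False")
  case False
  then show ?thesis unfolding vote_pmf_def by (subst (1 2) pmf_Pi) auto
next
  case True
  define t where "t = (\<lambda>z k. if f k then l * vote q n z k else - (l * vote q n z k))"
  have pm: "pmf (vote_pmf q l n z) f = (\<Prod>k\<in>cells q. logistic_fun (t z k))" for z
    unfolding vote_pmf_def using True by (subst pmf_Pi) (auto simp: pmf_bernoulli_logistic t_def)
  have "(\<Prod>k\<in>cells q. logistic_fun (t z k)) \<le> (\<Prod>k\<in>cells q. exp \<bar>t z k - t z' k\<bar> * logistic_fun (t z' k))"
    by (intro prod_mono) (auto simp: logistic_fun_ratio less_imp_le[OF logistic_fun_bounds(1)])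
  also have "\<dots> = exp (\<Sum>k\<in>cells q. \<bar>t z k - t z' k\<bar>) * (\<Prod>k\<in>cells q. logistic_fun (t z' k))"
    by (simp add: prod.distrib exp_sum)
  also have "(\<Sum>k\<in>cells q. \<bar>t z k - t z' k\<bar>) = l * (\<Sum>k\<in>cells q. \<bar>vote q n z k - vote q n z' k\<bar>)"
    unfolding sum_distrib_left
    by (intro sum.cong) (use \<open>0 \<le> l\<close> in \<open>auto simp: t_def abs_mult simp flip: right_diff_distrib\<close>)
  finally have "(\<Prod>k\<in>cells q. logistic_fun (t z k))
     \<le> exp (l * (\<Sum>k\<in>cells q. \<bar>vote q n z k - vote q n z' k\<bar>)) * (\<Prod>k\<in>cells q. logistic_fun (t z' k))" .
  also have "\<dots> \<le> exp (l * (2 * 3 ^ CARD('d))) * (\<Prod>k\<in>cells q. logistic_fun (t z' k))"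
    using vote_adjacent[OF assms(1), of q] assms(2)
    by (intro mult_right_mono prod_nonneg) (auto intro!: mult_left_mono less_imp_le[OF logistic_fun_bounds(1)])
  finally show ?thesis unfolding pm .
qed

lemma measure_pmf_le:
  assumes "\<And>x. pmf p x \<le> c * pmf q x" "0 \<le> c"
  shows "measure_pmf.prob p A \<le> c * measure_pmf.prob q A"
proof -
  have "emeasure p A = (\<integral>\<^sup>+x. pmf p x \<partial>count_space A)" by (simp add: nn_integral_pmf)
  also have "\<dots> \<le> (\<integral>\<^sup>+x. ennreal c * pmf q x \<partial>count_space A)"
    by (intro nn_integral_mono) (simp add: assms flip: ennreal_mult)
  also have "\<dots> = ennreal c * emeasure q A" by (simp add: nn_integral_cmult nn_integral_pmf)
  finally show ?thesis
    using assms(2) by (simp add: measure_pmf.emeasure_eq_measure flip: ennreal_mult)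
qed

definition vote_kernel :: "((('d \<Rightarrow> nat) \<Rightarrow> bool) \<Rightarrow> 't) \<Rightarrow> nat \<Rightarrow> real \<Rightarrow> nat \<Rightarrow> (nat \<Rightarrow> ('d::finite) obs) \<Rightarrow> 't measure" where
  "vote_kernel code q l n z = measure_pmf (map_pmf code (vote_pmf q l n z))"

lemma diff_private_vote_kernel:
  assumes "0 \<le> l" "l * (2 * 3 ^ CARD('d)) \<le> \<epsilon>" "0 \<le> \<delta>"
  shows "diff_private \<epsilon> \<delta> n (vote_kernel code q l n :: (nat \<Rightarrow> ('d::finite) obs) \<Rightarrow> _) S"
  unfolding diff_private_def
proof (intro ballI impI)
  fix z z' :: "nat \<Rightarrow> 'd obs" and A assume "adjacent n z z'"
  then have "measure (vote_kernel code q l n z) A \<le> exp (l * (2 * 3 ^ CARD('d))) * measure (vote_kernel code q l n z') A"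
    unfolding vote_kernel_def measure_map_pmf
    by (intro measure_pmf_le pmf_vote_adjacent assms) auto
  also have "\<dots> \<le> exp \<epsilon> * measure (vote_kernel code q l n z') A"
    using assms by (intro mult_right_mono) auto
  finally show "measure (vote_kernel code q l n z) A \<le> exp \<epsilon> * measure (vote_kernel code q l n z') A + \<delta>"
    using assms(3) by simp
qed

lemma measurable_vote [measurable]: "(\<lambda>z. vote q n z k) \<in> borel_measurable (sample_space n)"
proof -
  have [measurable]: "(\<lambda>z. z i) \<in> sample_space n \<rightarrow>\<^sub>M obs_space" if "i < n" for i
    unfolding sample_space_def using that by (intro measurable_component_singleton) auto
  show ?thesis unfolding vote_def by measurable
qed

text \<open>The transcript space carries all subsets, but only finitely many patterns have positive
  probability. The mass of any set is then a finite sum of products of logistic functions of the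
  votes.\<close>

lemma measurable_vote_kernel:
  fixes code :: "(('d::finite \<Rightarrow> nat) \<Rightarrow> bool) \<Rightarrow> 't"
  shows "vote_kernel code q l n \<in> sample_space n \<rightarrow>\<^sub>M prob_algebra (count_space UNIV)"
proof (rule measurable_prob_algebraI)
  fix z :: "nat \<Rightarrow> 'd obs" show "prob_space (vote_kernel code q l n z)"
    unfolding vote_kernel_def by (rule measure_pmf.prob_space_axioms)
next
  show "vote_kernel code q l n \<in> sample_space n \<rightarrow>\<^sub>M subprob_algebra (count_space UNIV)"
  proof (rule measurable_subprob_algebra)
    fix z :: "nat \<Rightarrow> 'd obs" show "subprob_space (vote_kernel code q l n z)"
      unfolding vote_kernel_def by (rule measure_pmf.subprob_space_axioms)
    show "sets (vote_kernel code q l n z) = sets (count_space UNIV)" by (simp add: vote_kernel_def)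
  next
    fix A :: "'t set"
    define \<Omega> where "\<Omega> = {f :: ('d \<Rightarrow> nat) \<Rightarrow> bool. \<forall>k. k \<notin> cells q \<longrightarrow> f k = False}"
    have \<Omega>: "finite \<Omega>" unfolding \<Omega>_def by (rule finite_bool_funs)
    have "emeasure (vote_kernel code q l n z) A = ennreal (\<Sum>f\<in>\<Omega> \<inter> code -` A. pmf (vote_pmf q l n z) f)" for z
    proof -
      have sub: "set_pmf (vote_pmf q l n z) \<subseteq> \<Omega>"
        unfolding vote_pmf_def \<Omega>_def by (rule set_Pi_pmf_subset) simp
      have "measure (vote_pmf q l n z) (code -` A) = measure (vote_pmf q l n z) (\<Omega> \<inter> code -` A)"
        by (rule measure_pmf.finite_measure_eq_AE) (use sub in \<open>auto intro!: AE_pmfI\<close>)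
      also have "\<dots> = (\<Sum>f\<in>\<Omega> \<inter> code -` A. pmf (vote_pmf q l n z) f)"
        by (rule measure_measure_pmf_finite) (use \<Omega> in simp)
      finally show ?thesis
        by (simp add: vote_kernel_def measure_pmf.emeasure_eq_measure)
    qed
    moreover have "(\<lambda>z. pmf (vote_pmf q l n z) f) \<in> borel_measurable (sample_space n)" if "f \<in> \<Omega>" for f
    proof -
      have "pmf (vote_pmf q l n z) f = (\<Prod>k\<in>cells q. logistic_fun (if f k then l * vote q n z k else - (l * vote q n z k)))" for z
        unfolding vote_pmf_def using that by (subst pmf_Pi) (auto simp: pmf_bernoulli_logistic \<Omega>_def)
      then show ?thesis unfolding logistic_fun_def by simp
    qed
    ultimately show "(\<lambda>z. emeasure (vote_kernel code q l n z) A) \<in> borel_measurable (sample_space n)"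
      by simp
  qed
qed

section \<open>Probability of a wrong bit\<close>

text \<open>An observation in \<open>G\<close> carries the correct label with probability at least
  1/2 + u, so its exponential moment is at most 1 + l^2 - 2 l u. The condition
  \<open>l \<le> u\<close> lets the quadratic term consume only half of the drift.\<close>

lemma chernoff_obs:
  fixes P :: "('d::finite) obs measure"
  assumes P: "P \<in> space (prob_algebra obs_space)" and \<eta>: "regression_fun P \<eta>"
    and G[measurable]: "G \<in> cube_space \<rightarrow>\<^sub>M count_space UNIV"
    and s: "s = 1 \<or> s = - 1"
    and u: "0 < u" "\<And>x. x \<in> unit_cube \<Longrightarrow> G x \<Longrightarrow> u \<le> s * (\<eta> x - 1/2)"
    and l: "0 \<le> l" "l \<le> u" "l \<le> 1"
  shows "(\<integral>z. exp (- (l * s * (of_bool (G (fst z)) * (if snd z then 1 else - 1)))) \<partial>P)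
     \<le> exp (- (measure P {z \<in> space P. G (fst z)} * u * l))"
proof -
  interpret prob_space P using obs_law_facts(1)[OF P] .
  note [measurable_cong] = obs_law_facts(2)[OF P]
  have spP: "space P = unit_cube \<times> UNIV" using obs_law_facts(3)[OF P] .
  have \<eta>m[measurable]: "\<eta> \<in> borel_measurable cube_space" and \<eta>01: "\<And>x. x \<in> unit_cube \<Longrightarrow> 0 \<le> \<eta> x \<and> \<eta> x \<le> 1"
    using \<eta> unfolding regression_fun_def by auto
  have el: "exp l \<le> 1 + l + l^2" using exp_bound[OF l(1,3)] .
  have eml: "exp (- l) \<le> 1 - l + l^2"
  proof -
    have "(1 - l + l^2) * (1 + l) = 1 + l^3" by (simp add: algebra_simps power2_eq_square power3_eq_cube)
    then have "1 \<le> (1 - l + l^2) * (1 + l)" using l(1) by simp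
    also have "\<dots> \<le> (1 - l + l^2) * exp l"
      using l by (intro mult_left_mono exp_ge_add_one_self) auto
    finally show ?thesis by (simp add: exp_minus divide_simps mult.commute)
  qed
  have Gs: "{z \<in> space P. G (fst z)} \<in> sets P" by measurable
  have Gint: "integrable P (\<lambda>z. u * l * indicator {z \<in> space P. G (fst z)} z)"
    by (intro integrable_mult_right integrable_real_indicator Gs) (auto simp: less_top[symmetric])
  define a where "a x = (if G x then exp (- (l * s)) else 1)" for x
  define b where "b x = (if G x then exp (l * s) else 1)" for x
  have [measurable]: "a \<in> borel_measurable cube_space" "b \<in> borel_measurable cube_space"
    unfolding a_def b_def by measurable
  have "(\<integral>z. exp (- (l * s * (of_bool (G (fst z)) * (if snd z then 1 else - 1)))) \<partial>P)
      = (\<integral>z. (if snd z then a (fst z) else b (fst z)) \<partial>P)"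
    by (intro Bochner_Integration.integral_cong) (auto simp: a_def b_def)
  also have "\<dots> = (\<integral>z. \<eta> (fst z) * a (fst z) + (1 - \<eta> (fst z)) * b (fst z) \<partial>P)"
    by (rule label_integral[OF P \<eta>, of _ _ "exp \<bar>l * s\<bar>"]) (auto simp: a_def b_def)
  also have "\<dots> \<le> (\<integral>z. 1 - u * l * indicator {z \<in> space P. G (fst z)} z \<partial>P)"
  proof (rule integral_mono)
    fix z assume z: "z \<in> space P"
    then have x: "fst z \<in> unit_cube" by (auto simp: spP)
    show "\<eta> (fst z) * a (fst z) + (1 - \<eta> (fst z)) * b (fst z) \<le> 1 - u * l * indicator {z \<in> space P. G (fst z)} z"
    proof (cases "G (fst z)")
      case True
      \<comment> \<open>The probability that the label agrees with the sign \<open>s\<close>; with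
        it both signs are treated at once.\<close>
      define e where "e = (if s = 1 then \<eta> (fst z) else 1 - \<eta> (fst z))"
      have e: "0 \<le> e" "e \<le> 1" "1/2 + u \<le> e"
        using \<eta>01[OF x] u(2)[OF x True] s by (auto simp: e_def)
      have "\<eta> (fst z) * a (fst z) + (1 - \<eta> (fst z)) * b (fst z) = e * exp (- l) + (1 - e) * exp l"
        using True s by (auto simp: a_def b_def e_def)
      also have "\<dots> \<le> e * (1 - l + l^2) + (1 - e) * (1 + l + l^2)"
        using e el eml by (intro add_mono mult_left_mono) auto
      also have "\<dots> = 1 + l^2 - l * (2 * e - 1)" by (simp add: algebra_simps)
      also have "\<dots> \<le> 1 + l * u - l * (2 * u)"
        using l e by (intro diff_mono add_mono mult_left_mono) (auto simp: power2_eq_square intro!: mult_left_mono)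
      finally show ?thesis using True z by (simp add: mult.commute)
    next
      case False
      then show ?thesis by (simp add: a_def b_def)
    qed
  next
    show "integrable P (\<lambda>z. \<eta> (fst z) * a (fst z) + (1 - \<eta> (fst z)) * b (fst z))"
    proof (rule integrable_const_bound[of _ "2 * exp \<bar>l * s\<bar>"])
      have "norm (\<eta> x * a x + (1 - \<eta> x) * b x) \<le> 2 * exp \<bar>l * s\<bar>" if x: "x \<in> unit_cube" for x
      proof -
        have "norm (\<eta> x * a x + (1 - \<eta> x) * b x) \<le> \<bar>\<eta> x\<bar> * \<bar>a x\<bar> + \<bar>1 - \<eta> x\<bar> * \<bar>b x\<bar>"
          by (metis abs_mult abs_triangle_ineq real_norm_def)
        also have "\<dots> \<le> 1 * exp \<bar>l * s\<bar> + 1 * exp \<bar>l * s\<bar>"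
          using \<eta>01[OF x] by (intro add_mono mult_mono) (auto simp: a_def b_def)
        finally show ?thesis by simp
      qed
      then show "AE z in P. norm (\<eta> (fst z) * a (fst z) + (1 - \<eta> (fst z)) * b (fst z)) \<le> 2 * exp \<bar>l * s\<bar>"
        by (intro AE_I2) (auto simp: spP)
    qed simp
    show "integrable P (\<lambda>z. 1 - u * l * indicator {z \<in> space P. G (fst z)} z)"
      by (intro Bochner_Integration.integrable_diff Gint) simp
  qed
  also have "\<dots> = 1 - u * l * measure P {z \<in> space P. G (fst z)}"
    by (subst Bochner_Integration.integral_diff) (use Gint Gs in \<open>auto simp: prob_space intro!: arg_cong[of _ _ prob]\<close>)
  also have "\<dots> \<le> exp (- (measure P {z \<in> space P. G (fst z)} * u * l))"
    using exp_ge_add_one_self[of "- (measure P {z \<in> space P. G (fst z)} * u * l)"] by (simp add: mult_ac)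
  finally show ?thesis .
qed

lemma integral_prod_sample_law:
  fixes f :: "('d::finite) obs \<Rightarrow> real"
  assumes P: "P \<in> space (prob_algebra obs_space)" and f: "integrable P f"
  shows "(\<integral>z. (\<Prod>i<n. f (z i)) \<partial>sample_law n P) = (\<integral>z. f z \<partial>P) ^ n"
    "integrable (sample_law n P) (\<lambda>z. \<Prod>i<n. f (z i))"
proof -
  interpret prob_space P using obs_law_facts(1)[OF P] .
  interpret product_sigma_finite "\<lambda>_. P" ..
  show "(\<integral>z. (\<Prod>i<n. f (z i)) \<partial>sample_law n P) = (\<integral>z. f z \<partial>P) ^ n"
    unfolding sample_law_def by (subst product_integral_prod) (auto simp: f)
  show "integrable (sample_law n P) (\<lambda>z. \<Prod>i<n. f (z i))"
    unfolding sample_law_def by (rule product_integrable_prod) (auto simp: f)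
qed

lemma measurable_sample_space_component [measurable]:
  "i < n \<Longrightarrow> (\<lambda>z. z i) \<in> sample_space n \<rightarrow>\<^sub>M obs_space"
  unfolding sample_space_def by (intro measurable_component_singleton) auto

text \<open>A wrong bit has logistic probability in the signed vote, hence is bounded by an
  exponential that factorises over the independent observations. The factor \<open>min l u\<close>
  separates two regimes: noise added for privacy dominates if \<open>l\<close> is smaller, sampling
  error if \<open>u\<close> is smaller.\<close>

lemma vote_error:
  fixes P :: "('d::finite) obs measure"
  assumes P: "P \<in> space (prob_algebra obs_space)" and \<eta>: "regression_fun P \<eta>"
    and k: "k \<in> cells q" and s: "s = 1 \<or> s = - 1" and l: "0 < l"
    and u: "0 < u" "u \<le> 1" "\<And>x. x \<in> unit_cube \<Longrightarrow> near q k x \<Longrightarrow> u \<le> s * (\<eta> x - 1/2)"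
  shows "(\<integral>z. measure (vote_pmf q l n z) {f. f k \<noteq> (s = 1)} \<partial>sample_law n P)
    \<le> exp (- (real n * measure P {z \<in> space P. near q k (fst z)} * u * min l u))"
proof -
  \<comment> \<open>The largest exponent that both the logistic noise and
    \<open>chernoff_obs\<close> allow.\<close>
  define \<mu> where "\<mu> = min l u"
  have \<mu>: "0 < \<mu>" "\<mu> \<le> l" "\<mu> \<le> u" "\<mu> \<le> 1" using l u by (auto simp: \<mu>_def)
  define S where "S = sample_law n P"
  have S: "prob_space S" "sets S = sets (sample_space n)"
    using sample_law_prob_algebra[OF P, of n] by (auto simp: S_def space_prob_algebra)
  interpret S: prob_space S by fact
  interpret P: prob_space P using obs_law_facts(1)[OF P] .
  note [measurable_cong] = S(2) obs_law_facts(2)[OF P]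
  define g :: "'d obs \<Rightarrow> real" where
    "g z = exp (- (\<mu> * s * (of_bool (near q k (fst z)) * (if snd z then 1 else - 1))))" for z
  have prob: "measure (vote_pmf q l n z) {f. f k \<noteq> (s = 1)} = logistic_fun (- (s * (l * vote q n z k)))" for z
  proof -
    have "measure (vote_pmf q l n z) {f. f k \<noteq> (s = 1)}
        = measure (map_pmf (\<lambda>f. f k) (vote_pmf q l n z)) {b. b \<noteq> (s = 1)}"
      by (simp add: vimage_def)
    also have "map_pmf (\<lambda>f. f k) (vote_pmf q l n z) = bernoulli_pmf (logistic_fun (l * vote q n z k))"
      unfolding vote_pmf_def using k by (subst Pi_pmf_component) auto
    also have "{b. b \<noteq> (s = 1)} = {\<not> (s = 1)}" by auto
    also have "measure (bernoulli_pmf (logistic_fun (l * vote q n z k))) {\<not> (s = 1)}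
        = pmf (bernoulli_pmf (logistic_fun (l * vote q n z k))) (\<not> (s = 1))"
      by (simp add: measure_pmf_single)
    also have "\<dots> = logistic_fun (- (s * (l * vote q n z k)))"
      unfolding pmf_bernoulli_logistic using s by auto
    finally show ?thesis .
  qed
  have le: "measure (vote_pmf q l n z) {f. f k \<noteq> (s = 1)} \<le> (\<Prod>i<n. g (z i))" for z
  proof -
    have "measure (vote_pmf q l n z) {f. f k \<noteq> (s = 1)} \<le> exp (- (\<mu> / l * (s * (l * vote q n z k))))"
      unfolding prob using \<mu> l by (intro logistic_fun_le_exp) auto
    also have "\<mu> / l * (s * (l * vote q n z k)) = \<mu> * s * vote q n z k" using l by simp
    also have "exp (- (\<mu> * s * vote q n z k)) = (\<Prod>i<n. g (z i))"
      unfolding vote_def g_def sum_distrib_left sum_negf[symmetric] by (simp only: exp_sum finite_lessThan)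
    finally show ?thesis .
  qed
  have gm: "g \<in> borel_measurable obs_space" unfolding g_def[abs_def] by measurable
  have gmP: "g \<in> borel_measurable P"
    by (subst measurable_cong_sets[OF obs_law_facts(2)[OF P] refl]) (rule gm)
  have gint: "integrable P g"
  proof (rule P.integrable_const_bound[of _ "exp \<mu>"])
    show "AE z in P. norm (g z) \<le> exp \<mu>" using s \<mu> by (intro AE_I2) (auto simp: g_def)
  qed (rule gmP)
  have "(\<integral>z. measure (vote_pmf q l n z) {f. f k \<noteq> (s = 1)} \<partial>S) \<le> (\<integral>z. (\<Prod>i<n. g (z i)) \<partial>S)"
  proof (rule integral_mono)
    show "integrable S (\<lambda>z. measure (vote_pmf q l n z) {f. f k \<noteq> (s = 1)})"
    proof (rule S.integrable_const_bound[of _ 1])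
      show "(\<lambda>z. measure (vote_pmf q l n z) {f. f k \<noteq> (s = 1)}) \<in> borel_measurable S"
        unfolding prob logistic_fun_def by simp
    qed simp
    show "integrable S (\<lambda>z. \<Prod>i<n. g (z i))"
      unfolding S_def by (rule integral_prod_sample_law(2)[OF P gint])
  qed (rule le)
  also have "\<dots> = (\<integral>z. g z \<partial>P) ^ n"
    unfolding S_def by (rule integral_prod_sample_law(1)[OF P gint])
  also have "\<dots> \<le> exp (- (measure P {z \<in> space P. near q k (fst z)} * u * \<mu>)) ^ n"
    unfolding g_def
    by (intro power_mono chernoff_obs[OF P \<eta> measurable_near s u(1) u(3)])
       (use \<mu> in auto)
  also have "\<dots> = exp (- (real n * measure P {z \<in> space P. near q k (fst z)} * u * min l u))"
    by (simp add: \<mu>_def mult_ac flip: exp_of_nat_mult)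
  finally show ?thesis unfolding S_def .
qed

text \<open>All sources except \<open>j\<close> release a constant; \<open>code\<close> embeds the possible bit patterns, of which
  there are finitely many, into the type of transcripts.\<close>
definition server_protocol ::
  "((('d::finite \<Rightarrow> nat) \<Rightarrow> bool) \<Rightarrow> 't) \<Rightarrow> nat \<Rightarrow> nat \<Rightarrow> real \<Rightarrow> (nat \<Rightarrow> nat) \<Rightarrow> ('d, 't) protocol" where
  "server_protocol code j q l n = \<lparr>
     src_space = (\<lambda>_. count_space UNIV),
     src_kernel = (\<lambda>i. if i = j then vote_kernel code q l (n j) else (\<lambda>_. return (count_space UNIV) undefined)),
     fin_space = count_space UNIV,
     fin_kernel = (\<lambda>(z, t). if j = 0 then vote_kernel code q l (n 0) z else return (count_space UNIV) (t j)),
     classifier = (\<lambda>(T, x). \<exists>k\<in>cells q. cell q x = k \<and> inv_into {f. \<forall>k. k \<notin> cells q \<longrightarrow> f k = False} code T k)\<rparr>"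

section \<open>Protocols in which a single server votes\<close>

lemma diff_private_const:
  assumes "0 < \<epsilon>" "0 \<le> \<delta>" shows "diff_private \<epsilon> \<delta> n (\<lambda>_. K) S"
proof -
  have "measure K A \<le> exp \<epsilon> * measure K A" for A
    using mult_right_mono[of 1 "exp \<epsilon>" "measure K A"] assms by simp
  then show ?thesis unfolding diff_private_def using assms by (metis add.right_neutral add_mono)
qed

lemma server_protocol_private:
  fixes code :: "(('d::finite \<Rightarrow> nat) \<Rightarrow> bool) \<Rightarrow> 't"
  assumes j: "j \<le> m" and \<epsilon>: "\<And>i. i \<le> m \<Longrightarrow> 0 < \<epsilon> i" "\<And>i. i \<le> m \<Longrightarrow> 0 \<le> \<delta> i"
    and l: "0 \<le> l" "l * (2 * 3 ^ CARD('d)) \<le> \<epsilon> j"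
  shows "server_protocol code j q l n \<in> private_protocols m n \<epsilon> \<delta>"
proof -
  note vk = measurable_vote_kernel[of code q l]
  have "(\<lambda>(z, t). if j = 0 then vote_kernel code q l (n 0) z else return (count_space UNIV) (t j))
     \<in> sample_space (n 0) \<Otimes>\<^sub>M PiM {1..m} (\<lambda>_. count_space UNIV) \<rightarrow>\<^sub>M prob_algebra (count_space UNIV)"
  proof (cases "j = 0")
    case True
    have "(\<lambda>x. vote_kernel code q l (n 0) (fst x)) \<in> sample_space (n 0) \<Otimes>\<^sub>M PiM {1..m} (\<lambda>_. count_space (UNIV :: 't set)) \<rightarrow>\<^sub>M prob_algebra (count_space UNIV)"
      by (rule measurable_compose[OF measurable_fst vk])
    then show ?thesis using True by (simp add: case_prod_unfold)
  next
    case False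
    then have jm: "j \<in> {1..m}" using j by auto
    have "(\<lambda>x. snd x j) \<in> sample_space (n 0) \<Otimes>\<^sub>M PiM {1..m} (\<lambda>_. count_space (UNIV :: 't set)) \<rightarrow>\<^sub>M count_space UNIV"
      by (rule measurable_compose[OF measurable_snd measurable_component_singleton[OF jm]])
    from measurable_compose[OF this measurable_return_prob_space]
    show ?thesis using False by (simp add: case_prod_unfold)
  qed
  moreover have "(\<lambda>(T, x). \<exists>k\<in>cells q. cell q x = k \<and> inv_into {f. \<forall>k. k \<notin> cells q \<longrightarrow> f k = False} code T k)
     \<in> count_space UNIV \<Otimes>\<^sub>M (cube_space :: (real^'d) measure) \<rightarrow>\<^sub>M count_space UNIV"
  proof -
    have [measurable]: "(\<lambda>x. inv_into {f. \<forall>k. k \<notin> cells q \<longrightarrow> f k = False} code (fst x) k)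
      \<in> count_space UNIV \<Otimes>\<^sub>M (cube_space :: (real^'d) measure) \<rightarrow>\<^sub>M count_space UNIV" for k
      by (rule measurable_compose[OF measurable_fst]) simp
    have [measurable]: "(\<lambda>x. cell q (snd x) = k) \<in> count_space (UNIV :: 't set) \<Otimes>\<^sub>M (cube_space :: (real^'d) measure) \<rightarrow>\<^sub>M count_space UNIV" for k
      by (rule measurable_compose[OF measurable_snd measurable_cell_eq])
    have [simp]: "countable (cells q :: ('d \<Rightarrow> nat) set)" by (simp add: countable_finite)
    show ?thesis unfolding case_prod_unfold by measurable
  qed
  moreover have "diff_private (\<epsilon> 0) (\<delta> 0) (n 0) (\<lambda>z. if j = 0 then vote_kernel code q l (n 0) z
      else return (count_space UNIV) (t j)) (count_space UNIV)" for t
    by (cases "j = 0") (use assms in \<open>auto intro!: diff_private_const diff_private_vote_kernel\<close>)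
  ultimately show ?thesis
    using vk assms
    by (auto simp: private_protocols_def server_protocol_def intro!: diff_private_const diff_private_vote_kernel
          measurable_const prob_space_return simp: space_prob_algebra)
qed

text \<open>Either the target votes itself, or it forwards the transcript of server
  \<open>j\<close>. The laws of all other samples and transcripts are probability measures and
  integrate out.\<close>

lemma server_final_law:
  fixes code :: "(('d::finite \<Rightarrow> nat) \<Rightarrow> bool) \<Rightarrow> 't" and P :: "nat \<Rightarrow> 'd obs measure"
  assumes p: "p \<in> private_protocols m n \<epsilon> \<delta>" "p = server_protocol code j q l n" and j: "j \<le> m"
    and P: "\<And>j. j \<le> m \<Longrightarrow> P j \<in> space (prob_algebra obs_space)"
  shows "measure (final_law m n p P) B = (\<integral>z. measure (vote_kernel code q l (n j) z) B \<partial>sample_law (n j) (P j))"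
proof -
  define S0 where "S0 = sample_law (n 0) (P 0)"
  define TT where "TT = PiM {1..m} (transcript_law n p P)"
  have Tj: "transcript_law n p P i \<in> space (prob_algebra (src_space p i))" if "i \<in> {1..m}" for i
    by (rule transcript_law_prob_algebra[OF p(1) P that])
  have "TT \<in> space (prob_algebra (PiM {1..m} (src_space p)))"
    unfolding TT_def by (rule PiM_in_prob_algebra[OF Tj])
  then interpret TT: prob_space TT by (simp add: space_prob_algebra)
  have "S0 \<in> space (prob_algebra (sample_space (n 0)))"
    unfolding S0_def by (rule sample_law_prob_algebra) (use P in auto)
  then interpret S0: prob_space S0 by (simp add: space_prob_algebra)
  have fl: "measure (final_law m n p P) B = (\<integral>z. (\<integral>t. measure (fin_kernel p (z, t)) B \<partial>TT) \<partial>S0)"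
    unfolding TT_def S0_def
    by (rule final_law_measure[OF p(1)], rule P, assumption) (simp add: p(2) server_protocol_def)
  show ?thesis
  proof (cases "j = 0")
    case True
    then show ?thesis unfolding fl by (simp add: p(2) server_protocol_def S0_def TT.prob_space)
  next
    case False
    then have jm: "j \<in> {1..m}" using j by auto
    have src: "src_space p j = count_space UNIV" "src_kernel p j = vote_kernel code q l (n j)"
      by (simp_all add: p(2) server_protocol_def)
    have ts: "sets (transcript_law n p P j) = UNIV"
      using Tj[OF jm] by (simp add: space_prob_algebra src)
    have tjm: "(\<lambda>t. t j) \<in> TT \<rightarrow>\<^sub>M transcript_law n p P j"
      unfolding TT_def by (rule measurable_component_singleton[OF jm])
    have Sj: "sample_law (n j) (P j) \<in> space (prob_algebra (sample_space (n j)))"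
      by (rule sample_law_prob_algebra) (use P j in auto)
    have "measure (final_law m n p P) B = (\<integral>t. indicator B (t j) \<partial>TT)"
      unfolding fl using False by (simp add: p(2) server_protocol_def S0.prob_space measure_return)
    also have "\<dots> = (\<integral>t. indicator B t \<partial>distr TT (transcript_law n p P j) (\<lambda>t. t j))"
      by (rule integral_distr[OF tjm, symmetric]) (rule borel_measurable_indicator, simp add: ts)
    also have "distr TT (transcript_law n p P j) (\<lambda>t. t j) = transcript_law n p P j"
      unfolding TT_def by (rule distr_PiM_component[OF _ jm]) (use Tj in \<open>auto simp: space_prob_algebra\<close>)
    also have "(\<integral>t. (indicator B t :: real) \<partial>transcript_law n p P j)
        = (\<integral>z. (\<integral>t. indicator B t \<partial>vote_kernel code q l (n j) z) \<partial>sample_law (n j) (P j))"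
      unfolding transcript_law_def src
      by (rule integral_bind_unit_valued[OF Sj measurable_vote_kernel unit_valued_indicator]) simp
    also have "\<dots> = (\<integral>z. measure (vote_kernel code q l (n j) z) B \<partial>sample_law (n j) (P j))"
      by (intro Bochner_Integration.integral_cong refl) (simp add: vote_kernel_def)
    finally show ?thesis .
  qed
qed

text \<open>The patterns of positive probability lie where \<open>code\<close> is injective, so
  decoding recovers them and the decision at \<open>x\<close> is the bit of the cell of
  \<open>x\<close>.\<close>

lemma server_misclassification:
  fixes code :: "(('d::finite \<Rightarrow> nat) \<Rightarrow> bool) \<Rightarrow> 't" and P :: "nat \<Rightarrow> 'd obs measure"
  assumes p: "p \<in> private_protocols m n \<epsilon> \<delta>" "p = server_protocol code j q l n" and j: "j \<le> m"
    and P: "\<And>j. j \<le> m \<Longrightarrow> P j \<in> space (prob_algebra obs_space)"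
    and code: "inj_on code {f. \<forall>k. k \<notin> cells q \<longrightarrow> f k = False}" and x: "x \<in> unit_cube"
  shows "measure (final_law m n p P) {T \<in> space (final_law m n p P). classifier p (T, x) \<noteq> b}
    = (\<integral>z. measure (vote_pmf q l (n j) z) {f. f (cell q x) \<noteq> b} \<partial>sample_law (n j) (P j))"
proof -
  define \<Omega> where "\<Omega> = {f. \<forall>k. k \<notin> (cells q :: ('d \<Rightarrow> nat) set) \<longrightarrow> f k = False}"
  have "measure (vote_kernel code q l (n j) z) {T \<in> space (final_law m n p P). classifier p (T, x) \<noteq> b}
     = measure (vote_pmf q l (n j) z) {f. f (cell q x) \<noteq> b}" for z
  proof -
    have fl: "final_law m n p P \<in> space (prob_algebra (fin_space p))"
      by (rule final_law_prob_algebra[OF p(1)]) (rule P)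
    have sp: "space (final_law m n p P) = UNIV"
      using sets_eq_imp_space_eq[of "final_law m n p P" "fin_space p"] fl
      by (simp add: space_prob_algebra) (simp add: p(2) server_protocol_def)
    have sub: "set_pmf (vote_pmf q l (n j) z) \<subseteq> \<Omega>"
      unfolding vote_pmf_def \<Omega>_def by (rule set_Pi_pmf_subset) simp
    have "inv_into {f. \<forall>k. k \<notin> cells q \<longrightarrow> \<not> f k} code (code f) = f" if "f \<in> \<Omega>" for f
      using inv_into_f_f[OF code, of f] that by (simp add: \<Omega>_def)
    then have "classifier p (code f, x) = f (cell q x)" if "f \<in> \<Omega>" for f
      using that cell_in_cells[OF x, of q] by (simp add: p(2) server_protocol_def)
    then show ?thesis
      unfolding vote_kernel_def measure_map_pmf sp
      by (intro measure_pmf.finite_measure_eq_AE AE_pmfI) (use sub in auto)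
  qed
  then show ?thesis by (subst server_final_law[OF p j P]) auto
qed

section \<open>Integrating the error against the margin condition\<close>

text \<open>From (1 + y/N)^N \<le> exp y one obtains decay of order y^(-N), and with y = a s^g this
  beats s^(-e) as soon as g N \<ge> e.\<close>

lemma exp_powr_decay:
  fixes a g e :: real
  assumes "0 < a" "0 < g" "0 \<le> e"
  shows "\<exists>D\<ge>1. \<forall>s\<ge>1. exp (- (a * s powr g)) \<le> D * s powr (- e)"
proof -
  define N where "N = Suc (nat \<lceil>e / g\<rceil>)"
  have N: "e \<le> g * real N" using assms unfolding N_def
    by (smt (verit) divide_le_eq mult.commute of_nat_Suc of_nat_nat le_of_int_ceiling ceiling_mono divide_nonneg_pos zero_le_ceiling)
  have N0: "0 < N" by (simp add: N_def)
  define D where "D = max 1 ((real N / a) ^ N)"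
  have "exp (- (a * s powr g)) \<le> D * s powr (- e)" if s: "1 \<le> s" for s
  proof -
    define y where "y = a * s powr g"
    have y: "0 < y" using assms s by (simp add: y_def)
    have "(y / real N) ^ N \<le> (1 + y / real N) ^ N"
      using y by (intro power_mono) (auto simp: N_def)
    also have "\<dots> \<le> exp y" by (rule exp_ge_one_plus_x_over_n_power_n) (use y in \<open>auto simp: N_def\<close>)
    finally have "exp (- y) \<le> (real N / y) ^ N"
      using y N0 by (simp add: exp_minus power_divide field_simps)
    also have "\<dots> = (real N / a) ^ N * s powr (- (g * real N))"
      using s by (simp add: y_def power_divide power_mult_distrib powr_minus powr_powr divide_simps flip: powr_realpow)
    also have "\<dots> \<le> D * s powr (- e)"
      using N s by (intro mult_mono powr_mono) (auto simp: D_def)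
    finally show ?thesis by (simp add: y_def)
  qed
  then show ?thesis by (intro exI[of _ D]) (auto simp: D_def)
qed

lemma half_powr: "(1/2::real) powr y = 2 powr (- y)"
  by (simp add: powr_divide powr_minus_divide)

lemma pow2_powr: "((2::real) ^ k) powr y = 2 powr (real k * y)"
  by (simp add: powr_powr flip: powr_realpow)

text \<open>Dyadic peeling. Where t is about 2^k T, the integrand is of order T 2^(- k (\<alpha> +
  1)), and the sublevel set has mass of order (2^k T)^\<alpha>. The products decay like 2^(-k),
  which is why the decay exponent \<alpha> + 2 suffices and no logarithm appears.\<close>

lemma margin_integral:
  fixes t err :: "'a \<Rightarrow> real"
  assumes "prob_space M"
    and t[measurable]: "t \<in> borel_measurable M" "\<And>z. z \<in> space M \<Longrightarrow> 0 \<le> t z \<and> t z \<le> 1/2"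
    and margin: "\<And>s. 0 < s \<Longrightarrow> measure M {z \<in> space M. t z \<le> s} \<le> C\<alpha> * s powr \<alpha>"
    and err: "\<And>z. z \<in> space M \<Longrightarrow> err z \<le> 1" "\<And>z. z \<in> space M \<Longrightarrow> 0 \<le> err z"
    and decay: "AE z in M. T \<le> t z \<longrightarrow> err z \<le> D * (t z / T) powr (- (\<alpha> + 2))"
    and D: "1 \<le> D" and T: "0 < T" and \<alpha>: "0 \<le> \<alpha>" and C\<alpha>: "0 < C\<alpha>"
  shows "(\<integral>z. 2 * t z * err z \<partial>M) \<le> 4 * 2 powr \<alpha> * D * C\<alpha> * T powr (1 + \<alpha>)"
proof -
  interpret prob_space M by fact
  \<comment> \<open>Because t is at most 1/2, finitely many shells exhaust its range.\<close>
  obtain K :: nat where K: "1 / T < 2 ^ K" using real_arch_pow[of 2 "1/T"] by auto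
  \<comment> \<open>The dominating function uses whole sublevel sets instead of shells, so that the
    margin condition applies to each term directly.\<close>
  define h where "h z = 2 * T * D * (\<Sum>k<Suc K. (1/2) powr (real k * (\<alpha> + 1)) * indicator {z \<in> space M. t z \<le> 2 ^ Suc k * T} z)" for z
  have hint: "integrable M (\<lambda>z. (1/2) powr (real k * (\<alpha> + 1)) * indicator {z \<in> space M. t z \<le> 2 ^ Suc k * T} z)" for k
    by (intro integrable_mult_right integrable_real_indicator) (auto simp: less_top[symmetric])
  have pt: "2 * t z * err z \<le> h z" if z: "z \<in> space M" and dz: "T \<le> t z \<longrightarrow> err z \<le> D * (t z / T) powr (- (\<alpha> + 2))" for z
  proof -
    have trm: "2 * T * D * (1/2) powr (real k * (\<alpha> + 1)) \<le> h z" if "t z \<le> 2 ^ Suc k * T" "k < Suc K" for k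
    proof -
      have "(1/2) powr (real k * (\<alpha> + 1)) * indicator {z \<in> space M. t z \<le> 2 ^ Suc k * T} z
          \<le> (\<Sum>k<Suc K. (1/2) powr (real k * (\<alpha> + 1)) * indicator {z \<in> space M. t z \<le> 2 ^ Suc k * T} z)"
        by (rule member_le_sum) (use that in auto)
      then show ?thesis
        using that z D T unfolding h_def mult.assoc by (intro mult_left_mono) auto
    qed
    show ?thesis
    proof (cases "T \<le> t z")
      case False
      have "2 * t z * err z \<le> 2 * T * D * 1"
        unfolding mult.assoc using False D T t(2)[OF z] err[OF z]
        by (intro mult_left_mono mult_mono order_trans[OF err(1)[OF z]]) auto
      also have "\<dots> \<le> h z" using trm[of 0] False T by simp
      finally show ?thesis .
    next
      case True
      define s where "s = t z / T"
      have s1: "1 \<le> s" using True T by (simp add: s_def)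
      have "s < 2 ^ K"
      proof -
        have "s \<le> 1 / T" unfolding s_def using t(2)[OF z] T by (intro divide_right_mono) auto
        then show ?thesis using K by simp
      qed
      define k where "k = nat \<lfloor>log 2 s\<rfloor>"
      have l0: "0 \<le> log 2 s" using s1 by simp
      have k: "real k \<le> log 2 s" "log 2 s < real k + 1" using l0 unfolding k_def by linarith+
      have "2 powr (real k) \<le> 2 powr (log 2 s)" using k by simp
      then have k1: "2 ^ k \<le> s" using s1 by (simp add: powr_realpow)
      have "2 powr (log 2 s) < 2 powr (real (Suc k))" using k by simp
      then have k2: "s < 2 ^ Suc k" using s1 by (simp add: powr_realpow del: of_nat_Suc power_Suc)
      have "(2::real) ^ k < 2 ^ K" using k1 \<open>s < 2 ^ K\<close> by linarith
      then have kK: "k < Suc K" by simp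
      have "2 * t z * err z \<le> 2 * (s * T) * (D * s powr (- (\<alpha> + 2)))"
        using dz True T t(2)[OF z] err(2)[OF z] by (intro mult_mono) (auto simp: s_def)
      also have "\<dots> = 2 * T * D * (s powr 1 * s powr (- (\<alpha> + 2)))" using s1 by simp
      also have "s powr 1 * s powr (- (\<alpha> + 2)) = s powr (- (\<alpha> + 1))"
        using powr_add[of s 1 "- (\<alpha> + 2)"] by (simp add: algebra_simps)
      also have "2 * T * D * s powr (- (\<alpha> + 1)) \<le> 2 * T * D * (2 ^ k) powr (- (\<alpha> + 1))"
        using k1 D T \<alpha> by (intro mult_left_mono powr_mono2') auto
      also have "(2 ^ k) powr (- (\<alpha> + 1)) = (1/2) powr (real k * (\<alpha> + 1))"
        unfolding half_powr pow2_powr by (simp add: algebra_simps)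
      also have "2 * T * D * (1/2) powr (real k * (\<alpha> + 1)) \<le> h z"
        by (rule trm[OF _ kK]) (use k2 T in \<open>simp add: s_def field_simps\<close>)
      finally show ?thesis .
    qed
  qed
  have "(\<integral>z. 2 * t z * err z \<partial>M) \<le> (\<integral>z. h z \<partial>M)"
  proof (rule integral_mono_AE')
    show "integrable M h"
      unfolding h_def[abs_def] by (intro integrable_mult_right Bochner_Integration.integrable_sum hint)
    show "AE z in M. 2 * t z * err z \<le> h z"
      using decay by (rule AE_mp) (auto intro!: AE_I2 pt)
    show "AE z in M. 0 \<le> h z"
      unfolding h_def using D T by (intro AE_I2 mult_nonneg_nonneg sum_nonneg) auto
  qed
  also have "\<dots> = 2 * T * D * (\<Sum>k<Suc K. (1/2) powr (real k * (\<alpha> + 1)) * measure M {z \<in> space M. t z \<le> 2 ^ Suc k * T})"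
    unfolding h_def[abs_def]
    by (subst Bochner_Integration.integral_mult_right_zero, subst Bochner_Integration.integral_sum[OF hint])
       (simp add: Int_def conj_commute)
  also have "\<dots> \<le> 2 * T * D * (\<Sum>k<Suc K. C\<alpha> * 2 powr \<alpha> * T powr \<alpha> * (1/2) ^ k)"
  proof (intro mult_left_mono sum_mono)
    fix k
    have "(1/2) powr (real k * (\<alpha> + 1)) * measure M {z \<in> space M. t z \<le> 2 ^ Suc k * T}
       \<le> (1/2) powr (real k * (\<alpha> + 1)) * (C\<alpha> * (2 ^ Suc k * T) powr \<alpha>)"
      by (intro mult_left_mono margin) (use T in auto)
    also have "(2 ^ Suc k * T) powr \<alpha> = 2 powr \<alpha> * 2 powr (real k * \<alpha>) * T powr \<alpha>"
      using T by (simp add: powr_mult pow2_powr)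
    also have "(1/2) powr (real k * (\<alpha> + 1)) * (C\<alpha> * (2 powr \<alpha> * 2 powr (real k * \<alpha>) * T powr \<alpha>))
      = C\<alpha> * 2 powr \<alpha> * T powr \<alpha> * (2 powr (- (real k * (\<alpha> + 1))) * 2 powr (real k * \<alpha>))"
      by (simp add: half_powr mult_ac)
    also have "2 powr (- (real k * (\<alpha> + 1))) * 2 powr (real k * \<alpha>) = 2 powr (- real k)"
      by (simp add: algebra_simps flip: powr_add)
    also have "2 powr (- real k) = (1/2) ^ k"
      by (simp add: powr_minus powr_realpow power_one_over divide_simps)
    finally show "(1/2) powr (real k * (\<alpha> + 1)) * measure M {z \<in> space M. t z \<le> 2 ^ Suc k * T}
      \<le> C\<alpha> * 2 powr \<alpha> * T powr \<alpha> * (1/2) ^ k" .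
  qed (use T D in auto)
  also have "(\<Sum>k<Suc K. C\<alpha> * 2 powr \<alpha> * T powr \<alpha> * (1/2) ^ k) = C\<alpha> * 2 powr \<alpha> * T powr \<alpha> * (\<Sum>k<Suc K. (1/2) ^ k)"
    by (rule sum_distrib_left[symmetric])
  also have "2 * T * D * (C\<alpha> * 2 powr \<alpha> * T powr \<alpha> * (\<Sum>k<Suc K. (1/2) ^ k))
      \<le> 2 * T * D * (C\<alpha> * 2 powr \<alpha> * T powr \<alpha> * 2)"
  proof (intro mult_left_mono)
    have "(\<Sum>k<Suc K. (1/2::real) ^ k) = 2 - 2 * (1/2) ^ Suc K"
      by (subst geometric_sum) (auto simp: field_simps)
    moreover have "(0::real) \<le> 2 * (1/2) ^ Suc K" by simp
    ultimately show "(\<Sum>k<Suc K. (1/2::real) ^ k) \<le> 2" by linarith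
  qed (use T D C\<alpha> in auto)
  also have "\<dots> = 4 * 2 powr \<alpha> * D * C\<alpha> * T powr (1 + \<alpha>)"
    using T by (simp add: powr_add)
  finally show ?thesis .
qed


section \<open>The upper bound\<close>

text \<open>The updates at 0 make the target a source with constant 1 and exponent 1, so that one
  argument serves all servers. The densities are passed on as lower bounds for the mass of subsets
  of the support.\<close>

lemma transfer_classE:
  fixes P :: "nat \<Rightarrow> ('d::finite) obs measure"
  assumes "P \<in> transfer_class m \<alpha> \<beta> \<gamma> L C\<alpha> Cs gmin gmax c\<mu> r\<mu>" and gmin: "0 < gmin"
  obtains \<eta> A where
    "\<And>j. j \<le> m \<Longrightarrow> P j \<in> space (prob_algebra obs_space)"
    "\<And>j. j \<le> m \<Longrightarrow> regression_fun (P j) (\<eta> j)"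
    "\<And>j x. j \<le> m \<Longrightarrow> x \<in> unit_cube \<Longrightarrow> sgn (\<eta> j x - 1/2) = sgn (\<eta> 0 x - 1/2)"
    "\<And>j x. j \<le> m \<Longrightarrow> x \<in> unit_cube \<Longrightarrow> (Cs(0 := 1)) j * \<bar>\<eta> 0 x - 1/2\<bar> powr (\<gamma>(0 := 1)) j \<le> \<bar>\<eta> j x - 1/2\<bar>"
    "\<And>x x'. x \<in> unit_cube \<Longrightarrow> x' \<in> unit_cube \<Longrightarrow> \<bar>\<eta> 0 x - \<eta> 0 x'\<bar> \<le> L * norm (x - x') powr \<beta>"
    "\<And>t. t > 0 \<Longrightarrow> measure (P 0) {z \<in> space (P 0). \<bar>\<eta> 0 (fst z) - 1/2\<bar> \<le> t} \<le> C\<alpha> * t powr \<alpha>"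
    "A \<subseteq> unit_cube" "A \<in> sets borel" "regular_set c\<mu> r\<mu> A"
    "AE z in P 0. fst z \<in> A"
    "\<And>j G. j \<le> m \<Longrightarrow> G \<in> sets borel \<Longrightarrow> G \<subseteq> A \<Longrightarrow> gmin * measure lborel G \<le> measure (P j) {z \<in> space (P j). fst z \<in> G}"
proof -
  note cl = assms(1)[unfolded transfer_class_def mem_Collect_eq]
  note P = conjunct1[OF cl] and ex\<eta> = conjunct1[OF conjunct2[OF cl]] and exA = conjunct2[OF conjunct2[OF cl]]
  from ex\<eta> obtain \<eta> where \<eta>1: "\<forall>j\<le>m. regression_fun (P j) (\<eta> j)"
    and \<eta>2: "\<forall>j\<in>{1..m}. \<forall>x\<in>unit_cube.
           sgn (\<eta> j x - 1 / 2) = sgn (\<eta> 0 x - 1 / 2) \<and>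
           \<bar>\<eta> j x - 1 / 2\<bar> \<ge> Cs j * \<bar>\<eta> 0 x - 1 / 2\<bar> powr \<gamma> j"
    and \<eta>3: "\<forall>x\<in>unit_cube. \<forall>x'\<in>unit_cube. \<bar>\<eta> 0 x - \<eta> 0 x'\<bar> \<le> L * norm (x - x') powr \<beta>"
    and \<eta>4: "\<forall>t>0. measure (P 0) {z \<in> space (P 0). \<bar>\<eta> 0 (fst z) - 1 / 2\<bar> \<le> t} \<le> C\<alpha> * t powr \<alpha>"
    by (elim exE conjE) (rule that)
  from exA obtain A where A: "A \<subseteq> unit_cube" "compact A" "regular_set c\<mu> r\<mu> A"
    and Ag': "\<forall>j\<le>m. measure_support (X_marginal (P j)) = A \<and>
           (\<exists>g. g \<in> borel_measurable borel \<and>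
              X_marginal (P j) = density lborel (\<lambda>x. ennreal (g x)) \<and>
              (\<forall>x\<in>A. gmin \<le> g x \<and> g x \<le> gmax) \<and> (\<forall>x. x \<notin> A \<longrightarrow> g x = 0))"
    by (elim exE conjE) (rule that)
  have Ag: "\<exists>g. g \<in> borel_measurable borel \<and>
              X_marginal (P j) = density lborel (\<lambda>x. ennreal (g x)) \<and>
              (\<forall>x\<in>A. gmin \<le> g x \<and> g x \<le> gmax) \<and> (\<forall>x. x \<notin> A \<longrightarrow> g x = 0)" if "j \<le> m" for j
    using Ag'[rule_format, OF that] by (rule conjunct2)
  have Ab: "A \<in> sets borel" using A(2) by (simp add: borel_compact)
  have fstm: "fst \<in> P j \<rightarrow>\<^sub>M borel" if "j \<le> m" for j
    by (subst measurable_cong_sets[OF obs_law_facts(2)[OF P[rule_format, OF that]] refl])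
       (rule measurable_compose[OF measurable_fst_obs measurable_cube_space_id])
  show thesis
  proof (rule that[of \<eta> A])
    show "sgn (\<eta> j x - 1/2) = sgn (\<eta> 0 x - 1/2)" if "j \<le> m" "x \<in> unit_cube" for j x
      using \<eta>2[rule_format, of j x] that by (cases "j = 0") auto
    show "(Cs(0 := 1)) j * \<bar>\<eta> 0 x - 1/2\<bar> powr (\<gamma>(0 := 1)) j \<le> \<bar>\<eta> j x - 1/2\<bar>" if "j \<le> m" "x \<in> unit_cube" for j x
      using \<eta>2[rule_format, of j x] that by (cases "j = 0") auto
    obtain g where g: "g \<in> borel_measurable borel" "X_marginal (P 0) = density lborel (\<lambda>x. ennreal (g x))"
       "\<forall>x. x \<notin> A \<longrightarrow> g x = 0" using Ag[of 0] by auto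
    have "AE x in X_marginal (P 0). x \<in> A"
      unfolding g(2) using g(1,3) by (subst AE_density) (auto intro!: AE_I2)
    then show "AE z in P 0. fst z \<in> A"
      unfolding X_marginal_def using fstm[of 0] Ab by (subst (asm) AE_distr_iff) auto
  next
    fix j G assume j: "j \<le> m" and G: "G \<in> sets borel" "G \<subseteq> A"
    interpret prob_space "P j" by (rule obs_law_facts(1)[OF P[rule_format, OF j]])
    obtain g where g[measurable]: "g \<in> borel_measurable borel" and g2: "X_marginal (P j) = density lborel (\<lambda>x. ennreal (g x))"
       "\<forall>x\<in>A. gmin \<le> g x \<and> g x \<le> gmax" using Ag[OF j] by auto
    have fin: "emeasure lborel G < \<infinity>"
    proof -
      have "emeasure lborel G \<le> emeasure lborel A" using G Ab by (intro emeasure_mono) auto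
      also have "\<dots> < \<infinity>" using emeasure_compact_finite[OF A(2)] by simp
      finally show ?thesis .
    qed
    have "ennreal (gmin * measure lborel G) = ennreal gmin * emeasure lborel G"
      using fin gmin by (simp add: ennreal_mult emeasure_eq_ennreal_measure)
    also have "\<dots> = (\<integral>\<^sup>+x. ennreal gmin * indicator G x \<partial>lborel)"
      using G by (simp add: nn_integral_cmult)
    also have "\<dots> \<le> (\<integral>\<^sup>+x. ennreal (g x) * indicator G x \<partial>lborel)"
      using G g2(2) by (intro nn_integral_mono) (auto simp: indicator_def intro!: ennreal_leI)
    also have "\<dots> = emeasure (X_marginal (P j)) G"
      unfolding g2(1) using G by (subst emeasure_density) auto
    also have "\<dots> = emeasure (P j) {z \<in> space (P j). fst z \<in> G}"
      unfolding X_marginal_def using fstm[OF j] G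
      by (subst emeasure_distr) (auto intro!: arg_cong[of _ _ "emeasure (P j)"])
    finally show "gmin * measure lborel G \<le> measure (P j) {z \<in> space (P j). fst z \<in> G}"
      by (simp add: emeasure_eq_measure)
  qed (fact A Ab | rule P[rule_format] \<eta>1[rule_format] \<eta>3[rule_format] \<eta>4[rule_format]; assumption)+
qed

lemma floor_diff_le_one: "\<bar>a - b\<bar> < 1 \<Longrightarrow> \<bar>\<lfloor>a\<rfloor> - \<lfloor>b\<rfloor>\<bar> \<le> 1" for a b :: real
  by linarith

lemma near_cell: "x \<in> unit_cube \<Longrightarrow> near q (cell q x) y \<longleftrightarrow> (\<forall>i. \<bar>\<lfloor>real q * y $ i\<rfloor> - \<lfloor>real q * x $ i\<rfloor>\<bar> \<le> 1)"
  unfolding near_def cell_def unit_cube_def by (auto simp: zero_le_mult_iff)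

lemma norm_le_of_components:
  fixes x :: "real^'d::finite"
  assumes "\<And>i. \<bar>x $ i\<bar> \<le> a"
  shows "norm x \<le> real CARD('d) * a"
proof -
  have "(\<Sum>i\<in>UNIV. \<bar>x $ i\<bar>) \<le> (\<Sum>i\<in>(UNIV :: 'd set). a)" by (intro sum_mono assms)
  then show ?thesis using norm_le_l1_cart[of x] by simp
qed

text \<open>The counterpart of \<open>ball_near\<close>: the neighbourhood is small enough for the
  Hoelder condition to preserve the sign of the target margin, and contains a ball large enough for
  the regularity condition to give it mass.\<close>

lemma near_cell_dist:
  fixes x y :: "real^'d::finite"
  assumes "x \<in> unit_cube" "near q (cell q x) y" "0 < q"
  shows "norm (x - y) \<le> 2 * real CARD('d) * (1 / real q)"
proof -
  have "\<bar>(x - y) $ i\<bar> \<le> 2 * (1 / real q)" for i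
  proof -
    have "\<bar>\<lfloor>real q * y $ i\<rfloor> - \<lfloor>real q * x $ i\<rfloor>\<bar> \<le> 1" using assms near_cell by blast
    then have "\<bar>real q * x $ i - real q * y $ i\<bar> \<le> 2" by linarith
    then have "real q * \<bar>x $ i - y $ i\<bar> \<le> 2"
      by (simp add: abs_mult flip: right_diff_distrib)
    then show ?thesis using assms(3) by (simp add: field_simps)
  qed
  then have "norm (x - y) \<le> real CARD('d) * (2 * (1 / real q))" by (rule norm_le_of_components)
  then show ?thesis by (simp add: mult.commute)
qed

lemma ball_near:
  fixes x y :: "real^'d::finite"
  assumes "x \<in> unit_cube" "y \<in> ball x (1 / real q)" "0 < q"
  shows "near q (cell q x) y"
  unfolding near_cell[OF assms(1)]
proof
  fix i
  have "\<bar>(x - y) $ i\<bar> \<le> norm (x - y)" by (rule component_le_norm_cart)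
  also have "\<dots> < 1 / real q" using assms(2) by (simp add: dist_norm)
  finally have "real q * \<bar>x $ i - y $ i\<bar> < 1" using assms(3) by (simp add: field_simps)
  then have "\<bar>real q * y $ i - real q * x $ i\<bar> < 1"
    by (simp add: abs_mult abs_minus_commute flip: right_diff_distrib)
  then show "\<bar>\<lfloor>real q * y $ i\<rfloor> - \<lfloor>real q * x $ i\<rfloor>\<bar> \<le> 1" by (rule floor_diff_le_one)
qed

lemma exists_code:
  assumes "\<exists>e :: real \<Rightarrow> 't. inj e" "finite (\<Omega> :: 'a set)"
  obtains code :: "'a \<Rightarrow> 't" where "inj_on code \<Omega>"
proof -
  obtain e :: "real \<Rightarrow> 't" where e: "inj e" using assms(1) by blast
  obtain f :: "'a \<Rightarrow> nat" where f: "inj_on f \<Omega>" using finite_imp_inj_to_nat_seg[OF assms(2)] by blast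
  have "inj_on (\<lambda>x. e (real (f x))) \<Omega>"
    using injD[OF e] inj_onD[OF f] by (intro inj_onI) (metis of_nat_eq_iff)
  then show thesis by (rule that)
qed

text \<open>Where the target margin is below \<open>T\<close>, of order q^(-\<beta>), the margin
  condition pays for any error. Above \<open>T\<close> the whole neighbourhood votes for the same
  sign. The two conditions with \<kappa> say that at margin \<open>T\<close> the exponent of
  \<open>vote_error\<close> is bounded below in the sampling and in the privacy regime; for a larger
  margin t it grows like (t / T)^g.\<close>

lemma server_upper:
  fixes \<gamma> Cs :: "nat \<Rightarrow> real" and Q :: "(nat \<Rightarrow> ('d::finite) obs measure) set"
  assumes inj: "\<exists>e :: real \<Rightarrow> 't. inj e"
    and \<alpha>: "0 \<le> \<alpha>" and \<beta>: "0 < \<beta>" and L: "0 < L" and C\<alpha>: "0 < C\<alpha>"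
    and gmin: "0 < gmin" and c\<mu>: "0 < c\<mu>" and j: "j \<le> m" and \<kappa>: "0 < \<kappa>"
    and \<gamma>: "\<And>i. i \<in> {1..m} \<Longrightarrow> 0 < \<gamma> i" and Cs: "\<And>i. i \<in> {1..m} \<Longrightarrow> 0 < Cs i"
    and Q: "Q = transfer_class m \<alpha> \<beta> \<gamma> L C\<alpha> Cs gmin gmax c\<mu> r\<mu>"
  shows "\<exists>C>0. \<forall>q n \<epsilon> \<delta>. 0 < q \<longrightarrow> 1 / real q \<le> r\<mu> \<longrightarrow> (\<forall>i\<le>m. 0 < \<epsilon> i \<and> 0 \<le> \<delta> i) \<longrightarrow>
     \<kappa> \<le> real (n j) * (1 / real q) ^ CARD('d) * (1 / real q) powr (2 * \<beta> * (\<gamma>(0 := 1)) j) \<longrightarrow>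
     \<kappa> \<le> real (n j) * \<epsilon> j * (1 / real q) ^ CARD('d) * (1 / real q) powr (\<beta> * (\<gamma>(0 := 1)) j) \<longrightarrow>
     (\<exists>p\<in>(private_protocols m n \<epsilon> \<delta> :: ('d, 't) protocol set). \<forall>P\<in>Q.
         excess_risk m n p P \<le> C * (1 / real q) powr (\<beta> * (1 + \<alpha>)))"
proof -
  define d where "d = CARD('d)"
  have d: "0 < d" by (simp add: d_def)
  define g where "g = (\<gamma>(0 := 1)) j"
  define c where "c = (Cs(0 := 1)) j"
  have g: "0 < g" and c: "0 < c" using \<gamma>[of j] Cs[of j] j by (auto simp: g_def c_def)
  define V where "V = unit_ball_vol (real d)"
  have V: "0 < V" by (simp add: V_def)
  \<comment> \<open>\<open>b * h powr \<beta>\<close> bounds the oscillation of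
    \<open>\<eta> 0\<close> over a neighbourhood, whose points are within 2 d h of each point of the
    cell's own centre of reference \<open>x\<close>.\<close>
  define b where "b = L * (2 * real d) powr \<beta>"
  have b: "0 < b" using L d by (simp add: b_def)
  \<comment> \<open>\<open>B * h powr (\<beta> * g)\<close> is the margin \<open>u\<close> of server
    \<open>j\<close> that remains in the neighbourhood when the target margin equals
    \<open>T\<close>.\<close>
  define B where "B = c * b powr g"
  have B: "0 < B" using c b by (simp add: B_def)
  \<comment> \<open>With \<open>l = \<epsilon> j * \<tau>\<close> the sensitivity bound of
    \<open>vote_adjacent\<close>, times \<open>l\<close>, is exactly
    \<open>\<epsilon> j\<close>.\<close>
  define \<tau> :: real where "\<tau> = 1 / (2 * 3 ^ d)"
  have \<tau>: "0 < \<tau>" by (simp add: \<tau>_def)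
  \<comment> \<open>The exponent that the hypotheses guarantee at target margin \<open>T\<close>;
    the factors before \<kappa> come from the mass of the neighbourhood and from
    \<open>u\<close>.\<close>
  define a where "a = gmin * c\<mu> * V * B * \<kappa> * min \<tau> B"
  have a: "0 < a" using gmin c\<mu> V B \<kappa> \<tau> by (simp add: a_def)
  obtain D where D: "1 \<le> D" "\<And>s. 1 \<le> s \<Longrightarrow> exp (- (a * s powr g)) \<le> D * s powr (- (\<alpha> + 2))"
    using exp_powr_decay[OF a g, of "\<alpha> + 2"] \<alpha> by auto
  define C where "C = 4 * 2 powr \<alpha> * D * C\<alpha> * (2 * b) powr (1 + \<alpha>)"
  have C0: "0 < C" using D(1) C\<alpha> b by (simp add: C_def)
  have main: "\<exists>p\<in>(private_protocols m n \<epsilon> \<delta> :: ('d, 't) protocol set). \<forall>P\<in>Q.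
         excess_risk m n p P \<le> C * (1 / real q) powr (\<beta> * (1 + \<alpha>))"
    if q: "0 < q" and hr: "1 / real q \<le> r\<mu>" and \<epsilon>: "\<forall>i\<le>m. 0 < \<epsilon> i \<and> 0 \<le> \<delta> i"
      and k1: "\<kappa> \<le> real (n j) * (1 / real q) ^ CARD('d) * (1 / real q) powr (2 * \<beta> * (\<gamma>(0 := 1)) j)"
      and k2: "\<kappa> \<le> real (n j) * \<epsilon> j * (1 / real q) ^ CARD('d) * (1 / real q) powr (\<beta> * (\<gamma>(0 := 1)) j)"
    for q n \<epsilon> \<delta>
  proof -
    define h where "h = 1 / real q"
    have h: "0 < h" using q by (simp add: h_def)
    obtain code :: "(('d \<Rightarrow> nat) \<Rightarrow> bool) \<Rightarrow> 't" where code: "inj_on code {f. \<forall>k. k \<notin> cells q \<longrightarrow> f k = False}"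
      using exists_code[OF inj finite_bool_funs] .
    define l where "l = \<epsilon> j * \<tau>"
    have l: "0 < l" using \<epsilon> j \<tau> by (simp add: l_def)
    define p where "p = server_protocol code j q l n"
    have p: "p \<in> private_protocols m n \<epsilon> \<delta>"
      unfolding p_def by (rule server_protocol_private[OF j]) (use \<epsilon> l in \<open>auto simp: l_def \<tau>_def d_def\<close>)
    \<comment> \<open>Twice the oscillation over a neighbourhood, so that half of a margin above
      \<open>T\<close> survives throughout it.\<close>
    define T where "T = 2 * b * h powr \<beta>"
    have T: "0 < T" using b h by (simp add: T_def)
    have "excess_risk m n p P \<le> C * h powr (\<beta> * (1 + \<alpha>))" if PQ: "P \<in> Q" for P
    proof (rule transfer_classE[OF PQ[unfolded Q] gmin])
      fix \<eta> A assume PP: "\<And>j. j \<le> m \<Longrightarrow> P j \<in> space (prob_algebra obs_space)"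
        and \<eta>: "\<And>j. j \<le> m \<Longrightarrow> regression_fun (P j) (\<eta> j)"
        and sg: "\<And>j x. j \<le> m \<Longrightarrow> x \<in> unit_cube \<Longrightarrow> sgn (\<eta> j x - 1/2) = sgn (\<eta> 0 x - 1/2)"
        and tr: "\<And>j x. j \<le> m \<Longrightarrow> x \<in> unit_cube \<Longrightarrow> (Cs(0 := 1)) j * \<bar>\<eta> 0 x - 1/2\<bar> powr (\<gamma>(0 := 1)) j \<le> \<bar>\<eta> j x - 1/2\<bar>"
        and hol: "\<And>x x'. x \<in> unit_cube \<Longrightarrow> x' \<in> unit_cube \<Longrightarrow> \<bar>\<eta> 0 x - \<eta> 0 x'\<bar> \<le> L * norm (x - x') powr \<beta>"
        and mar: "\<And>t. t > 0 \<Longrightarrow> measure (P 0) {z \<in> space (P 0). \<bar>\<eta> 0 (fst z) - 1/2\<bar> \<le> t} \<le> C\<alpha> * t powr \<alpha>"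
        and A: "A \<subseteq> unit_cube" "A \<in> sets borel" "regular_set c\<mu> r\<mu> A"
        and AEA: "AE z in P 0. fst z \<in> A"
        and mass: "\<And>j G. j \<le> m \<Longrightarrow> G \<in> sets borel \<Longrightarrow> G \<subseteq> A \<Longrightarrow> gmin * measure lborel G \<le> measure (P j) {z \<in> space (P j). fst z \<in> G}"
      have P0: "P 0 \<in> space (prob_algebra obs_space)" and Pj: "P j \<in> space (prob_algebra obs_space)"
        using PP j by auto
      interpret P0: prob_space "P 0" by (rule obs_law_facts(1)[OF P0])
      interpret Pj: prob_space "P j" by (rule obs_law_facts(1)[OF Pj])
      have spP: "space (P i) = unit_cube \<times> UNIV" if "i \<le> m" for i using obs_law_facts(3)[OF PP[OF that]] .
      have \<eta>m[measurable]: "\<eta> 0 \<in> borel_measurable cube_space" and \<eta>01: "\<And>i x. i \<le> m \<Longrightarrow> x \<in> unit_cube \<Longrightarrow> 0 \<le> \<eta> i x \<and> \<eta> i x \<le> 1"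
        using \<eta> unfolding regression_fun_def by auto
      define t where "t z = \<bar>\<eta> 0 (fst z) - 1/2\<bar>" for z :: "'d obs"
      have tm: "t \<in> borel_measurable obs_space" unfolding t_def[abs_def] by measurable
      define err where "err z = measure (final_law m n p P)
         {T \<in> space (final_law m n p P). classifier p (T, fst z) \<noteq> (1/2 \<le> \<eta> 0 (fst z))}" for z :: "'d obs"
      have "final_law m n p P \<in> space (prob_algebra (fin_space p))"
        by (rule final_law_prob_algebra[OF p]) (rule PP)
      then interpret F: prob_space "final_law m n p P" by (simp add: space_prob_algebra)
      \<comment> \<open>Only points of the support are treated, because the regularity condition
        speaks of balls centred in \<open>A\<close>; \<open>AEA\<close> shows that this is
        enough.\<close>
      have key: "err z \<le> D * (t z / T) powr (- (\<alpha> + 2))" if zA: "fst z \<in> A" and tz: "T \<le> t z" for z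
      proof -
        define x where "x = fst z"
        have x: "x \<in> unit_cube" using zA A by (auto simp: x_def)
        define tt where "tt = t z"
        have tt: "tt = \<bar>\<eta> 0 x - 1/2\<bar>" by (simp add: tt_def t_def x_def)
        define s :: real where "s = (if 1/2 \<le> \<eta> 0 x then 1 else - 1)"
        have s: "s = 1 \<or> s = - 1" by (simp add: s_def)
        define u where "u = c * (tt / 2) powr g"
        have tt0: "0 < tt" using T tz by (simp add: tt_def)
        have u0: "0 < u" using c tt0 by (simp add: u_def)
        have un: "u \<le> s * (\<eta> j y - 1/2)" if y: "y \<in> unit_cube" "near q (cell q x) y" for y
        proof -
          have "\<bar>\<eta> 0 x - \<eta> 0 y\<bar> \<le> L * norm (x - y) powr \<beta>" by (rule hol[OF x y(1)])
          also have "\<dots> \<le> L * (2 * real d * h) powr \<beta>"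
            using near_cell_dist[OF x y(2) q] L \<beta> by (intro mult_left_mono powr_mono2) (auto simp: d_def h_def)
          also have "\<dots> = T / 2" using h by (simp add: powr_mult T_def b_def)
          also have "\<dots> \<le> tt / 2" using tz by (simp add: tt_def)
          finally have near1: "\<bar>\<eta> 0 x - \<eta> 0 y\<bar> \<le> tt / 2" .
          then have pos: "tt / 2 \<le> s * (\<eta> 0 y - 1/2)" using tt by (auto simp: s_def abs_if split: if_splits)
          then have "sgn (\<eta> 0 y - 1/2) = s" using tt0 s by (auto simp: sgn_if)
          then have "sgn (\<eta> j y - 1/2) = s" using sg[OF j y(1)] by simp
          then have "s * (\<eta> j y - 1/2) = \<bar>\<eta> j y - 1/2\<bar>" using abs_sgn[of "\<eta> j y - 1/2"] by (simp add: mult.commute)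
          moreover have "\<bar>\<eta> 0 y - 1/2\<bar> = s * (\<eta> 0 y - 1/2)" using pos tt0 s by auto
          then have "u \<le> c * \<bar>\<eta> 0 y - 1/2\<bar> powr g"
            unfolding u_def using pos tt0 c g by (intro mult_left_mono powr_mono2) auto
          then have "u \<le> \<bar>\<eta> j y - 1/2\<bar>" using tr[OF j y(1)] by (simp add: c_def g_def)
          ultimately show ?thesis by simp
        qed
        have "near q (cell q x) x" using near_cell[OF x] by simp
        then have "u \<le> s * (\<eta> j x - 1/2)" using un x by simp
        then have u1: "u \<le> 1" using \<eta>01[OF j x] s by auto
        have "err z = (\<integral>z. measure (vote_pmf q l (n j) z) {f. f (cell q x) \<noteq> (1/2 \<le> \<eta> 0 x)} \<partial>sample_law (n j) (P j))"
          unfolding err_def x_def[symmetric] by (rule server_misclassification[OF p p_def j PP code x])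
        also have "(1/2 \<le> \<eta> 0 x) = (s = 1)" by (simp add: s_def)
        also have "(\<integral>z. measure (vote_pmf q l (n j) z) {f. f (cell q x) \<noteq> (s = 1)} \<partial>sample_law (n j) (P j))
          \<le> exp (- (real (n j) * measure (P j) {z \<in> space (P j). near q (cell q x) (fst z)} * u * min l u))"
          by (rule vote_error[OF Pj \<eta>[OF j] cell_in_cells[OF x] s l u0 u1 un])
        also have "\<dots> \<le> exp (- (a * (tt / T) powr g))"
        proof -
          define \<pi> where "\<pi> = measure (P j) {z \<in> space (P j). near q (cell q x) (fst z)}"
          define s' where "s' = (tt / T) powr g"
          have s'1: "1 \<le> s'" using tz T g unfolding s'_def tt_def by (intro ge_one_powr_ge_zero) auto
          have \<pi>: "gmin * (c\<mu> * (V * h ^ d)) \<le> \<pi>"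
          proof -
            have "c\<mu> * measure lborel (ball x h) \<le> measure lborel (A \<inter> ball x h)"
              using A(3)[unfolded regular_set_def, rule_format, OF zA, of h] h hr by (simp add: h_def x_def)
            moreover have "measure lborel (ball x h) = V * h ^ d"
              using content_ball[of h x] h by (simp add: V_def d_def)
            ultimately have "gmin * (c\<mu> * (V * h ^ d)) \<le> gmin * measure lborel (A \<inter> ball x h)"
              using gmin by simp
            also have "\<dots> \<le> measure (P j) {z \<in> space (P j). fst z \<in> A \<inter> ball x h}"
              using A by (intro mass[OF j]) auto
            also have "\<dots> \<le> \<pi>"
              unfolding \<pi>_def
            proof (rule Pj.finite_measure_mono)
              have "Measurable.pred (P j) (\<lambda>z. near q (cell q x) (fst z))"
                by (subst measurable_cong_sets[OF obs_law_facts(2)[OF Pj] refl])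
                   (rule measurable_compose[OF measurable_fst_obs measurable_near])
              then show "{z \<in> space (P j). near q (cell q x) (fst z)} \<in> sets (P j)" by (simp add: pred_def)
              show "{z \<in> space (P j). fst z \<in> A \<inter> ball x h} \<subseteq> {z \<in> space (P j). near q (cell q x) (fst z)}"
                using ball_near[OF x _ q] unfolding h_def by blast
            qed
            finally show ?thesis .
          qed
          have ueq: "u = B * h powr (\<beta> * g) * s'"
          proof -
            have "tt / 2 = (T / 2) * (tt / T)" using T by simp
            also have "T / 2 = b * h powr \<beta>" by (simp add: T_def)
            finally have "tt / 2 = (b * h powr \<beta>) * (tt / T)" .
            then have "(tt / 2) powr g = ((b * h powr \<beta>) * (tt / T)) powr g" by (rule arg_cong)
            also have "\<dots> = (b * h powr \<beta>) powr g * s'"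
              unfolding s'_def by (rule powr_mult)
            also have "(b * h powr \<beta>) powr g = b powr g * h powr (\<beta> * g)"
              using b h by (simp add: powr_mult powr_powr)
            finally show ?thesis by (simp add: u_def B_def)
          qed
          \<comment> \<open>The privacy hypothesis \<open>k2\<close> bounds the product with
            \<open>l\<close>, the sampling hypothesis \<open>k1\<close> the product with
            \<open>u\<close>.\<close>
          have kk: "\<kappa> * min \<tau> B \<le> real (n j) * h ^ d * h powr (\<beta> * g) * min l u"
          proof -
            have "\<kappa> * min \<tau> B \<le> real (n j) * h ^ d * h powr (\<beta> * g) * l"
            proof -
              have "\<kappa> * min \<tau> B \<le> \<kappa> * \<tau>" using \<kappa> by simp
              also have "\<dots> \<le> (real (n j) * \<epsilon> j * h ^ d * h powr (\<beta> * g)) * \<tau>"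
                using k2 \<tau> by (intro mult_right_mono) (auto simp: h_def d_def g_def)
              finally show ?thesis by (simp add: l_def mult_ac)
            qed
            moreover have "\<kappa> * min \<tau> B \<le> real (n j) * h ^ d * h powr (\<beta> * g) * u"
            proof -
              have "\<kappa> * min \<tau> B \<le> \<kappa> * B" using \<kappa> by simp
              also have "\<dots> \<le> (real (n j) * h ^ d * h powr (2 * \<beta> * g)) * B"
                using k1 B by (intro mult_right_mono) (auto simp: h_def d_def g_def)
              also have "\<dots> = real (n j) * h ^ d * h powr (\<beta> * g) * (B * h powr (\<beta> * g) * 1)"
              proof -
                have "h powr (2 * \<beta> * g) = h powr (\<beta> * g) * h powr (\<beta> * g)"
                  by (simp add: mult.assoc flip: powr_add)
                then show ?thesis by simp
              qed
              also have "\<dots> \<le> real (n j) * h ^ d * h powr (\<beta> * g) * u"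
                unfolding ueq using s'1 B h by (intro mult_left_mono) auto
              finally show ?thesis .
            qed
            ultimately show ?thesis by (simp add: min_def)
          qed
          have "a * s' = (gmin * c\<mu> * V) * B * s' * (\<kappa> * min \<tau> B)"
            by (simp add: a_def)
          also have "\<dots> \<le> (gmin * c\<mu> * V) * B * s' * (real (n j) * h ^ d * h powr (\<beta> * g) * min l u)"
            using gmin c\<mu> V B s'1 by (intro mult_left_mono kk) auto
          also have "\<dots> = real (n j) * (gmin * (c\<mu> * (V * h ^ d))) * u * min l u"
            unfolding ueq by (simp add: mult_ac)
          also have "\<dots> \<le> real (n j) * \<pi> * u * min l u"
            using \<pi> u0 l by (intro mult_right_mono mult_left_mono) auto
          finally show ?thesis by (simp add: \<pi>_def s'_def)
        qed
        also have "\<dots> \<le> D * (tt / T) powr (- (\<alpha> + 2))"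
          by (rule D(2)) (use tz T in \<open>simp add: tt_def\<close>)
        finally show ?thesis by (simp add: tt_def)
      qed
      have abs2: "\<bar>2 * y - 1\<bar> = 2 * \<bar>y - 1/2\<bar>" for y :: real by (simp add: abs_if field_simps)
      have "excess_risk m n p P = (\<integral>z. 2 * t z * err z \<partial>P 0)"
        unfolding t_def err_def abs2[symmetric] by (rule excess_risk_eq[OF p]) (use PP \<eta> in auto)
      also have "\<dots> \<le> 4 * 2 powr \<alpha> * D * C\<alpha> * T powr (1 + \<alpha>)"
      proof (rule margin_integral)
        show "prob_space (P 0)" by (rule P0.prob_space_axioms)
        show "t \<in> borel_measurable (P 0)" by (subst measurable_cong_sets[OF obs_law_facts(2)[OF P0] refl]) (rule tm)
        show "0 \<le> t z \<and> t z \<le> 1/2" if "z \<in> space (P 0)" for z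
        proof -
          have "fst z \<in> unit_cube" using that spP[of 0] by (simp add: mem_Times_iff)
          then have "0 \<le> \<eta> 0 (fst z)" "\<eta> 0 (fst z) \<le> 1" using \<eta>01[of 0] by auto
          then show ?thesis unfolding t_def by linarith
        qed
        show "measure (P 0) {z \<in> space (P 0). t z \<le> s} \<le> C\<alpha> * s powr \<alpha>" if "0 < s" for s
          using mar[OF that] unfolding t_def .
        show "AE z in P 0. T \<le> t z \<longrightarrow> err z \<le> D * (t z / T) powr (- (\<alpha> + 2))"
          using AEA by (rule AE_mp) (rule AE_I2, intro impI, rule key)
        show "err z \<le> 1" "0 \<le> err z" for z unfolding err_def by simp_all
      qed (use D T \<alpha> C\<alpha> in simp_all)
      also have "\<dots> = C * h powr (\<beta> * (1 + \<alpha>))"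
        unfolding T_def powr_mult powr_powr C_def by (simp add: mult.assoc)
      finally show ?thesis .
    qed
    then show ?thesis unfolding h_def by (intro bexI[OF _ p] ballI)
  qed
  show ?thesis by (intro exI[of _ C] conjI C0, intro allI impI, rule main)
qed

lemma excess_risk_le_one:
  fixes P :: "nat \<Rightarrow> ('d::finite) obs measure"
  assumes p: "p \<in> private_protocols m n \<epsilon> \<delta>"
    and P: "\<And>j. j \<le> m \<Longrightarrow> P j \<in> space (prob_algebra obs_space)"
  shows "excess_risk m n p P \<le> 1"
proof -
  interpret P0: prob_space "P 0" by (rule obs_law_facts(1)[OF P]) simp
  have "final_law m n p P \<in> space (prob_algebra (fin_space p))"
    by (rule final_law_prob_algebra[OF p]) (rule P)
  then interpret F: prob_space "final_law m n p P" by (simp add: space_prob_algebra)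
  have "(\<integral>T. risk (P 0) (\<lambda>x. classifier p (T, x)) \<partial>final_law m n p P) \<le> 1"
  proof (cases "integrable (final_law m n p P) (\<lambda>T. risk (P 0) (\<lambda>x. classifier p (T, x)))")
    case True
    then show ?thesis by (rule F.integral_le_const) (simp add: risk_def)
  next
    case False
    then show ?thesis by (simp add: not_integrable_integral_eq)
  qed
  moreover have "0 \<le> risk (P 0) (bayes_classifier (P 0))" by (simp add: risk_def)
  ultimately show ?thesis unfolding excess_risk_def by linarith
qed

lemma minimax_risk_leI:
  assumes "p \<in> (private_protocols m n \<epsilon> \<delta> :: ('d::finite, 't) protocol set)"
    "\<And>P. P \<in> Q \<Longrightarrow> excess_risk m n p P \<le> c"
  shows "minimax_risk TYPE('t) m n \<epsilon> \<delta> Q \<le> ennreal c"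
  unfolding minimax_risk_def
  by (rule INF_lower2[OF assms(1)]) (intro SUP_least ennreal_leI assms(2))

lemma minimax_risk_le_one:
  fixes Q :: "(nat \<Rightarrow> ('d::finite) obs measure) set"
  assumes inj: "\<exists>e :: real \<Rightarrow> 't. inj e" and "\<forall>j\<le>m. 0 < \<epsilon> j \<and> 0 < \<delta> j"
    and Q: "\<And>P j. P \<in> Q \<Longrightarrow> j \<le> m \<Longrightarrow> P j \<in> space (prob_algebra obs_space)"
  shows "minimax_risk TYPE('t) m n \<epsilon> \<delta> Q \<le> 1"
proof -
  \<comment> \<open>The trivial bound requires some private protocol. With \<open>l = 0\<close>
    every bit is a fair coin, whatever the data.\<close>
  have sp: "server_protocol (undefined :: _ \<Rightarrow> 't) 0 0 0 n \<in> (private_protocols m n \<epsilon> \<delta> :: ('d, 't) protocol set)"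
    using assms(2) by (intro server_protocol_private) (auto intro: less_imp_le)
  have "minimax_risk TYPE('t) m n \<epsilon> \<delta> Q \<le> ennreal 1"
    by (rule minimax_risk_leI[OF sp], rule excess_risk_le_one[OF sp], rule Q)
  then show ?thesis by simp
qed

lemma rate_lhs_eq:
  "rate_lhs d m \<beta> \<gamma> n \<epsilon> r = (\<Sum>j\<le>m. min (real (n j)) (real (n j) ^ 2 * \<epsilon> j ^ 2 * r ^ d)
     * r powr (2 * \<beta> * (\<gamma>(0 := 1)) j + real d))"
  unfolding rate_lhs_def
  by (subst atLeast0AtMost[symmetric], subst sum.atLeast_Suc_atMost) (auto intro!: sum.cong)

text \<open>The mesh has to be the reciprocal of an integer for the grid to fit the unit cube;
  rounding costs a factor 2.\<close>

lemma inverse_nat_approx: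
  fixes r :: real
  assumes "0 < r" "r \<le> 1"
  obtains q :: nat where "0 < q" "1 / real q \<le> r" "r / 2 \<le> 1 / real q"
proof
  define q where "q = nat \<lceil>1 / r\<rceil>"
  have 1: "1 \<le> 1 / r" using assms by simp
  have q: "1 / r \<le> real q" "real q \<le> 1 / r + 1" unfolding q_def using 1 by linarith+
  show q0: "0 < q" using q(1) 1 by (simp add: gr0_conv_Suc) (metis not0_implies_Suc not_one_le_zero of_nat_0 order_trans)
  show "1 / real q \<le> r" using q(1) q0 assms by (simp add: field_simps)
  have "real q \<le> 2 / r" using q(2) 1 by simp
  then show "r / 2 \<le> 1 / real q" using q0 assms by (simp add: field_simps)
qed

text \<open>The server to be used depends on the sample sizes and privacy parameters, but there are
  only finitely many servers, so one constant dominates all of theirs. The regularity condition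
  reaches only radii up to \<open>r\<mu>\<close>; for larger r the trivial bound is of the right
  order.\<close>

lemma minimax_upper:
  fixes \<gamma> Cs :: "nat \<Rightarrow> real" and Q :: "(nat \<Rightarrow> ('d::finite) obs measure) set"
  assumes inj: "\<exists>e :: real \<Rightarrow> 't. inj e"
    and \<alpha>: "0 \<le> \<alpha>" and \<beta>: "0 < \<beta>" and L: "0 < L" and C\<alpha>: "0 < C\<alpha>"
    and gmin: "0 < gmin" and c\<mu>: "0 < c\<mu>" and r\<mu>: "0 < r\<mu>"
    and \<gamma>: "\<And>i. i \<in> {1..m} \<Longrightarrow> 0 < \<gamma> i" and Cs: "\<And>i. i \<in> {1..m} \<Longrightarrow> 0 < Cs i"
    and Q: "Q = transfer_class m \<alpha> \<beta> \<gamma> L C\<alpha> Cs gmin gmax c\<mu> r\<mu>"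
  shows "\<exists>C>0. \<forall>n \<epsilon> \<delta> r. (\<forall>j\<le>m. 1 \<le> n j \<and> 0 < \<epsilon> j \<and> 0 < \<delta> j) \<longrightarrow> 0 < r \<longrightarrow>
     rate_lhs CARD('d) m \<beta> \<gamma> n \<epsilon> r = 1 \<longrightarrow>
     minimax_risk TYPE('t) m n \<epsilon> \<delta> Q \<le> ennreal (C * r powr (\<beta> * (1 + \<alpha>)))"
proof -
  define d where "d = CARD('d)"
  define \<gamma>' where "\<gamma>' = \<gamma>(0 := 1)"
  have \<gamma>': "0 < \<gamma>' j" if "j \<le> m" for j using \<gamma>[of j] that by (auto simp: \<gamma>'_def)
  define \<kappa>\<^sub>0 where "\<kappa>\<^sub>0 = 1 / real (Suc m)"
  have \<kappa>\<^sub>0: "0 < \<kappa>\<^sub>0" "\<kappa>\<^sub>0 \<le> 1" by (auto simp: \<kappa>\<^sub>0_def)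
  \<comment> \<open>The powers of 1/2 pay for replacing r by the mesh, which is at least r /
    2.\<close>
  define \<kappa> where "\<kappa> j = \<kappa>\<^sub>0 * (1/2) ^ d * (1/2) powr (2 * \<beta> * \<gamma>' j)" for j
  have \<kappa>: "0 < \<kappa> j" for j using \<kappa>\<^sub>0 by (simp add: \<kappa>_def)
  have "\<forall>j\<in>{..m}. \<exists>C>0. \<forall>q n \<epsilon> \<delta>. 0 < q \<longrightarrow> 1 / real q \<le> r\<mu> \<longrightarrow> (\<forall>i\<le>m. 0 < \<epsilon> i \<and> 0 \<le> \<delta> i) \<longrightarrow>
     \<kappa> j \<le> real (n j) * (1 / real q) ^ CARD('d) * (1 / real q) powr (2 * \<beta> * (\<gamma>(0 := 1)) j) \<longrightarrow>
     \<kappa> j \<le> real (n j) * \<epsilon> j * (1 / real q) ^ CARD('d) * (1 / real q) powr (\<beta> * (\<gamma>(0 := 1)) j) \<longrightarrow>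
     (\<exists>p\<in>(private_protocols m n \<epsilon> \<delta> :: ('d, 't) protocol set). \<forall>P\<in>Q.
         excess_risk m n p P \<le> C * (1 / real q) powr (\<beta> * (1 + \<alpha>)))"
    by (intro ballI server_upper[OF inj \<alpha> \<beta> L C\<alpha> gmin c\<mu> _ \<kappa> _ _ Q] \<gamma> Cs) auto
  from bchoice[OF this] obtain C where C: "\<And>j. j \<le> m \<Longrightarrow> 0 < C j" and
    Cj: "\<And>j q n \<epsilon> \<delta>. j \<le> m \<Longrightarrow> 0 < q \<Longrightarrow> 1 / real q \<le> r\<mu> \<Longrightarrow> (\<forall>i\<le>m. 0 < \<epsilon> i \<and> 0 \<le> \<delta> i) \<Longrightarrow>
     \<kappa> j \<le> real (n j) * (1 / real q) ^ CARD('d) * (1 / real q) powr (2 * \<beta> * (\<gamma>(0 := 1)) j) \<Longrightarrow>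
     \<kappa> j \<le> real (n j) * \<epsilon> j * (1 / real q) ^ CARD('d) * (1 / real q) powr (\<beta> * (\<gamma>(0 := 1)) j) \<Longrightarrow>
     (\<exists>p\<in>(private_protocols m n \<epsilon> \<delta> :: ('d, 't) protocol set). \<forall>P\<in>Q.
         excess_risk m n p P \<le> C j * (1 / real q) powr (\<beta> * (1 + \<alpha>)))"
    by (metis atMost_iff)
  define r\<^sub>1 where "r\<^sub>1 = min 1 r\<mu>"
  have r\<^sub>1: "0 < r\<^sub>1" "r\<^sub>1 \<le> 1" "r\<^sub>1 \<le> r\<mu>" using r\<mu> by (auto simp: r\<^sub>1_def)
  define \<theta> where "\<theta> = \<beta> * (1 + \<alpha>)"
  have \<theta>: "0 < \<theta>" using \<alpha> \<beta> by (simp add: \<theta>_def)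
  \<comment> \<open>The sum covers the constants of all servers; the last term makes the bound at
    least 1 once r exceeds \<open>r\<^sub>1\<close>.\<close>
  define D where "D = (\<Sum>j\<le>m. C j) + 1 / r\<^sub>1 powr \<theta>"
  have Csum: "0 \<le> (\<Sum>j\<le>m. C j)" by (rule sum_nonneg) (use C in \<open>auto intro: less_imp_le\<close>)
  have D: "0 < D" using Csum r\<^sub>1 unfolding D_def by (intro add_nonneg_pos) auto
  have DC: "C j \<le> D" if "j \<le> m" for j
  proof -
    have "C j \<le> (\<Sum>j\<le>m. C j)" by (rule member_le_sum) (use that C in \<open>auto intro: less_imp_le\<close>)
    then show ?thesis using r\<^sub>1 by (simp add: D_def add_increasing2)
  qed
  have Qp: "P j \<in> space (prob_algebra obs_space)" if "P \<in> Q" "j \<le> m" for P j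
    using that unfolding Q transfer_class_def by blast
  have main: "minimax_risk TYPE('t) m n \<epsilon> \<delta> Q \<le> ennreal (D * r powr \<theta>)"
    if pos: "\<forall>j\<le>m. 1 \<le> n j \<and> 0 < \<epsilon> j \<and> 0 < \<delta> j" and r: "0 < r" and eq: "rate_lhs CARD('d) m \<beta> \<gamma> n \<epsilon> r = 1"
    for n \<epsilon> \<delta> r
  proof (cases "r \<le> r\<^sub>1")
    case False
    have "minimax_risk TYPE('t) m n \<epsilon> \<delta> Q \<le> 1"
      by (rule minimax_risk_le_one[OF inj]) (use pos Qp in auto)
    also have "1 \<le> ennreal (D * r powr \<theta>)"
    proof -
      have "1 = 1 / r\<^sub>1 powr \<theta> * r\<^sub>1 powr \<theta>" using r\<^sub>1 by simp
      also have "\<dots> \<le> D * r powr \<theta>"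
        using Csum False r\<^sub>1 \<theta> by (intro mult_mono powr_mono2) (auto simp: D_def)
      finally show ?thesis by (simp flip: ennreal_1)
    qed
    finally show ?thesis .
  next
    case True
    define a where "a j = min (real (n j)) (real (n j) ^ 2 * \<epsilon> j ^ 2 * r ^ d) * r powr (2 * \<beta> * \<gamma>' j + real d)" for j
    obtain j where j: "j \<le> m" "\<kappa>\<^sub>0 \<le> a j"
    proof (rule ccontr)
      assume "\<not> thesis"
      then have "a j < \<kappa>\<^sub>0" if "j \<le> m" for j using that \<open>\<And>j. j \<le> m \<Longrightarrow> \<kappa>\<^sub>0 \<le> a j \<Longrightarrow> thesis\<close> by force
      then have "(\<Sum>j\<le>m. a j) < (\<Sum>j\<le>m. \<kappa>\<^sub>0)" by (intro sum_strict_mono) auto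
      also have "\<dots> = 1" by (simp add: \<kappa>\<^sub>0_def)
      also have "1 = (\<Sum>j\<le>m. a j)" using eq unfolding rate_lhs_eq a_def \<gamma>'_def d_def by simp
      finally show False by simp
    qed
    obtain q where q: "0 < q" "1 / real q \<le> r" "r / 2 \<le> 1 / real q"
      using inverse_nat_approx[of r] r True r\<^sub>1 by auto
    define h where "h = 1 / real q"
    have h: "0 < h" "h \<le> r" "r / 2 \<le> h" using q by (auto simp: h_def)
    have g0: "0 < \<gamma>' j" by (rule \<gamma>'[OF j(1)])
    have n0: "0 \<le> real (n j)" "0 < \<epsilon> j" using pos j(1) by auto
    have pw: "r powr (2 * \<beta> * \<gamma>' j + real d) = r ^ d * r powr (2 * \<beta> * \<gamma>' j)"
      using r by (simp add: powr_add powr_realpow)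
    have hd: "r ^ d * (1/2) ^ d \<le> h ^ d"
      using power_mono[OF h(3), of d] r by (simp add: power_divide)
    have hp: "r powr e * (1/2) powr e \<le> h powr e" if "0 \<le> e" for e
      using powr_mono2[OF that _ h(3)] r by (simp add: powr_divide)
    have k1: "\<kappa> j \<le> real (n j) * h ^ d * h powr (2 * \<beta> * \<gamma>' j)"
    proof -
      have "\<kappa>\<^sub>0 \<le> real (n j) * (r ^ d * r powr (2 * \<beta> * \<gamma>' j))"
        using j(2) unfolding a_def pw
        by (rule order_trans) (intro mult_right_mono mult_nonneg_nonneg; use r in simp)
      then have "\<kappa> j \<le> (real (n j) * (r ^ d * r powr (2 * \<beta> * \<gamma>' j))) * ((1/2) ^ d * (1/2) powr (2 * \<beta> * \<gamma>' j))"
        unfolding \<kappa>_def mult.assoc[of \<kappa>\<^sub>0] by (rule mult_right_mono) simp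
      also have "\<dots> = real (n j) * ((r ^ d * (1/2) ^ d) * (r powr (2 * \<beta> * \<gamma>' j) * (1/2) powr (2 * \<beta> * \<gamma>' j)))"
        by (simp only: mult_ac)
      also have "\<dots> \<le> real (n j) * (h ^ d * h powr (2 * \<beta> * \<gamma>' j))"
        using g0 \<beta> r h(1) by (intro mult_left_mono mult_mono hd hp) auto
      finally show ?thesis by (simp only: mult.assoc)
    qed
    have k2: "\<kappa> j \<le> real (n j) * \<epsilon> j * h ^ d * h powr (\<beta> * \<gamma>' j)"
    proof -
      define y where "y = real (n j) * \<epsilon> j * r ^ d * r powr (\<beta> * \<gamma>' j)"
      have y0: "0 \<le> y" using n0 r by (simp add: y_def)
      have "\<kappa>\<^sub>0 \<le> (real (n j) ^ 2 * \<epsilon> j ^ 2 * r ^ d) * (r ^ d * r powr (2 * \<beta> * \<gamma>' j))"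
        using j(2) unfolding a_def pw
        by (rule order_trans) (intro mult_right_mono mult_nonneg_nonneg; use r in simp)
      also have "\<dots> = y ^ 2"
      proof -
        have "r powr (2 * \<beta> * \<gamma>' j) = r powr (\<beta> * \<gamma>' j) * r powr (\<beta> * \<gamma>' j)"
          by (simp add: mult.assoc flip: powr_add)
        then show ?thesis by (simp add: y_def power2_eq_square mult_ac)
      qed
      \<comment> \<open>The privacy summand is the square of \<open>y\<close>. Since
        \<open>\<kappa>\<^sub>0\<close> is at most 1, its own square is below this summand as well,
        and no root has to be taken.\<close>
      finally have "\<kappa>\<^sub>0 ^ 2 \<le> y ^ 2"
        using \<kappa>\<^sub>0 power_decreasing[of 1 2 \<kappa>\<^sub>0] by simp
      then have "\<kappa>\<^sub>0 \<le> y" using y0 by (rule power2_le_imp_le)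
      then have "\<kappa>\<^sub>0 * ((1/2) ^ d * (1/2) powr (2 * \<beta> * \<gamma>' j)) \<le> y * ((1/2) ^ d * (1/2) powr (\<beta> * \<gamma>' j))"
        using \<beta> g0 y0 by (intro mult_mono powr_mono') auto
      also have "\<dots> = real (n j) * \<epsilon> j * ((r ^ d * (1/2) ^ d) * (r powr (\<beta> * \<gamma>' j) * (1/2) powr (\<beta> * \<gamma>' j)))"
        unfolding y_def by (simp only: mult_ac)
      also have "\<dots> \<le> real (n j) * \<epsilon> j * (h ^ d * h powr (\<beta> * \<gamma>' j))"
        using g0 \<beta> r h(1) n0 by (intro mult_left_mono mult_mono hd hp) auto
      finally show ?thesis unfolding \<kappa>_def by (simp only: mult.assoc)
    qed
    have "\<exists>p\<in>(private_protocols m n \<epsilon> \<delta> :: ('d, 't) protocol set). \<forall>P\<in>Q.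
         excess_risk m n p P \<le> C j * (1 / real q) powr (\<beta> * (1 + \<alpha>))"
      by (rule Cj[OF j(1) q(1)]) (use k1 k2 True r\<^sub>1 q(2) pos in \<open>auto simp: h_def d_def \<gamma>'_def intro: less_imp_le\<close>)
    then obtain p where p: "p \<in> (private_protocols m n \<epsilon> \<delta> :: ('d, 't) protocol set)"
      and pe: "\<forall>P\<in>Q. excess_risk m n p P \<le> C j * h powr \<theta>" by (auto simp: h_def \<theta>_def)
    have "C j * h powr \<theta> \<le> D * r powr \<theta>"
      using DC[OF j(1)] D h \<theta> by (intro mult_mono powr_mono2) auto
    then show ?thesis
      by (intro minimax_risk_leI[OF p]) (use pe in force)
  qed
  show ?thesis
    by (intro exI[of _ D] conjI D, intro allI impI, fold \<theta>_def, rule main)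
qed


section \<open>Stability of private protocols\<close>

text \<open>The oscillation bound \<open>\<omega>\<close> encodes privacy when the coordinates are observations; for
  transcripts it is void with \<open>\<omega> = 1\<close>.\<close>
lemma hybrid_PiM:
  fixes b :: "'i \<Rightarrow> real" and \<omega> :: real
  assumes "finite I"
    and M: "\<And>i. M i \<in> space (prob_algebra (N i))" and M': "\<And>i. M' i \<in> space (prob_algebra (N i))"
    and F: "unit_valued (PiM I N) F"
    and osc: "\<And>i z x. i \<in> I \<Longrightarrow> z \<in> space (PiM I N) \<Longrightarrow> x \<in> space (N i) \<Longrightarrow> \<bar>F (z(i := x)) - F z\<bar> \<le> \<omega>"
    and b: "\<And>i G. i \<in> I \<Longrightarrow> unit_valued (N i) G \<Longrightarrow>
      (\<And>x y. x \<in> space (N i) \<Longrightarrow> y \<in> space (N i) \<Longrightarrow> \<bar>G x - G y\<bar> \<le> \<omega>) \<Longrightarrow>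
      \<bar>(\<integral>x. G x \<partial>M i) - (\<integral>x. G x \<partial>M' i)\<bar> \<le> b i"
  shows "\<bar>(\<integral>z. F z \<partial>PiM I M) - (\<integral>z. F z \<partial>PiM I M')\<bar> \<le> (\<Sum>i\<in>I. b i)"
  using assms(1) F osc b
proof (induction I arbitrary: F rule: finite_induct)
  case empty
  have "PiM {} M = PiM {} M'" by (simp add: PiM_empty)
  then show ?case by simp
next
  case (insert i I F)
  have pM: "prob_space (M j)" "prob_space (M' j)" "sets (M j) = sets (N j)" "sets (M' j) = sets (N j)" for j
    using M[of j] M'[of j] by (auto simp: space_prob_algebra)
  interpret M: product_sigma_finite M
    by (simp add: product_sigma_finite_def prob_space_imp_sigma_finite pM)
  interpret M': product_sigma_finite M'
    by (simp add: product_sigma_finite_def prob_space_imp_sigma_finite pM)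
  have PM: "PiM J M \<in> space (prob_algebra (PiM J N))" "PiM J M' \<in> space (prob_algebra (PiM J N))" for J
    by (auto intro!: PiM_in_prob_algebra M M')
  define g where "g = (\<lambda>(z, x). F (z(i := x)))"
  have upd: "z(i := x) \<in> space (PiM (insert i I) N)" if "z \<in> space (PiM I N)" "x \<in> space (N i)" for z x
    using that by (auto simp: space_PiM PiE_iff extensional_def)
  have g: "unit_valued (PiM I N \<Otimes>\<^sub>M N i) g"
    unfolding unit_valued_def
  proof
    have "(\<lambda>x. F ((\<lambda>(f, y). f(i := y)) x)) \<in> borel_measurable (PiM I N \<Otimes>\<^sub>M N i)"
      by (rule measurable_compose[OF measurable_add_dim unit_valuedD(1)[OF insert.prems(1)]])
    then show "g \<in> borel_measurable (PiM I N \<Otimes>\<^sub>M N i)" by (simp add: g_def case_prod_unfold)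
    show "\<forall>x\<in>space (PiM I N \<Otimes>\<^sub>M N i). 0 \<le> g x \<and> g x \<le> 1"
      using unit_valuedD(2,3)[OF insert.prems(1)] upd by (auto simp: g_def space_pair_measure)
  qed
  \<comment> \<open>\<open>F1\<close> and \<open>F2\<close> integrate coordinate \<open>i\<close> by
    the old and the new law. The intermediate term of the triangle inequality is the integral of
    \<open>F1\<close> when all other coordinates have been exchanged.\<close>
  define F1 where "F1 z = (\<integral>x. g (z, x) \<partial>M i)" for z
  define F2 where "F2 z = (\<integral>x. g (z, x) \<partial>M' i)" for z
  have F1: "unit_valued (PiM I N) F1" and F2: "unit_valued (PiM I N) F2"
    unfolding F1_def F2_def by (rule unit_valued_pair(1)[OF _ g], rule M, rule unit_valued_pair(1)[OF _ g], rule M')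
  have eq: "(\<integral>z. F z \<partial>PiM (insert i I) M) = (\<integral>z. F1 z \<partial>PiM I M)"
    by (subst M.product_integral_insert[OF insert.hyps(1,2) unit_valued_integral(1)[OF PM(1) insert.prems(1)]])
       (simp add: F1_def[abs_def] g_def)
  have eq': "(\<integral>z. F z \<partial>PiM (insert i I) M') = (\<integral>z. F2 z \<partial>PiM I M')"
    by (subst M'.product_integral_insert[OF insert.hyps(1,2) unit_valued_integral(1)[OF PM(2) insert.prems(1)]])
       (simp add: F2_def[abs_def] g_def)
  have "\<bar>(\<integral>z. F1 z \<partial>PiM I M) - (\<integral>z. F1 z \<partial>PiM I M')\<bar> \<le> (\<Sum>i\<in>I. b i)"
  proof (rule insert.IH[OF F1])
    fix j z x assume j: "j \<in> I" and z: "z \<in> space (PiM I N)" and x: "x \<in> space (N j)"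
    have zj: "z(j := x) \<in> space (PiM I N)" using z x j by (auto simp: space_PiM PiE_iff extensional_def)
    show "\<bar>F1 (z(j := x)) - F1 z\<bar> \<le> \<omega>"
      unfolding F1_def
    proof (rule abs_integral_diff_le[OF M])
      show "integrable (M i) (\<lambda>xa. g (z(j := x), xa))" "integrable (M i) (\<lambda>x. g (z, x))"
        by (rule unit_valued_integral(1)[OF M unit_valued_pair(2)[OF M g zj]],
            rule unit_valued_integral(1)[OF M unit_valued_pair(2)[OF M g z]])
      fix y assume y: "y \<in> space (N i)"
      have "i \<noteq> j" using j insert.hyps by auto
      then have "z(j := x, i := y) = (z(i := y))(j := x)" by (simp add: fun_upd_twist)
      then show "\<bar>g (z(j := x), y) - g (z, y)\<bar> \<le> \<omega>"
        using insert.prems(2)[OF insertI2[OF j] upd[OF z y] x] by (simp only: g_def prod.case)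
    qed
  next
    fix j G assume "j \<in> I" and "unit_valued (N j) G"
      and "\<And>x y. x \<in> space (N j) \<Longrightarrow> y \<in> space (N j) \<Longrightarrow> \<bar>G x - G y\<bar> \<le> \<omega>"
    then show "\<bar>(\<integral>x. G x \<partial>M j) - (\<integral>x. G x \<partial>M' j)\<bar> \<le> b j"
      by (intro insert.prems(3)) auto
  qed
  moreover have "\<bar>(\<integral>z. F1 z \<partial>PiM I M') - (\<integral>z. F2 z \<partial>PiM I M')\<bar> \<le> b i"
  proof (rule abs_integral_diff_le[OF PM(2) unit_valued_integral(1)[OF PM(2) F1] unit_valued_integral(1)[OF PM(2) F2]])
    fix z assume z: "z \<in> space (PiM I N)"
    show "\<bar>F1 z - F2 z\<bar> \<le> b i"
      unfolding F1_def F2_def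
    proof (rule insert.prems(3))
      show "unit_valued (N i) (\<lambda>x. g (z, x))" by (rule unit_valued_pair(2)[OF M g z])
      fix x y assume x: "x \<in> space (N i)" and y: "y \<in> space (N i)"
      show "\<bar>g (z, x) - g (z, y)\<bar> \<le> \<omega>"
        using insert.prems(2)[OF insertI1 upd[OF z y] x] by (simp only: g_def prod.case fun_upd_upd)
    qed simp
  qed
  ultimately show ?case
    unfolding eq eq' using insert.hyps by (simp add: abs_if split: if_splits)
qed

text \<open>Layer cake: the integral of \<open>G\<close> averages the mass of the events u < G over
  u in [0, 1), an interval of length one, so the additive error does not grow. This carries privacy
  over from events to test functions.\<close>

lemma integral_le_of_measure_le:
  fixes c :: real
  assumes M: "M \<in> space (prob_algebra N)" and M': "M' \<in> space (prob_algebra N)"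
    and le: "\<And>A. A \<in> sets N \<Longrightarrow> measure M A \<le> measure M' A + c" and G: "unit_valued N G"
  shows "(\<integral>x. G x \<partial>M) \<le> (\<integral>x. G x \<partial>M') + c"
proof -
  have c: "0 \<le> c" using le[of "{}"] by simp
  have layer: "(\<integral>\<^sup>+x. G x \<partial>K) = (\<integral>\<^sup>+u. emeasure K {x \<in> space N. u < G x} * indicator {0..<1} u \<partial>lborel)"
    if K: "K \<in> space (prob_algebra N)" for K
  proof -
    have K': "prob_space K" "sets K = sets N" using K by (auto simp: space_prob_algebra)
    interpret K: prob_space K by fact
    have sp: "space K = space N" using K'(2) by (rule sets_eq_imp_space_eq)
    interpret KL: pair_sigma_finite K "lborel :: real measure" ..
    have Gm[measurable]: "G \<in> borel_measurable K"
      by (subst measurable_cong_sets[OF K'(2) refl]) (rule unit_valuedD(1)[OF G])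
    define h :: "'a \<Rightarrow> real \<Rightarrow> ennreal" where "h x u = indicator {y. fst y < G (snd y)} (u, x) * indicator {0..<1} u" for x u
    have hm: "case_prod h \<in> borel_measurable (K \<Otimes>\<^sub>M lborel)"
    proof -
      have "case_prod h = (\<lambda>p. if snd p < G (fst p) \<and> snd p \<in> {0..<1} then 1 else 0)"
        by (auto simp: h_def indicator_def fun_eq_iff)
      then show ?thesis by simp
    qed
    have "(\<integral>\<^sup>+x. G x \<partial>K) = (\<integral>\<^sup>+x. (\<integral>\<^sup>+u. h x u \<partial>lborel) \<partial>K)"
    proof (rule nn_integral_cong)
      fix x assume "x \<in> space K"
      then have G01: "0 \<le> G x" "G x \<le> 1" using unit_valuedD(2,3)[OF G] by (auto simp: sp)
      have "(\<integral>\<^sup>+u. h x u \<partial>lborel) = (\<integral>\<^sup>+u. indicator {0..<G x} u \<partial>lborel)"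
        by (rule nn_integral_cong) (use G01 in \<open>auto simp: h_def indicator_def\<close>)
      also have "\<dots> = G x" using G01 by simp
      finally show "ennreal (G x) = (\<integral>\<^sup>+u. h x u \<partial>lborel)" ..
    qed
    also have "\<dots> = (\<integral>\<^sup>+u. (\<integral>\<^sup>+x. h x u \<partial>K) \<partial>lborel)"
      by (rule KL.Fubini'[OF hm, symmetric])
    also have "\<dots> = (\<integral>\<^sup>+u. emeasure K {x \<in> space N. u < G x} * indicator {0..<1} u \<partial>lborel)"
    proof (rule nn_integral_cong)
      fix u :: real
      have "(\<integral>\<^sup>+x. h x u \<partial>K) = (\<integral>\<^sup>+x. indicator {x \<in> space K. u < G x} x * indicator {0..<1} u \<partial>K)"
        by (rule nn_integral_cong) (auto simp: h_def indicator_def)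
      also have "\<dots> = emeasure K {x \<in> space K. u < G x} * indicator {0..<1} u"
        by (subst nn_integral_multc) auto
      finally show "(\<integral>\<^sup>+x. h x u \<partial>K) = emeasure K {x \<in> space N. u < G x} * indicator {0..<1} u"
        by (simp add: sp)
    qed
    finally show ?thesis .
  qed
  have set: "{x \<in> space N. u < G x} \<in> sets N" for u
    using unit_valuedD(1)[OF G] by measurable
  interpret M: prob_space M using M by (simp add: space_prob_algebra)
  interpret M': prob_space M' using M' by (simp add: space_prob_algebra)
  have "(\<integral>\<^sup>+x. G x \<partial>M) \<le> (\<integral>\<^sup>+u. (emeasure M' {x \<in> space N. u < G x} + ennreal c) * indicator {0..<1} u \<partial>lborel)"
    unfolding layer[OF M]
    by (intro nn_integral_mono mult_right_mono)
       (use le[OF set] c in \<open>auto simp: M.emeasure_eq_measure M'.emeasure_eq_measure simp flip: ennreal_plus intro!: ennreal_leI\<close>)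
  also have "\<dots> = (\<integral>\<^sup>+u. emeasure M' {x \<in> space N. u < G x} * indicator {0..<1} u + ennreal c * indicator {0..<1} u \<partial>lborel)"
    by (simp add: distrib_right)
  also have "\<dots> = (\<integral>\<^sup>+u. emeasure M' {x \<in> space N. u < G x} * indicator {0..<1} u \<partial>lborel)
      + (\<integral>\<^sup>+u. ennreal c * indicator {0..<1::real} u \<partial>lborel)"
  proof (rule nn_integral_add)
    \<comment> \<open>Monotonicity in \<open>u\<close> yields the measurability that splitting the
      integral requires.\<close>
    have "antimono (\<lambda>u. measure M' {x \<in> space N. u < G x})"
      by (intro antimonoI M'.finite_measure_mono) (use set M' in \<open>auto simp: space_prob_algebra\<close>)
    then have "mono (\<lambda>u. - measure M' {x \<in> space N. u < G x})" by (auto simp: mono_def antimono_def)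
    from borel_measurable_mono[OF this] have "(\<lambda>u. - (- measure M' {x \<in> space N. u < G x})) \<in> borel_measurable borel"
      by (rule borel_measurable_uminus)
    then have "(\<lambda>u. measure M' {x \<in> space N. u < G x}) \<in> borel_measurable borel" by simp
    then show "(\<lambda>u. emeasure M' {x \<in> space N. u < G x} * indicator {0..<1} u) \<in> borel_measurable lborel"
      by (simp add: M'.emeasure_eq_measure)
  qed simp
  also have "(\<integral>\<^sup>+u. ennreal c * indicator {0..<1::real} u \<partial>lborel) = ennreal c"
    by (subst nn_integral_cmult_indicator) auto
  finally have "(\<integral>\<^sup>+x. G x \<partial>M) \<le> (\<integral>\<^sup>+x. G x \<partial>M') + ennreal c" by (simp add: layer[OF M'])
  then show ?thesis
    using unit_valued_integral(2)[OF M' G] c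
    by (simp add: unit_valued_integral(4)[OF M G, symmetric] unit_valued_integral(4)[OF M' G, symmetric] flip: ennreal_plus)
qed

lemma sample_law_density:
  fixes P :: "('d::finite) obs measure"
  assumes P: "P \<in> space (prob_algebra obs_space)" and P': "density P (\<lambda>x. ennreal (R x)) \<in> space (prob_algebra obs_space)"
    and R: "R \<in> borel_measurable obs_space" "\<And>x. x \<in> space obs_space \<Longrightarrow> 0 \<le> R x"
  shows "sample_law n (density P (\<lambda>x. ennreal (R x))) = density (sample_law n P) (\<lambda>z. ennreal (\<Prod>i<n. R (z i)))"
proof -
  define P' where "P' = density P (\<lambda>x. ennreal (R x))"
  interpret P: prob_space P using obs_law_facts(1)[OF P] .
  interpret P': prob_space P' using obs_law_facts(1)[OF P'] by (simp add: P'_def)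
  have sP: "sets P = sets obs_space" by (rule obs_law_facts(2)[OF P])
  have spP: "space P = space obs_space" by (rule sets_eq_imp_space_eq[OF sP])
  have Rm[measurable]: "R \<in> borel_measurable P"
    by (subst measurable_cong_sets[OF sP refl]) (rule R(1))
  interpret PP: product_sigma_finite "\<lambda>_. P" ..
  interpret PP': product_sigma_finite "\<lambda>_. P'" ..
  define D where "D = density (PiM {..<n} (\<lambda>_. P)) (\<lambda>z. ennreal (\<Prod>i<n. R (z i)))"
  have Dm[measurable]: "(\<lambda>z. ennreal (\<Prod>i<n. R (z i))) \<in> borel_measurable (PiM {..<n} (\<lambda>_. P))"
    by measurable
  have "D = PiM {..<n} (\<lambda>_. P')"
  proof (rule PP'.PiM_eqI)
    show "sets D = sets (PiM {..<n} (\<lambda>_. P'))" by (simp add: D_def P'_def cong: sets_PiM_cong)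
    fix A assume "\<And>i. i \<in> {..<n} \<Longrightarrow> A i \<in> sets P'"
    then have A: "\<And>i. i < n \<Longrightarrow> A i \<in> sets P" by (simp add: P'_def)
    have Am: "(\<lambda>x. ennreal (R x) * indicator (A i) x) \<in> borel_measurable P" if "i \<in> {..<n}" for i
      using A[of i] that by simp
    have "emeasure D (Pi\<^sub>E {..<n} A) = (\<integral>\<^sup>+z. ennreal (\<Prod>i<n. R (z i)) * indicator (Pi\<^sub>E {..<n} A) z \<partial>PiM {..<n} (\<lambda>_. P))"
      unfolding D_def by (rule emeasure_density[OF Dm]) (use A in \<open>auto intro!: sets_PiM_I_finite\<close>)
    also have "\<dots> = (\<integral>\<^sup>+z. (\<Prod>i\<in>{..<n}. ennreal (R (z i)) * indicator (A i) (z i)) \<partial>PiM {..<n} (\<lambda>_. P))"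
    proof (rule nn_integral_cong)
      fix z assume z: "z \<in> space (PiM {..<n} (\<lambda>_. P))"
      then have "\<And>i. i < n \<Longrightarrow> 0 \<le> R (z i)" by (auto simp: space_PiM PiE_iff spP intro!: R(2)) 
      then have "ennreal (\<Prod>i<n. R (z i)) = (\<Prod>i<n. ennreal (R (z i)))" by (subst prod_ennreal) auto
      moreover have "indicator (Pi\<^sub>E {..<n} A) z = (\<Prod>i<n. indicator (A i) (z i) :: ennreal)"
      proof (cases "z \<in> Pi\<^sub>E {..<n} A")
        case True
        then show ?thesis by (simp add: PiE_iff)
      next
        case False
        then obtain i where "i < n" "z i \<notin> A i" using z by (auto simp: space_PiM PiE_iff)
        then show ?thesis using False by (auto intro!: prod_zero[symmetric] simp: bexI[of _ i])
      qed
      ultimately show "ennreal (\<Prod>i<n. R (z i)) * indicator (Pi\<^sub>E {..<n} A) z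
         = (\<Prod>i\<in>{..<n}. ennreal (R (z i)) * indicator (A i) (z i))"
        by (simp add: prod.distrib)
    qed
    also have "\<dots> = (\<Prod>i\<in>{..<n}. \<integral>\<^sup>+x. ennreal (R x) * indicator (A i) x \<partial>P)"
      by (rule PP.product_nn_integral_prod) (use Am in auto)
    also have "\<dots> = (\<Prod>i\<in>{..<n}. emeasure P' (A i))"
      by (intro prod.cong refl) (use A in \<open>auto simp: P'_def emeasure_density\<close>)
    finally show "emeasure D (Pi\<^sub>E {..<n} A) = (\<Prod>i\<in>{..<n}. emeasure P' (A i))" .
  qed simp
  then show ?thesis by (simp add: sample_law_def D_def P'_def)
qed

context
  fixes P :: "('d::finite) obs measure" and R :: "'d obs \<Rightarrow> real"
  assumes P: "P \<in> space (prob_algebra obs_space)" and P': "density P (\<lambda>x. ennreal (R x)) \<in> space (prob_algebra obs_space)"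
    and R: "R \<in> borel_measurable obs_space" "\<And>x. x \<in> space obs_space \<Longrightarrow> 0 \<le> R x" "\<And>x. x \<in> space obs_space \<Longrightarrow> R x \<le> 3"
begin

text \<open>The bound 3 is the largest likelihood ratio when both regression functions take values
  in [1/4, 3/4].\<close>

lemma density_obs_basics:
  shows "R \<in> borel_measurable P" "AE x in P. 0 \<le> R x" "integrable P R" "integrable P (\<lambda>x. R x ^ 2)"
    "(\<integral>x. R x \<partial>P) = 1"
    "integrable P (\<lambda>x. \<bar>R x - 1\<bar>)"
proof -
  interpret P: prob_space P using obs_law_facts(1)[OF P] .
  interpret P': prob_space "density P (\<lambda>x. ennreal (R x))" using obs_law_facts(1)[OF P'] .
  have sP: "sets P = sets obs_space" by (rule obs_law_facts(2)[OF P])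
  have spP: "space P = space obs_space" by (rule sets_eq_imp_space_eq[OF sP])
  show Rm[measurable]: "R \<in> borel_measurable P"
    by (subst measurable_cong_sets[OF sP refl]) (rule R(1))
  show AE0: "AE x in P. 0 \<le> R x" using R(2) by (intro AE_I2) (simp add: spP del: space_obs_space)
  have b: "0 \<le> R x" "R x \<le> 3" if "x \<in> space P" for x using R(2,3) that spP by auto
  have AEb: "AE x in P. norm (R x) \<le> 3" using b by (intro AE_I2) (simp add: abs_le_iff order_trans[of _ 0])
  show int: "integrable P R"
    by (rule P.integrable_const_bound[OF AEb]) simp
  have "\<bar>R x ^ 2\<bar> \<le> 9" if "x \<in> space P" for x
    using b[OF that] power_mono[of "R x" 3 2] by simp
  then show "integrable P (\<lambda>x. R x ^ 2)"
    by (intro P.integrable_const_bound[of _ 9]) (auto intro!: AE_I2)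
  show "integrable P (\<lambda>x. \<bar>R x - 1\<bar>)" using int by (intro integrable_abs Bochner_Integration.integrable_diff) auto
  have "(\<integral>x. (1::real) \<partial>density P (\<lambda>x. ennreal (R x))) = (\<integral>x. R x *\<^sub>R 1 \<partial>P)"
    by (rule integral_density) (use AE0 in auto)
  then show "(\<integral>x. R x \<partial>P) = 1" using P'.prob_space by simp
qed

text \<open>Since R - 1 has mean zero, a constant may be subtracted from \<open>G\<close>. Only its
  oscillation then counts, and the effects of privacy and of closeness of the laws multiply.\<close>

lemma density_osc_step:
  assumes a: "(\<integral>x. \<bar>R x - 1\<bar> \<partial>P) \<le> a" and \<omega>: "0 \<le> \<omega>"
    and G: "unit_valued obs_space G"
    and osc: "\<And>x y. x \<in> space obs_space \<Longrightarrow> y \<in> space obs_space \<Longrightarrow> \<bar>G x - G y\<bar> \<le> \<omega>"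
  shows "\<bar>(\<integral>x. G x \<partial>P) - (\<integral>x. G x \<partial>density P (\<lambda>x. ennreal (R x)))\<bar> \<le> \<omega> * a"
proof -
  interpret P: prob_space P using obs_law_facts(1)[OF P] .
  have sP: "sets P = sets obs_space" by (rule obs_law_facts(2)[OF P])
  have spP: "space P = space obs_space" by (rule sets_eq_imp_space_eq[OF sP])
  obtain x0 :: "'d obs" where x0: "x0 \<in> space obs_space" using P.not_empty unfolding spP by (meson ex_in_conv)
  note Rb = density_obs_basics
  note [measurable] = Rb(1)
  have Gm[measurable]: "G \<in> borel_measurable P"
    by (subst measurable_cong_sets[OF sP refl]) (rule unit_valuedD(1)[OF G])
  have Gi: "integrable P G" by (rule unit_valued_integral(1)[OF P G])
  have "(\<integral>x. G x \<partial>density P (\<lambda>x. ennreal (R x))) = (\<integral>x. R x * G x \<partial>P)"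
    by (subst integral_density) (use Rb(2) in auto)
  moreover have RG: "integrable P (\<lambda>x. R x * G x)"
  proof (rule Bochner_Integration.integrable_bound[OF Rb(3)])
    have "\<bar>R x * G x\<bar> \<le> \<bar>R x\<bar>" if "x \<in> space P" for x
      using unit_valuedD(2,3)[OF G, of x] that mult_left_le[of "G x" "\<bar>R x\<bar>"] by (simp add: abs_mult spP)
    then show "AE x in P. norm (R x * G x) \<le> norm (R x)" by (intro AE_I2) auto
  qed simp
  moreover have "(\<integral>x. G x \<partial>P) - (\<integral>x. R x * G x \<partial>P) = (\<integral>x. (1 - R x) * (G x - G x0) \<partial>P)"
  proof -
    have "(\<integral>x. (1 - R x) * (G x - G x0) \<partial>P) = (\<integral>x. (G x - R x * G x) - (G x0 - G x0 * R x) \<partial>P)"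
      by (intro Bochner_Integration.integral_cong) (auto simp: algebra_simps)
    also have "\<dots> = ((\<integral>x. G x \<partial>P) - (\<integral>x. R x * G x \<partial>P)) - (G x0 - G x0 * (\<integral>x. R x \<partial>P))"
      using Gi RG Rb(3) by (simp add: Bochner_Integration.integral_diff P.prob_space)
    finally show ?thesis by (simp add: Rb(5))
  qed
  moreover have "\<bar>\<integral>x. (1 - R x) * (G x - G x0) \<partial>P\<bar> \<le> (\<integral>x. \<omega> * \<bar>R x - 1\<bar> \<partial>P)"
  proof (rule order_trans[OF integral_abs_bound], rule integral_mono_AE')
    show "integrable P (\<lambda>x. \<omega> * \<bar>R x - 1\<bar>)" using Rb(6) by simp
    have "\<bar>(1 - R x) * (G x - G x0)\<bar> \<le> \<omega> * \<bar>R x - 1\<bar>" if "x \<in> space P" for x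
      using mult_left_mono[OF osc[of x x0], of "\<bar>1 - R x\<bar>"] that x0
      by (simp add: abs_mult spP mult.commute abs_minus_commute del: space_obs_space)
    then show "AE x in P. \<bar>(1 - R x) * (G x - G x0)\<bar> \<le> \<omega> * \<bar>R x - 1\<bar>" by (intro AE_I2)
  qed (use \<omega> in auto)
  moreover have "(\<integral>x. \<omega> * \<bar>R x - 1\<bar> \<partial>P) \<le> \<omega> * a" using a \<omega> by (simp add: mult_left_mono)
  ultimately show ?thesis by simp
qed

text \<open>Exchanging the observations one at a time changes one datum per step, so adjacency
  bounds the oscillation in each coordinate and the costs of the n steps add up.\<close>

lemma sample_law_osc_step:
  assumes a: "(\<integral>x. \<bar>R x - 1\<bar> \<partial>P) \<le> a" and \<omega>: "0 \<le> \<omega>"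
    and F: "unit_valued (sample_space n) F"
    and osc: "\<And>z z'. z \<in> space (sample_space n) \<Longrightarrow> z' \<in> space (sample_space n) \<Longrightarrow> adjacent n z z' \<Longrightarrow> \<bar>F z - F z'\<bar> \<le> \<omega>"
  shows "\<bar>(\<integral>z. F z \<partial>sample_law n P) - (\<integral>z. F z \<partial>sample_law n (density P (\<lambda>x. ennreal (R x))))\<bar> \<le> real n * (\<omega> * a)"
proof -
  have "\<bar>(\<integral>z. F z \<partial>PiM {..<n} (\<lambda>_. P)) - (\<integral>z. F z \<partial>PiM {..<n} (\<lambda>_. density P (\<lambda>x. ennreal (R x))))\<bar> \<le> (\<Sum>i\<in>{..<n}. \<omega> * a)"
  proof (rule hybrid_PiM[where N = "\<lambda>_. obs_space" and \<omega> = \<omega>])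
    show "unit_valued (PiM {..<n} (\<lambda>_. obs_space)) F" using F by (simp add: sample_space_def)
    fix i z x assume i: "i \<in> {..<n}" and z: "z \<in> space (PiM {..<n} (\<lambda>_. obs_space :: 'd obs measure))" and x: "x \<in> space (obs_space :: 'd obs measure)"
    show "\<bar>F (z(i := x)) - F z\<bar> \<le> \<omega>"
    proof (rule osc)
      show "z \<in> space (sample_space n)" using z by (simp add: sample_space_def)
      show "z(i := x) \<in> space (sample_space n)"
        using z x i by (auto simp: sample_space_def space_PiM PiE_iff extensional_def)
      show "adjacent n (z(i := x)) z" using i by (auto simp: adjacent_def)
    qed
  next
    fix i G assume "unit_valued (obs_space :: 'd obs measure) G"
      "\<And>x y. x \<in> space (obs_space :: 'd obs measure) \<Longrightarrow> y \<in> space (obs_space :: 'd obs measure) \<Longrightarrow> \<bar>G x - G y\<bar> \<le> \<omega>"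
    then show "\<bar>(\<integral>x. G x \<partial>P) - (\<integral>x. G x \<partial>density P (\<lambda>x. ennreal (R x)))\<bar> \<le> \<omega> * a"
      by (rule density_osc_step[OF a \<omega>])
  qed (use P P' in auto)
  then show ?thesis by (simp add: sample_law_def)
qed

text \<open>Second moments of likelihood ratios multiply over independent observations, so the
  chi-square distance of the samples is at most exp (n c) - 1, hence at most 2 n c and s^2. This is
  of better order than n separate steps when privacy does not help.\<close>

lemma sample_law_chi_step:
  assumes c: "(\<integral>x. R x ^ 2 \<partial>P) \<le> 1 + c" and s: "0 < s" "s \<le> 1" "0 \<le> c" "2 * (real n * c) \<le> s ^ 2"
    and F: "unit_valued (sample_space n) F"
  shows "\<bar>(\<integral>z. F z \<partial>sample_law n P) - (\<integral>z. F z \<partial>sample_law n (density P (\<lambda>x. ennreal (R x))))\<bar> \<le> s"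
proof -
  define S where "S = sample_law n P"
  have S: "S \<in> space (prob_algebra (sample_space n))" unfolding S_def by (rule sample_law_prob_algebra[OF P])
  then have sS: "sets S = sets (sample_space n)" and pS: "prob_space S" by (auto simp: space_prob_algebra)
  interpret S: prob_space S by fact
  have spS: "space S = space (sample_space n)" by (rule sets_eq_imp_space_eq[OF sS])
  define W where "W z = (\<Prod>i<n. R (z i))" for z
  note Rb = density_obs_basics
  have WS: "sample_law n (density P (\<lambda>x. ennreal (R x))) = density S (\<lambda>z. ennreal (W z))"
    unfolding S_def W_def by (rule sample_law_density[OF P P' R(1,2)])
  have Wi: "integrable S W" "(\<integral>z. W z \<partial>S) = 1"
    unfolding W_def[abs_def] S_def using integral_prod_sample_law[OF P Rb(3)] Rb(5) by auto
  have W2i: "integrable S (\<lambda>z. W z ^ 2)" "(\<integral>z. W z ^ 2 \<partial>S) = (\<integral>x. R x ^ 2 \<partial>P) ^ n"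
    unfolding W_def[abs_def] S_def using integral_prod_sample_law[OF P Rb(4)] by (auto simp: prod_power_distrib)
  have Fi: "integrable S F" by (rule unit_valued_integral(1)[OF S F])
  have [measurable]: "F \<in> borel_measurable S" "W \<in> borel_measurable S" using Fi Wi by auto
  have AEW: "AE z in S. 0 \<le> W z"
  proof (rule AE_I2)
    fix z assume "z \<in> space S"
    then have "\<And>i. i < n \<Longrightarrow> z i \<in> space obs_space"
      unfolding spS sample_space_def by (auto simp: space_PiM PiE_iff simp del: space_obs_space)
    then show "0 \<le> W z" unfolding W_def by (intro prod_nonneg) (use R(2) in auto)
  qed
  have FW: "integrable S (\<lambda>z. W z * F z)"
  proof (rule Bochner_Integration.integrable_bound[OF Wi(1)])
    have "\<bar>W x * F x\<bar> \<le> \<bar>W x\<bar>" if "x \<in> space S" for x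
      using unit_valuedD(2,3)[OF F, of x] that mult_left_le[of "F x" "\<bar>W x\<bar>"] by (simp add: abs_mult spS)
    then show "AE x in S. norm (W x * F x) \<le> norm (W x)" by (intro AE_I2) auto
  qed simp
  have "\<bar>(\<integral>z. F z \<partial>S) - (\<integral>z. F z \<partial>density S (\<lambda>z. ennreal (W z)))\<bar> = \<bar>(\<integral>z. F z \<partial>S) - (\<integral>z. W z * F z \<partial>S)\<bar>"
    by (subst integral_density) (use AEW in auto)
  also have "\<dots> = \<bar>\<integral>z. F z - W z * F z \<partial>S\<bar>"
    by (subst Bochner_Integration.integral_diff[OF Fi FW]) simp
  also have "\<dots> \<le> (\<integral>z. \<bar>F z - W z * F z\<bar> \<partial>S)" by (rule integral_abs_bound)
  \<comment> \<open>The integrand is s / 2 + (W - 1)^2 / (2 s), expanded so that the first and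
    second moment of \<open>W\<close> can be inserted.\<close>
  also have "\<dots> \<le> (\<integral>z. (s / 2 + 1 / (2 * s)) + (W z ^ 2 / (2 * s) - W z / s) \<partial>S)"
  proof (rule integral_mono)
    show "integrable S (\<lambda>z. \<bar>F z - W z * F z\<bar>)" using Fi FW by (intro integrable_abs Bochner_Integration.integrable_diff)
    show "integrable S (\<lambda>z. (s / 2 + 1 / (2 * s)) + (W z ^ 2 / (2 * s) - W z / s))"
      using Wi(1) W2i(1) by simp
    fix z assume z: "z \<in> space S"
    define w where "w = W z"
    have F0: "0 \<le> F z" "F z \<le> 1" using unit_valuedD(2,3)[OF F, of z] z by (auto simp: spS)
    have "F z - W z * F z = - ((w - 1) * F z)" by (simp add: w_def left_diff_distrib)
    then have "\<bar>F z - W z * F z\<bar> = \<bar>w - 1\<bar> * F z" using F0 by (simp add: abs_mult)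
    also have "\<dots> \<le> \<bar>w - 1\<bar>" using F0 by (intro mult_left_le) auto
    \<comment> \<open>AM-GM, so that the first absolute moment is bounded by the second moment without roots\<close>
    also have "\<dots> \<le> s / 2 + (w - 1)^2 / (2 * s)"
    proof -
      have "0 \<le> (s - \<bar>w - 1\<bar>)^2" by simp
      then have "2 * s * \<bar>w - 1\<bar> \<le> s^2 + (w - 1)^2" by (simp add: power2_diff)
      then have "\<bar>w - 1\<bar> \<le> (s^2 + (w - 1)^2) / (2 * s)" using s(1) by (simp add: field_simps)
      also have "\<dots> = s / 2 + (w - 1)^2 / (2 * s)" using s(1) by (simp add: power2_eq_square field_simps)
      finally show ?thesis .
    qed
    also have "\<dots> = (s / 2 + 1 / (2 * s)) + (w ^ 2 / (2 * s) - w / s)"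
      using s(1) by (simp add: power2_eq_square field_simps)
    finally show "\<bar>F z - W z * F z\<bar> \<le> (s / 2 + 1 / (2 * s)) + (W z ^ 2 / (2 * s) - W z / s)" by (simp add: w_def)
  qed
  also have "\<dots> = s / 2 + ((\<integral>x. R x ^ 2 \<partial>P) ^ n - 1) / (2 * s)"
  proof -
    have "(\<integral>z. (s / 2 + 1 / (2 * s)) + (W z ^ 2 / (2 * s) - W z / s) \<partial>S)
      = (s / 2 + 1 / (2 * s)) + ((\<integral>z. W z ^ 2 \<partial>S) / (2 * s) - (\<integral>z. W z \<partial>S) / s)"
      using Wi(1) W2i(1) by (simp add: S.prob_space)
    also have "\<dots> = s / 2 + ((\<integral>x. R x ^ 2 \<partial>P) ^ n - 1) / (2 * s)"
      unfolding W2i(2) Wi(2) using s(1) by (simp add: field_simps)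
    finally show ?thesis .
  qed
  also have "\<dots> \<le> s / 2 + s^2 / (2 * s)"
  proof -
    define y where "y = real n * c"
    have y: "0 \<le> y" "y \<le> 1" using s power_le_one[of s 2] by (auto simp: y_def)
    have "(\<integral>x. R x ^ 2 \<partial>P) ^ n \<le> (1 + c) ^ n"
      using c by (intro power_mono) auto
    also have "\<dots> \<le> exp c ^ n" using s by (intro power_mono exp_ge_add_one_self) auto
    also have "\<dots> = exp y" by (simp add: y_def exp_of_nat_mult)
    also have "\<dots> \<le> 1 + y + y^2" by (rule exp_bound[OF y])
    also have "\<dots> \<le> 1 + 2 * y" using y by (simp add: power2_eq_square mult_left_le)
    also have "\<dots> \<le> 1 + s^2" using s(4) by (simp add: y_def)
    finally show ?thesis using s(1) by (intro add_left_mono divide_right_mono) auto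
  qed
  also have "\<dots> = s" using s(1) by (simp add: power2_eq_square)
  finally show ?thesis unfolding WS S_def .
qed

end

text \<open>For \<open>\<epsilon> > 1\<close> the bound is trivial. It is additive, so it can be summed over the observations
  that are exchanged, without the exponential loss of group privacy.\<close>
lemma diff_private_measure_le:
  assumes "diff_private \<epsilon> \<delta> n K S" "0 < \<epsilon>" "0 < \<delta>"
    and K: "\<And>z. z \<in> space (sample_space n) \<Longrightarrow> K z \<in> space (prob_algebra S)"
    and z: "z \<in> space (sample_space n)" "z' \<in> space (sample_space n)" "adjacent n z z'" and A: "A \<in> sets S"
  shows "measure (K z) A \<le> measure (K z') A + (2 * \<epsilon> + \<delta>)"
proof -
  interpret z: prob_space "K z" using K[OF z(1)] by (simp add: space_prob_algebra)
  interpret z': prob_space "K z'" using K[OF z(2)] by (simp add: space_prob_algebra)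
  show ?thesis
  proof (cases "\<epsilon> \<le> 1")
    case True
    have "exp \<epsilon> \<le> 1 + \<epsilon> + \<epsilon>^2" by (rule exp_bound) (use assms True in auto)
    also have "\<dots> \<le> 1 + 2 * \<epsilon>" using True assms by (simp add: power2_eq_square mult_left_le)
    finally have e: "exp \<epsilon> \<le> 1 + 2 * \<epsilon>" .
    have "measure (K z) A \<le> exp \<epsilon> * measure (K z') A + \<delta>"
      using assms(1) z A unfolding diff_private_def by blast
    also have "exp \<epsilon> * measure (K z') A \<le> (1 + 2 * \<epsilon>) * measure (K z') A" using e by (rule mult_right_mono) simp
    also have "\<dots> = measure (K z') A + 2 * \<epsilon> * measure (K z') A" by (simp add: distrib_right)
    also have "2 * \<epsilon> * measure (K z') A \<le> 2 * \<epsilon>" using assms by simp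
    finally show ?thesis by simp
  next
    case False
    have "measure (K z) A \<le> 1" by simp
    also have "\<dots> \<le> 0 + (2 * \<epsilon> + \<delta>)" using False assms by simp
    also have "\<dots> \<le> measure (K z') A + (2 * \<epsilon> + \<delta>)" by (intro add_right_mono) simp
    finally show ?thesis .
  qed
qed

lemma adjacent_sym: "adjacent n z z' \<longleftrightarrow> adjacent n z' z"
  unfolding adjacent_def by (metis (no_types))

context
  fixes m :: nat and n :: "nat \<Rightarrow> nat" and \<epsilon> \<delta> :: "nat \<Rightarrow> real" and p :: "('d::finite, 't) protocol"
  assumes p: "p \<in> private_protocols m n \<epsilon> \<delta>"
begin

text \<open>Seen from one server, the rest of the protocol is a test function of its transcript. The
  oscillation in the sample of that server is then at most 2 \<epsilon> + \<delta>: for a source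
  because post-processing preserves privacy, for the target because its privacy holds for each fixed
  value of the source transcripts.\<close>

lemma protocol_hybrid:
  fixes b :: "nat \<Rightarrow> real"
  assumes \<epsilon>\<delta>: "\<And>j. j \<le> m \<Longrightarrow> 0 < \<epsilon> j" "\<And>j. j \<le> m \<Longrightarrow> 0 < \<delta> j"
    and P: "\<And>j. j \<le> m \<Longrightarrow> P j \<in> space (prob_algebra obs_space)"
    and P': "\<And>j. j \<le> m \<Longrightarrow> P' j \<in> space (prob_algebra obs_space)"
    and step: "\<And>j F. j \<le> m \<Longrightarrow> unit_valued (sample_space (n j)) F \<Longrightarrow>
       (\<And>z z'. z \<in> space (sample_space (n j)) \<Longrightarrow> z' \<in> space (sample_space (n j)) \<Longrightarrow> adjacent (n j) z z' \<Longrightarrow>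
          \<bar>F z - F z'\<bar> \<le> 2 * \<epsilon> j + \<delta> j) \<Longrightarrow>
       \<bar>(\<integral>z. F z \<partial>sample_law (n j) (P j)) - (\<integral>z. F z \<partial>sample_law (n j) (P' j))\<bar> \<le> b j"
    and B: "B \<in> sets (fin_space p)"
  shows "\<bar>measure (final_law m n p P) B - measure (final_law m n p P') B\<bar> \<le> (\<Sum>j\<le>m. b j)"
proof -
  define g where "g x = measure (fin_kernel p x) B" for x
  define S where "S = sample_law (n 0) (P 0)"
  define S' where "S' = sample_law (n 0) (P' 0)"
  define T where "T = PiM {1..m} (transcript_law n p P)"
  define T' where "T' = PiM {1..m} (transcript_law n p P')"
  define N0 where "N0 = (sample_space (n 0) :: (nat \<Rightarrow> 'd obs) measure)"
  define NT where "NT = PiM {1..m} (src_space p)"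
  have S: "S \<in> space (prob_algebra N0)" "S' \<in> space (prob_algebra N0)"
    unfolding S_def S'_def N0_def by (rule sample_law_prob_algebra, rule P, simp, rule sample_law_prob_algebra, rule P', simp)
  have Tj: "transcript_law n p P j \<in> space (prob_algebra (src_space p j))"
    "transcript_law n p P' j \<in> space (prob_algebra (src_space p j))" if "j \<in> {1..m}" for j
    by (rule transcript_law_prob_algebra[OF p _ that], rule P, assumption, rule transcript_law_prob_algebra[OF p _ that], rule P')
  have T: "T \<in> space (prob_algebra NT)" "T' \<in> space (prob_algebra NT)"
    unfolding T_def T'_def NT_def by (rule PiM_in_prob_algebra, rule Tj, assumption, rule PiM_in_prob_algebra, rule Tj)
  have g: "unit_valued (N0 \<Otimes>\<^sub>M NT) g"
    unfolding g_def[abs_def] N0_def NT_def by (rule fin_kernel_unit_valued[OF p B])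
  have ker: "fin_kernel p \<in> N0 \<Otimes>\<^sub>M NT \<rightarrow>\<^sub>M prob_algebra (fin_space p)"
    using p by (simp add: private_protocols_def N0_def NT_def)
  have f1: "unit_valued N0 (\<lambda>z. \<integral>t. g (z, t) \<partial>T)" and f2: "unit_valued N0 (\<lambda>z. \<integral>t. g (z, t) \<partial>T')"
    by (rule unit_valued_pair(1)[OF T(1) g], rule unit_valued_pair(1)[OF T(2) g])
  have target: "\<bar>(\<integral>z. (\<integral>t. g (z, t) \<partial>T) \<partial>S) - (\<integral>z. (\<integral>t. g (z, t) \<partial>T) \<partial>S')\<bar> \<le> b 0"
    unfolding S_def S'_def
  proof (rule step)
    show "unit_valued (sample_space (n 0)) (\<lambda>z. \<integral>t. g (z, t) \<partial>T)" using f1 by (simp add: N0_def)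
    fix z z' :: "nat \<Rightarrow> 'd obs"
    assume z: "z \<in> space (sample_space (n 0))" "z' \<in> space (sample_space (n 0))" "adjacent (n 0) z z'"
    show "\<bar>(\<integral>t. g (z, t) \<partial>T) - (\<integral>t. g (z', t) \<partial>T)\<bar> \<le> 2 * \<epsilon> 0 + \<delta> 0"
    proof (rule abs_integral_diff_le[OF T(1)])
      show "integrable T (\<lambda>t. g (z, t))" "integrable T (\<lambda>t. g (z', t))"
        by (rule unit_valued_integral(1)[OF T(1) unit_valued_pair(2)[OF T(1) g]]; use z in \<open>simp add: N0_def\<close>)+
      fix t assume t: "t \<in> space NT"
      have dp: "diff_private (\<epsilon> 0) (\<delta> 0) (n 0) (\<lambda>z. fin_kernel p (z, t)) (fin_space p)"
        using p t by (simp add: private_protocols_def NT_def)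
      have K: "fin_kernel p (y, t) \<in> space (prob_algebra (fin_space p))" if "y \<in> space (sample_space (n 0))" for y
        by (rule measurable_space[OF ker]) (use that t in \<open>simp add: space_pair_measure N0_def\<close>)
      have "g (y, t) \<le> g (y', t) + (2 * \<epsilon> 0 + \<delta> 0)"
        if "y \<in> space (sample_space (n 0))" "y' \<in> space (sample_space (n 0))" "adjacent (n 0) y y'" for y y'
        unfolding g_def by (rule diff_private_measure_le[OF dp _ _ K that B]) (use \<epsilon>\<delta> in auto)
      from this[OF z] this[OF z(2,1)] z(3) show "\<bar>g (z, t) - g (z', t)\<bar> \<le> 2 * \<epsilon> 0 + \<delta> 0"
        by (simp add: adjacent_sym[of _ z'] abs_le_iff)
    qed
  qed simp
  have sources: "\<bar>(\<integral>t. F t \<partial>T) - (\<integral>t. F t \<partial>T')\<bar> \<le> (\<Sum>j\<in>{1..m}. b j)" if F: "unit_valued NT F" for F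
  proof -
    \<comment> \<open>\<open>hybrid_PiM\<close> asks for a probability law at every index; outside
      of \<open>{1..m}\<close> a point mass stands in.\<close>
    define M where "M i = (if i \<in> {1..m} then transcript_law n p P i else return (count_space UNIV) undefined)" for i
    define M' where "M' i = (if i \<in> {1..m} then transcript_law n p P' i else return (count_space UNIV) undefined)" for i
    define N where "N i = (if i \<in> {1..m} then src_space p i else count_space UNIV)" for i
    have eqs: "T = PiM {1..m} M" "T' = PiM {1..m} M'" "NT = PiM {1..m} N"
      unfolding T_def T'_def NT_def by (rule PiM_cong; simp add: M_def M'_def N_def)+
    have "\<bar>(\<integral>t. F t \<partial>PiM {1..m} M) - (\<integral>t. F t \<partial>PiM {1..m} M')\<bar> \<le> (\<Sum>j\<in>{1..m}. b j)"
    proof (rule hybrid_PiM[where N = N and \<omega> = 1])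
      show "M i \<in> space (prob_algebra (N i))" "M' i \<in> space (prob_algebra (N i))" for i
        using Tj[of i] by (auto simp: M_def M'_def N_def space_prob_algebra prob_space_return)
      show Fu: "unit_valued (PiM {1..m} N) F" using F eqs by simp
      fix i z x assume i: "i \<in> {1..m}" and z: "z \<in> space (PiM {1..m} N)" and x: "x \<in> space (N i)"
      have "z(i := x) \<in> space (PiM {1..m} N)" using z x i by (auto simp: space_PiM PiE_iff extensional_def)
      then show "\<bar>F (z(i := x)) - F z\<bar> \<le> 1"
        using unit_valuedD(2,3)[OF Fu z] unit_valuedD(2,3)[OF Fu] by (smt (verit))
    next
      fix i G assume i: "i \<in> {1..m}" and "unit_valued (N i) G"
      then have G: "unit_valued (src_space p i) G" by (simp add: N_def)
      have K: "src_kernel p i \<in> sample_space (n i) \<rightarrow>\<^sub>M prob_algebra (src_space p i)"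
        and dp: "diff_private (\<epsilon> i) (\<delta> i) (n i) (src_kernel p i) (src_space p i)"
        using p i by (simp_all add: private_protocols_def)
      have i': "i \<le> m" using i by simp
      have tl: "(\<integral>t. G t \<partial>transcript_law n p Q i) = (\<integral>z. (\<integral>t. G t \<partial>src_kernel p i z) \<partial>sample_law (n i) (Q i))"
        if "Q i \<in> space (prob_algebra obs_space)" for Q
        unfolding transcript_law_def by (rule integral_bind_unit_valued[OF sample_law_prob_algebra[OF that] K G])
      have "\<bar>(\<integral>z. (\<integral>t. G t \<partial>src_kernel p i z) \<partial>sample_law (n i) (P i)) - (\<integral>z. (\<integral>t. G t \<partial>src_kernel p i z) \<partial>sample_law (n i) (P' i))\<bar> \<le> b i"
      proof (rule step[OF i' unit_valued_kernel[OF K G]])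
        fix z z' :: "nat \<Rightarrow> 'd obs"
        assume z: "z \<in> space (sample_space (n i))" "z' \<in> space (sample_space (n i))" "adjacent (n i) z z'"
        have le: "(\<integral>t. G t \<partial>src_kernel p i y) \<le> (\<integral>t. G t \<partial>src_kernel p i y') + (2 * \<epsilon> i + \<delta> i)"
          if "y \<in> space (sample_space (n i))" "y' \<in> space (sample_space (n i))" "adjacent (n i) y y'" for y y'
        proof (rule integral_le_of_measure_le[OF measurable_space[OF K that(1)] measurable_space[OF K that(2)] _ G])
          fix A assume A: "A \<in> sets (src_space p i)"
          show "measure (src_kernel p i y) A \<le> measure (src_kernel p i y') A + (2 * \<epsilon> i + \<delta> i)"
            by (rule diff_private_measure_le[OF dp \<epsilon>\<delta>(1)[OF i'] \<epsilon>\<delta>(2)[OF i'] measurable_space[OF K] that A])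
        qed
        have "adjacent (n i) z' z" using z(3) by (simp add: adjacent_sym)
        from le[OF z] le[OF z(2,1) this]
        show "\<bar>(\<integral>t. G t \<partial>src_kernel p i z) - (\<integral>t. G t \<partial>src_kernel p i z')\<bar> \<le> 2 * \<epsilon> i + \<delta> i"
          by (simp add: abs_le_iff)
      qed
      then show "\<bar>(\<integral>x. G x \<partial>M i) - (\<integral>x. G x \<partial>M' i)\<bar> \<le> b i"
        using i tl[of P, OF P[OF i']] tl[of P', OF P'[OF i']] by (simp add: M_def M'_def)
    qed simp
    then show ?thesis by (simp add: eqs)
  qed
  have src: "\<bar>(\<integral>z. (\<integral>t. g (z, t) \<partial>T) \<partial>S') - (\<integral>z. (\<integral>t. g (z, t) \<partial>T') \<partial>S')\<bar> \<le> (\<Sum>j\<in>{1..m}. b j)"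
    by (rule abs_integral_diff_le[OF S(2) unit_valued_integral(1)[OF S(2) f1] unit_valued_integral(1)[OF S(2) f2]])
       (rule sources[OF unit_valued_pair(2)[OF T(1) g]])
  have "measure (final_law m n p P) B = (\<integral>z. (\<integral>t. g (z, t) \<partial>T) \<partial>S)"
    unfolding g_def T_def S_def by (rule final_law_measure[OF p _ B]) (rule P)
  moreover have "measure (final_law m n p P') B = (\<integral>z. (\<integral>t. g (z, t) \<partial>T') \<partial>S')"
    unfolding g_def T'_def S'_def by (rule final_law_measure[OF p _ B]) (rule P')
  moreover have "(\<Sum>j\<le>m. b j) = b 0 + (\<Sum>j\<in>{1..m}. b j)"
    by (subst atLeast0AtMost[symmetric], subst sum.atLeast_Suc_atMost) auto
  ultimately show ?thesis using target src by linarith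
qed

end


section \<open>Regression functions with bumps\<close>

text \<open>After scaling to a sum of 1 it suffices that y \<le> y^e on [0, 1].\<close>

lemma powr_subadditive:
  fixes a b e :: real
  assumes "0 \<le> a" "0 \<le> b" "0 < e" "e \<le> 1"
  shows "(a + b) powr e \<le> a powr e + b powr e"
proof (cases "a + b = 0")
  case True
  then show ?thesis using assms by (simp add: add_nonneg_eq_0_iff)
next
  case False
  define s where "s = a + b"
  have s: "0 < s" using False assms by (simp add: s_def)
  have le: "y / s \<le> (y / s) powr e" if "0 \<le> y" "y \<le> s" for y
    using powr_mono'[of e 1 "y / s"] that s assms by simp
  have "1 = a / s + b / s" using s by (simp add: s_def flip: add_divide_distrib)
  also have "\<dots> \<le> (a / s) powr e + (b / s) powr e"
    using assms by (intro add_mono le) (auto simp: s_def)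
  finally have "s powr e \<le> s powr e * ((a / s) powr e + (b / s) powr e)"
    using s by (simp add: mult_le_cancel_left1)
  also have "\<dots> = (s * (a / s)) powr e + (s * (b / s)) powr e"
    unfolding powr_mult distrib_left ..
  also have "\<dots> = a powr e + b powr e" using s by simp
  finally show ?thesis by (simp add: s_def)
qed

text \<open>Turns a nonnegative Lipschitz function into a Hoelder continuous one by taking a
  power.\<close>

lemma powr_diff_le:
  fixes a b e :: real
  assumes "0 \<le> a" "0 \<le> b" "0 < e" "e \<le> 1"
  shows "\<bar>a powr e - b powr e\<bar> \<le> \<bar>a - b\<bar> powr e"
proof -
  have *: "x powr e - y powr e \<le> \<bar>x - y\<bar> powr e" if "0 \<le> x" "0 \<le> y" for x y :: real
  proof -
    have "x powr e \<le> (y + \<bar>x - y\<bar>) powr e" by (intro powr_mono2) (use assms that in auto)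
    also have "\<dots> \<le> y powr e + \<bar>x - y\<bar> powr e" by (intro powr_subadditive) (use assms that in auto)
    finally show ?thesis by simp
  qed
  show ?thesis using *[of a b] *[of b a] assms by (simp add: abs_minus_commute abs_le_iff)
qed

text \<open>In this norm the balls are cubes, so a profile measured from the centre of a grid cell
  vanishes on the whole boundary of the cell.\<close>

definition maxnorm :: "real^'d::finite \<Rightarrow> real" where
  "maxnorm x = Max (range (\<lambda>i. \<bar>x $ i\<bar>))"

lemma maxnorm_le_iff: "maxnorm x \<le> a \<longleftrightarrow> (\<forall>i. \<bar>x $ i\<bar> \<le> a)"
  unfolding maxnorm_def by (subst Max_le_iff) auto

lemma component_le_maxnorm: "\<bar>x $ i\<bar> \<le> maxnorm x"
  using maxnorm_le_iff[of x "maxnorm x"] by simp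

lemma maxnorm_lipschitz: "\<bar>maxnorm x - maxnorm y\<bar> \<le> norm (x - y)"
proof -
  have "maxnorm x \<le> maxnorm y + norm (x - y)" for x y :: "real^'d"
    unfolding maxnorm_le_iff
  proof
    fix i
    have "\<bar>x $ i\<bar> \<le> \<bar>y $ i\<bar> + \<bar>(x - y) $ i\<bar>" by simp
    then show "\<bar>x $ i\<bar> \<le> maxnorm y + norm (x - y)"
      using component_le_maxnorm[of y i] component_le_norm_cart[of "x - y" i] by linarith
  qed
  from this[of x y] this[of y x] show ?thesis by (simp add: abs_le_iff norm_minus_commute)
qed

text \<open>The cells \<open>k\<close> with \<open>k i < w\<close> carry a bump each; outside of the cube that they fill the
  regression function grows with the distance from that cube. \<open>None\<close> indexes that outer region.\<close>

definition centre :: "nat \<Rightarrow> ('d \<Rightarrow> nat) \<Rightarrow> real^'d::finite" where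
  "centre q k = (\<chi> i. (real (k i) + 1/2) / real q)"

definition region :: "nat \<Rightarrow> nat \<Rightarrow> real^'d::finite \<Rightarrow> ('d \<Rightarrow> nat) option" where
  "region q w x = (if \<exists>i. real w \<le> real q * x $ i then None else Some (cell q x))"

text \<open>The region is a separate argument, because the Hoelder estimate evaluates the profile of
  one region at points of another.\<close>

definition bump_height :: "nat \<Rightarrow> nat \<Rightarrow> real \<Rightarrow> real \<Rightarrow> ('d \<Rightarrow> nat) option \<Rightarrow> real^'d::finite \<Rightarrow> real" where
  "bump_height q w c \<beta> r x = c * (max 0 (case r of None \<Rightarrow> maxnorm x - real w / real q
     | Some k \<Rightarrow> 1 / (2 * real q) - maxnorm (x - centre q k))) powr \<beta>"

definition region_sign :: "('d \<Rightarrow> nat) set \<Rightarrow> ('d \<Rightarrow> nat) option \<Rightarrow> real" where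
  "region_sign \<sigma> r = (case r of None \<Rightarrow> 1 | Some k \<Rightarrow> if k \<in> \<sigma> then 1 else - 1)"

lemma region_sign_cases: "region_sign \<sigma> r = 1 \<or> region_sign \<sigma> r = - 1"
  by (auto simp: region_sign_def split: option.splits)

lemma abs_region_sign [simp]: "\<bar>region_sign \<sigma> r\<bar> = 1"
  using region_sign_cases[of \<sigma> r] by auto

text \<open>With the constant and exponent of source \<open>j\<close> the transfer condition holds
  with equality, so the sources are as uninformative as the class permits. The target has both equal
  to 1.\<close>

definition bump_regression :: "nat \<Rightarrow> nat \<Rightarrow> real \<Rightarrow> real \<Rightarrow> real \<Rightarrow> real \<Rightarrow> ('d \<Rightarrow> nat) set \<Rightarrow> real^'d::finite \<Rightarrow> real" where
  "bump_regression q w c \<beta> C \<gamma> \<sigma> x =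
     1/2 + region_sign \<sigma> (region q w x) * (C * bump_height q w c \<beta> (region q w x) x powr \<gamma>)"

text \<open>The small cubes have relative side \<theta>. The gap around them keeps the features away
  from the boundaries of the cells, where the bumps vanish.\<close>

definition grid_support :: "nat \<Rightarrow> real \<Rightarrow> (real^'d::finite) set" where
  "grid_support q \<theta> = {x. \<forall>i. \<exists>k<q. \<bar>real q * x $ i - (real k + 1/2)\<bar> \<le> \<theta> / 2}"

lemma centre_scaled:
  assumes "0 < q"
  shows "real q * \<bar>(x - centre q k) $ i\<bar> = \<bar>real q * x $ i - (real (k i) + 1/2)\<bar>"
proof -
  have "real q * ((x - centre q k) $ i) = real q * x $ i - (real (k i) + 1/2)"
    using assms by (simp add: centre_def right_diff_distrib)
  then show ?thesis by (metis abs_mult abs_of_nat)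
qed

section \<open>Heights of the bumps\<close>

context
  fixes q w :: nat and c \<beta> :: real
  assumes q: "0 < q" and c: "0 < c" and \<beta>: "0 < \<beta>" "\<beta> \<le> 1"
begin

lemma height_nonneg: "0 \<le> bump_height q w c \<beta> r x"
  using c by (simp add: bump_height_def)

lemma height_holder: "\<bar>bump_height q w c \<beta> r x - bump_height q w c \<beta> r y\<bar> \<le> c * norm (x - y) powr \<beta>"
proof -
  have *: "\<bar>c * max 0 a powr \<beta> - c * max 0 b powr \<beta>\<bar> \<le> c * norm (x - y) powr \<beta>" if "\<bar>a - b\<bar> \<le> norm (x - y)" for a b :: real
  proof -
    have "\<bar>c * max 0 a powr \<beta> - c * max 0 b powr \<beta>\<bar> = c * \<bar>max 0 a powr \<beta> - max 0 b powr \<beta>\<bar>"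
      using c by (simp add: abs_mult flip: right_diff_distrib)
    also have "\<dots> \<le> c * \<bar>max 0 a - max 0 b\<bar> powr \<beta>"
      using c \<beta> by (intro mult_left_mono powr_diff_le) auto
    also have "\<dots> \<le> c * norm (x - y) powr \<beta>"
      using c \<beta> that by (intro mult_left_mono powr_mono2) auto
    finally show ?thesis .
  qed
  show ?thesis
  proof (cases r)
    case None
    then show ?thesis using *[of "maxnorm x - real w / real q" "maxnorm y - real w / real q"] maxnorm_lipschitz[of x y]
      by (simp add: bump_height_def)
  next
    case (Some k)
    then show ?thesis
      using *[of "1 / (2 * real q) - maxnorm (x - centre q k)" "1 / (2 * real q) - maxnorm (y - centre q k)"]
        maxnorm_lipschitz[of "x - centre q k" "y - centre q k"]
      by (simp add: bump_height_def abs_minus_commute)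
  qed
qed

lemma region_Some_less:
  assumes r: "region q w x = Some k" and x: "x \<in> unit_cube"
  shows "k i < w"
proof -
  have "0 \<le> real q * x $ i" using x by (simp add: unit_cube_def)
  moreover have "real q * x $ i < real w" "k = cell q x" using r by (auto simp: region_def not_le split: if_splits)
  ultimately show ?thesis by (simp add: cell_def) linarith
qed

text \<open>Each profile vanishes outside its own region. Therefore the signs of the regions can be
  chosen independently without a jump between regions.\<close>

lemma height_eq_0:
  assumes x: "x \<in> unit_cube" and ne: "r \<noteq> region q w x" and r: "\<And>k i. r = Some k \<Longrightarrow> k i < w"
  shows "bump_height q w c \<beta> r x = 0"
proof -
  have x0: "0 \<le> x $ i" for i using x by (simp add: unit_cube_def)
  show ?thesis
  proof (cases r)
    case None
    then have "\<And>i. real q * x $ i < real w" using ne by (auto simp: region_def not_le split: if_splits)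
    then have "maxnorm x \<le> real w / real q"
      unfolding maxnorm_le_iff using q x0 by (auto simp: field_simps intro: less_imp_le)
    then show ?thesis using None by (simp add: bump_height_def max_def)
  next
    case (Some k)
    have "\<exists>i. 1/2 \<le> \<bar>real q * x $ i - (real (k i) + 1/2)\<bar>"
    proof (cases "region q w x")
      case None
      then obtain i where "real w \<le> real q * x $ i" by (auto simp: region_def split: if_splits)
      moreover have "real (k i) + 1 \<le> real w" using r[OF Some, of i] by linarith
      ultimately show ?thesis by (intro exI[of _ i]) linarith
    next
      case (Some k')
      then have "k' = cell q x" by (simp add: region_def split: if_splits)
      moreover have "k \<noteq> k'" using ne Some \<open>r = Some k\<close> by auto
      ultimately obtain i where i: "k i \<noteq> nat \<lfloor>real q * x $ i\<rfloor>" by (auto simp: cell_def fun_eq_iff)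
      then have "int (k i) \<noteq> \<lfloor>real q * x $ i\<rfloor>" by auto
      then show ?thesis by (intro exI[of _ i]) linarith
    qed
    then obtain i where i: "1/2 \<le> \<bar>real q * x $ i - (real (k i) + 1/2)\<bar>" ..
    have "real q * \<bar>(x - centre q k) $ i\<bar> = \<bar>real q * x $ i - (real (k i) + 1/2)\<bar>"
      by (rule centre_scaled[OF q])
    then have "1 / (2 * real q) \<le> \<bar>(x - centre q k) $ i\<bar>" using i q by (simp add: field_simps)
    then have "1 / (2 * real q) \<le> maxnorm (x - centre q k)" using component_le_maxnorm[of "x - centre q k" i] by linarith
    then show ?thesis using Some by (simp add: bump_height_def max_def)
  qed
qed

text \<open>For points of different regions the height at one point equals its difference from the
  other point within the same profile, which vanishes there. Two such differences account for the
  factor 2.\<close>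

lemma signed_height_holder:
  assumes x: "x \<in> unit_cube" and y: "y \<in> unit_cube"
  shows "\<bar>region_sign \<sigma> (region q w x) * bump_height q w c \<beta> (region q w x) x
     - region_sign \<sigma> (region q w y) * bump_height q w c \<beta> (region q w y) y\<bar> \<le> 2 * c * norm (x - y) powr \<beta>"
proof (cases "region q w x = region q w y")
  case True
  have "\<bar>region_sign \<sigma> (region q w x) * bump_height q w c \<beta> (region q w x) x
     - region_sign \<sigma> (region q w y) * bump_height q w c \<beta> (region q w y) y\<bar>
     = \<bar>bump_height q w c \<beta> (region q w x) x - bump_height q w c \<beta> (region q w x) y\<bar>"
    using True by (simp add: abs_mult flip: right_diff_distrib)
  also have "\<dots> \<le> c * norm (x - y) powr \<beta>" by (rule height_holder)
  also have "\<dots> \<le> 2 * c * norm (x - y) powr \<beta>" using c by simp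
  finally show ?thesis .
next
  case False
  have "bump_height q w c \<beta> (region q w x) y = 0"
    by (rule height_eq_0[OF y False]) (rule region_Some_less[OF _ x])
  then have "bump_height q w c \<beta> (region q w x) x \<le> c * norm (x - y) powr \<beta>"
    using height_holder[of "region q w x" x y] by simp
  moreover have "bump_height q w c \<beta> (region q w y) x = 0"
    by (rule height_eq_0[OF x False[symmetric]]) (rule region_Some_less[OF _ y])
  then have "bump_height q w c \<beta> (region q w y) y \<le> c * norm (x - y) powr \<beta>"
    using height_holder[of "region q w y" x y] by simp
  ultimately show ?thesis
    using height_nonneg[of "region q w x" x] height_nonneg[of "region q w y" y]
      region_sign_cases[of \<sigma> "region q w x"] region_sign_cases[of \<sigma> "region q w y"] by auto
qed

lemma height_le:
  assumes "x \<in> unit_cube"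
  shows "bump_height q w c \<beta> r x \<le> c"
proof -
  have "maxnorm x \<le> 1" using assms by (auto simp: maxnorm_le_iff unit_cube_def)
  moreover have "0 \<le> real w / real q" "1 / (2 * real q) \<le> 1" using q by auto
  moreover have mn: "0 \<le> maxnorm (x - centre q k)" for k using component_le_maxnorm[of "x - centre q k"] by (meson abs_ge_zero order_trans)
  ultimately have "(case r of None \<Rightarrow> maxnorm x - real w / real q
     | Some k \<Rightarrow> 1 / (2 * real q) - maxnorm (x - centre q k)) \<le> 1"
  proof (cases r)
    case None
    have "maxnorm x - real w / real q \<le> 1"
      using \<open>maxnorm x \<le> 1\<close> \<open>0 \<le> real w / real q\<close> by linarith
    then show ?thesis using None by simp
  next
    case (Some k)
    then show ?thesis using \<open>1 / (2 * real q) \<le> 1\<close> mn[of k] by simp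
  qed
  then have "max 0 (case r of None \<Rightarrow> maxnorm x - real w / real q
     | Some k \<Rightarrow> 1 / (2 * real q) - maxnorm (x - centre q k)) powr \<beta> \<le> 1 powr \<beta>"
    using \<beta> by (intro powr_mono2) auto
  then show ?thesis using c by (simp add: bump_height_def)
qed

lemma height_Some_le: "bump_height q w c \<beta> (Some k) x \<le> c * (1 / real q) powr \<beta>"
proof -
  have "0 \<le> maxnorm (x - centre q k)" using component_le_maxnorm[of "x - centre q k"] by (meson abs_ge_zero order_trans)
  moreover have "1 / (2 * real q) \<le> 1 / real q" using q by (simp add: field_simps)
  ultimately show ?thesis unfolding bump_height_def using c \<beta> by (intro mult_left_mono powr_mono2) auto
qed

lemma grid_support_cell:
  assumes "x \<in> grid_support q \<theta>" "\<theta> < 1"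
  shows "cell q x i < q" "\<bar>real q * x $ i - (real (cell q x i) + 1/2)\<bar> \<le> \<theta> / 2"
proof -
  obtain k where k: "k < q" "\<bar>real q * x $ i - (real k + 1/2)\<bar> \<le> \<theta> / 2"
    using assms by (auto simp: grid_support_def)
  have "real k \<le> real q * x $ i" "real q * x $ i < real k + 1"
    using assms(2) abs_le_D1[OF k(2)] abs_le_D2[OF k(2)] by linarith+
  then have "\<lfloor>real q * x $ i\<rfloor> = int k" by (intro floor_unique) auto
  then have "cell q x i = k" by (simp add: cell_def)
  then show "cell q x i < q" "\<bar>real q * x $ i - (real (cell q x i) + 1/2)\<bar> \<le> \<theta> / 2" using k by auto
qed

text \<open>Here the gap pays: a point of the support has distance at least (1 - \<theta>) / (2 q),
  in the maximum norm, from the boundary of its region.\<close>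

lemma height_ge:
  assumes x: "x \<in> grid_support q \<theta>" and \<theta>: "\<theta> < 1"
  shows "c * ((1 - \<theta>) / (2 * real q)) powr \<beta> \<le> bump_height q w c \<beta> (region q w x) x"
proof -
  note s = grid_support_cell[OF x \<theta>]
  have "(1 - \<theta>) / (2 * real q) \<le> (case region q w x of None \<Rightarrow> maxnorm x - real w / real q
     | Some k \<Rightarrow> 1 / (2 * real q) - maxnorm (x - centre q k))"
  proof (cases "region q w x")
    case None
    then obtain i where i: "real w \<le> real q * x $ i" by (auto simp: region_def split: if_splits)
    have "real q * x $ i < real (cell q x i) + 1" using s(2)[of i] \<theta> by linarith
    \<comment> \<open>Both sides are integers, so the outer region contains whole cells only, and
      the margin of the small cube inside its cell separates the point from the inner cube.\<close>
    then have "w \<le> cell q x i" using i by linarith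
    then have "real w \<le> real (cell q x i)" by simp
    then have "real w + (1 - \<theta>) / 2 \<le> real q * x $ i"
      using abs_le_D2[OF s(2)[of i]] by argo
    then have "(real w + (1 - \<theta>) / 2) / real q \<le> x $ i" using q by (simp add: field_simps)
    also have "x $ i \<le> maxnorm x" using component_le_maxnorm[of x i] by simp
    finally show ?thesis using None by (simp add: add_divide_distrib)
  next
    case (Some k)
    then have k: "k = cell q x" by (simp add: region_def split: if_splits)
    have "maxnorm (x - centre q k) \<le> \<theta> / (2 * real q)"
      unfolding maxnorm_le_iff
    proof
      fix i
      have "real q * \<bar>(x - centre q k) $ i\<bar> = \<bar>real q * x $ i - (real (k i) + 1/2)\<bar>"
        by (rule centre_scaled[OF q])
      then show "\<bar>(x - centre q k) $ i\<bar> \<le> \<theta> / (2 * real q)" using s(2)[of i] q by (simp add: k field_simps)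
    qed
    then show ?thesis using Some by (simp add: diff_divide_distrib)
  qed
  then show ?thesis unfolding bump_height_def using c \<beta> \<theta> q by (intro mult_left_mono powr_mono2) auto
qed

end

section \<open>Volume and regularity of the grid support\<close>

lemma grid_support_subset_cube: "0 < q \<Longrightarrow> \<theta> < 1 \<Longrightarrow> grid_support q \<theta> \<subseteq> unit_cube"
proof
  fix x :: "real^'d" assume q: "0 < q" and \<theta>: "\<theta> < 1" and x: "x \<in> grid_support q \<theta>"
  show "x \<in> unit_cube" unfolding unit_cube_def
  proof (intro CollectI allI)
    fix i
    obtain k where k: "k < q" "\<bar>real q * x $ i - (real k + 1/2)\<bar> \<le> \<theta> / 2"
      using x by (auto simp: grid_support_def)
    have "real k + 1 \<le> real q" using k(1) by linarith
    then have "0 \<le> real q * x $ i" "real q * x $ i \<le> real q * 1"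
      using \<theta> abs_le_D1[OF k(2)] abs_le_D2[OF k(2)] of_nat_0_le_iff[of k, where ?'a = real] by linarith+
    then show "0 \<le> x $ i \<and> x $ i \<le> 1" using q by (simp add: zero_le_mult_iff)
  qed
qed

definition inner_cell :: "nat \<Rightarrow> real \<Rightarrow> ('d \<Rightarrow> nat) \<Rightarrow> (real^'d::finite) set" where
  "inner_cell q \<theta> k = {x. \<forall>i. \<bar>real q * x $ i - (real (k i) + 1/2)\<bar> \<le> \<theta> / 2}"

lemma content_cube:
  fixes a :: "real^'d::finite"
  assumes "0 \<le> l"
  shows "measure lborel (cbox a (\<chi> i. a $ i + l)) = l ^ CARD('d)"
  using assms by (subst content_cbox_cart) (auto simp: interval_ne_empty_cart)

lemma inner_cell_eq_cbox:
  assumes "0 < q"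
  shows "inner_cell q \<theta> k = cbox (\<chi> i. (real (k i) + 1/2 - \<theta>/2) / real q) (\<chi> i. (\<chi> i. (real (k i) + 1/2 - \<theta>/2) / real q) $ i + \<theta> / real q)"
proof -
  have "\<bar>real q * y - (a + 1/2)\<bar> \<le> \<theta> / 2 \<longleftrightarrow> (a + 1/2 - \<theta>/2) / real q \<le> y \<and> y \<le> (a + 1/2 - \<theta>/2) / real q + \<theta> / real q" for y a :: real
  proof -
    have "(a + 1/2 - \<theta>/2) / real q \<le> y \<longleftrightarrow> a + 1/2 - \<theta>/2 \<le> real q * y"
      using assms by (simp add: pos_divide_le_eq mult.commute)
    moreover have "(a + 1/2 - \<theta>/2) / real q + \<theta> / real q = (a + 1/2 + \<theta>/2) / real q"
      by (simp flip: add_divide_distrib)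
    moreover have "y \<le> (a + 1/2 + \<theta>/2) / real q \<longleftrightarrow> real q * y \<le> a + 1/2 + \<theta>/2"
      using assms by (simp add: pos_le_divide_eq mult.commute)
    ultimately show ?thesis unfolding abs_le_iff by linarith
  qed
  then show ?thesis by (auto simp: inner_cell_def mem_box_cart)
qed

lemma content_inner_cell:
  assumes "0 < q" "0 \<le> \<theta>"
  shows "measure lborel (inner_cell q \<theta> k :: (real^'d::finite) set) = (\<theta> / real q) ^ CARD('d)"
  unfolding inner_cell_eq_cbox[OF assms(1)] by (rule content_cube) (use assms in simp)

lemma compact_inner_cell: "0 < q \<Longrightarrow> compact (inner_cell q \<theta> k)"
  by (simp add: inner_cell_eq_cbox compact_cbox)

lemma inner_cell_cell: "x \<in> inner_cell q \<theta> k \<Longrightarrow> \<theta> < 1 \<Longrightarrow> cell q x = k"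
proof
  fix i assume "x \<in> inner_cell q \<theta> k" and \<theta>: "\<theta> < 1"
  then have k: "\<bar>real q * x $ i - (real (k i) + 1/2)\<bar> \<le> \<theta> / 2" by (auto simp: inner_cell_def)
  have "real (k i) \<le> real q * x $ i" "real q * x $ i < real (k i) + 1"
    using \<theta> abs_le_D1[OF k] abs_le_D2[OF k] by linarith+
  then have "\<lfloor>real q * x $ i\<rfloor> = int (k i)" by (intro floor_unique) auto
  then show "cell q x i = k i" by (simp add: cell_def)
qed

lemma finite_bounded_funs: "finite {k :: 'd::finite \<Rightarrow> nat. \<forall>i. k i < b}"
proof -
  have "{k :: 'd \<Rightarrow> nat. \<forall>i. k i < b} = PiE UNIV (\<lambda>_. {..<b})" by auto
  then show ?thesis by (simp only:) (rule finite_PiE, auto)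
qed

lemma card_bounded_funs: "card {k :: 'd::finite \<Rightarrow> nat. \<forall>i. k i < b} = b ^ CARD('d)"
proof -
  have "{k :: 'd \<Rightarrow> nat. \<forall>i. k i < b} = PiE UNIV (\<lambda>_. {..<b})" by auto
  then show ?thesis by (simp only: card_PiE[OF finite]) simp
qed

lemma grid_support_eq: "(grid_support q \<theta> :: (real^'d::finite) set) = (\<Union>k\<in>{k. \<forall>i. k i < q}. inner_cell q \<theta> k)"
proof
  show "(grid_support q \<theta> :: (real^'d) set) \<subseteq> (\<Union>k\<in>{k. \<forall>i. k i < q}. inner_cell q \<theta> k)"
  proof
    fix x :: "real^'d" assume "x \<in> grid_support q \<theta>"
    then obtain k where "\<And>i. k i < q \<and> \<bar>real q * x $ i - (real (k i) + 1/2)\<bar> \<le> \<theta> / 2"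
      unfolding grid_support_def by simp metis
    then show "x \<in> (\<Union>k\<in>{k. \<forall>i. k i < q}. inner_cell q \<theta> k)" by (auto simp: inner_cell_def intro!: exI[of _ k])
  qed
qed (auto simp: grid_support_def inner_cell_def)

lemma content_UN_inner_cell:
  assumes "0 < q" "0 \<le> \<theta>" "\<theta> < 1" "finite J"
  shows "measure lborel (\<Union>k\<in>J. inner_cell q \<theta> k :: (real^'d::finite) set) = real (card J) * (\<theta> / real q) ^ CARD('d)"
proof -
  have "measure lborel (\<Union>k\<in>J. inner_cell q \<theta> k :: (real^'d) set) = (\<Sum>k\<in>J. measure lborel (inner_cell q \<theta> k :: (real^'d) set))"
  proof (rule measure_finite_Union[OF \<open>finite J\<close>])
    show "disjoint_family_on (inner_cell q \<theta>) J"
      unfolding disjoint_family_on_def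
    proof (intro ballI impI)
      fix k k' :: "'d \<Rightarrow> nat" assume ne: "k \<noteq> k'"
      show "inner_cell q \<theta> k \<inter> inner_cell q \<theta> k' = {}"
      proof (rule ccontr)
        assume "inner_cell q \<theta> k \<inter> inner_cell q \<theta> k' \<noteq> {}"
        then obtain x where "x \<in> inner_cell q \<theta> k" "x \<in> inner_cell q \<theta> k'" by auto
        then have "cell q x = k" "cell q x = k'" using inner_cell_cell[OF _ assms(3)] by blast+
        then show False using ne by simp
      qed
    qed
    show "inner_cell q \<theta> ` J \<subseteq> sets lborel"
      using compact_inner_cell[OF assms(1)] by (auto intro!: borel_compact)
    show "emeasure lborel (inner_cell q \<theta> k) \<noteq> \<infinity>" for k :: "'d \<Rightarrow> nat"
      using emeasure_compact_finite[OF compact_inner_cell[OF assms(1), of \<theta> k]] by simp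
  qed
  then show ?thesis using content_inner_cell[OF assms(1,2), where 'd = 'd] by simp
qed

lemma content_grid_support:
  assumes "0 < q" "0 \<le> \<theta>" "\<theta> < 1"
  shows "measure lborel (grid_support q \<theta> :: (real^'d::finite) set) = \<theta> ^ CARD('d)"
  unfolding grid_support_eq content_UN_inner_cell[OF assms finite_bounded_funs] card_bounded_funs
  using assms by (simp add: power_divide)

lemma compact_grid_support: "0 < q \<Longrightarrow> compact (grid_support q \<theta>)"
  unfolding grid_support_eq by (intro compact_UN finite_bounded_funs compact_inner_cell)

lemma content_mono_bounded:
  fixes S :: "(real^'d::finite) set"
  assumes "S \<subseteq> T" "S \<in> sets borel" "T \<in> sets borel" "bounded T"
  shows "measure lborel S \<le> measure lborel T"
proof (rule measure_mono_fmeasurable[OF assms(1)])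
  show "T \<in> fmeasurable lborel"
    using emeasure_bounded_finite[OF assms(4)] assms(3) by (intro fmeasurableI) auto
qed (use assms in auto)

text \<open>The constant must not depend on \<open>q\<close>, as the class is fixed while the grid
  becomes finer. A ball below the scale of the cells contains a large part of one small cube; a ball
  above it contains a block of whole cells, of which the small cubes fill the fraction
  \<theta>^d.\<close>

lemma grid_support_ball:
  fixes x :: "real^'d::finite"
  assumes q: "0 < q" and \<theta>: "0 < \<theta>" "\<theta> < 1" and x: "x \<in> grid_support q \<theta>" and s: "0 < s" "s \<le> r\<mu>"
  shows "(\<theta> * min (1 / (4 * real CARD('d))) (1 / r\<mu>) * s) ^ CARD('d) \<le> measure lborel (grid_support q \<theta> \<inter> ball x s)"
proof -
  define d where "d = real CARD('d)"
  have d: "1 \<le> d" unfolding d_def using zero_less_card_finite[where 'a='d] by linarith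
  \<comment> \<open>The factor 4 d covers the passage from balls to cubes and the loss from rounding
    to whole cells; \<open>1 / r\<mu>\<close> covers radii at which the block is already the entire
    grid.\<close>
  define \<kappa> where "\<kappa> = min (1 / (4 * d)) (1 / r\<mu>)"
  have \<kappa>: "0 < \<kappa>" using d s by (simp add: \<kappa>_def)
  have A: "grid_support q \<theta> \<in> sets (borel :: (real^'d) measure)" by (rule borel_compact[OF compact_grid_support[OF q]])
  have mono: "measure lborel S \<le> measure lborel (grid_support q \<theta> \<inter> ball x s)"
    if "S \<subseteq> grid_support q \<theta> \<inter> ball x s" "S \<in> sets borel" for S
    by (rule content_mono_bounded[OF that]) (use A in \<open>auto intro: bounded_subset[OF bounded_ball]\<close>)
  obtain k where k: "\<And>i. k i < q" and xk: "x \<in> inner_cell q \<theta> k"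
    using x unfolding grid_support_eq by auto
  show ?thesis
  proof (cases "s \<le> 2 * d / real q")
    case True
    \<comment> \<open>The side fits into the small cube by the first bound and into the ball by the
      second.\<close>
    define l where "l = min (\<theta> / real q) (s / (2 * d))"
    have l0: "0 \<le> l" using \<theta> s d by (simp add: l_def)
    define lo where "lo i = (real (k i) + 1/2 - \<theta>/2) / real q" for i
    \<comment> \<open>The corner lies \<open>l\<close> below \<open>x\<close>, clipped to the small
      cube; the cube of side \<open>l\<close> then contains \<open>x\<close> and stays
      inside.\<close>
    define a :: "real^'d" where "a = (\<chi> i. max (lo i) (x $ i - l))"
    have xi: "lo i \<le> x $ i" "x $ i \<le> lo i + \<theta> / real q" for i
      using xk unfolding inner_cell_eq_cbox[OF q] by (auto simp: mem_box_cart lo_def)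
    have "cbox a (\<chi> i. a $ i + l) \<subseteq> grid_support q \<theta> \<inter> ball x s"
    proof
      fix y assume "y \<in> cbox a (\<chi> i. a $ i + l)"
      then have y: "a $ i \<le> y $ i" "y $ i \<le> a $ i + l" for i by (auto simp: mem_box_cart)
      have ai: "lo i \<le> a $ i" "x $ i - l \<le> a $ i" "a $ i \<le> x $ i" "a $ i + l \<le> lo i + \<theta> / real q" for i
        using xi[of i] l0 by (auto simp: a_def l_def max_def)
      have "y \<in> inner_cell q \<theta> k"
        unfolding inner_cell_eq_cbox[OF q] mem_box_cart
        using order_trans[OF ai(1) y(1)] order_trans[OF y(2) ai(4)] by (simp add: lo_def)
      then have "y \<in> grid_support q \<theta>" using k unfolding grid_support_eq by auto
      moreover have "\<bar>(x - y) $ i\<bar> \<le> s / (2 * d)" for i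
      proof -
        have "\<bar>(x - y) $ i\<bar> \<le> l" using y[of i] ai(2,3)[of i] by simp
        then show ?thesis by (simp add: l_def)
      qed
      then have "norm (x - y) \<le> d * (s / (2 * d))" unfolding d_def by (rule norm_le_of_components)
      then have "dist x y < s" using d s by (simp add: dist_norm)
      ultimately show "y \<in> grid_support q \<theta> \<inter> ball x s" by simp
    qed
    then have "l ^ CARD('d) \<le> measure lborel (grid_support q \<theta> \<inter> ball x s)"
      using mono[of "cbox a (\<chi> i. a $ i + l)"] content_cube[OF l0, of a] by simp
    moreover have "\<theta> * \<kappa> * s \<le> l"
    proof -
      have "\<theta> * \<kappa> * s \<le> \<theta> * (1 / (4 * d)) * s" using \<theta> s d by (intro mult_mono) (auto simp: \<kappa>_def)
      also have "\<dots> \<le> \<theta> * (s / (2 * d))" using \<theta> s d by (simp add: field_simps)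
      finally have 1: "\<theta> * \<kappa> * s \<le> \<theta> * (s / (2 * d))" .
      also have "\<dots> \<le> \<theta> * (1 / real q)" using True \<theta> d q by (intro mult_left_mono) (auto simp: field_simps)
      finally have 2: "\<theta> * \<kappa> * s \<le> \<theta> / real q" by simp
      have "\<theta> * (s / (2 * d)) \<le> 1 * (s / (2 * d))" using \<theta> s d by (intro mult_right_mono) auto
      then show ?thesis using 1 2 by (simp add: l_def)
    qed
    then have "(\<theta> * \<kappa> * s) ^ CARD('d) \<le> l ^ CARD('d)" using \<theta> \<kappa> s by (intro power_mono) auto
    ultimately show ?thesis by (simp add: \<kappa>_def d_def)
  next
    case False
    \<comment> \<open>The number of cells per side, before rounding, of a block with side
      \<open>s / (2 * d)\<close>.\<close>
    define t where "t = s * real q / (2 * d)"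
    have t1: "1 < t" using False d q by (simp add: t_def field_simps)
    define J where "J = min q (nat \<lfloor>t\<rfloor>)"
    have J1: "1 \<le> J" using t1 q by (simp add: J_def nat_le_eq_zle le_floor_iff) linarith
    have Jt: "real J \<le> t" using t1 by (simp add: J_def min_le_iff_disj) linarith
    have Jq: "J \<le> q" by (simp add: J_def)
    have J\<kappa>: "\<kappa> * s \<le> real J / real q"
    proof (cases "q \<le> nat \<lfloor>t\<rfloor>")
      case True
      then have "real J / real q = 1" using q by (simp add: J_def)
      moreover have "\<kappa> * s \<le> 1 / r\<mu> * r\<mu>" using s \<kappa> by (intro mult_mono) (auto simp: \<kappa>_def)
      ultimately show ?thesis using s by simp
    next
      case False
      then have "J = nat \<lfloor>t\<rfloor>" by (simp add: J_def)
      then have "t - 1 \<le> real J" using t1 by linarith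
      moreover have "1 \<le> real J" using J1 by simp
      ultimately have "t / 2 \<le> real J" by simp
      then have "t / 2 / real q \<le> real J / real q" by (intro divide_right_mono) auto
      moreover have "t / 2 / real q = 1 / (4 * d) * s" using q by (simp add: t_def)
      moreover have "\<kappa> * s \<le> 1 / (4 * d) * s" using s by (intro mult_right_mono) (auto simp: \<kappa>_def)
      ultimately show ?thesis by linarith
    qed
    define a where "a i = min (k i) (q - J)" for i
    define I where "I = PiE UNIV (\<lambda>i. {a i..<a i + J})"
    have finI: "finite I" unfolding I_def by (rule finite_PiE) auto
    have cardI: "card I = J ^ CARD('d)" unfolding I_def by (subst card_PiE) auto
    have kI: "a i \<le> k i" "k i < a i + J" "a i + J \<le> q" for i
      using k[of i] J1 Jq by (auto simp: a_def min_def)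
    have "(\<Union>k\<in>I. inner_cell q \<theta> k) \<subseteq> grid_support q \<theta> \<inter> ball x s"
    proof
      fix y assume "y \<in> (\<Union>k\<in>I. inner_cell q \<theta> k)"
      then obtain k' where k': "k' \<in> I" and yk: "y \<in> inner_cell q \<theta> k'" by auto
      have k'I: "a i \<le> k' i" "k' i < a i + J" for i using k' by (auto simp: I_def)
      have "k' i < q" for i using k'I(2)[of i] kI(3)[of i] by linarith
      then have "y \<in> grid_support q \<theta>" using yk unfolding grid_support_eq by auto
      moreover have "\<bar>(x - y) $ i\<bar> \<le> s / (2 * d)" for i
      proof -
        have bnd: "real (a i) \<le> real q * z $ i \<and> real q * z $ i \<le> real (a i) + real J"
          if "z \<in> inner_cell q \<theta> k''" "a i \<le> k'' i" "k'' i < a i + J" for z :: "real^'d" and k''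
        proof -
          have ab: "\<bar>real q * z $ i - (real (k'' i) + 1/2)\<bar> \<le> \<theta> / 2" using that(1) by (auto simp: inner_cell_def)
          have "real (a i) \<le> real (k'' i)" "real (k'' i) + 1 \<le> real (a i) + real J" using that(2,3) by linarith+
          then show ?thesis using abs_le_D1[OF ab] abs_le_D2[OF ab] \<theta> by linarith
        qed
        have "\<bar>real q * x $ i - real q * y $ i\<bar> \<le> real J"
          using bnd[OF xk kI(1,2)] bnd[OF yk k'I] by linarith
        then have "real q * \<bar>x $ i - y $ i\<bar> \<le> real q * (s / (2 * d))"
          using Jt by (simp add: abs_mult t_def mult.commute flip: right_diff_distrib)
        then have "\<bar>x $ i - y $ i\<bar> \<le> s / (2 * d)" by (rule mult_left_le_imp_le) (use q in simp)
        then show ?thesis by simp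
      qed
      then have "norm (x - y) \<le> d * (s / (2 * d))" unfolding d_def by (rule norm_le_of_components)
      then have "dist x y < s" using d s by (simp add: dist_norm)
      ultimately show "y \<in> grid_support q \<theta> \<inter> ball x s" by simp
    qed
    then have "measure lborel (\<Union>k\<in>I. inner_cell q \<theta> k :: (real^'d) set) \<le> measure lborel (grid_support q \<theta> \<inter> ball x s)"
      using compact_UN[OF finI compact_inner_cell[OF q]] by (intro mono borel_compact) auto
    moreover have "measure lborel (\<Union>k\<in>I. inner_cell q \<theta> k :: (real^'d) set) = (\<theta> * (real J / real q)) ^ CARD('d)"
      using content_UN_inner_cell[OF q _ \<theta>(2) finI] \<theta> by (simp add: cardI power_mult_distrib power_divide)
    moreover have "(\<theta> * (\<kappa> * s)) ^ CARD('d) \<le> (\<theta> * (real J / real q)) ^ CARD('d)"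
      using \<theta> \<kappa> s J\<kappa> by (intro power_mono mult_left_mono) auto
    ultimately show ?thesis by (simp add: \<kappa>_def d_def mult.assoc)
  qed
qed

lemma regular_grid_support:
  assumes q: "0 < q" and \<theta>: "0 < \<theta>" "\<theta> < 1"
    and c\<mu>: "c\<mu> \<le> (\<theta> * min (1 / (4 * real CARD('d))) (1 / r\<mu>)) ^ CARD('d) / unit_ball_vol (real CARD('d))"
  shows "regular_set c\<mu> r\<mu> (grid_support q \<theta> :: (real^'d::finite) set)"
  unfolding regular_set_def
proof (intro ballI allI impI)
  fix x :: "real^'d" and s assume x: "x \<in> grid_support q \<theta>" and s: "0 < s" "s \<le> r\<mu>"
  have V: "0 < unit_ball_vol (real CARD('d))" by simp
  then have Vne: "unit_ball_vol (real CARD('d)) \<noteq> 0" by linarith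
  have "c\<mu> * measure lborel (ball x s) = c\<mu> * (unit_ball_vol (real CARD('d)) * s ^ CARD('d))"
    using content_ball[of s x] s by simp
  also have "\<dots> \<le> (\<theta> * min (1 / (4 * real CARD('d))) (1 / r\<mu>)) ^ CARD('d) / unit_ball_vol (real CARD('d)) * (unit_ball_vol (real CARD('d)) * s ^ CARD('d))"
    using c\<mu> V s by (intro mult_right_mono) auto
  also have "\<dots> = (\<theta> * min (1 / (4 * real CARD('d))) (1 / r\<mu>) * s) ^ CARD('d)"
    using Vne by (simp add: power_mult_distrib)
  also have "\<dots> \<le> measure lborel (grid_support q \<theta> \<inter> ball x s)" by (rule grid_support_ball[OF q \<theta> x s])
  finally show "c\<mu> * measure lborel (ball x s) \<le> measure lborel (grid_support q \<theta> \<inter> ball x s)" .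
qed

section \<open>Laws of observations with given feature law and regression function\<close>

definition obs_law :: "(real^'d::finite) measure \<Rightarrow> (real^'d \<Rightarrow> real) \<Rightarrow> 'd obs measure" where
  "obs_law M \<eta> = density (M \<Otimes>\<^sub>M count_space UNIV) (\<lambda>z. ennreal (if snd z then \<eta> (fst z) else 1 - \<eta> (fst z)))"

lemma obs_law_base:
  fixes M :: "(real^'d::finite) measure"
  assumes M: "M \<in> space (prob_algebra cube_space)"
  shows "sets (M \<Otimes>\<^sub>M count_space UNIV) = sets (obs_space :: 'd obs measure)"
    "space M = unit_cube" "sets M = sets cube_space" "prob_space M"
proof -
  show M': "prob_space M" "sets M = sets cube_space" using M by (auto simp: space_prob_algebra)
  show "space M = unit_cube" using sets_eq_imp_space_eq[OF M'(2)] by simp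
  show "sets (M \<Otimes>\<^sub>M count_space UNIV) = sets (obs_space :: 'd obs measure)"
    unfolding obs_space_def by (rule sets_pair_measure_cong[OF M'(2) refl])
qed

context
  fixes M :: "(real^'d::finite) measure" and \<eta> :: "real^'d \<Rightarrow> real"
  assumes M: "M \<in> space (prob_algebra cube_space)"
    and \<eta>: "\<eta> \<in> borel_measurable cube_space" "\<And>x. x \<in> unit_cube \<Longrightarrow> 0 \<le> \<eta> x \<and> \<eta> x \<le> 1"
begin

lemma obs_law_weight_measurable:
  "(\<lambda>z. if snd z then \<eta> (fst z) else 1 - \<eta> (fst z)) \<in> borel_measurable (M \<Otimes>\<^sub>M count_space UNIV)"
proof -
  note [measurable] = \<eta>(1)
  have "(\<lambda>z. if snd z then \<eta> (fst z) else 1 - \<eta> (fst z)) \<in> borel_measurable (obs_space :: 'd obs measure)"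
    by measurable
  then show ?thesis by (subst measurable_cong_sets[OF obs_law_base(1)[OF M] refl])
qed

lemma nn_integral_obs_law:
  assumes f: "f \<in> borel_measurable (obs_space :: 'd obs measure)"
  shows "(\<integral>\<^sup>+z. f z \<partial>obs_law M \<eta>) = (\<integral>\<^sup>+x. ennreal (\<eta> x) * f (x, True) + ennreal (1 - \<eta> x) * f (x, False) \<partial>M)"
proof -
  interpret M: prob_space M by (rule obs_law_base(4)[OF M])
  interpret C: sigma_finite_measure "count_space (UNIV :: bool set)" by (rule sigma_finite_measure_count_space_finite) simp
  have fm: "f \<in> borel_measurable (M \<Otimes>\<^sub>M count_space UNIV)"
    by (subst measurable_cong_sets[OF obs_law_base(1)[OF M] refl]) (rule f)
  note [measurable] = fm obs_law_weight_measurable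
  have "(\<integral>\<^sup>+z. f z \<partial>obs_law M \<eta>) = (\<integral>\<^sup>+z. ennreal (if snd z then \<eta> (fst z) else 1 - \<eta> (fst z)) * f z \<partial>(M \<Otimes>\<^sub>M count_space UNIV))"
    unfolding obs_law_def by (rule nn_integral_density) measurable
  also have "\<dots> = (\<integral>\<^sup>+x. (\<integral>\<^sup>+y. ennreal (if y then \<eta> x else 1 - \<eta> x) * f (x, y) \<partial>count_space UNIV) \<partial>M)"
    by (subst C.nn_integral_fst[symmetric]) (measurable, simp only: fst_conv snd_conv)
  also have "\<dots> = (\<integral>\<^sup>+x. ennreal (\<eta> x) * f (x, True) + ennreal (1 - \<eta> x) * f (x, False) \<partial>M)"
    by (intro nn_integral_cong) (simp add: nn_integral_count_space_finite UNIV_bool add.commute)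
  finally show ?thesis .
qed

lemma nn_integral_obs_law_fst:
  assumes f: "f \<in> borel_measurable cube_space"
  shows "(\<integral>\<^sup>+z. f (fst z) \<partial>obs_law M \<eta>) = (\<integral>\<^sup>+x. f x \<partial>M)"
proof -
  have "(\<integral>\<^sup>+z. f (fst z) \<partial>obs_law M \<eta>) = (\<integral>\<^sup>+x. ennreal (\<eta> x) * f (fst (x, True)) + ennreal (1 - \<eta> x) * f (fst (x, False)) \<partial>M)"
    by (rule nn_integral_obs_law) (rule measurable_compose[OF measurable_fst_obs f])
  also have "\<dots> = (\<integral>\<^sup>+x. f x \<partial>M)"
  proof (rule nn_integral_cong)
    fix x assume "x \<in> space M"
    then have "0 \<le> \<eta> x \<and> \<eta> x \<le> 1" using \<eta>(2) by (simp add: obs_law_base(2)[OF M])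
    then have "ennreal (\<eta> x) + ennreal (1 - \<eta> x) = 1" by (simp flip: ennreal_plus)
    then show "ennreal (\<eta> x) * f (fst (x, True)) + ennreal (1 - \<eta> x) * f (fst (x, False)) = f x"
      by (simp flip: distrib_right)
  qed
  finally show ?thesis .
qed

lemma obs_law_prob_algebra: "obs_law M \<eta> \<in> space (prob_algebra obs_space)"
proof -
  interpret M: prob_space M by (rule obs_law_base(4)[OF M])
  have s: "sets (obs_law M \<eta>) = sets obs_space" by (simp add: obs_law_def obs_law_base(1)[OF M])
  have "emeasure (obs_law M \<eta>) (space (obs_law M \<eta>)) = (\<integral>\<^sup>+z. 1 \<partial>obs_law M \<eta>)" by simp
  also have "\<dots> = (\<integral>\<^sup>+x. 1 \<partial>M)" using nn_integral_obs_law_fst[of "\<lambda>_. 1"] by simp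
  also have "\<dots> = 1" by (simp add: M.emeasure_space_1)
  finally have "prob_space (obs_law M \<eta>)" by (rule prob_spaceI)
  then show ?thesis using s by (simp add: space_prob_algebra)
qed

lemma regression_fun_obs_law: "regression_fun (obs_law M \<eta>) \<eta>"
  unfolding regression_fun_def
proof (intro conjI ballI \<eta>(1))
  fix B :: "(real^'d) set" assume B: "B \<in> sets cube_space"
  note [measurable] = \<eta>(1) B
  have BT: "B \<times> {True} \<in> sets (obs_space :: 'd obs measure)" using B by (simp add: obs_space_def)
  have s: "sets (obs_law M \<eta>) = sets obs_space" by (simp add: obs_law_def obs_law_base(1)[OF M])
  have "emeasure (obs_law M \<eta>) (B \<times> {True}) = (\<integral>\<^sup>+z. indicator (B \<times> {True}) z \<partial>obs_law M \<eta>)"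
    using BT s by simp
  also have "\<dots> = (\<integral>\<^sup>+x. ennreal (\<eta> x) * indicator (B \<times> {True}) (x, True) + ennreal (1 - \<eta> x) * indicator (B \<times> {True}) (x, False) \<partial>M)"
    by (rule nn_integral_obs_law) (use BT in simp)
  also have "\<dots> = (\<integral>\<^sup>+x. ennreal (\<eta> x) * indicator B x \<partial>M)"
    by (intro nn_integral_cong) (simp add: indicator_def)
  also have "\<dots> = (\<integral>\<^sup>+z. ennreal (\<eta> (fst z)) * indicator B (fst z) \<partial>obs_law M \<eta>)"
    by (rule nn_integral_obs_law_fst[symmetric]) measurable
  finally show "emeasure (obs_law M \<eta>) (B \<times> {True}) = (\<integral>\<^sup>+z. ennreal (\<eta> (fst z)) * indicator B (fst z) \<partial>obs_law M \<eta>)" .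
qed (use \<eta>(2) in auto)

lemma integral_obs_law:
  fixes f :: "'d obs \<Rightarrow> real"
  assumes f: "f \<in> borel_measurable obs_space" "\<And>x. x \<in> unit_cube \<Longrightarrow> 0 \<le> f (x, True) \<and> 0 \<le> f (x, False)"
  shows "(\<integral>z. f z \<partial>obs_law M \<eta>) = (\<integral>x. \<eta> x * f (x, True) + (1 - \<eta> x) * f (x, False) \<partial>M)"
proof -
  have s: "sets (obs_law M \<eta>) = sets obs_space" by (simp add: obs_law_def obs_law_base(1)[OF M])
  have sp: "space (obs_law M \<eta>) = unit_cube \<times> UNIV" using sets_eq_imp_space_eq[OF s] by simp
  have fl: "f \<in> borel_measurable (obs_law M \<eta>)" by (subst measurable_cong_sets[OF s refl]) (rule f(1))
  have f0: "0 \<le> f z" if "z \<in> unit_cube \<times> UNIV" for z using f(2)[of "fst z"] that by (cases z, cases "snd z") auto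
  have [measurable]: "(\<lambda>x. f (x, b)) \<in> borel_measurable M" for b
  proof -
    have "(\<lambda>x. (x, b)) \<in> cube_space \<rightarrow>\<^sub>M obs_space" unfolding obs_space_def by measurable
    from measurable_compose[OF this f(1)] show ?thesis by (subst measurable_cong_sets[OF obs_law_base(3)[OF M] refl])
  qed
  have [measurable]: "\<eta> \<in> borel_measurable M" by (subst measurable_cong_sets[OF obs_law_base(3)[OF M] refl]) (rule \<eta>(1))
  have "(\<integral>z. f z \<partial>obs_law M \<eta>) = enn2real (\<integral>\<^sup>+z. ennreal (f z) \<partial>obs_law M \<eta>)"
    by (rule integral_eq_nn_integral[OF fl]) (use f0 in \<open>auto simp: sp intro!: AE_I2\<close>)
  also have "(\<integral>\<^sup>+z. ennreal (f z) \<partial>obs_law M \<eta>)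
     = (\<integral>\<^sup>+x. ennreal (\<eta> x) * ennreal (f (x, True)) + ennreal (1 - \<eta> x) * ennreal (f (x, False)) \<partial>M)"
    by (rule nn_integral_obs_law) (use f(1) in simp)
  also have "\<dots> = (\<integral>\<^sup>+x. ennreal (\<eta> x * f (x, True) + (1 - \<eta> x) * f (x, False)) \<partial>M)"
    using \<eta>(2) f(2) by (intro nn_integral_cong) (simp add: obs_law_base(2)[OF M] ennreal_mult ennreal_plus)
  also have "enn2real \<dots> = (\<integral>x. \<eta> x * f (x, True) + (1 - \<eta> x) * f (x, False) \<partial>M)"
    by (rule integral_eq_nn_integral[symmetric]) (use \<eta>(2) f(2) in \<open>auto simp: obs_law_base(2)[OF M] intro!: AE_I2\<close>)
  finally show ?thesis .
qed

end

section \<open>Distances between two regression functions with the same feature law\<close>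

definition likelihood_ratio :: "(real^'d::finite \<Rightarrow> real) \<Rightarrow> (real^'d \<Rightarrow> real) \<Rightarrow> 'd obs \<Rightarrow> real" where
  "likelihood_ratio \<eta> \<eta>' z = (if snd z then \<eta>' (fst z) / \<eta> (fst z) else (1 - \<eta>' (fst z)) / (1 - \<eta> (fst z)))"

context
  fixes M :: "(real^'d::finite) measure" and \<eta> \<eta>' :: "real^'d \<Rightarrow> real"
  assumes M: "M \<in> space (prob_algebra cube_space)"
    and \<eta>: "\<eta> \<in> borel_measurable cube_space" "\<And>x. x \<in> unit_cube \<Longrightarrow> 1/4 \<le> \<eta> x \<and> \<eta> x \<le> 3/4"
    and \<eta>': "\<eta>' \<in> borel_measurable cube_space" "\<And>x. x \<in> unit_cube \<Longrightarrow> 1/4 \<le> \<eta>' x \<and> \<eta>' x \<le> 3/4"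
begin

lemma regression_values_unit: "x \<in> unit_cube \<Longrightarrow> 0 \<le> \<eta> x \<and> \<eta> x \<le> 1" "x \<in> unit_cube \<Longrightarrow> 0 \<le> \<eta>' x \<and> \<eta>' x \<le> 1"
  using \<eta>(2)[of x] \<eta>'(2)[of x] by auto

lemma likelihood_ratio_props:
  shows "likelihood_ratio \<eta> \<eta>' \<in> borel_measurable obs_space"
    "z \<in> space obs_space \<Longrightarrow> 0 \<le> likelihood_ratio \<eta> \<eta>' z" "z \<in> space obs_space \<Longrightarrow> likelihood_ratio \<eta> \<eta>' z \<le> 3"
proof -
  note [measurable] = \<eta>(1) \<eta>'(1)
  show "likelihood_ratio \<eta> \<eta>' \<in> borel_measurable obs_space"
    unfolding likelihood_ratio_def[abs_def] by measurable
  assume "z \<in> space obs_space"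
  then have "fst z \<in> unit_cube" by auto
  from \<eta>(2)[OF this] \<eta>'(2)[OF this]
  show "0 \<le> likelihood_ratio \<eta> \<eta>' z" "likelihood_ratio \<eta> \<eta>' z \<le> 3"
    by (auto simp: likelihood_ratio_def divide_le_eq)
qed

lemma obs_law_ratio: "obs_law M \<eta>' = density (obs_law M \<eta>) (\<lambda>z. ennreal (likelihood_ratio \<eta> \<eta>' z))"
proof -
  note b = obs_law_base[OF M]
  have L: "(\<lambda>z. ennreal (likelihood_ratio \<eta> \<eta>' z)) \<in> borel_measurable (M \<Otimes>\<^sub>M count_space UNIV)"
    using likelihood_ratio_props(1) by (subst measurable_cong_sets[OF b(1) refl]) simp
  have W: "(\<lambda>z. ennreal (if snd z then \<eta> (fst z) else 1 - \<eta> (fst z))) \<in> borel_measurable (M \<Otimes>\<^sub>M count_space UNIV)"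
    using obs_law_weight_measurable[OF M \<eta>(1) regression_values_unit(1)] by simp
  have W': "(\<lambda>z. ennreal (if snd z then \<eta>' (fst z) else 1 - \<eta>' (fst z))) \<in> borel_measurable (M \<Otimes>\<^sub>M count_space UNIV)"
    using obs_law_weight_measurable[OF M \<eta>'(1) regression_values_unit(2)] by simp
  show ?thesis
    unfolding obs_law_def
    apply (subst density_density_eq[OF W L])
  proof (rule density_cong[OF W'])
    show "(\<lambda>z. ennreal (if snd z then \<eta> (fst z) else 1 - \<eta> (fst z)) * ennreal (likelihood_ratio \<eta> \<eta>' z)) \<in> borel_measurable (M \<Otimes>\<^sub>M count_space UNIV)"
      using W L by measurable
    show "AE z in M \<Otimes>\<^sub>M count_space UNIV. ennreal (if snd z then \<eta>' (fst z) else 1 - \<eta>' (fst z))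
      = ennreal (if snd z then \<eta> (fst z) else 1 - \<eta> (fst z)) * ennreal (likelihood_ratio \<eta> \<eta>' z)"
    proof (rule AE_I2)
      fix z assume "z \<in> space (M \<Otimes>\<^sub>M count_space (UNIV :: bool set))"
      then have "fst z \<in> unit_cube" by (auto simp: space_pair_measure b(2))
      from \<eta>(2)[OF this] \<eta>'(2)[OF this]
      show "ennreal (if snd z then \<eta>' (fst z) else 1 - \<eta>' (fst z))
      = ennreal (if snd z then \<eta> (fst z) else 1 - \<eta> (fst z)) * ennreal (likelihood_ratio \<eta> \<eta>' z)"
        by (simp add: likelihood_ratio_def flip: ennreal_mult)
    qed
  qed
qed

lemma cube_integrable:
  fixes f :: "real^'d \<Rightarrow> real"
  assumes "f \<in> borel_measurable cube_space" "\<And>x. x \<in> unit_cube \<Longrightarrow> \<bar>f x\<bar> \<le> B"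
  shows "integrable M f"
proof -
  note b = obs_law_base[OF M]
  interpret prob_space M by (rule b(4))
  show ?thesis
  proof (rule integrable_const_bound[of _ B])
    show "f \<in> borel_measurable M" by (subst measurable_cong_sets[OF b(3) refl]) (rule assms(1))
  qed (use assms(2) in \<open>auto simp: b(2) intro!: AE_I2\<close>)
qed

text \<open>Multiplied by its own probability, each of the two labels contributes the difference of
  the regression functions.\<close>

lemma likelihood_ratio_l1:
  "(\<integral>z. \<bar>likelihood_ratio \<eta> \<eta>' z - 1\<bar> \<partial>obs_law M \<eta>) = (\<integral>x. 2 * \<bar>\<eta>' x - \<eta> x\<bar> \<partial>M)"
proof -
  note [measurable] = likelihood_ratio_props(1)
  have "(\<integral>z. \<bar>likelihood_ratio \<eta> \<eta>' z - 1\<bar> \<partial>obs_law M \<eta>) =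
    (\<integral>x. \<eta> x * \<bar>likelihood_ratio \<eta> \<eta>' (x, True) - 1\<bar> + (1 - \<eta> x) * \<bar>likelihood_ratio \<eta> \<eta>' (x, False) - 1\<bar> \<partial>M)"
    by (rule integral_obs_law[OF M \<eta>(1) regression_values_unit(1)]) auto
  also have "\<dots> = (\<integral>x. 2 * \<bar>\<eta>' x - \<eta> x\<bar> \<partial>M)"
  proof (rule Bochner_Integration.integral_cong[OF refl])
    fix x assume "x \<in> space M"
    then have x: "x \<in> unit_cube" by (simp add: obs_law_base[OF M])
    have p: "0 < \<eta> x" "0 < 1 - \<eta> x" using \<eta>(2)[OF x] by auto
    have "\<eta> x * \<bar>likelihood_ratio \<eta> \<eta>' (x, True) - 1\<bar> = \<bar>\<eta> x * (likelihood_ratio \<eta> \<eta>' (x, True) - 1)\<bar>"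
      using p by (simp add: abs_mult)
    also have "\<eta> x * (likelihood_ratio \<eta> \<eta>' (x, True) - 1) = \<eta>' x - \<eta> x"
      using p by (simp add: likelihood_ratio_def right_diff_distrib)
    finally have 1: "\<eta> x * \<bar>likelihood_ratio \<eta> \<eta>' (x, True) - 1\<bar> = \<bar>\<eta>' x - \<eta> x\<bar>" .
    have "(1 - \<eta> x) * \<bar>likelihood_ratio \<eta> \<eta>' (x, False) - 1\<bar> = \<bar>(1 - \<eta> x) * (likelihood_ratio \<eta> \<eta>' (x, False) - 1)\<bar>"
      using p by (simp add: abs_mult)
    also have "(1 - \<eta> x) * (likelihood_ratio \<eta> \<eta>' (x, False) - 1) = (1 - \<eta> x) * likelihood_ratio \<eta> \<eta>' (x, False) - (1 - \<eta> x)"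
      by (simp add: right_diff_distrib)
    also have "(1 - \<eta> x) * likelihood_ratio \<eta> \<eta>' (x, False) = 1 - \<eta>' x"
      using p by (simp add: likelihood_ratio_def)
    finally have "(1 - \<eta> x) * \<bar>likelihood_ratio \<eta> \<eta>' (x, False) - 1\<bar> = \<bar>\<eta>' x - \<eta> x\<bar>"
      by (simp add: abs_minus_commute)
    with 1 show "\<eta> x * \<bar>likelihood_ratio \<eta> \<eta>' (x, True) - 1\<bar> + (1 - \<eta> x) * \<bar>likelihood_ratio \<eta> \<eta>' (x, False) - 1\<bar> = 2 * \<bar>\<eta>' x - \<eta> x\<bar>"
      by simp
  qed
  finally show ?thesis .
qed

text \<open>Given the feature, the chi-square distance of labels with success probabilities a and b
  is (b - a)^2 / (a (1 - a)), and both factors of the denominator are at least 1/4.\<close>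

lemma likelihood_ratio_l2:
  "(\<integral>z. likelihood_ratio \<eta> \<eta>' z ^ 2 \<partial>obs_law M \<eta>) \<le> 1 + (\<integral>x. 16 * (\<eta>' x - \<eta> x) ^ 2 \<partial>M)"
proof -
  interpret prob_space M by (rule obs_law_base(4)[OF M])
  note [measurable] = likelihood_ratio_props(1) \<eta>(1) \<eta>'(1)
  define f where "f x = \<eta> x * likelihood_ratio \<eta> \<eta>' (x, True) ^ 2 + (1 - \<eta> x) * likelihood_ratio \<eta> \<eta>' (x, False) ^ 2" for x
  have fb: "f x \<le> 1 + 16 * (\<eta>' x - \<eta> x)^2" if x: "x \<in> unit_cube" for x
  proof -
    define a b where "a = \<eta> x" and "b = \<eta>' x"
    have a: "1/4 \<le> a" "a \<le> 3/4" using \<eta>(2)[OF x] by (auto simp: a_def)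
    have "f x = b^2 / a + (1 - b)^2 / (1 - a)"
      using a by (simp add: f_def likelihood_ratio_def power2_eq_square flip: a_def b_def)
    also have "\<dots> = (b^2 * (1 - a) + (1 - b)^2 * a) / (a * (1 - a))"
      using a by (subst add_frac_eq) auto
    also have "b^2 * (1 - a) + (1 - b)^2 * a = a * (1 - a) + (b - a)^2"
      by (simp add: power2_eq_square algebra_simps)
    also have "(a * (1 - a) + (b - a)^2) / (a * (1 - a)) = 1 + (b - a)^2 / (a * (1 - a))"
      using a by (simp add: add_divide_distrib)
    finally have eq: "f x = 1 + (b - a)^2 / (a * (1 - a))" .
    have "(b - a)^2 / (a * (1 - a)) \<le> (b - a)^2 / (1/16)"
    proof (rule divide_left_mono)
      have "1/4 * (1/4) \<le> a * (1 - a)" using a by (intro mult_mono) auto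
      then show "1/16 \<le> a * (1 - a)" by simp
      then show "0 < a * (1 - a) * (1/16)" by simp
    qed simp
    then show ?thesis unfolding eq by (simp add: a_def b_def)
  qed
  have sq1: "(\<eta>' x - \<eta> x)^2 \<le> 1" if "x \<in> unit_cube" for x
    unfolding abs_square_le_1 using \<eta>(2)[OF that] \<eta>'(2)[OF that] by linarith
  have i2: "integrable M (\<lambda>x. 16 * (\<eta>' x - \<eta> x)^2)"
    by (rule cube_integrable[of _ 16]) (use sq1 in auto)
  have "(\<integral>z. likelihood_ratio \<eta> \<eta>' z ^ 2 \<partial>obs_law M \<eta>) = (\<integral>x. f x \<partial>M)"
    unfolding f_def by (rule integral_obs_law[OF M \<eta>(1) regression_values_unit(1)]) auto
  also have "\<dots> \<le> (\<integral>x. 1 + 16 * (\<eta>' x - \<eta> x)^2 \<partial>M)"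
    using i2 fb sq1 regression_values_unit by (intro integral_mono_AE') (auto simp: obs_law_base[OF M] intro!: AE_I2)
  also have "\<dots> = 1 + (\<integral>x. 16 * (\<eta>' x - \<eta> x)^2 \<partial>M)"
    using i2 by (subst Bochner_Integration.integral_add) (auto simp: prob_space)
  finally show ?thesis .
qed

end

section \<open>The uniform law on the grid support\<close>

text \<open>The restriction places the law on \<open>cube_space\<close>, where observations take
  their features; \<open>X_marginal_grid\<close> returns to the density on the whole space.\<close>

definition grid_law :: "nat \<Rightarrow> real \<Rightarrow> (real^'d::finite) measure" where
  "grid_law q \<theta> = restrict_space (density lborel (\<lambda>x. ennreal (indicator (grid_support q \<theta>) x / \<theta> ^ CARD('d)))) unit_cube"

lemma obs_law_prob_fst:
  fixes M :: "(real^'d::finite) measure"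
  assumes M: "M \<in> space (prob_algebra cube_space)"
    and \<eta>: "\<eta> \<in> borel_measurable cube_space" "\<And>x. x \<in> unit_cube \<Longrightarrow> 0 \<le> \<eta> x \<and> \<eta> x \<le> 1"
    and B: "B \<in> sets cube_space"
  shows "emeasure (obs_law M \<eta>) {z \<in> space (obs_law M \<eta>). fst z \<in> B} = emeasure M B"
proof -
  have P: "obs_law M \<eta> \<in> space (prob_algebra obs_space)" by (rule obs_law_prob_algebra[OF M \<eta>])
  note s = obs_law_facts(2)[OF P]
  have fm: "fst \<in> obs_law M \<eta> \<rightarrow>\<^sub>M cube_space"
    by (subst measurable_cong_sets[OF s refl]) (rule measurable_fst_obs)
  have S: "{z \<in> space (obs_law M \<eta>). fst z \<in> B} \<in> sets (obs_law M \<eta>)"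
    using measurable_sets[OF fm B] by (simp add: vimage_def Int_def conj_commute)
  have "emeasure (obs_law M \<eta>) {z \<in> space (obs_law M \<eta>). fst z \<in> B}
     = (\<integral>\<^sup>+z. indicator {z \<in> space (obs_law M \<eta>). fst z \<in> B} z \<partial>obs_law M \<eta>)" using S by simp
  also have "\<dots> = (\<integral>\<^sup>+z. indicator B (fst z) \<partial>obs_law M \<eta>)"
    by (rule nn_integral_cong) (simp add: indicator_def)
  also have "\<dots> = (\<integral>\<^sup>+x. indicator B x \<partial>M)"
    by (rule nn_integral_obs_law_fst[OF M \<eta> borel_measurable_indicator[OF B]])
  also have "\<dots> = emeasure M B" using B M by (simp add: space_prob_algebra)
  finally show ?thesis .
qed

context
  fixes q :: nat and \<theta> :: real
  assumes q: "0 < q" and \<theta>: "0 < \<theta>" "\<theta> < 1"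
begin

lemma grid_support_borel: "(grid_support q \<theta> :: (real^'d::finite) set) \<in> sets borel"
  by (rule borel_compact[OF compact_grid_support[OF q]])

lemma emeasure_grid_density:
  fixes B :: "(real^'d::finite) set"
  assumes B: "B \<in> sets borel"
  shows "emeasure (density lborel (\<lambda>x. ennreal (indicator (grid_support q \<theta>) x / \<theta> ^ CARD('d)))) B
    = ennreal (measure lborel (grid_support q \<theta> \<inter> B) / \<theta> ^ CARD('d))"
proof -
  note [measurable] = grid_support_borel B
  have fin: "emeasure lborel (grid_support q \<theta> \<inter> B) < \<infinity>"
  proof -
    have "emeasure lborel (grid_support q \<theta> \<inter> B) \<le> emeasure lborel (grid_support q \<theta> :: (real^'d) set)"
      by (rule emeasure_mono) auto
    also have "\<dots> < \<infinity>" using emeasure_compact_finite[OF compact_grid_support[OF q]] by simp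
    finally show ?thesis .
  qed
  have "emeasure (density lborel (\<lambda>x. ennreal (indicator (grid_support q \<theta>) x / \<theta> ^ CARD('d)))) B
    = (\<integral>\<^sup>+x. ennreal (1 / \<theta> ^ CARD('d)) * indicator (grid_support q \<theta> \<inter> B) x \<partial>lborel)"
    by (subst emeasure_density) (auto intro!: nn_integral_cong simp: indicator_def)
  also have "\<dots> = ennreal (1 / \<theta> ^ CARD('d)) * emeasure lborel (grid_support q \<theta> \<inter> B)"
    by (rule nn_integral_cmult_indicator) simp
  also have "\<dots> = ennreal (measure lborel (grid_support q \<theta> \<inter> B) / \<theta> ^ CARD('d))"
    using fin \<theta> by (subst emeasure_eq_ennreal_measure) (auto simp flip: ennreal_mult)
  finally show ?thesis .
qed

lemma emeasure_grid_law:
  fixes B :: "(real^'d::finite) set"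
  assumes B: "B \<in> sets cube_space"
  shows "emeasure (grid_law q \<theta>) B = ennreal (measure lborel (grid_support q \<theta> \<inter> B) / \<theta> ^ CARD('d))"
proof -
  have B': "B \<subseteq> unit_cube" "B \<in> sets borel"
    using B sets.sets_into_space[OF B] by (auto simp: cube_space_def sets_restrict_space_iff)
  have "emeasure (grid_law q \<theta>) B = emeasure (density lborel (\<lambda>x. ennreal (indicator (grid_support q \<theta>) x / \<theta> ^ CARD('d)))) B"
    unfolding grid_law_def by (rule emeasure_restrict_space) (use B' in auto)
  then show ?thesis using emeasure_grid_density[OF B'(2)] by simp
qed

lemma grid_law_prob_algebra: "(grid_law q \<theta> :: (real^'d::finite) measure) \<in> space (prob_algebra cube_space)"
proof -
  have s: "sets (grid_law q \<theta> :: (real^'d) measure) = sets cube_space"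
    unfolding grid_law_def cube_space_def by (rule sets_restrict_space_cong) simp
  have sp: "space (grid_law q \<theta> :: (real^'d) measure) = unit_cube" using sets_eq_imp_space_eq[OF s] by simp
  have U: "unit_cube \<in> sets (cube_space :: (real^'d) measure)" using sets.top[of "cube_space :: (real^'d) measure"] by simp
  have "grid_support q \<theta> \<inter> unit_cube = (grid_support q \<theta> :: (real^'d) set)"
    using grid_support_subset_cube[OF q \<theta>(2)] by auto
  then have "emeasure (grid_law q \<theta> :: (real^'d) measure) unit_cube = 1"
    using emeasure_grid_law[OF U] content_grid_support[OF q _ \<theta>(2), where 'd = 'd] \<theta> by simp
  then have "prob_space (grid_law q \<theta> :: (real^'d) measure)" by (intro prob_spaceI) (simp add: sp)
  then show ?thesis using s by (simp add: space_prob_algebra)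
qed

lemma grid_law_facts:
  shows "sets (grid_law q \<theta> :: (real^'d::finite) measure) = sets cube_space"
    "space (grid_law q \<theta> :: (real^'d::finite) measure) = unit_cube"
    "prob_space (grid_law q \<theta> :: (real^'d::finite) measure)"
  using grid_law_prob_algebra[where 'd = 'd] sets_eq_imp_space_eq[of "grid_law q \<theta> :: (real^'d) measure" cube_space]
  by (auto simp: space_prob_algebra)

lemma grid_law_AE: "AE x in (grid_law q \<theta> :: (real^'d::finite) measure). x \<in> grid_support q \<theta>"
proof (rule AE_I')
  have B: "unit_cube - grid_support q \<theta> \<in> sets (cube_space :: (real^'d) measure)"
    unfolding cube_space_def by (simp add: sets_restrict_space_iff sets.Diff[OF unit_cube_borel grid_support_borel])
  have "grid_support q \<theta> \<inter> (unit_cube - grid_support q \<theta>) = ({} :: (real^'d) set)" by auto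
  then have "emeasure (grid_law q \<theta> :: (real^'d) measure) (unit_cube - grid_support q \<theta>) = 0"
    using emeasure_grid_law[OF B] by simp
  then show "unit_cube - grid_support q \<theta> \<in> null_sets (grid_law q \<theta> :: (real^'d) measure)"
    using B by (simp add: null_sets_def grid_law_facts)
qed (auto simp: grid_law_facts)

lemma inner_cell_sets:
  assumes "\<forall>i. k i < q"
  shows "inner_cell q \<theta> k \<in> sets (cube_space :: (real^'d::finite) measure)" "inner_cell q \<theta> k \<subseteq> grid_support q \<theta>"
proof -
  show sub: "inner_cell q \<theta> k \<subseteq> grid_support q \<theta>" using assms unfolding grid_support_eq by auto
  then have "inner_cell q \<theta> k \<subseteq> unit_cube" using grid_support_subset_cube[OF q \<theta>(2)] by blast
  then show "inner_cell q \<theta> k \<in> sets (cube_space :: (real^'d) measure)"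
    unfolding cube_space_def using borel_compact[OF compact_inner_cell[OF q]] by (simp add: sets_restrict_space_iff)
qed

text \<open>The normalisation cancels \<theta>: each small cube carries the mass that a full cell
  has under the uniform law on the unit cube.\<close>

lemma measure_grid_law_inner_cell:
  assumes "\<forall>i. k i < q"
  shows "measure (grid_law q \<theta> :: (real^'d::finite) measure) (inner_cell q \<theta> k) = (1 / real q) ^ CARD('d)"
proof -
  have "grid_support q \<theta> \<inter> inner_cell q \<theta> k = inner_cell q \<theta> k" using inner_cell_sets(2)[OF assms] by auto
  then have "emeasure (grid_law q \<theta>) (inner_cell q \<theta> k) = ennreal ((\<theta> / real q) ^ CARD('d) / \<theta> ^ CARD('d))"
    using emeasure_grid_law[OF inner_cell_sets(1)[OF assms]] content_inner_cell[OF q, of \<theta> k] \<theta> by simp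
  then show ?thesis using \<theta> by (simp add: measure_def power_divide)
qed

context
  fixes \<eta> :: "real^'d::finite \<Rightarrow> real"
  assumes \<eta>: "\<eta> \<in> borel_measurable cube_space" "\<And>x. x \<in> unit_cube \<Longrightarrow> 0 \<le> \<eta> x \<and> \<eta> x \<le> 1"
begin

lemma X_marginal_grid:
  "X_marginal (obs_law (grid_law q \<theta>) \<eta>) = density lborel (\<lambda>x. ennreal (indicator (grid_support q \<theta>) x / \<theta> ^ CARD('d)))"
proof (rule measure_eqI)
  fix B assume "B \<in> sets (X_marginal (obs_law (grid_law q \<theta>) \<eta>))"
  then have B: "B \<in> sets borel" by (simp add: X_marginal_def)
  have BU: "B \<inter> unit_cube \<in> sets cube_space" using B by (simp add: cube_space_def sets_restrict_space_iff)
  have P: "obs_law (grid_law q \<theta>) \<eta> \<in> space (prob_algebra obs_space)" by (rule obs_law_prob_algebra[OF grid_law_prob_algebra \<eta>])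
  have fm: "fst \<in> obs_law (grid_law q \<theta>) \<eta> \<rightarrow>\<^sub>M borel"
    by (subst measurable_cong_sets[OF obs_law_facts(2)[OF P] refl])
       (rule measurable_compose[OF measurable_fst_obs measurable_cube_space_id])
  have "emeasure (X_marginal (obs_law (grid_law q \<theta>) \<eta>)) B
     = emeasure (obs_law (grid_law q \<theta>) \<eta>) {z \<in> space (obs_law (grid_law q \<theta>) \<eta>). fst z \<in> B \<inter> unit_cube}"
    unfolding X_marginal_def using obs_law_facts(3)[OF P]
    by (subst emeasure_distr[OF fm B]) (auto intro!: arg_cong[of _ _ "emeasure (obs_law (grid_law q \<theta>) \<eta>)"])
  also have "\<dots> = emeasure (grid_law q \<theta>) (B \<inter> unit_cube)" by (rule obs_law_prob_fst[OF grid_law_prob_algebra \<eta> BU])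
  also have "\<dots> = ennreal (measure lborel (grid_support q \<theta> \<inter> (B \<inter> unit_cube)) / \<theta> ^ CARD('d))"
    by (rule emeasure_grid_law[OF BU])
  also have "grid_support q \<theta> \<inter> (B \<inter> unit_cube) = grid_support q \<theta> \<inter> B"
    using grid_support_subset_cube[OF q \<theta>(2)] by auto
  also have "ennreal (measure lborel (grid_support q \<theta> \<inter> B) / \<theta> ^ CARD('d))
     = emeasure (density lborel (\<lambda>x. ennreal (indicator (grid_support q \<theta>) x / \<theta> ^ CARD('d)))) B"
    by (rule emeasure_grid_density[OF B, symmetric])
  finally show "emeasure (X_marginal (obs_law (grid_law q \<theta>) \<eta>)) B
    = emeasure (density lborel (\<lambda>x. ennreal (indicator (grid_support q \<theta>) x / \<theta> ^ CARD('d)))) B" .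
qed (simp add: X_marginal_def)

lemma support_grid: "measure_support (X_marginal (obs_law (grid_law q \<theta>) \<eta>)) = grid_support q \<theta>"
proof
  show "grid_support q \<theta> \<subseteq> measure_support (X_marginal (obs_law (grid_law q \<theta>) \<eta>))"
  proof
    fix x :: "real^'d" assume x: "x \<in> grid_support q \<theta>"
    show "x \<in> measure_support (X_marginal (obs_law (grid_law q \<theta>) \<eta>))"
      unfolding measure_support_def X_marginal_grid
    proof (intro CollectI allI impI)
      fix U :: "(real^'d) set" assume U: "open U" "x \<in> U"
      then obtain e where e: "0 < e" "ball x e \<subseteq> U" by (meson open_contains_ball)
      \<comment> \<open>The radius \<open>e\<close> serves as its own bound in place of
        \<open>r\<mu>\<close>, since positivity is all that is asked for here.\<close>
      have "0 < (\<theta> * min (1 / (4 * real CARD('d))) (1 / e) * e) ^ CARD('d)" using \<theta> e by (simp add: min_def)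
      also have "\<dots> \<le> measure lborel (grid_support q \<theta> \<inter> ball x e)" by (rule grid_support_ball[OF q \<theta> x e(1) order_refl])
      also have "\<dots> \<le> measure lborel (grid_support q \<theta> \<inter> U)"
        by (rule content_mono_bounded)
           (use e U grid_support_borel in \<open>auto intro: bounded_subset[OF compact_imp_bounded[OF compact_grid_support[OF q]]]\<close>)
      finally show "0 < emeasure (density lborel (\<lambda>x. ennreal (indicator (grid_support q \<theta>) x / \<theta> ^ CARD('d)))) U"
        using U \<theta> by (subst emeasure_grid_density) auto
    qed
  qed
  show "measure_support (X_marginal (obs_law (grid_law q \<theta>) \<eta>)) \<subseteq> grid_support q \<theta>"
  proof (rule subsetI, rule ccontr)
    fix x assume x: "x \<in> measure_support (X_marginal (obs_law (grid_law q \<theta>) \<eta>))" "x \<notin> grid_support q \<theta>"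
    have o: "open (- grid_support q \<theta> :: (real^'d) set)"
      by (rule open_Compl[OF compact_imp_closed[OF compact_grid_support[OF q]]])
    have "grid_support q \<theta> \<inter> - grid_support q \<theta> = ({} :: (real^'d) set)" by auto
    then have "emeasure (X_marginal (obs_law (grid_law q \<theta>) \<eta>)) (- grid_support q \<theta>) = 0"
      unfolding X_marginal_grid using o by (subst emeasure_grid_density) auto
    then show False using x o unfolding measure_support_def by auto
  qed
qed

end

end

section \<open>The bump laws belong to the class\<close>

lemma maxnorm_borel [measurable]: "maxnorm \<in> borel_measurable (borel :: (real^'d::finite) measure)"
proof (rule borel_measurableI_le)
  fix a :: real
  have "{x \<in> space (borel :: (real^'d) measure). maxnorm x \<le> a} = {x \<in> space borel. \<forall>i. \<bar>x $ i\<bar> \<le> a}"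
    by (simp add: maxnorm_le_iff)
  also have "\<dots> \<in> sets borel" by measurable
  finally show "{x \<in> space (borel :: (real^'d) measure). maxnorm x \<le> a} \<in> sets borel" .
qed

lemma height_borel: "bump_height q w c \<beta> r \<in> borel_measurable (borel :: (real^'d::finite) measure)"
proof (cases r)
  case None
  show ?thesis unfolding None bump_height_def[abs_def] option.case by measurable
next
  case (Some k)
  show ?thesis unfolding Some bump_height_def[abs_def] option.case by measurable
qed

text \<open>On the unit cube the region takes finitely many values, each on a measurable set, so the
  function is a finite combination of measurable ones.\<close>

lemma region_dependent_measurable:
  fixes f :: "('d \<Rightarrow> nat) option \<Rightarrow> real^'d::finite \<Rightarrow> real"
  assumes f: "\<And>r. f r \<in> borel_measurable borel"
  shows "(\<lambda>x. f (region q w x) x) \<in> borel_measurable cube_space"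
proof -
  have [measurable]: "f r \<in> borel_measurable cube_space" for r by (rule borel_measurable_cube_spaceI[OF f])
  have "(\<lambda>x. if \<exists>i. real w \<le> real q * x $ i then f None x else (\<Sum>k\<in>cells q. of_bool (cell q x = k) * f (Some k) x)) \<in> borel_measurable cube_space"
    by measurable
  moreover have eq: "f (region q w x) x = (if \<exists>i. real w \<le> real q * x $ i then f None x else (\<Sum>k\<in>cells q. of_bool (cell q x = k) * f (Some k) x))"
    if "x \<in> space cube_space" for x
  proof -
    have "(\<Sum>k\<in>cells q. of_bool (cell q x = k) * f (Some k) x) = (\<Sum>k\<in>cells q. if k = cell q x then f (Some k) x else 0)"
      by (intro sum.cong) auto
    also have "\<dots> = f (Some (cell q x)) x" using cell_in_cells[of x q] that by simp
    finally show ?thesis by (simp add: region_def)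
  qed
  ultimately show ?thesis by (subst measurable_cong[OF eq])
qed

lemma bump_regression_measurable: "bump_regression q w c \<beta> C \<gamma> \<sigma> \<in> borel_measurable cube_space"
  unfolding bump_regression_def[abs_def]
  by (rule region_dependent_measurable[where f = "\<lambda>r x. 1/2 + region_sign \<sigma> r * (C * bump_height q w c \<beta> r x powr \<gamma>)"])
     (use height_borel in measurable)

definition bump_family :: "nat \<Rightarrow> nat \<Rightarrow> real \<Rightarrow> real \<Rightarrow> real \<Rightarrow> (nat \<Rightarrow> real) \<Rightarrow> (nat \<Rightarrow> real) \<Rightarrow> ('d \<Rightarrow> nat) set \<Rightarrow> nat \<Rightarrow> ('d::finite) obs measure" where
  "bump_family q w \<theta> c \<beta> Cs \<gamma> \<sigma> j = obs_law (grid_law q \<theta>) (bump_regression q w c \<beta> ((Cs(0 := 1)) j) ((\<gamma>(0 := 1)) j) \<sigma>)"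

context
  fixes q w :: nat and c \<beta> :: real
  assumes q: "0 < q" and c: "0 < c" and \<beta>: "0 < \<beta>" "\<beta> \<le> 1"
begin

lemma bump_regression_dist:
  assumes "0 < C"
  shows "\<bar>bump_regression q w c \<beta> C \<gamma> \<sigma> x - 1/2\<bar> = C * bump_height q w c \<beta> (region q w x) x powr \<gamma>"
  using assms by (simp add: bump_regression_def abs_mult)

lemma bump_regression_bounds:
  assumes C: "0 < C" "0 < \<gamma>" "C * c powr \<gamma> \<le> 1/4" and x: "x \<in> unit_cube"
  shows "1/4 \<le> bump_regression q w c \<beta> C \<gamma> \<sigma> x \<and> bump_regression q w c \<beta> C \<gamma> \<sigma> x \<le> 3/4"
proof -
  have "C * bump_height q w c \<beta> (region q w x) x powr \<gamma> \<le> C * c powr \<gamma>"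
    using C height_nonneg[OF q c \<beta>] height_le[OF q c \<beta> x] by (intro mult_left_mono powr_mono2) auto
  then have "\<bar>bump_regression q w c \<beta> C \<gamma> \<sigma> x - 1/2\<bar> \<le> 1/4"
    using C(3) unfolding bump_regression_dist[OF C(1)] by linarith
  then show ?thesis by linarith
qed

lemma bump_regression_one:
  "bump_regression q w c \<beta> 1 1 \<sigma> x = 1/2 + region_sign \<sigma> (region q w x) * bump_height q w c \<beta> (region q w x) x"
  using height_nonneg[OF q c \<beta>, of w "region q w x" x] by (simp add: bump_regression_def)

lemma sgn_bump_regression:
  assumes "0 < C"
  shows "sgn (bump_regression q w c \<beta> C \<gamma> \<sigma> x - 1/2) = sgn (bump_regression q w c \<beta> 1 1 \<sigma> x - 1/2)"
proof (cases "bump_height q w c \<beta> (region q w x) x = 0")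
  case True
  then show ?thesis by (simp add: bump_regression_def)
next
  case False
  then have "0 < bump_height q w c \<beta> (region q w x) x" using height_nonneg[OF q c \<beta>, of w "region q w x" x] by simp
  then show ?thesis using assms by (simp add: bump_regression_def sgn_mult)
qed

text \<open>If some point of the support has height at most t, then t is at least of order
  q^(-\<beta>). For t \<le> c all such points lie in a corner cube of side w/q + (t/c)^(1/\<beta>).
  The first term is of order q^(-\<alpha> \<beta> / d), the second is at most (t/c)^(\<alpha>/d)
  because \<alpha> \<beta> \<le> d; so the side is of order (t/c)^(\<alpha>/d) and the volume of
  order t^\<alpha>.\<close>

lemma grid_margin:
  fixes \<theta> \<alpha> t :: real and \<sigma> :: "('d::finite \<Rightarrow> nat) set"
  assumes b: "\<And>x. x \<in> unit_cube \<Longrightarrow> 0 \<le> bump_regression q w c \<beta> 1 1 \<sigma> x \<and> bump_regression q w c \<beta> 1 1 \<sigma> x \<le> 1"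
    and \<theta>: "0 < \<theta>" "\<theta> < 1" and \<alpha>: "0 \<le> \<alpha>" "\<alpha> * \<beta> \<le> real CARD('d)"
    and w: "real w / real q \<le> 2 * (1 / real q) powr (\<alpha> * \<beta> / real CARD('d))"
    and t: "0 < t"
  shows "measure (obs_law (grid_law q \<theta>) (bump_regression q w c \<beta> 1 1 \<sigma>))
      {z \<in> space (obs_law (grid_law q \<theta>) (bump_regression q w c \<beta> 1 1 \<sigma>)).
         \<bar>bump_regression q w c \<beta> 1 1 \<sigma> (fst z) - 1/2\<bar> \<le> t}
    \<le> ((1 + 4 / (1 - \<theta>)) / \<theta>) ^ CARD('d) * c powr (- \<alpha>) * t powr \<alpha>"
    (is "measure ?P ?S \<le> _")
proof -
  define d where "d = real CARD('d)"
  have d: "1 \<le> d" unfolding d_def using zero_less_card_finite[where 'a='d] by linarith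
  \<comment> \<open>The side of the corner cube in units of
    \<open>(t / c) powr (\<alpha> / d)\<close>: 1 from the growing outer profile, the rest from
    \<open>w / q\<close>.\<close>
  define E where "E = 1 + 4 / (1 - \<theta>)"
  have E1: "1 \<le> E" using \<theta> by (simp add: E_def)
  have E\<theta>: "1 \<le> (E / \<theta>) ^ CARD('d)" using E1 \<theta> by (intro one_le_power) simp
  have ct: "c powr (- \<alpha>) * t powr \<alpha> = (t / c) powr \<alpha>" using c t by (simp add: powr_minus powr_divide divide_simps)
  note M = grid_law_prob_algebra[OF q \<theta>, where 'd = 'd]
  note bm = bump_regression_measurable[of q w c \<beta> 1 1 \<sigma>]
  have P: "?P \<in> space (prob_algebra obs_space)" by (rule obs_law_prob_algebra[OF M bm b])
  interpret prob_space ?P by (rule obs_law_facts(1)[OF P])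
  have bd: "\<bar>bump_regression q w c \<beta> 1 1 \<sigma> x - 1/2\<bar> = bump_height q w c \<beta> (region q w x) x" for x :: "real^'d"
    using height_nonneg[OF q c \<beta>, of w "region q w x" x] by (simp add: bump_regression_dist)
  show ?thesis
  proof (cases "c < t")
    case True
    have "measure ?P ?S \<le> 1" by (rule prob_le_1)
    also have "1 \<le> (t / c) powr \<alpha>" using True c \<alpha> by (intro ge_one_powr_ge_zero) auto
    also have "\<dots> \<le> (E / \<theta>) ^ CARD('d) * (t / c) powr \<alpha>" using mult_right_mono[OF E\<theta>, of "(t / c) powr \<alpha>"] by simp
    finally show ?thesis by (simp add: E_def mult.assoc ct)
  next
    case False
    define B where "B = {x \<in> unit_cube. \<bar>bump_regression q w c \<beta> 1 1 \<sigma> x - 1/2\<bar> \<le> t}"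
    have B: "B \<in> sets (cube_space :: (real^'d) measure)"
    proof -
      note [measurable] = bm
      have "{x \<in> space cube_space. \<bar>bump_regression q w c \<beta> 1 1 \<sigma> x - 1/2\<bar> \<le> t} \<in> sets (cube_space :: (real^'d) measure)"
        by measurable
      then show ?thesis by (simp add: B_def)
    qed
    have "?S = {z \<in> space ?P. fst z \<in> B}" using obs_law_facts(3)[OF P] by (auto simp: B_def)
    then have "emeasure ?P ?S = emeasure (grid_law q \<theta>) B" using obs_law_prob_fst[OF M bm b B] by simp
    also have "\<dots> = ennreal (measure lborel (grid_support q \<theta> \<inter> B) / \<theta> ^ CARD('d))"
      by (rule emeasure_grid_law[OF q \<theta> B])
    finally have mS: "measure ?P ?S = measure lborel (grid_support q \<theta> \<inter> B) / \<theta> ^ CARD('d)"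
      using \<theta> by (simp add: measure_def)
    \<comment> \<open>The depth at which a profile reaches the height \<open>t\<close>.\<close>
    define y where "y = (t / c) powr (1 / \<beta>)"
    have y0: "0 < y" using t c by (simp add: y_def)
    have yb: "y powr \<beta> = t / c" using t c \<beta> by (simp add: y_def powr_powr)
    have hle: "h \<le> y" if "c * h powr \<beta> \<le> t" "0 \<le> h" for h
    proof (rule ccontr)
      assume "\<not> h \<le> y"
      then have "y powr \<beta> < h powr \<beta>" using y0 \<beta> by (intro powr_less_mono2) auto
      then show False using that c by (simp add: yb field_simps)
    qed
    show ?thesis
    proof (cases "(grid_support q \<theta> \<inter> B :: (real^'d) set) = {}")
      case True
      then show ?thesis using mS \<theta> E1 by (simp add: E_def flip: E_def)
    next
      case False
      then obtain x0 :: "real^'d" where x0: "x0 \<in> grid_support q \<theta>" "x0 \<in> B" by auto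
      have "c * ((1 - \<theta>) / (2 * real q)) powr \<beta> \<le> t"
        using height_ge[OF q c \<beta> x0(1) \<theta>(2), of w] x0(2) by (simp add: B_def bd)
      then have "(1 - \<theta>) / (2 * real q) \<le> y" by (rule hle) (use \<theta> in simp)
      then have qy: "1 / real q \<le> 2 / (1 - \<theta>) * y" using \<theta> q by (simp add: field_simps)
      have tc: "t / c \<le> 1" using \<open>\<not> c < t\<close> c by simp
      define \<rho> where "\<rho> = (t / c) powr (\<alpha> / d)"
      have \<rho>0: "0 \<le> \<rho>" by (simp add: \<rho>_def)
      have y\<rho>: "y \<le> \<rho>"
        unfolding y_def \<rho>_def using tc t c \<alpha> \<beta> d by (intro powr_mono') (auto simp: field_simps d_def)
      have ab: "0 \<le> \<alpha> * \<beta> / d" "\<alpha> * \<beta> / d \<le> 1" using \<alpha> \<beta> d by (auto simp: d_def)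
      have "(1 / real q) powr (\<alpha> * \<beta> / d) \<le> (2 / (1 - \<theta>) * y) powr (\<alpha> * \<beta> / d)"
        using qy ab by (intro powr_mono2) auto
      also have "\<dots> = (2 / (1 - \<theta>)) powr (\<alpha> * \<beta> / d) * y powr (\<alpha> * \<beta> / d)" by (rule powr_mult)
      also have "y powr (\<alpha> * \<beta> / d) = \<rho>" using \<beta> by (simp add: y_def \<rho>_def powr_powr)
      also have "(2 / (1 - \<theta>)) powr (\<alpha> * \<beta> / d) * \<rho> \<le> (2 / (1 - \<theta>)) powr 1 * \<rho>"
        using \<theta> ab \<rho>0 by (intro mult_right_mono powr_mono) auto
      finally have "(1 / real q) powr (\<alpha> * \<beta> / d) \<le> 2 / (1 - \<theta>) * \<rho>" using \<theta> by simp
      then have wl: "real w / real q \<le> 4 / (1 - \<theta>) * \<rho>" using w by (simp add: d_def)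
      define l where "l = real w / real q + y"
      have l0: "0 \<le> l" using y0 by (simp add: l_def)
      have "grid_support q \<theta> \<inter> B \<subseteq> cbox (0 :: real^'d) (\<chi> i. (0 :: real^'d) $ i + l)"
      proof
        fix x :: "real^'d" assume "x \<in> grid_support q \<theta> \<inter> B"
        then have x: "x \<in> unit_cube" and ht: "bump_height q w c \<beta> (region q w x) x \<le> t" by (auto simp: B_def bd)
        have "maxnorm x \<le> l"
        proof (cases "region q w x")
          case None
          then have "c * max 0 (maxnorm x - real w / real q) powr \<beta> \<le> t" using ht by (simp add: bump_height_def)
          then have "max 0 (maxnorm x - real w / real q) \<le> y" by (rule hle) simp
          then show ?thesis by (simp add: l_def)
        next
          case (Some k)
          then have "real q * x $ i \<le> real w" for i by (auto simp: region_def not_le split: if_splits intro: less_imp_le)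
          then have "x $ i \<le> real w / real q" for i using q by (simp add: field_simps)
          moreover have "0 \<le> x $ i" for i using x by (simp add: unit_cube_def)
          ultimately have "maxnorm x \<le> real w / real q" by (simp add: maxnorm_le_iff)
          then show ?thesis using y0 by (simp add: l_def)
        qed
        then have "\<bar>x $ i\<bar> \<le> l" for i by (simp add: maxnorm_le_iff)
        then have "x $ i \<le> l" for i by (meson abs_le_D1)
        moreover have "0 \<le> x $ i" for i using x by (simp add: unit_cube_def)
        ultimately show "x \<in> cbox 0 (\<chi> i. (0 :: real^'d) $ i + l)" by (simp add: mem_box_cart)
      qed
      then have "measure lborel (grid_support q \<theta> \<inter> B) \<le> measure lborel (cbox (0 :: real^'d) (\<chi> i. (0 :: real^'d) $ i + l))"
        by (rule content_mono_bounded)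
           (use B grid_support_borel[OF q \<theta>, where 'd = 'd] in \<open>auto simp: cube_space_def sets_restrict_space_iff\<close>)
      also have "\<dots> = l ^ CARD('d)" by (rule content_cube[OF l0])
      also have "\<dots> \<le> (E * \<rho>) ^ CARD('d)"
        using l0 wl y\<rho> by (intro power_mono) (auto simp: l_def E_def distrib_right)
      also have "\<dots> = E ^ CARD('d) * (t / c) powr \<alpha>"
      proof -
        have "\<rho> ^ CARD('d) = (t / c) powr \<alpha>"
          using t c d by (simp add: \<rho>_def powr_powr d_def flip: powr_realpow)
        then show ?thesis by (simp add: power_mult_distrib)
      qed
      finally have "measure ?P ?S \<le> E ^ CARD('d) * (t / c) powr \<alpha> / \<theta> ^ CARD('d)"
        unfolding mS using \<theta> by (intro divide_right_mono) auto
      then show ?thesis by (simp add: E_def power_divide mult.assoc ct)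
    qed
  qed
qed

text \<open>\<open>cL\<close> is for the Hoelder condition, \<open>c4\<close> keeps the regression
  functions away from 0 and 1, \<open>g\<close> bounds the constant density 1/\<theta>^d, and
  \<open>C\<alpha>\<close> and \<open>c\<mu>\<close> are the constants of \<open>grid_margin\<close>
  and \<open>regular_grid_support\<close>.\<close>

lemma bump_family_in_class:
  fixes \<gamma> Cs :: "nat \<Rightarrow> real" and \<theta> \<alpha> :: real
  assumes \<theta>: "0 < \<theta>" "\<theta> < 1" and \<alpha>: "0 \<le> \<alpha>" "\<alpha> * \<beta> \<le> real CARD('d)"
    and w: "real w / real q \<le> 2 * (1 / real q) powr (\<alpha> * \<beta> / real CARD('d))"
    and \<gamma>: "\<And>j. j \<in> {1..m} \<Longrightarrow> 0 < \<gamma> j" and Cs: "\<And>j. j \<in> {1..m} \<Longrightarrow> 0 < Cs j"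
    and cL: "2 * c \<le> L" and c4: "c \<le> 1/4" "\<And>j. j \<in> {1..m} \<Longrightarrow> Cs j * c powr \<gamma> j \<le> 1/4"
    and g: "gmin \<le> 1 / \<theta> ^ CARD('d)" "1 / \<theta> ^ CARD('d) \<le> gmax"
    and C\<alpha>: "((1 + 4 / (1 - \<theta>)) / \<theta>) ^ CARD('d) * c powr (- \<alpha>) \<le> C\<alpha>"
    and c\<mu>: "c\<mu> \<le> (\<theta> * min (1 / (4 * real CARD('d))) (1 / r\<mu>)) ^ CARD('d) / unit_ball_vol (real CARD('d))"
  shows "(bump_family q w \<theta> c \<beta> Cs \<gamma> \<sigma> :: nat \<Rightarrow> ('d::finite) obs measure)
     \<in> transfer_class m \<alpha> \<beta> \<gamma> L C\<alpha> Cs gmin gmax c\<mu> r\<mu>"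
proof -
  define \<eta> :: "nat \<Rightarrow> real^'d \<Rightarrow> real" where "\<eta> j = bump_regression q w c \<beta> ((Cs(0 := 1)) j) ((\<gamma>(0 := 1)) j) \<sigma>" for j
  have \<gamma>': "0 < (\<gamma>(0 := 1)) j" and Cs': "0 < (Cs(0 := 1)) j" and cc: "(Cs(0 := 1)) j * c powr (\<gamma>(0 := 1)) j \<le> 1/4" if "j \<le> m" for j
    using \<gamma>[of j] Cs[of j] c4(1) c4(2)[of j] c that by (cases "j = 0"; simp)+
  note M = grid_law_prob_algebra[OF q \<theta>, where 'd = 'd]
  have \<eta>m: "\<eta> j \<in> borel_measurable cube_space" for j unfolding \<eta>_def by (rule bump_regression_measurable)
  have \<eta>b: "0 \<le> \<eta> j x \<and> \<eta> j x \<le> 1" if "j \<le> m" "x \<in> unit_cube" for j x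
  proof -
    have "1/4 \<le> \<eta> j x \<and> \<eta> j x \<le> 3/4"
      unfolding \<eta>_def by (rule bump_regression_bounds[OF Cs'[OF that(1)] \<gamma>'[OF that(1)] cc[OF that(1)] that(2)])
    then show ?thesis by auto
  qed
  have P: "bump_family q w \<theta> c \<beta> Cs \<gamma> \<sigma> j = obs_law (grid_law q \<theta>) (\<eta> j)" for j by (simp add: bump_family_def \<eta>_def)
  have \<eta>0: "\<eta> 0 = bump_regression q w c \<beta> 1 1 \<sigma>" by (simp add: \<eta>_def)
  show ?thesis
    unfolding transfer_class_def
  proof (intro CollectI conjI allI impI ballI exI[of _ \<eta>] exI[of _ "grid_support q \<theta>"])
    fix j assume j: "j \<le> m"
    show "bump_family q w \<theta> c \<beta> Cs \<gamma> \<sigma> j \<in> space (prob_algebra (obs_space :: 'd obs measure))"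
      unfolding P by (rule obs_law_prob_algebra[OF M \<eta>m \<eta>b[OF j]])
    show "regression_fun (bump_family q w \<theta> c \<beta> Cs \<gamma> \<sigma> j) (\<eta> j)"
      unfolding P by (rule regression_fun_obs_law[OF M \<eta>m \<eta>b[OF j]])
    show "measure_support (X_marginal (bump_family q w \<theta> c \<beta> Cs \<gamma> \<sigma> j)) = (grid_support q \<theta> :: (real^'d) set)"
      unfolding P by (rule support_grid[OF q \<theta> \<eta>m \<eta>b[OF j]])
    have "X_marginal (bump_family q w \<theta> c \<beta> Cs \<gamma> \<sigma> j) = density lborel (\<lambda>x :: real^'d. ennreal (indicator (grid_support q \<theta>) x / \<theta> ^ CARD('d)))"
      unfolding P by (rule X_marginal_grid[OF q \<theta> \<eta>m \<eta>b[OF j]])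
    moreover have "(\<lambda>x :: real^'d. indicator (grid_support q \<theta>) x / \<theta> ^ CARD('d)) \<in> borel_measurable borel"
      using grid_support_borel[OF q \<theta>, where 'd = 'd] by simp
    ultimately show "\<exists>g. g \<in> borel_measurable borel \<and>
        X_marginal (bump_family q w \<theta> c \<beta> Cs \<gamma> \<sigma> j) = density lborel (\<lambda>x :: real^'d. ennreal (g x)) \<and>
        (\<forall>x\<in>grid_support q \<theta>. gmin \<le> g x \<and> g x \<le> gmax) \<and> (\<forall>x. x \<notin> grid_support q \<theta> \<longrightarrow> g x = 0)"
      using g by (intro exI[of _ "\<lambda>x :: real^'d. indicator (grid_support q \<theta>) x / \<theta> ^ CARD('d)"]) simp
  next
    fix j and x :: "real^'d" assume j: "j \<in> {1..m}" and x: "x \<in> unit_cube"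
    then have jm: "j \<le> m" "j \<noteq> 0" by auto
    show "sgn (\<eta> j x - 1 / 2) = sgn (\<eta> 0 x - 1 / 2)"
      unfolding \<eta>0 unfolding \<eta>_def by (rule sgn_bump_regression[OF Cs'[OF jm(1)]])
    show "Cs j * \<bar>\<eta> 0 x - 1 / 2\<bar> powr \<gamma> j \<le> \<bar>\<eta> j x - 1 / 2\<bar>"
      unfolding \<eta>0 unfolding \<eta>_def bump_regression_dist[OF Cs'[OF jm(1)]] bump_regression_dist[OF zero_less_one]
      using jm height_nonneg[OF q c \<beta>, of w "region q w x" x] by simp
  next
    fix x y :: "real^'d" assume x: "x \<in> unit_cube" and y: "y \<in> unit_cube"
    have "\<bar>\<eta> 0 x - \<eta> 0 y\<bar> \<le> 2 * c * norm (x - y) powr \<beta>"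
      unfolding \<eta>0 bump_regression_one using signed_height_holder[OF q c \<beta> x y, of \<sigma> w] by simp
    also have "\<dots> \<le> L * norm (x - y) powr \<beta>" using cL by (intro mult_right_mono) auto
    finally show "\<bar>\<eta> 0 x - \<eta> 0 y\<bar> \<le> L * norm (x - y) powr \<beta>" .
  next
    fix t :: real assume t: "0 < t"
    have "measure (bump_family q w \<theta> c \<beta> Cs \<gamma> \<sigma> 0) {z \<in> space (bump_family q w \<theta> c \<beta> Cs \<gamma> \<sigma> 0). \<bar>\<eta> 0 (fst z) - 1 / 2\<bar> \<le> t}
      \<le> ((1 + 4 / (1 - \<theta>)) / \<theta>) ^ CARD('d) * c powr (- \<alpha>) * t powr \<alpha>"
      unfolding P \<eta>0 by (rule grid_margin[OF \<eta>b[of 0, unfolded \<eta>0] \<theta> \<alpha> w t]) auto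
    also have "\<dots> \<le> C\<alpha> * t powr \<alpha>" by (rule mult_right_mono[OF C\<alpha>]) simp
    finally show "measure (bump_family q w \<theta> c \<beta> Cs \<gamma> \<sigma> 0) {z \<in> space (bump_family q w \<theta> c \<beta> Cs \<gamma> \<sigma> 0). \<bar>\<eta> 0 (fst z) - 1 / 2\<bar> \<le> t}
      \<le> C\<alpha> * t powr \<alpha>" .
  next
    show "(grid_support q \<theta> :: (real^'d) set) \<subseteq> unit_cube" by (rule grid_support_subset_cube[OF q \<theta>(2)])
    show "compact (grid_support q \<theta> :: (real^'d) set)" by (rule compact_grid_support[OF q])
    show "regular_set c\<mu> r\<mu> (grid_support q \<theta> :: (real^'d) set)" by (rule regular_grid_support[OF q \<theta> c\<mu>])
  qed
qed

text \<open>Flipping the sign of cell \<open>k\<close> changes the regression function by at most 2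
  v, on one small cube of mass q^(-d), where v is the largest height of a bump for this server. The
  alternatives of \<open>small\<close> select the chi-square or the privacy argument; 128 is the 64
  of the chi-square bound times the 2 in \<open>sample_law_chi_step\<close>.\<close>

lemma bump_step:
  fixes \<theta> C \<gamma> s \<epsilon> \<delta> :: real and k :: "'d::finite \<Rightarrow> nat" and n :: nat
  assumes \<theta>: "0 < \<theta>" "\<theta> < 1" and C: "0 < C" "0 < \<gamma>" "C * c powr \<gamma> \<le> 1/4"
    and k: "\<And>i. k i < w" and wq: "w \<le> q" and s: "0 < s" "s \<le> 1" and \<epsilon>\<delta>: "0 < \<epsilon>" "0 < \<delta>"
    and small: "real n * (128 * (C * (c * (1 / real q) powr \<beta>) powr \<gamma>)^2 * (1 / real q) ^ CARD('d)) \<le> s^2 \<or>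
       real n * ((2 * \<epsilon> + \<delta>) * (4 * (C * (c * (1 / real q) powr \<beta>) powr \<gamma>) * (1 / real q) ^ CARD('d))) \<le> s"
    and F: "unit_valued (sample_space n) F"
    and osc: "\<And>z z'. z \<in> space (sample_space n) \<Longrightarrow> z' \<in> space (sample_space n) \<Longrightarrow> adjacent n z z' \<Longrightarrow>
        \<bar>F z - F z'\<bar> \<le> 2 * \<epsilon> + \<delta>"
  shows "\<bar>(\<integral>z. F z \<partial>sample_law n (obs_law (grid_law q \<theta>) (bump_regression q w c \<beta> C \<gamma> \<sigma>)))
     - (\<integral>z. F z \<partial>sample_law n (obs_law (grid_law q \<theta>) (bump_regression q w c \<beta> C \<gamma> (insert k \<sigma>))))\<bar> \<le> s"
proof -
  define \<eta> where "\<eta> = bump_regression q w c \<beta> C \<gamma> \<sigma>"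
  define \<eta>' where "\<eta>' = bump_regression q w c \<beta> C \<gamma> (insert k \<sigma>)"
  define v where "v = C * (c * (1 / real q) powr \<beta>) powr \<gamma>"
  have v: "0 \<le> v" using C by (simp add: v_def)
  define M :: "(real^'d) measure" where "M = grid_law q \<theta>"
  have M: "M \<in> space (prob_algebra cube_space)" unfolding M_def by (rule grid_law_prob_algebra[OF q \<theta>])
  interpret M: prob_space M using M by (simp add: space_prob_algebra)
  have \<eta>: "\<eta> \<in> borel_measurable cube_space" "\<And>x. x \<in> unit_cube \<Longrightarrow> 1/4 \<le> \<eta> x \<and> \<eta> x \<le> 3/4"
    unfolding \<eta>_def by (rule bump_regression_measurable, rule bump_regression_bounds[OF C])
  have \<eta>': "\<eta>' \<in> borel_measurable cube_space" "\<And>x. x \<in> unit_cube \<Longrightarrow> 1/4 \<le> \<eta>' x \<and> \<eta>' x \<le> 3/4"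
    unfolding \<eta>'_def by (rule bump_regression_measurable, rule bump_regression_bounds[OF C])
  have e01: "0 \<le> \<eta> x \<and> \<eta> x \<le> 1" "0 \<le> \<eta>' x \<and> \<eta>' x \<le> 1" if "x \<in> unit_cube" for x
    using \<eta>(2)[OF that] \<eta>'(2)[OF that] by auto
  have kq: "\<forall>i. k i < q" using k wq by (meson order_less_le_trans)
  note cellm = measure_grid_law_inner_cell[OF q \<theta> kq, folded M_def]
  have cells: "inner_cell q \<theta> k \<in> sets M"
    using inner_cell_sets(1)[OF q \<theta> kq] M by (simp add: space_prob_algebra)
  have diff: "AE x in M. \<bar>\<eta>' x - \<eta> x\<bar> \<le> 2 * v * indicator (inner_cell q \<theta> k) x"
    using grid_law_AE[OF q \<theta>, where 'd = 'd] unfolding M_def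
  proof (rule AE_mp, intro AE_I2 impI)
    fix x :: "real^'d" assume x: "x \<in> grid_support q \<theta>"
    have eq: "\<eta>' x - \<eta> x = (region_sign (insert k \<sigma>) (region q w x) - region_sign \<sigma> (region q w x)) * (C * bump_height q w c \<beta> (region q w x) x powr \<gamma>)"
      by (simp add: \<eta>_def \<eta>'_def bump_regression_def algebra_simps)
    show "\<bar>\<eta>' x - \<eta> x\<bar> \<le> 2 * v * indicator (inner_cell q \<theta> k) x"
    proof (cases "region q w x = Some k")
      case True
      then have "cell q x = k" by (simp add: region_def split: if_splits)
      then have "x \<in> inner_cell q \<theta> k" using grid_support_cell(2)[OF q c \<beta> x \<theta>(2)] by (simp add: inner_cell_def)
      moreover have "\<bar>region_sign (insert k \<sigma>) (region q w x) - region_sign \<sigma> (region q w x)\<bar> \<le> 2"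
        using region_sign_cases[of "insert k \<sigma>" "region q w x"] region_sign_cases[of \<sigma> "region q w x"] by auto
      moreover have "C * bump_height q w c \<beta> (region q w x) x powr \<gamma> \<le> v"
        unfolding v_def True using C height_nonneg[OF q c \<beta>] height_Some_le[OF q c \<beta>, of w k x] by (intro mult_left_mono powr_mono2) auto
      ultimately show ?thesis
        unfolding eq abs_mult using C by (auto intro!: mult_mono)
    next
      case False
      then have "region_sign (insert k \<sigma>) (region q w x) = region_sign \<sigma> (region q w x)"
        by (auto simp: region_sign_def split: option.splits)
      then show ?thesis unfolding eq using v by simp
    qed
  qed
  have ind: "integrable M (\<lambda>x. a * indicator (inner_cell q \<theta> k) x)" for a :: real
    using cells by (intro integrable_mult_right integrable_real_indicator) (auto simp: less_top[symmetric])
  have l1: "(\<integral>x. 2 * \<bar>\<eta>' x - \<eta> x\<bar> \<partial>M) \<le> 4 * v * (1 / real q) ^ CARD('d)"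
  proof -
    have "(\<integral>x. 2 * \<bar>\<eta>' x - \<eta> x\<bar> \<partial>M) \<le> (\<integral>x. 4 * v * indicator (inner_cell q \<theta> k) x \<partial>M)"
    proof (rule integral_mono_AE'[OF ind])
      show "AE x in M. 2 * \<bar>\<eta>' x - \<eta> x\<bar> \<le> 4 * v * indicator (inner_cell q \<theta> k) x" using diff by (rule AE_mp) (auto intro!: AE_I2)
    qed (use v in \<open>auto simp: indicator_def\<close>)
    also have "\<dots> = 4 * v * (1 / real q) ^ CARD('d)" using cells by (simp add: cellm sets.Int_space_eq2)
    finally show ?thesis .
  qed
  have l2: "(\<integral>x. 16 * (\<eta>' x - \<eta> x)^2 \<partial>M) \<le> 64 * v^2 * (1 / real q) ^ CARD('d)"
  proof -
    have "(\<integral>x. 16 * (\<eta>' x - \<eta> x)^2 \<partial>M) \<le> (\<integral>x. 64 * v^2 * indicator (inner_cell q \<theta> k) x \<partial>M)"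
    proof (rule integral_mono_AE'[OF ind])
      show "AE x in M. 16 * (\<eta>' x - \<eta> x)^2 \<le> 64 * v^2 * indicator (inner_cell q \<theta> k) x"
        using diff
      proof (rule AE_mp, intro AE_I2 impI)
        fix x assume "\<bar>\<eta>' x - \<eta> x\<bar> \<le> 2 * v * indicator (inner_cell q \<theta> k) x"
        then have "\<bar>\<eta>' x - \<eta> x\<bar>^2 \<le> (2 * v * indicator (inner_cell q \<theta> k) x)^2" by (intro power_mono) auto
        then show "16 * (\<eta>' x - \<eta> x)^2 \<le> 64 * v^2 * indicator (inner_cell q \<theta> k) x"
          by (cases "x \<in> inner_cell q \<theta> k") (simp_all add: power_mult_distrib)
      qed
    qed (use v in \<open>auto simp: indicator_def\<close>)
    also have "\<dots> = 64 * v^2 * (1 / real q) ^ CARD('d)" using cells by (simp add: cellm sets.Int_space_eq2)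
    finally show ?thesis .
  qed
  define P where "P = obs_law M \<eta>"
  define R where "R = likelihood_ratio \<eta> \<eta>'"
  have P: "P \<in> space (prob_algebra obs_space)" unfolding P_def by (rule obs_law_prob_algebra[OF M \<eta>(1) e01(1)])
  have P'eq: "obs_law M \<eta>' = density P (\<lambda>z. ennreal (R z))" unfolding P_def R_def by (rule obs_law_ratio[OF M \<eta> \<eta>'])
  have P': "density P (\<lambda>z. ennreal (R z)) \<in> space (prob_algebra obs_space)"
    unfolding P'eq[symmetric] by (rule obs_law_prob_algebra[OF M \<eta>'(1) e01(2)])
  have R: "R \<in> borel_measurable obs_space" "\<And>z. z \<in> space obs_space \<Longrightarrow> 0 \<le> R z" "\<And>z. z \<in> space obs_space \<Longrightarrow> R z \<le> 3"
    unfolding R_def using likelihood_ratio_props[OF M \<eta> \<eta>'] by blast+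
  have "\<bar>(\<integral>z. F z \<partial>sample_law n P) - (\<integral>z. F z \<partial>sample_law n (density P (\<lambda>z. ennreal (R z))))\<bar> \<le> s"
    using small unfolding v_def[symmetric]
  proof
    assume sm: "real n * (128 * v^2 * (1 / real q) ^ CARD('d)) \<le> s^2"
    show ?thesis
    proof (rule sample_law_chi_step[OF P P' R _ s _ _ F])
      show "(\<integral>z. R z ^ 2 \<partial>P) \<le> 1 + 64 * v^2 * (1 / real q) ^ CARD('d)"
        unfolding P_def R_def using likelihood_ratio_l2[OF M \<eta> \<eta>'] l2 by linarith
      show "2 * (real n * (64 * v^2 * (1 / real q) ^ CARD('d))) \<le> s^2" using sm by (simp add: mult_ac)
      show "0 \<le> 64 * v^2 * (1 / real q) ^ CARD('d)" by (intro mult_nonneg_nonneg) auto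
    qed
  next
    assume sm: "real n * ((2 * \<epsilon> + \<delta>) * (4 * v * (1 / real q) ^ CARD('d))) \<le> s"
    have "(\<integral>z. \<bar>R z - 1\<bar> \<partial>P) \<le> 4 * v * (1 / real q) ^ CARD('d)"
      unfolding P_def R_def by (rule ord_eq_le_trans[OF likelihood_ratio_l1[OF M \<eta> \<eta>'] l1])
    from sample_law_osc_step[OF P P' R this _ F osc] \<epsilon>\<delta> sm show ?thesis by simp
  qed
  then show ?thesis unfolding P'eq[symmetric] by (simp add: P_def M_def \<eta>_def \<eta>'_def)
qed

end


section \<open>The lower bound\<close>

text \<open>Pairs each sign pattern with the one that differs from it at \<open>k\<close> only, as
  Assouad's argument requires.\<close>

lemma sum_Pow_split:
  fixes f :: "'a set \<Rightarrow> real"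
  assumes K: "finite K" and k: "k \<in> K"
  shows "(\<Sum>\<sigma>\<in>Pow K. f \<sigma>) = (\<Sum>\<sigma>\<in>Pow (K - {k}). f \<sigma> + f (insert k \<sigma>))"
proof -
  have "Pow K = Pow (K - {k}) \<union> insert k ` Pow (K - {k})"
    using k by (metis Pow_insert insert_Diff)
  then have "(\<Sum>\<sigma>\<in>Pow K. f \<sigma>) = (\<Sum>\<sigma>\<in>Pow (K - {k}). f \<sigma>) + (\<Sum>\<sigma>\<in>insert k ` Pow (K - {k}). f \<sigma>)"
    using K by (simp only:) (rule sum.union_disjoint, auto)
  also have "(\<Sum>\<sigma>\<in>insert k ` Pow (K - {k}). f \<sigma>) = (\<Sum>\<sigma>\<in>Pow (K - {k}). f (insert k \<sigma>))"
  proof (subst sum.reindex)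
    show "inj_on (insert k) (Pow (K - {k}))" by (rule inj_onI) (auto dest: insert_ident[THEN iffD1, rotated 2])
  qed simp
  finally show ?thesis by (simp add: sum.distrib)
qed

context
  fixes q w m :: nat and c \<beta> \<theta> :: real
    and \<gamma> Cs \<epsilon> \<delta> :: "nat \<Rightarrow> real" and n :: "nat \<Rightarrow> nat"
    and p :: "('d::finite, 't) protocol"
  assumes q: "0 < q" and c: "0 < c" and \<beta>: "0 < \<beta>" "\<beta> \<le> 1" and \<theta>: "0 < \<theta>" "\<theta> < 1"
    and wq: "w \<le> q"
    and \<gamma>: "\<And>j. j \<le> m \<Longrightarrow> 0 < (\<gamma>(0 := 1)) j" and Cs: "\<And>j. j \<le> m \<Longrightarrow> 0 < (Cs(0 := 1)) j"
    and c4: "\<And>j. j \<le> m \<Longrightarrow> (Cs(0 := 1)) j * c powr (\<gamma>(0 := 1)) j \<le> 1/4"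
    and \<epsilon>\<delta>: "\<And>j. j \<le> m \<Longrightarrow> 0 < \<epsilon> j" "\<And>j. j \<le> m \<Longrightarrow> 0 < \<delta> j"
    and p: "p \<in> private_protocols m n \<epsilon> \<delta>"
    and small: "\<And>j. j \<le> m \<Longrightarrow>
       real (n j) * (128 * ((Cs(0 := 1)) j * (c * (1 / real q) powr \<beta>) powr (\<gamma>(0 := 1)) j)^2 * (1 / real q) ^ CARD('d)) \<le> (1 / (2 * real (Suc m)))^2 \<or>
       real (n j) * ((2 * \<epsilon> j + \<delta> j) * (4 * ((Cs(0 := 1)) j * (c * (1 / real q) powr \<beta>) powr (\<gamma>(0 := 1)) j) * (1 / real q) ^ CARD('d))) \<le> 1 / (2 * real (Suc m))"
begin

abbreviation "bump_laws \<sigma> \<equiv> (bump_family q w \<theta> c \<beta> Cs \<gamma> \<sigma> :: nat \<Rightarrow> 'd obs measure)"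

lemma bump_laws_prob_algebra:
  assumes "j \<le> m" shows "bump_laws \<sigma> j \<in> space (prob_algebra obs_space)"
  unfolding bump_family_def
proof (rule obs_law_prob_algebra[OF grid_law_prob_algebra[OF q \<theta>] bump_regression_measurable])
  fix x :: "real^'d" assume x: "x \<in> unit_cube"
  show "0 \<le> bump_regression q w c \<beta> ((Cs(0 := 1)) j) ((\<gamma>(0 := 1)) j) \<sigma> x \<and> bump_regression q w c \<beta> ((Cs(0 := 1)) j) ((\<gamma>(0 := 1)) j) \<sigma> x \<le> 1"
    using bump_regression_bounds[OF q c \<beta> Cs[OF assms] \<gamma>[OF assms] c4[OF assms] x, where w = w and \<sigma> = \<sigma>] by auto
qed

lemma bump_laws_final_law: "final_law m n p (bump_laws \<sigma>) \<in> space (prob_algebra (fin_space p))"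
  by (rule final_law_prob_algebra[OF p]) (rule bump_laws_prob_algebra)

text \<open>Each of the m + 1 servers has the budget 1 / (2 (m + 1)).\<close>

lemma bump_laws_tv:
  assumes k: "\<And>i. k i < w" and B: "B \<in> sets (fin_space p)"
  shows "\<bar>measure (final_law m n p (bump_laws \<sigma>)) B - measure (final_law m n p (bump_laws (insert k \<sigma>))) B\<bar> \<le> 1/2"
proof -
  define s where "s = 1 / (2 * real (Suc m))"
  have s: "0 < s" "s \<le> 1" by (auto simp: s_def)
  have "\<bar>measure (final_law m n p (bump_laws \<sigma>)) B - measure (final_law m n p (bump_laws (insert k \<sigma>))) B\<bar> \<le> (\<Sum>j\<le>m. s)"
  proof (rule protocol_hybrid[OF p \<epsilon>\<delta> bump_laws_prob_algebra bump_laws_prob_algebra _ B])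
    fix j and F :: "(nat \<Rightarrow> 'd obs) \<Rightarrow> real"
    assume j: "j \<le> m" and F: "unit_valued (sample_space (n j)) F"
      and osc: "\<And>z z'. z \<in> space (sample_space (n j)) \<Longrightarrow> z' \<in> space (sample_space (n j)) \<Longrightarrow> adjacent (n j) z z' \<Longrightarrow> \<bar>F z - F z'\<bar> \<le> 2 * \<epsilon> j + \<delta> j"
    show "\<bar>(\<integral>z. F z \<partial>sample_law (n j) (bump_laws \<sigma> j)) - (\<integral>z. F z \<partial>sample_law (n j) (bump_laws (insert k \<sigma>) j))\<bar> \<le> s"
      unfolding bump_family_def
      by (rule bump_step[OF q c \<beta> \<theta> Cs[OF j] \<gamma>[OF j] c4[OF j] k wq s \<epsilon>\<delta>(1)[OF j] \<epsilon>\<delta>(2)[OF j] small[OF j, folded s_def] F osc])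
  qed
  also have "(\<Sum>j\<le>m. s) = 1/2" by (simp add: s_def field_simps)
  finally show ?thesis .
qed

definition wrong_prob :: "('d \<Rightarrow> nat) set \<Rightarrow> real^'d \<Rightarrow> bool \<Rightarrow> real" where
  "wrong_prob \<sigma> x b = measure (final_law m n p (bump_laws \<sigma>)) {T \<in> space (final_law m n p (bump_laws \<sigma>)). classifier p (T, x) \<noteq> b}"

lemma classifier_set:
  assumes x: "x \<in> unit_cube"
  shows "{T \<in> space (final_law m n p (bump_laws \<sigma>)). classifier p (T, x) \<noteq> b} \<in> sets (fin_space p)"
    "space (final_law m n p (bump_laws \<sigma>)) = space (fin_space p)"
proof -
  have s: "sets (final_law m n p (bump_laws \<sigma>)) = sets (fin_space p)" using bump_laws_final_law by (simp add: space_prob_algebra)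
  show sp: "space (final_law m n p (bump_laws \<sigma>)) = space (fin_space p)" by (rule sets_eq_imp_space_eq[OF s])
  have cl: "classifier p \<in> fin_space p \<Otimes>\<^sub>M cube_space \<rightarrow>\<^sub>M count_space UNIV"
    using p by (simp add: private_protocols_def)
  have "(\<lambda>T. (T, x)) \<in> fin_space p \<rightarrow>\<^sub>M fin_space p \<Otimes>\<^sub>M cube_space" using x by simp
  from measurable_compose[OF this cl] have [measurable]: "(\<lambda>T. classifier p (T, x)) \<in> fin_space p \<rightarrow>\<^sub>M count_space UNIV" .
  show "{T \<in> space (final_law m n p (bump_laws \<sigma>)). classifier p (T, x) \<noteq> b} \<in> sets (fin_space p)"
    unfolding sp by measurable
qed

lemma wrong_prob_bounds: "0 \<le> wrong_prob \<sigma> x b" "wrong_prob \<sigma> x b \<le> 1"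
proof -
  interpret prob_space "final_law m n p (bump_laws \<sigma>)" using bump_laws_final_law by (simp add: space_prob_algebra)
  show "0 \<le> wrong_prob \<sigma> x b" "wrong_prob \<sigma> x b \<le> 1" unfolding wrong_prob_def by auto
qed

text \<open>Le Cam's two-point bound at a single feature: the error probabilities under two
  hypotheses add up to at least one minus their total variation distance.\<close>

lemma wrong_prob_pair:
  assumes x: "x \<in> unit_cube" and k: "\<And>i. k i < w"
  shows "1/2 \<le> wrong_prob \<sigma> x False + wrong_prob (insert k \<sigma>) x True"
proof -
  define B where "B = {T \<in> space (fin_space p). classifier p (T, x)}"
  have B: "B \<in> sets (fin_space p)" using classifier_set(1)[OF x, of \<sigma> False] by (simp add: B_def classifier_set(2)[OF x])
  interpret F: prob_space "final_law m n p (bump_laws (insert k \<sigma>))" using bump_laws_final_law by (simp add: space_prob_algebra)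
  have B': "B \<in> sets (final_law m n p (bump_laws (insert k \<sigma>)))" using B bump_laws_final_law[of "insert k \<sigma>"] by (simp add: space_prob_algebra)
  have e1: "wrong_prob \<sigma> x False = measure (final_law m n p (bump_laws \<sigma>)) B"
    unfolding wrong_prob_def B_def classifier_set(2)[OF x] by simp
  have "wrong_prob (insert k \<sigma>) x True = measure (final_law m n p (bump_laws (insert k \<sigma>))) (space (final_law m n p (bump_laws (insert k \<sigma>))) - B)"
    unfolding wrong_prob_def B_def classifier_set(2)[OF x] by (rule arg_cong[of _ _ "measure _"]) auto
  also have "\<dots> = 1 - measure (final_law m n p (bump_laws (insert k \<sigma>))) B" by (rule F.prob_compl[OF B'])
  finally have e2: "wrong_prob (insert k \<sigma>) x True = 1 - measure (final_law m n p (bump_laws (insert k \<sigma>))) B" .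
  have "\<bar>measure (final_law m n p (bump_laws \<sigma>)) B - measure (final_law m n p (bump_laws (insert k \<sigma>))) B\<bar> \<le> 1/2"
    by (rule bump_laws_tv[OF _ B]) (rule k)
  then show ?thesis using e1 e2 by linarith
qed

lemma wrong_prob_measurable: "(\<lambda>x. wrong_prob \<sigma> x b) \<in> borel_measurable cube_space"
proof -
  interpret F: prob_space "final_law m n p (bump_laws \<sigma>)" using bump_laws_final_law by (simp add: space_prob_algebra)
  have s: "sets (final_law m n p (bump_laws \<sigma>)) = sets (fin_space p)" using bump_laws_final_law by (simp add: space_prob_algebra)
  have "classifier p \<in> fin_space p \<Otimes>\<^sub>M cube_space \<rightarrow>\<^sub>M count_space UNIV"
    using p by (simp add: private_protocols_def)
  then have cl: "classifier p \<in> final_law m n p (bump_laws \<sigma>) \<Otimes>\<^sub>M cube_space \<rightarrow>\<^sub>M count_space UNIV"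
    by (subst measurable_cong_sets[OF sets_pair_measure_cong[OF s refl] refl])
  have "(\<lambda>y. (snd y, fst y)) \<in> cube_space \<Otimes>\<^sub>M final_law m n p (bump_laws \<sigma>) \<rightarrow>\<^sub>M final_law m n p (bump_laws \<sigma>) \<Otimes>\<^sub>M cube_space" by simp
  from measurable_compose[OF this cl]
  have [measurable]: "(\<lambda>y. classifier p (snd y, fst y)) \<in> cube_space \<Otimes>\<^sub>M final_law m n p (bump_laws \<sigma>) \<rightarrow>\<^sub>M count_space UNIV" .
  define Q where "Q = {y \<in> space (cube_space \<Otimes>\<^sub>M final_law m n p (bump_laws \<sigma>)). classifier p (snd y, fst y) \<noteq> b}"
  have Q: "Q \<in> sets (cube_space \<Otimes>\<^sub>M final_law m n p (bump_laws \<sigma>))" unfolding Q_def by measurable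
  have "(\<lambda>x. emeasure (final_law m n p (bump_laws \<sigma>)) (Pair x -` Q)) \<in> borel_measurable cube_space"
    by (rule F.measurable_emeasure_Pair[OF Q])
  then have "(\<lambda>x. measure (final_law m n p (bump_laws \<sigma>)) (Pair x -` Q)) \<in> borel_measurable cube_space"
    unfolding measure_def by simp
  moreover have eq: "wrong_prob \<sigma> x b = measure (final_law m n p (bump_laws \<sigma>)) (Pair x -` Q)" if "x \<in> space cube_space" for x
    unfolding wrong_prob_def Q_def using that by (auto simp: space_pair_measure intro!: arg_cong[of _ _ "measure (final_law m n p (bump_laws \<sigma>))"])
  ultimately show ?thesis by (subst measurable_cong[OF eq])
qed

definition cell_err :: "('d \<Rightarrow> nat) set \<Rightarrow> ('d \<Rightarrow> nat) \<Rightarrow> real" where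
  "cell_err \<sigma> k = (\<integral>x. indicator (inner_cell q \<theta> k) x * wrong_prob \<sigma> x (k \<in> \<sigma>) \<partial>grid_law q \<theta>)"

lemma cell_err_integrable:
  assumes k: "\<And>i. k i < w"
  shows "integrable (grid_law q \<theta>) (\<lambda>x. indicator (inner_cell q \<theta> k) x * wrong_prob \<sigma> x b)"
proof -
  have kq: "\<forall>i. k i < q" using k wq by (meson order_less_le_trans)
  note [measurable] = wrong_prob_measurable inner_cell_sets(1)[OF q \<theta> kq]
  interpret M: prob_space "grid_law q \<theta> :: (real^'d) measure" by (rule grid_law_facts(3)[OF q \<theta>])
  show ?thesis
  proof (rule M.integrable_const_bound[of _ 1])
    show "AE x in grid_law q \<theta>. norm (indicator (inner_cell q \<theta> k) x * wrong_prob \<sigma> x b) \<le> 1"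
      using wrong_prob_bounds by (intro AE_I2) (auto simp: indicator_def abs_le_iff intro: order_trans[of _ 0])
    show "(\<lambda>x. indicator (inner_cell q \<theta> k) x * wrong_prob \<sigma> x b) \<in> borel_measurable (grid_law q \<theta>)"
      by (subst measurable_cong_sets[OF grid_law_facts(1)[OF q \<theta>] refl]) measurable
  qed
qed

lemma cell_err_pair:
  assumes k: "\<And>i. k i < w" "k \<notin> \<sigma>"
  shows "(1 / real q) ^ CARD('d) / 2 \<le> cell_err \<sigma> k + cell_err (insert k \<sigma>) k"
proof -
  have kq: "\<forall>i. k i < q" using k wq by (meson order_less_le_trans)
  have cells: "inner_cell q \<theta> k \<in> sets (grid_law q \<theta> :: (real^'d) measure)"
    using inner_cell_sets(1)[OF q \<theta> kq] by (simp add: grid_law_facts(1)[OF q \<theta>])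
  interpret M: prob_space "grid_law q \<theta> :: (real^'d) measure" by (rule grid_law_facts(3)[OF q \<theta>])
  have "(1 / real q) ^ CARD('d) / 2 = (\<integral>x. 1/2 * indicator (inner_cell q \<theta> k) x \<partial>grid_law q \<theta>)"
    using cells measure_grid_law_inner_cell[OF q \<theta> kq] by (simp add: sets.Int_space_eq2)
  also have "\<dots> \<le> (\<integral>x. indicator (inner_cell q \<theta> k) x * wrong_prob \<sigma> x False + indicator (inner_cell q \<theta> k) x * wrong_prob (insert k \<sigma>) x True \<partial>grid_law q \<theta>)"
  proof (rule integral_mono)
    show "integrable (grid_law q \<theta>) (\<lambda>x. 1/2 * indicator (inner_cell q \<theta> k) x :: real)"
      using cells by (intro integrable_mult_right integrable_real_indicator) (auto simp: less_top[symmetric])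
    show "integrable (grid_law q \<theta>) (\<lambda>x. indicator (inner_cell q \<theta> k) x * wrong_prob \<sigma> x False + indicator (inner_cell q \<theta> k) x * wrong_prob (insert k \<sigma>) x True)"
      by (intro Bochner_Integration.integrable_add cell_err_integrable k(1))
    fix x :: "real^'d" assume "x \<in> space (grid_law q \<theta>)"
    then have x: "x \<in> unit_cube" by (simp add: grid_law_facts(2)[OF q \<theta>])
    show "1/2 * indicator (inner_cell q \<theta> k) x \<le> indicator (inner_cell q \<theta> k) x * wrong_prob \<sigma> x False + indicator (inner_cell q \<theta> k) x * wrong_prob (insert k \<sigma>) x True"
      using wrong_prob_pair[OF x k(1), of \<sigma>] by (simp add: indicator_def)
  qed
  also have "\<dots> = cell_err \<sigma> k + cell_err (insert k \<sigma>) k"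
    unfolding cell_err_def using k(2) by (subst Bochner_Integration.integral_add[OF cell_err_integrable[OF k(1)] cell_err_integrable[OF k(1)]]) simp
  finally show ?thesis .
qed

text \<open>Only the cells with a bump of unknown sign are kept. There the sign of the bump decides
  the correct label, and by \<open>height_ge\<close> the weight \<bar>2 \<eta> - 1\<bar> is at least
  2 a.\<close>

lemma excess_ge_cell_err:
  "(\<Sum>k\<in>{k. \<forall>i. k i < w}. 2 * (c * ((1 - \<theta>) / (2 * real q)) powr \<beta>) * cell_err \<sigma> k) \<le> excess_risk m n p (bump_laws \<sigma>)"
proof -
  define a where "a = c * ((1 - \<theta>) / (2 * real q)) powr \<beta>"
  have a: "0 < a" using c \<theta> q by (simp add: a_def)
  define K where "K = {k :: 'd \<Rightarrow> nat. \<forall>i. k i < w}"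
  have K: "finite K" unfolding K_def by (rule finite_bounded_funs)
  define \<eta> where "\<eta> = bump_regression q w c \<beta> 1 1 \<sigma>"
  have c1: "1 * c powr 1 \<le> 1/4" using c4[of 0] by simp
  have \<eta>: "\<eta> \<in> borel_measurable cube_space" "\<And>x. x \<in> unit_cube \<Longrightarrow> 0 \<le> \<eta> x \<and> \<eta> x \<le> 1"
  proof -
    show "\<eta> \<in> borel_measurable cube_space" unfolding \<eta>_def by (rule bump_regression_measurable)
    fix x :: "real^'d" assume x: "x \<in> unit_cube"
    show "0 \<le> \<eta> x \<and> \<eta> x \<le> 1"
      using bump_regression_bounds[OF q c \<beta> zero_less_one zero_less_one c1 x, of w \<sigma>] by (auto simp: \<eta>_def)
  qed
  note M = grid_law_prob_algebra[OF q \<theta>, where 'd = 'd]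
  interpret M: prob_space "grid_law q \<theta> :: (real^'d) measure" by (rule grid_law_facts(3)[OF q \<theta>])
  have P0: "bump_laws \<sigma> 0 = obs_law (grid_law q \<theta>) \<eta>" by (simp add: bump_family_def \<eta>_def)
  define h where "h x = \<bar>2 * \<eta> x - 1\<bar> * wrong_prob \<sigma> x (1/2 \<le> \<eta> x)" for x
  have hm: "h \<in> borel_measurable cube_space"
  proof -
    note [measurable] = \<eta>(1) wrong_prob_measurable
    have "(\<lambda>x. \<bar>2 * \<eta> x - 1\<bar> * (if 1/2 \<le> \<eta> x then wrong_prob \<sigma> x True else wrong_prob \<sigma> x False)) \<in> borel_measurable cube_space" by measurable
    moreover have "h = (\<lambda>x. \<bar>2 * \<eta> x - 1\<bar> * (if 1/2 \<le> \<eta> x then wrong_prob \<sigma> x True else wrong_prob \<sigma> x False))" by (auto simp: h_def)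
    ultimately show ?thesis by simp
  qed
  have h01: "0 \<le> h x" "h x \<le> 1" if "x \<in> unit_cube" for x
  proof -
    show "0 \<le> h x" unfolding h_def using wrong_prob_bounds by simp
    have "\<bar>2 * \<eta> x - 1\<bar> \<le> 1" using \<eta>(2)[OF that] by linarith
    then have "h x \<le> 1 * 1" unfolding h_def using wrong_prob_bounds by (intro mult_mono) auto
    then show "h x \<le> 1" by simp
  qed
  have "excess_risk m n p (bump_laws \<sigma>) = (\<integral>z. h (fst z) \<partial>bump_laws \<sigma> 0)"
    unfolding h_def wrong_prob_def
    by (rule excess_risk_eq[OF p]) (auto simp: P0 intro: bump_laws_prob_algebra regression_fun_obs_law[OF M \<eta>])
  also have "\<dots> = (\<integral>x. \<eta> x * h (fst (x, True)) + (1 - \<eta> x) * h (fst (x, False)) \<partial>grid_law q \<theta>)"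
    unfolding P0 by (rule integral_obs_law[OF M \<eta>]) (use h01 measurable_compose[OF measurable_fst_obs hm] in auto)
  also have "\<dots> = (\<integral>x. h x \<partial>grid_law q \<theta>)"
    by (intro Bochner_Integration.integral_cong) (auto simp: algebra_simps)
  finally have ex: "excess_risk m n p (bump_laws \<sigma>) = (\<integral>x. h x \<partial>grid_law q \<theta>)" .
  have kint: "integrable (grid_law q \<theta>) (\<lambda>x. 2 * a * (indicator (inner_cell q \<theta> k) x * wrong_prob \<sigma> x (k \<in> \<sigma>)))" if "k \<in> K" for k
    using that by (intro integrable_mult_right cell_err_integrable) (auto simp: K_def)
  have "(\<Sum>k\<in>K. 2 * a * cell_err \<sigma> k) = (\<Sum>k\<in>K. (\<integral>x. 2 * a * (indicator (inner_cell q \<theta> k) x * wrong_prob \<sigma> x (k \<in> \<sigma>)) \<partial>grid_law q \<theta>))"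
    by (intro sum.cong refl) (simp add: cell_err_def)
  also have "\<dots> = (\<integral>x. (\<Sum>k\<in>K. 2 * a * (indicator (inner_cell q \<theta> k) x * wrong_prob \<sigma> x (k \<in> \<sigma>))) \<partial>grid_law q \<theta>)"
    by (rule Bochner_Integration.integral_sum[OF kint, symmetric])
  also have "\<dots> \<le> (\<integral>x. h x \<partial>grid_law q \<theta>)"
  proof (rule integral_mono)
    show "integrable (grid_law q \<theta>) (\<lambda>x. \<Sum>k\<in>K. 2 * a * (indicator (inner_cell q \<theta> k) x * wrong_prob \<sigma> x (k \<in> \<sigma>)))"
      by (rule Bochner_Integration.integrable_sum[OF kint])
    show "integrable (grid_law q \<theta>) h"
    proof (rule M.integrable_const_bound[of _ 1])
      show "AE x in grid_law q \<theta>. norm (h x) \<le> 1"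
        using h01 by (intro AE_I2) (simp add: grid_law_facts(2)[OF q \<theta>])
      show "h \<in> borel_measurable (grid_law q \<theta>)"
        by (subst measurable_cong_sets[OF grid_law_facts(1)[OF q \<theta>] refl]) (rule hm)
    qed
    fix x :: "real^'d" assume "x \<in> space (grid_law q \<theta>)"
    then have x: "x \<in> unit_cube" by (simp add: grid_law_facts(2)[OF q \<theta>])
    show "(\<Sum>k\<in>K. 2 * a * (indicator (inner_cell q \<theta> k) x * wrong_prob \<sigma> x (k \<in> \<sigma>))) \<le> h x"
    proof (cases "\<exists>k\<in>K. x \<in> inner_cell q \<theta> k")
      case False
      then have "(\<Sum>k\<in>K. 2 * a * (indicator (inner_cell q \<theta> k) x * wrong_prob \<sigma> x (k \<in> \<sigma>))) = 0" by (intro sum.neutral) auto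
      then show ?thesis using h01[OF x] by simp
    next
      case True
      then obtain k where k: "k \<in> K" "x \<in> inner_cell q \<theta> k" by auto
      have ck: "cell q x = k" by (rule inner_cell_cell[OF k(2) \<theta>(2)])
      have other: "x \<notin> inner_cell q \<theta> k'" if "k' \<noteq> k" for k' using inner_cell_cell[OF _ \<theta>(2), of x q k'] ck that by auto
      have "(\<Sum>k'\<in>K. 2 * a * (indicator (inner_cell q \<theta> k') x * wrong_prob \<sigma> x (k' \<in> \<sigma>)))
         = (\<Sum>k'\<in>K. if k' = k then 2 * a * wrong_prob \<sigma> x (k \<in> \<sigma>) else 0)"
        by (intro sum.cong refl) (use k(2) other in auto)
      also have "\<dots> = 2 * a * wrong_prob \<sigma> x (k \<in> \<sigma>)" using K k(1) by simp
      finally have sum: "(\<Sum>k'\<in>K. 2 * a * (indicator (inner_cell q \<theta> k') x * wrong_prob \<sigma> x (k' \<in> \<sigma>))) = 2 * a * wrong_prob \<sigma> x (k \<in> \<sigma>)" .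
      have kw: "k i < w" for i using k(1) by (simp add: K_def)
      have "x \<in> grid_support q \<theta>" using inner_cell_sets(2)[OF q \<theta>, of k] kw wq k(2) by (meson order_less_le_trans subsetD)
      then have ha: "a \<le> bump_height q w c \<beta> (region q w x) x" unfolding a_def by (rule height_ge[OF q c \<beta> _ \<theta>(2)])
      have reg: "region q w x = Some k"
      proof -
        have "real q * x $ i < real w" for i
        proof -
          have ab: "\<bar>real q * x $ i - (real (k i) + 1/2)\<bar> \<le> \<theta> / 2" using k(2) by (auto simp: inner_cell_def)
          have "real (k i) + 1 \<le> real w" using kw[of i] by linarith
          then show ?thesis using abs_le_D1[OF ab] \<theta> by linarith
        qed
        then show ?thesis using ck by (auto simp: region_def not_le[symmetric])
      qed
      have \<eta>eq: "\<eta> x = 1/2 + (if k \<in> \<sigma> then 1 else - 1) * bump_height q w c \<beta> (region q w x) x"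
        unfolding \<eta>_def bump_regression_one[OF q c \<beta>] reg by (simp add: region_sign_def)
      have dec: "(1/2 \<le> \<eta> x) = (k \<in> \<sigma>)" using \<eta>eq ha a by auto
      have "2 * a \<le> \<bar>2 * \<eta> x - 1\<bar>" using \<eta>eq ha a by (simp split: if_splits)
      then have "2 * a * wrong_prob \<sigma> x (k \<in> \<sigma>) \<le> h x"
        unfolding h_def dec using wrong_prob_bounds by (intro mult_right_mono) auto
      then show ?thesis using sum by simp
    qed
  qed
  finally show ?thesis unfolding ex K_def a_def .
qed

text \<open>If every pattern had a smaller excess risk, so would the sum over all patterns. But for
  each cell, pairing the patterns by \<open>cell_err_pair\<close> bounds the summed error from
  below, and the cells add up.\<close>

lemma assouad_bound:
  "\<exists>\<sigma>. c * ((1 - \<theta>) / (2 * real q)) powr \<beta> * (real w / real q) ^ CARD('d) / 2 \<le> excess_risk m n p (bump_laws \<sigma>)"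
proof (rule ccontr)
  define a where "a = c * ((1 - \<theta>) / (2 * real q)) powr \<beta>"
  have a: "0 < a" using c \<theta> q by (simp add: a_def)
  define K where "K = {k :: 'd \<Rightarrow> nat. \<forall>i. k i < w}"
  have K: "finite K" unfolding K_def by (rule finite_bounded_funs)
  have cK: "real (card K) = real w ^ CARD('d)" unfolding K_def by (simp add: card_bounded_funs)
  define hd where "hd = (1 / real q) ^ CARD('d)"
  define E where "E = a * (real w / real q) ^ CARD('d) / 2"
  have E: "E = a * real (card K) * hd / 2" unfolding E_def cK hd_def by (simp add: power_divide)
  assume "\<not> ?thesis"
  then have less: "excess_risk m n p (bump_laws \<sigma>) < E" for \<sigma> by (auto simp: E_def a_def not_le)
  have "(\<Sum>\<sigma>\<in>Pow K. excess_risk m n p (bump_laws \<sigma>)) < (\<Sum>\<sigma>\<in>Pow K. E)"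
    using K less by (intro sum_strict_mono) auto
  also have "\<dots> = 2 ^ card K * E" using K by (simp add: card_Pow)
  finally have up: "(\<Sum>\<sigma>\<in>Pow K. excess_risk m n p (bump_laws \<sigma>)) < 2 ^ card K * E" .
  have per: "2 ^ card K / 2 * (hd / 2) \<le> (\<Sum>\<sigma>\<in>Pow K. cell_err \<sigma> k)" if k: "k \<in> K" for k
  proof -
    have kw: "k i < w" for i using k by (simp add: K_def)
    have "card K = Suc (card (K - {k}))" using K k by (metis card_Suc_Diff1)
    then have "2 ^ card K / 2 * (hd / 2) = (\<Sum>\<sigma>\<in>Pow (K - {k}). hd / 2)" using K by (simp add: card_Pow)
    also have "\<dots> \<le> (\<Sum>\<sigma>\<in>Pow (K - {k}). cell_err \<sigma> k + cell_err (insert k \<sigma>) k)"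
      unfolding hd_def by (intro sum_mono cell_err_pair kw) auto
    also have "\<dots> = (\<Sum>\<sigma>\<in>Pow K. cell_err \<sigma> k)" by (rule sum_Pow_split[OF K k, symmetric])
    finally show ?thesis .
  qed
  have "2 ^ card K * E = (\<Sum>k\<in>K. 2 * a * (2 ^ card K / 2 * (hd / 2)))" by (simp add: E)
  also have "\<dots> \<le> (\<Sum>k\<in>K. 2 * a * (\<Sum>\<sigma>\<in>Pow K. cell_err \<sigma> k))" using a by (intro sum_mono mult_left_mono per) auto
  also have "\<dots> = (\<Sum>k\<in>K. \<Sum>\<sigma>\<in>Pow K. 2 * a * cell_err \<sigma> k)" by (simp add: sum_distrib_left)
  also have "\<dots> = (\<Sum>\<sigma>\<in>Pow K. \<Sum>k\<in>K. 2 * a * cell_err \<sigma> k)" by (rule sum.swap)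
  also have "\<dots> \<le> (\<Sum>\<sigma>\<in>Pow K. excess_risk m n p (bump_laws \<sigma>))"
    unfolding K_def a_def by (intro sum_mono excess_ge_cell_err)
  finally show False using up by simp
qed

end

text \<open>The Hoelder constant of the signed bumps is 2 c, and the bounds by 1/4 keep the
  regression functions of all servers within [1/4, 3/4].\<close>

lemma exists_height:
  fixes \<gamma> Cs :: "nat \<Rightarrow> real" and L :: real
  assumes "0 < L" and \<gamma>: "\<And>j. j \<in> {1..m} \<Longrightarrow> 0 < \<gamma> j" and Cs: "\<And>j. j \<in> {1..m} \<Longrightarrow> 0 < Cs j"
  shows "\<exists>c>0. 2 * c \<le> L \<and> c \<le> 1/4 \<and> (\<forall>j\<in>{1..m}. Cs j * c powr \<gamma> j \<le> 1/4)"
proof (intro exI conjI ballI)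
  define S where "S = {L / 2, 1/4} \<union> (\<lambda>j. (1 / (4 * Cs j)) powr (1 / \<gamma> j)) ` {1..m}"
  have S: "finite S" "S \<noteq> {}" by (auto simp: S_def)
  have pp: "0 < (1 / (4 * Cs j)) powr (1 / \<gamma> j)" if "j \<in> {1..m}" for j using Cs[OF that] by simp
  have pos: "0 < y" if "y \<in> S" for y
  proof -
    from that consider "y = L / 2" | "y = 1/4" | j where "j \<in> {1..m}" "y = (1 / (4 * Cs j)) powr (1 / \<gamma> j)"
      unfolding S_def by blast
    then show ?thesis using assms(1) pp by cases (simp, simp, simp only:)
  qed
  have min: "Min S \<le> y" if "y \<in> S" for y using Min_le[OF S(1) that] .
  show c0: "0 < Min S" using pos Min_in[OF S] by blast
  show "2 * Min S \<le> L" using min[of "L / 2"] by (simp add: S_def)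
  show "Min S \<le> 1/4" using min[of "1/4"] by (simp add: S_def)
  fix j assume j: "j \<in> {1..m}"
  have "Min S powr \<gamma> j \<le> ((1 / (4 * Cs j)) powr (1 / \<gamma> j)) powr \<gamma> j"
    using c0 \<gamma>[OF j] j by (intro powr_mono2 min) (auto simp: S_def)
  also have "\<dots> = 1 / (4 * Cs j)" using \<gamma>[OF j] Cs[OF j] by (simp add: powr_powr)
  finally have "Cs j * Min S powr \<gamma> j \<le> Cs j * (1 / (4 * Cs j))" using Cs[OF j] by (intro mult_left_mono) auto
  then show "Cs j * Min S powr \<gamma> j \<le> 1/4" using Cs[OF j] by simp
qed

text \<open>The hard family determines its own margin and regularity constants, so
  \<open>C\<^sub>0\<close> and \<open>c\<^sub>0\<close> come before \<open>C\<alpha>\<close> and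
  \<open>c\<mu>\<close>: any class with weaker requirements contains it. The mesh is a small
  multiple of \<open>min r 1\<close>, since cells cannot exceed the unit cube.\<close>

lemma minimax_lower:
  fixes \<gamma> Cs :: "nat \<Rightarrow> real"
  assumes \<alpha>: "0 \<le> \<alpha>" "\<alpha> * \<beta> \<le> real CARD('d::finite)" and \<beta>: "0 < \<beta>" "\<beta> \<le> 1" and L: "0 < L"
    and \<gamma>: "\<And>j. j \<in> {1..m} \<Longrightarrow> 0 < \<gamma> j" and Cs: "\<And>j. j \<in> {1..m} \<Longrightarrow> 0 < Cs j"
    and g: "0 < gmin" "gmin < gmax" "1 < gmax" and r\<mu>: "0 < r\<mu>"
  shows "\<exists>C\<^sub>0>0. \<exists>c\<^sub>0>0. \<exists>\<kappa>>0. \<exists>s>0. \<forall>C\<alpha> c\<mu> n \<epsilon> \<delta> r. C\<^sub>0 \<le> C\<alpha> \<longrightarrow> c\<mu> \<le> c\<^sub>0 \<longrightarrow>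
     (\<forall>j\<le>m. 0 < \<epsilon> j \<and> 0 < \<delta> j \<and> real (n j) * \<delta> j \<le> s) \<longrightarrow> 0 < r \<longrightarrow> rate_lhs CARD('d) m \<beta> \<gamma> n \<epsilon> r = 1 \<longrightarrow>
     ennreal (\<kappa> * min r 1 powr (\<beta> * (1 + \<alpha>)))
       \<le> minimax_risk TYPE('t) m n \<epsilon> \<delta> (transfer_class m \<alpha> \<beta> \<gamma> L C\<alpha> Cs gmin gmax c\<mu> r\<mu> :: (nat \<Rightarrow> 'd obs measure) set)"
proof -
  define d where "d = CARD('d)"
  have d: "0 < d" "1 \<le> real d" unfolding d_def using zero_less_card_finite[where 'a='d] by linarith+
  \<comment> \<open>Chosen so that the constant density 1/\<theta>^d equals \<open>gmax\<close>;
    \<open>1 < gmax\<close> is what makes \<theta> less than 1 and leaves gaps between the small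
    cubes.\<close>
  define \<theta> where "\<theta> = (1 / gmax) powr (1 / real d)"
  have \<theta>d: "\<theta> ^ d = 1 / gmax" using g d by (simp add: \<theta>_def powr_powr flip: powr_realpow)
  have \<theta>: "0 < \<theta>" "\<theta> < 1"
  proof -
    show "0 < \<theta>" using g by (simp add: \<theta>_def)
    have "\<theta> < 1 powr (1 / real d)" unfolding \<theta>_def using g d by (intro powr_less_mono2) auto
    then show "\<theta> < 1" by simp
  qed
  obtain c where c: "0 < c" "2 * c \<le> L" "c \<le> 1/4" "\<And>j. j \<in> {1..m} \<Longrightarrow> Cs j * c powr \<gamma> j \<le> 1/4"
    using exists_height[of L m \<gamma> Cs, OF L \<gamma> Cs] by blast
  define C\<^sub>0 where "C\<^sub>0 = ((1 + 4 / (1 - \<theta>)) / \<theta>) ^ CARD('d) * c powr (- \<alpha>)"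
  define c\<^sub>0 where "c\<^sub>0 = (\<theta> * min (1 / (4 * real CARD('d))) (1 / r\<mu>)) ^ CARD('d) / unit_ball_vol (real CARD('d))"
  have C\<^sub>0: "0 < C\<^sub>0"
  proof -
    have "0 < 1 + 4 / (1 - \<theta>)" using \<theta> by (intro add_pos_pos) auto
    then show ?thesis using \<theta> c by (simp add: C\<^sub>0_def)
  qed
  have c\<^sub>0: "0 < c\<^sub>0" using \<theta> r\<mu> d by (simp add: c\<^sub>0_def d_def min_def)
  define s where "s = 1 / (2 * real (Suc m))"
  have s: "0 < s" "s \<le> 1" by (auto simp: s_def)
  \<comment> \<open>In the chi-square regime 128 v^2 with v at most a quarter of
    \<open>h powr a\<close> leaves the factor 8, so \<open>8 * c\<^sub>1\<close> must fit below
    \<open>s^2\<close>. In the privacy regime \<open>2 * c\<^sub>1\<close> may use half of the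
    budget \<open>s\<close>; the other half is for the terms n_j \<delta>_j.\<close>
  define c\<^sub>1 where "c\<^sub>1 = s^2 / 8"
  have c\<^sub>1: "0 < c\<^sub>1" "c\<^sub>1 \<le> 1" "8 * c\<^sub>1 \<le> s^2" "2 * c\<^sub>1 \<le> s / 2"
  proof -
    have "s^2 \<le> 1" "s^2 \<le> s" using s power_decreasing[of 1 2 s] power_le_one[of s 2] by auto
    then show "0 < c\<^sub>1" "c\<^sub>1 \<le> 1" "8 * c\<^sub>1 \<le> s^2" "2 * c\<^sub>1 \<le> s / 2" using s by (auto simp: c\<^sub>1_def)
  qed
  define \<theta>e where "\<theta>e = \<beta> * (1 + \<alpha>)"
  have \<theta>e: "0 < \<theta>e" using \<alpha> \<beta> by (simp add: \<theta>e_def)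
  define \<kappa> where "\<kappa> = c * ((1 - \<theta>) / 2) powr \<beta> / 2 * (c\<^sub>1 / 2) powr \<theta>e"
  have \<kappa>: "0 < \<kappa>" using c \<theta> c\<^sub>1 by (simp add: \<kappa>_def)
  have \<gamma>': "0 < (\<gamma>(0 := 1)) j" and Cs': "0 < (Cs(0 := 1)) j" and cc: "(Cs(0 := 1)) j * c powr (\<gamma>(0 := 1)) j \<le> 1/4" if "j \<le> m" for j
    using \<gamma>[of j] Cs[of j] c(1,3) c(4)[of j] that by (cases "j = 0"; simp)+
  have main: "ennreal (\<kappa> * min r 1 powr \<theta>e)
       \<le> minimax_risk TYPE('t) m n \<epsilon> \<delta> (transfer_class m \<alpha> \<beta> \<gamma> L C\<alpha> Cs gmin gmax c\<mu> r\<mu> :: (nat \<Rightarrow> 'd obs measure) set)"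
    if C\<alpha>: "C\<^sub>0 \<le> C\<alpha>" and c\<mu>: "c\<mu> \<le> c\<^sub>0" and pos: "\<forall>j\<le>m. 0 < \<epsilon> j \<and> 0 < \<delta> j \<and> real (n j) * \<delta> j \<le> s / 2"
      and r: "0 < r" and rate: "rate_lhs CARD('d) m \<beta> \<gamma> n \<epsilon> r = 1" for C\<alpha> c\<mu> n \<epsilon> \<delta> r
  proof -
    define r' where "r' = min r 1"
    have r': "0 < r'" "r' \<le> 1" "r' \<le> r" using r by (auto simp: r'_def)
    have c1r: "0 < c\<^sub>1 * r'" "c\<^sub>1 * r' \<le> 1" using c\<^sub>1 r' by (auto simp: mult_le_one)
    obtain q where q: "0 < q" "1 / real q \<le> c\<^sub>1 * r'" "c\<^sub>1 * r' / 2 \<le> 1 / real q"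
      using inverse_nat_approx[OF c1r] .
    define h where "h = 1 / real q"
    have h: "0 < h" "h \<le> c\<^sub>1 * r'" "c\<^sub>1 * r' / 2 \<le> h" "h \<le> 1" using q by (auto simp: h_def)
    define e where "e = \<alpha> * \<beta> / real d"
    have e: "0 \<le> e" "e \<le> 1" using \<alpha> \<beta> d by (auto simp: e_def d_def)
    \<comment> \<open>There are w^d bumps, about q^(d - \<alpha> \<beta>). Rounding up keeps
      \<open>w\<close> positive, and \<open>w \<le> q\<close> still holds because the exponent is at
      most 1 and \<open>q\<close> is an integer.\<close>
    define w where "w = nat \<lceil>real q powr (1 - e)\<rceil>"
    have q1: "1 \<le> real q" using q(1) by simp
    have qe: "1 \<le> real q powr (1 - e)" using q1 e by (intro ge_one_powr_ge_zero) auto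
    have w: "real q powr (1 - e) \<le> real w" "real w \<le> real q powr (1 - e) + 1" unfolding w_def using qe by linarith+
    have qh: "real q powr (1 - e) = real q * h powr e"
    proof -
      have "h powr e = real q powr (- e)" using q1 by (simp add: h_def powr_divide powr_minus_divide)
      then have "real q * h powr e = real q powr 1 * real q powr (- e)" using q1 by simp
      also have "\<dots> = real q powr (1 + - e)" by (rule powr_add[symmetric])
      finally show ?thesis by simp
    qed
    have wq: "w \<le> q"
    proof -
      have "real q powr (1 - e) \<le> real q powr 1" using q1 e by (intro powr_mono) auto
      then have "real q powr (1 - e) \<le> real q" using q1 by simp
      then show ?thesis unfolding w_def by (simp add: nat_le_iff ceiling_le_iff)
    qed
    have wh: "real w / real q \<le> 2 * h powr e"
    proof -
      have "real w \<le> 2 * (real q * h powr e)" using w(2) qe qh by linarith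
      then show ?thesis using q1 by (simp add: field_simps)
    qed
    have wl: "h powr e \<le> real w / real q" using w(1) q1 unfolding qh by (simp add: field_simps)
    \<comment> \<open>Of all the powers of \<open>c\<^sub>1\<close> gained from
      \<open>h \<le> c\<^sub>1 * r\<close>, a single factor is kept; it is enough and does not
      depend on the exponents.\<close>
    have hp: "h powr a * h ^ d \<le> c\<^sub>1 * (r powr a * r ^ d)" if "0 \<le> a" for a
    proof -
      have 1: "h powr a \<le> r powr a"
      proof (rule powr_mono2[OF that])
        have "c\<^sub>1 * r' \<le> r'" using c\<^sub>1 r' by (simp add: mult_left_le_one_le)
        then show "h \<le> r" using h(2) r'(3) by linarith
      qed (use h in simp)
      have "h ^ d \<le> (c\<^sub>1 * r) ^ d"
      proof (rule power_mono)
        have "c\<^sub>1 * r' \<le> c\<^sub>1 * r" using c\<^sub>1 r' by simp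
        then show "h \<le> c\<^sub>1 * r" using h(2) by linarith
      qed (use h in simp)
      also have "\<dots> = c\<^sub>1 ^ d * r ^ d" by (rule power_mult_distrib)
      also have "\<dots> \<le> c\<^sub>1 * r ^ d"
        using c\<^sub>1 r d power_decreasing[of 1 d c\<^sub>1] by (intro mult_right_mono) auto
      finally have 2: "h ^ d \<le> c\<^sub>1 * r ^ d" .
      have "h powr a * h ^ d \<le> r powr a * (c\<^sub>1 * r ^ d)" using 1 2 h by (intro mult_mono) auto
      then show ?thesis by (simp add: mult_ac)
    qed
    have small: "real (n j) * (128 * ((Cs(0 := 1)) j * (c * (1 / real q) powr \<beta>) powr (\<gamma>(0 := 1)) j)^2 * (1 / real q) ^ CARD('d)) \<le> (1 / (2 * real (Suc m)))^2 \<or>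
       real (n j) * ((2 * \<epsilon> j + \<delta> j) * (4 * ((Cs(0 := 1)) j * (c * (1 / real q) powr \<beta>) powr (\<gamma>(0 := 1)) j) * (1 / real q) ^ CARD('d))) \<le> 1 / (2 * real (Suc m))"
      if j: "j \<le> m" for j
    proof -
      define a where "a = \<beta> * (\<gamma>(0 := 1)) j"
      have a: "0 < a" using \<beta> \<gamma>'[OF j] by (simp add: a_def)
      define v where "v = (Cs(0 := 1)) j * (c * h powr \<beta>) powr (\<gamma>(0 := 1)) j"
      have "v = ((Cs(0 := 1)) j * c powr (\<gamma>(0 := 1)) j) * h powr a"
        using h by (simp add: v_def powr_mult powr_powr a_def)
      also have "\<dots> \<le> 1/4 * h powr a" by (rule mult_right_mono[OF cc[OF j]]) simp
      finally have v: "v \<le> h powr a / 4" by simp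
      have v0: "0 \<le> v" using Cs'[OF j] by (simp add: v_def)
      have ej: "0 < \<epsilon> j" "0 < \<delta> j" "real (n j) * \<delta> j \<le> s / 2" using pos j by auto
      define T where "T i = min (real (n i)) (real (n i) ^ 2 * \<epsilon> i ^ 2 * r ^ d) * r powr (2 * \<beta> * (\<gamma>(0 := 1)) i + real d)" for i
      have "(\<Sum>i\<le>m. T i) = 1" using rate unfolding rate_lhs_eq T_def d_def .
      moreover have "T j \<le> (\<Sum>i\<le>m. T i)" by (rule member_le_sum) (use j r in \<open>auto simp: T_def\<close>)
      ultimately have Tj: "T j \<le> 1" by simp
      have pw: "r powr (2 * \<beta> * (\<gamma>(0 := 1)) j + real d) = r powr (2 * a) * r ^ d"
        using r by (simp add: powr_add powr_realpow a_def mult.assoc)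
      show ?thesis
      proof (cases "real (n j) \<le> real (n j) ^ 2 * \<epsilon> j ^ 2 * r ^ d")
        case True
        then have n1: "real (n j) * (r powr (2 * a) * r ^ d) \<le> 1" using Tj unfolding T_def pw by (simp add: min_def)
        have "v^2 \<le> (h powr a / 4)^2" using v v0 by (intro power_mono) auto
        also have "\<dots> = h powr (2 * a) / 16" by (simp add: power_divide power2_eq_square flip: powr_add)
        finally have v2: "v^2 \<le> h powr (2 * a) / 16" .
        have "real (n j) * (128 * v^2 * h ^ d) \<le> real (n j) * (128 * (h powr (2 * a) / 16) * h ^ d)"
          using v2 h by (intro mult_left_mono mult_right_mono) auto
        also have "\<dots> = 8 * (real (n j) * (h powr (2 * a) * h ^ d))" by simp
        also have "\<dots> \<le> 8 * (real (n j) * (c\<^sub>1 * (r powr (2 * a) * r ^ d)))"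
          using a by (intro mult_left_mono hp) auto
        also have "\<dots> = 8 * c\<^sub>1 * (real (n j) * (r powr (2 * a) * r ^ d))" by simp
        also have "\<dots> \<le> 8 * c\<^sub>1 * 1" by (rule mult_left_mono[OF n1]) (use c\<^sub>1 in simp)
        also have "\<dots> \<le> s^2" using c\<^sub>1 by simp
        finally show ?thesis by (simp add: v_def h_def d_def s_def)
      next
        case False
        \<comment> \<open>In this case \<open>y^2\<close> is the summand of server \<open>j\<close>
          in the equation for r, so \<open>y\<close> is at most 1.\<close>
        define y where "y = real (n j) * \<epsilon> j * (r powr a * r ^ d)"
        have y0: "0 \<le> y" using ej r by (simp add: y_def)
        have "y^2 = real (n j) ^ 2 * \<epsilon> j ^ 2 * r ^ d * (r powr (2 * a) * r ^ d)"
        proof -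
          have "r powr (2 * a) = r powr a * r powr a" by (simp flip: powr_add)
          then show ?thesis by (simp add: y_def power2_eq_square mult_ac)
        qed
        also have "\<dots> \<le> 1" using False Tj unfolding T_def pw by (simp add: min_def)
        finally have "y \<le> 1" using y0 by (simp add: abs_square_le_1[symmetric, of y] power2_le_imp_le[of y 1])
        have "real (n j) * ((2 * \<epsilon> j + \<delta> j) * (4 * v * h ^ d)) \<le> real (n j) * ((2 * \<epsilon> j + \<delta> j) * (h powr a * h ^ d))"
          using v h ej by (intro mult_left_mono mult_right_mono) auto
        also have "\<dots> = 2 * (real (n j) * \<epsilon> j * (h powr a * h ^ d)) + real (n j) * \<delta> j * (h powr a * h ^ d)"
          by (simp add: algebra_simps)
        also have "\<dots> \<le> 2 * (real (n j) * \<epsilon> j * (c\<^sub>1 * (r powr a * r ^ d))) + real (n j) * \<delta> j * 1"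
        proof (intro add_mono mult_left_mono hp)
          have "h powr a \<le> 1 powr a" using h a by (intro powr_mono2) auto
          moreover have "h ^ d \<le> 1" using h by (intro power_le_one) auto
          ultimately have "h powr a * h ^ d \<le> 1 * 1" using h by (intro mult_mono) auto
          then show "h powr a * h ^ d \<le> 1" by simp
        qed (use a ej in auto)
        also have "\<dots> = 2 * c\<^sub>1 * y + real (n j) * \<delta> j" by (simp add: y_def)
        also have "\<dots> \<le> 2 * c\<^sub>1 * 1 + s / 2" using \<open>y \<le> 1\<close> c\<^sub>1 ej by (intro add_mono mult_left_mono) auto
        also have "\<dots> \<le> s" using c\<^sub>1 by simp
        finally show ?thesis by (simp add: v_def h_def d_def s_def)
      qed
    qed
    have in_class: "(bump_family q w \<theta> c \<beta> Cs \<gamma> \<sigma> :: nat \<Rightarrow> 'd obs measure) \<in> transfer_class m \<alpha> \<beta> \<gamma> L C\<alpha> Cs gmin gmax c\<mu> r\<mu>" for \<sigma>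
      by (rule bump_family_in_class[OF q(1) c(1) \<beta> \<theta> \<alpha> _ \<gamma> Cs c(2,3) c(4)])
         (use wh \<theta>d g C\<alpha> c\<mu> in \<open>auto simp: h_def e_def d_def C\<^sub>0_def c\<^sub>0_def\<close>)
    have bound: "\<kappa> * r' powr \<theta>e \<le> c * ((1 - \<theta>) / (2 * real q)) powr \<beta> * (real w / real q) ^ CARD('d) / 2"
    proof -
      have "(h powr e) ^ d \<le> (real w / real q) ^ d" using wl h by (intro power_mono) auto
      also have "(h powr e) ^ d = h powr (\<alpha> * \<beta>)" using h d by (simp add: e_def powr_powr flip: powr_realpow)
      finally have W: "h powr (\<alpha> * \<beta>) \<le> (real w / real q) ^ d" .
      have "\<kappa> * r' powr \<theta>e = c * ((1 - \<theta>) / 2) powr \<beta> / 2 * (c\<^sub>1 * r' / 2) powr \<theta>e"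
        using powr_mult[of "c\<^sub>1 / 2" r' \<theta>e] by (simp add: \<kappa>_def)
      also have "\<dots> \<le> c * ((1 - \<theta>) / 2) powr \<beta> / 2 * h powr \<theta>e"
        using c \<theta>e h c1r by (intro mult_left_mono powr_mono2) auto
      also have "h powr \<theta>e = h powr \<beta> * h powr (\<alpha> * \<beta>)"
        by (simp add: \<theta>e_def distrib_left mult.commute flip: powr_add)
      also have "c * ((1 - \<theta>) / 2) powr \<beta> / 2 * (h powr \<beta> * h powr (\<alpha> * \<beta>))
         \<le> c * ((1 - \<theta>) / 2) powr \<beta> / 2 * (h powr \<beta> * (real w / real q) ^ d)"
        using c by (intro mult_left_mono W) auto
      also have "\<dots> = c * (((1 - \<theta>) / 2) powr \<beta> * h powr \<beta>) * (real w / real q) ^ d / 2" by simp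
      also have "((1 - \<theta>) / 2) powr \<beta> * h powr \<beta> = ((1 - \<theta>) / (2 * real q)) powr \<beta>"
        using powr_mult[of "(1 - \<theta>) / 2" h \<beta>] by (simp add: h_def)
      finally show ?thesis by (simp add: d_def)
    qed
    show ?thesis
      unfolding minimax_risk_def
    proof (rule INF_greatest)
      fix p :: "('d, 't) protocol" assume p: "p \<in> private_protocols m n \<epsilon> \<delta>"
      have "\<exists>\<sigma>. c * ((1 - \<theta>) / (2 * real q)) powr \<beta> * (real w / real q) ^ CARD('d) / 2 \<le> excess_risk m n p (bump_family q w \<theta> c \<beta> Cs \<gamma> \<sigma>)"
        by (rule assouad_bound[OF q(1) c(1) \<beta> \<theta> wq \<gamma>' Cs' cc _ _ p small]) (use pos in auto)
      then obtain \<sigma> where \<sigma>: "\<kappa> * r' powr \<theta>e \<le> excess_risk m n p (bump_family q w \<theta> c \<beta> Cs \<gamma> \<sigma>)"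
        using bound by (meson order_trans)
      have "ennreal (\<kappa> * r' powr \<theta>e) \<le> ennreal (excess_risk m n p (bump_family q w \<theta> c \<beta> Cs \<gamma> \<sigma>))" by (rule ennreal_leI[OF \<sigma>])
      also have "\<dots> \<le> (SUP P\<in>transfer_class m \<alpha> \<beta> \<gamma> L C\<alpha> Cs gmin gmax c\<mu> r\<mu>. ennreal (excess_risk m n p P))"
        by (rule SUP_upper[OF in_class])
      finally show "ennreal (\<kappa> * min r 1 powr \<theta>e) \<le> (SUP P\<in>transfer_class m \<alpha> \<beta> \<gamma> L C\<alpha> Cs gmin gmax c\<mu> r\<mu>. ennreal (excess_risk m n p P))"
        by (simp add: r'_def)
    qed
  qed
  have s2: "0 < s / 2" using s by simp
  show ?thesis
    by (rule exI[of _ C\<^sub>0], rule conjI[OF C\<^sub>0], rule exI[of _ c\<^sub>0], rule conjI[OF c\<^sub>0], rule exI[of _ \<kappa>], rule conjI[OF \<kappa>],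
        rule exI[of _ "s / 2"], rule conjI[OF s2], intro allI impI, fold \<theta>e_def, rule main)
qed


section \<open>The minimax rate\<close>

text \<open>All sample sizes are at least 1, so every \<delta>_j tends to 0. Once \<delta>_min is at
  most exp (-1), its negative logarithm is at least 1, and so is any nonnegative power of
  it.\<close>

lemma delta_min_small:
  fixes n :: "nat \<Rightarrow> nat \<Rightarrow> nat" and \<delta> :: "nat \<Rightarrow> nat \<Rightarrow> real"
  assumes pos: "\<forall>N. \<forall>j\<le>m. 1 \<le> n N j \<and> 0 < \<delta> N j"
    and lim: "(\<lambda>N. \<Sum>j=0..m. real (n N j) * \<delta> N j) \<longlonglongrightarrow> 0" and s: "0 < s"
  shows "\<forall>\<^sub>F N in sequentially. \<forall>j\<le>m. real (n N j) * \<delta> N j \<le> s"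
    and "0 \<le> e \<Longrightarrow> \<forall>\<^sub>F N in sequentially. 1 \<le> (- ln (delta_min m (\<delta> N))) powr e"
proof -
  have nn: "0 \<le> real (n N j) * \<delta> N j" if "j \<le> m" for N j
    using pos[rule_format, OF that, of N] by simp
  have ev: "\<forall>\<^sub>F N in sequentially. \<forall>j\<le>m. real (n N j) * \<delta> N j \<le> t" if t: "0 < t" for t
    using order_tendstoD(2)[OF lim t]
  proof eventually_elim
    case (elim N)
    have "real (n N j) * \<delta> N j \<le> (\<Sum>j=0..m. real (n N j) * \<delta> N j)" if "j \<le> m" for j
      by (rule member_le_sum) (use that nn in auto)
    then show ?case using elim by force
  qed
  show "\<forall>\<^sub>F N in sequentially. \<forall>j\<le>m. real (n N j) * \<delta> N j \<le> s" by (rule ev[OF s])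
  assume e: "0 \<le> e"
  have "0 < exp (- 1 :: real)" by simp
  from ev[OF this] show "\<forall>\<^sub>F N in sequentially. 1 \<le> (- ln (delta_min m (\<delta> N))) powr e"
  proof eventually_elim
    case (elim N)
    have "delta_min m (\<delta> N) \<in> \<delta> N ` {0..m}" unfolding delta_min_def by (rule Min_in) auto
    then obtain j where j: "j \<le> m" "delta_min m (\<delta> N) = \<delta> N j" by auto
    have "1 * \<delta> N j \<le> real (n N j) * \<delta> N j" using pos[rule_format, OF j(1), of N] by (intro mult_right_mono) auto
    then have "\<delta> N j \<le> exp (- 1)" using elim j(1) by force
    then have "ln (\<delta> N j) \<le> ln (exp (- 1))"
      using pos[rule_format, OF j(1), of N] by (subst ln_le_cancel_iff) auto
    then have "ln (\<delta> N j) \<le> - 1" by simp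
    then show ?case using e unfolding j(2) by (intro ge_one_powr_ge_zero) auto
  qed
qed

theorem theorem3p4:
  fixes m :: nat
    and \<alpha> \<beta> L gmin gmax r\<mu> :: real
    and \<gamma> Cs :: "nat \<Rightarrow> real"
  assumes "\<exists>e :: real \<Rightarrow> 't. inj e"
    and "0 \<le> \<alpha>" and "0 < \<beta>" and "\<beta> \<le> 1" and "\<alpha> * \<beta> \<le> real CARD('d::finite)"
    and "0 < L"
    and "\<And>j. j \<in> {1..m} \<Longrightarrow> 0 < \<gamma> j"
    and "\<And>j. j \<in> {1..m} \<Longrightarrow> 0 < Cs j"
    and "0 < gmin" and "gmin < gmax"
    and "0 < r\<mu>"
  shows "\<exists>C\<^sub>0>0. \<exists>c\<^sub>0>0. \<forall>C\<alpha>>0. \<forall>c\<mu>>0. \<exists>c>0. \<exists>C>0. \<exists>K>0.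
    \<forall>(n :: nat \<Rightarrow> nat \<Rightarrow> nat) (\<epsilon> :: nat \<Rightarrow> nat \<Rightarrow> real) (\<delta> :: nat \<Rightarrow> nat \<Rightarrow> real) (r :: nat \<Rightarrow> real).
      (\<forall>N. \<forall>j\<le>m. 1 \<le> n N j \<and> 0 < \<epsilon> N j \<and> 0 < \<delta> N j \<and> \<delta> N j < 1) \<longrightarrow>
      (\<forall>N. 0 < r N \<and> rate_lhs CARD('d) m \<beta> \<gamma> (n N) (\<epsilon> N) (r N) = 1) \<longrightarrow>
      (\<lambda>N. \<Sum>j=0..m. real (n N j) * \<delta> N j) \<longlonglongrightarrow> 0 \<longrightarrow>
      (\<exists>LN :: nat \<Rightarrow> real.
         (\<forall>N. 0 \<le> LN N) \<and>
         (1 < gmax \<and> C\<^sub>0 \<le> C\<alpha> \<and> c\<mu> \<le> c\<^sub>0 \<longrightarrow> (\<forall>N. 1 \<le> LN N)) \<and>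
         (\<forall>\<^sub>F N in sequentially.
            LN N \<le> K * (- ln (delta_min m (\<delta> N)))
                       powr (\<beta> * (1 + \<alpha>) / (2 * \<beta> * gamma_min m \<gamma> + real CARD('d)))) \<and>
         (\<forall>\<^sub>F N in sequentially.
            ennreal (c * min (LN N * r N powr (\<beta> * (1 + \<alpha>))) 1)
              \<le> minimax_risk TYPE('t) m (n N) (\<epsilon> N) (\<delta> N)
                   (transfer_class m \<alpha> \<beta> \<gamma> L C\<alpha> Cs gmin gmax c\<mu> r\<mu> :: (nat \<Rightarrow> 'd obs measure) set) \<and>
            minimax_risk TYPE('t) m (n N) (\<epsilon> N) (\<delta> N)
                   (transfer_class m \<alpha> \<beta> \<gamma> L C\<alpha> Cs gmin gmax c\<mu> r\<mu> :: (nat \<Rightarrow> 'd obs measure) set)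
              \<le> ennreal (C * min (LN N * r N powr (\<beta> * (1 + \<alpha>))) 1)))"
proof -
  let ?Q = "\<lambda>C\<alpha> c\<mu>. transfer_class m \<alpha> \<beta> \<gamma> L C\<alpha> Cs gmin gmax c\<mu> r\<mu> :: (nat \<Rightarrow> 'd obs measure) set"
  define \<theta> where "\<theta> = \<beta> * (1 + \<alpha>)"
  have \<theta>: "0 < \<theta>" using assms by (simp add: \<theta>_def)
  define e where "e = \<beta> * (1 + \<alpha>) / (2 * \<beta> * gamma_min m \<gamma> + real CARD('d))"
  have e: "0 \<le> e"
  proof -
    have "gamma_min m \<gamma> \<in> insert 1 (\<gamma> ` {1..m})" unfolding gamma_min_def by (rule Min_in) auto
    then have "0 < gamma_min m \<gamma>" using assms(7) by auto
    then show ?thesis using assms by (simp add: e_def)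
  qed
  \<comment> \<open>Moving \<open>1 < gmax\<close> inside the quantifiers provides constants in
    every case; for \<open>gmax \<le> 1\<close> the claim is vacuous and any positive numbers
    do.\<close>
  have lower: "\<exists>C\<^sub>0>0. \<exists>c\<^sub>0>0. \<exists>\<kappa>>0. \<exists>s>0. 1 < gmax \<longrightarrow> (\<forall>C\<alpha> c\<mu> n \<epsilon> \<delta> r. C\<^sub>0 \<le> C\<alpha> \<longrightarrow> c\<mu> \<le> c\<^sub>0 \<longrightarrow>
     (\<forall>j\<le>m. 0 < \<epsilon> j \<and> 0 < \<delta> j \<and> real (n j) * \<delta> j \<le> s) \<longrightarrow> 0 < r \<longrightarrow> rate_lhs CARD('d) m \<beta> \<gamma> n \<epsilon> r = 1 \<longrightarrow>
     ennreal (\<kappa> * min r 1 powr \<theta>) \<le> minimax_risk TYPE('t) m n \<epsilon> \<delta> (?Q C\<alpha> c\<mu>))"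
  proof (cases "1 < gmax")
    case True
    show ?thesis
      using minimax_lower[where 'd = 'd and 't = 't and m = m and \<gamma> = \<gamma> and Cs = Cs, OF assms(2,5,3,4,6) assms(7,8) assms(9,10) True assms(11)]
      unfolding \<theta>_def by blast
  next
    case False
    then show ?thesis by (auto intro!: exI[of _ 1])
  qed
  then obtain C\<^sub>0 c\<^sub>0 \<kappa> s where C\<^sub>0: "0 < C\<^sub>0" and c\<^sub>0: "0 < c\<^sub>0" and \<kappa>: "0 < \<kappa>" and s: "0 < s"
    and lo: "\<And>C\<alpha> c\<mu> n \<epsilon> \<delta> r. 1 < gmax \<Longrightarrow> C\<^sub>0 \<le> C\<alpha> \<Longrightarrow> c\<mu> \<le> c\<^sub>0 \<Longrightarrow>
     (\<forall>j\<le>m. 0 < \<epsilon> j \<and> 0 < \<delta> j \<and> real (n j) * \<delta> j \<le> s) \<Longrightarrow> 0 < r \<Longrightarrow> rate_lhs CARD('d) m \<beta> \<gamma> n \<epsilon> r = 1 \<Longrightarrow>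
     ennreal (\<kappa> * min r 1 powr \<theta>) \<le> minimax_risk TYPE('t) m n \<epsilon> \<delta> (?Q C\<alpha> c\<mu>)" by metis
  show ?thesis
  proof (rule exI[of _ C\<^sub>0], rule conjI[OF C\<^sub>0], rule exI[of _ c\<^sub>0], rule conjI[OF c\<^sub>0], intro allI impI, goal_cases)
    case (1 C\<alpha> c\<mu>)
    obtain C where C: "0 < C" and up: "\<And>n \<epsilon> \<delta> r. (\<forall>j\<le>m. 1 \<le> n j \<and> 0 < \<epsilon> j \<and> 0 < \<delta> j) \<Longrightarrow> 0 < r \<Longrightarrow>
       rate_lhs CARD('d) m \<beta> \<gamma> n \<epsilon> r = 1 \<Longrightarrow> minimax_risk TYPE('t) m n \<epsilon> \<delta> (?Q C\<alpha> c\<mu>) \<le> ennreal (C * r powr \<theta>)"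
      using minimax_upper[where 'd = 'd and 't = 't and m = m and \<gamma> = \<gamma> and Cs = Cs, OF assms(1,2,3,6) 1(1) assms(9) 1(2) assms(11) assms(7,8) refl]
      unfolding \<theta>_def by blast
    \<comment> \<open>The constants for which \<open>minimax_lower\<close> applies and
      \<open>LN\<close> has to be at least 1.\<close>
    define rich where "rich \<longleftrightarrow> 1 < gmax \<and> C\<^sub>0 \<le> C\<alpha> \<and> c\<mu> \<le> c\<^sub>0"
    \<comment> \<open>At most 1, because the risk itself equals the truncated rate whenever the
      lower bound is not invoked.\<close>
    define \<kappa>' where "\<kappa>' = min \<kappa> 1"
    have \<kappa>': "0 < \<kappa>'" "\<kappa>' \<le> \<kappa>" "\<kappa>' \<le> 1" using \<kappa> by (auto simp: \<kappa>'_def)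
    define K where "K = max 1 C"
    have K: "0 < K" "1 \<le> K" "C \<le> K" by (auto simp: K_def)
    show ?case
    \<comment> \<open>The upper constant is 1: \<open>LN N\<close> will be at least the ratio of the
      risk to the power of r, and the risk is at most 1.\<close>
    proof (rule exI[of _ \<kappa>'], rule conjI[OF \<kappa>'(1)], rule exI[of _ "1 :: real"], rule conjI[OF zero_less_one],
        rule exI[of _ K], rule conjI[OF K(1)], intro allI impI, goal_cases)
      case (1 n \<epsilon> \<delta> r)
      note pos = 1(1) and rate = 1(2) and lim = 1(3)
      define R where "R N = minimax_risk TYPE('t) m (n N) (\<epsilon> N) (\<delta> N) (?Q C\<alpha> c\<mu>)" for N
      have R1: "R N \<le> 1" for N
        unfolding R_def by (rule minimax_risk_le_one[OF assms(1)]) (use pos in \<open>auto simp: transfer_class_def\<close>)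
      define M where "M N = enn2real (R N)" for N
      have RM: "R N = ennreal (M N)" for N
        unfolding M_def using R1[of N] by (metis ennreal_enn2real ennreal_one_less_top order_le_less_trans)
      have M: "0 \<le> M N" "M N \<le> 1" for N
        using R1[of N] unfolding RM by (auto simp: M_def)
      define \<rho> where "\<rho> N = r N powr \<theta>" for N
      have \<rho>: "0 < \<rho> N" for N using rate[rule_format, of N] by (simp add: \<rho>_def)
      have MC: "M N \<le> C * \<rho> N" for N
      proof -
        have "ennreal (M N) \<le> ennreal (C * \<rho> N)"
          unfolding RM[symmetric] R_def \<rho>_def by (rule up) (use pos rate in auto)
        then show ?thesis using C \<rho>[of N] by simp
      qed
      \<comment> \<open>\<open>LN\<close> is read off from the minimax risk itself, and the two bounds say that it is bounded.\<close>
      define LN where "LN N = (if rich then max 1 (M N / \<rho> N) else M N / \<rho> N)" for N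
      have LN: "LN N * \<rho> N = (if rich then max (\<rho> N) (M N) else M N)" for N
        using \<rho>[of N] by (auto simp: LN_def max_def field_simps)
      have pos': "\<forall>N. \<forall>j\<le>m. 1 \<le> n N j \<and> 0 < \<delta> N j" using pos by blast
      note small = delta_min_small[of m n \<delta>, OF pos' lim s]
      have LNK: "LN N \<le> K" for N
      proof -
        have "M N / \<rho> N \<le> C" using MC[of N] \<rho>[of N] by (simp add: divide_le_eq)
        then show ?thesis using K by (auto simp: LN_def)
      qed
      have ub: "M N \<le> min (LN N * \<rho> N) 1" for N using M[of N] by (auto simp: LN)
      have lb: "\<kappa>' * min (LN N * \<rho> N) 1 \<le> M N" if small: "\<forall>j\<le>m. real (n N j) * \<delta> N j \<le> s" for N
      proof (cases "rich \<and> M N < \<rho> N")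
        case False
        then have "min (LN N * \<rho> N) 1 \<le> M N" by (auto simp: LN max_def)
        then have "\<kappa>' * min (LN N * \<rho> N) 1 \<le> 1 * M N" using \<kappa>' M[of N] \<rho>[of N] by (intro mult_mono) (auto simp: LN)
        then show ?thesis by simp
      next
        \<comment> \<open>The only case in which \<open>LN\<close> was raised from the ratio to 1,
          so that the lower bound has to show that the risk is not much smaller than the
          rate.\<close>
        case True
        have r0: "0 < r N" using rate by simp
        have "ennreal (\<kappa> * min (r N) 1 powr \<theta>) \<le> ennreal (M N)"
          unfolding RM[symmetric] R_def by (rule lo) (use True small pos rate in \<open>auto simp: rich_def\<close>)
        then have "\<kappa> * min (r N) 1 powr \<theta> \<le> M N" using \<kappa> M(1)[of N] by simp
        moreover have "min (r N) 1 powr \<theta> = min (\<rho> N) 1"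
        proof (cases "r N \<le> 1")
          case True
          then have "r N powr \<theta> \<le> 1 powr \<theta>" using r0 \<theta> by (intro powr_mono2) auto
          then show ?thesis using True by (simp add: \<rho>_def)
        next
          case False
          then have "1 powr \<theta> \<le> r N powr \<theta>" using \<theta> by (intro powr_mono2) auto
          then show ?thesis using False by (simp add: \<rho>_def)
        qed
        moreover have "\<kappa>' * min (\<rho> N) 1 \<le> \<kappa> * min (\<rho> N) 1" using \<kappa>' \<rho>[of N] by (intro mult_right_mono) auto
        moreover have "LN N * \<rho> N = \<rho> N" using True by (simp add: LN)
        ultimately show ?thesis by (simp only:)
      qed
      have "\<forall>\<^sub>F N in sequentially. LN N \<le> K * (- ln (delta_min m (\<delta> N))) powr e"
        using small(2)[OF e]
      proof eventually_elim
        case (elim N)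
        have "LN N \<le> K * 1" using LNK by simp
        also have "\<dots> \<le> K * (- ln (delta_min m (\<delta> N))) powr e" using elim K by (intro mult_left_mono) auto
        finally show ?case .
      qed
      moreover have "\<forall>\<^sub>F N in sequentially. ennreal (\<kappa>' * min (LN N * \<rho> N) 1) \<le> R N \<and> R N \<le> ennreal (1 * min (LN N * \<rho> N) 1)"
        using small(1)
      proof eventually_elim
        case (elim N)
        show ?case
          unfolding RM using lb[of N] elim ub[of N] by (auto intro!: ennreal_leI)
      qed
      moreover have "0 \<le> LN N" for N using M(1)[of N] \<rho>[of N] by (auto simp: LN_def)
      moreover have "1 < gmax \<and> C\<^sub>0 \<le> C\<alpha> \<and> c\<mu> \<le> c\<^sub>0 \<longrightarrow> (\<forall>N. 1 \<le> LN N)" by (auto simp: LN_def rich_def)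
      ultimately show ?case unfolding R_def \<rho>_def \<theta>_def e_def by blast
    qed
  qed
qed

end
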